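(* Let $1 \le k \le n$ be integers with $n \ge 2$ and let $0 < \epsilon < 1$. There is a randomized construction of a matrix $A \in \mathbb{R}^{m \times n}$ with $m = O((k/\epsilon)\log n)$ rows and $O(\log n)$ non-zero entries per column, together with a recovery algorithm, such that for every $x \in \mathbb{R}^n$, given $Ax$, the algorithm computes in time $O(m)$ a vector $x' \in \mathbb{R}^n$ satisfying $$\|x - x'\|_2 \le (1+\epsilon)\,\|x_{-k}\|_2$$ with arbitrarily large constant probability. (That is, for every constant $\delta > 0$ the construction can be chosen so that for each fixed $x$ the guarantee holds with probability at least $1-\delta$ over the random choice of $A$, where the constants hidden in the $O(\cdot)$-notation depend only on $\delta$ and not on $n, k, \epsilon, x$.)
   Context: For $x \in \mathbb{R}^n$, $x_{-k}$ denotes the vector obtained from $x$ by setting to zero its $k$ largest coordinates in absolute value (ties broken arbitrarily but consistently). The matrix $A$ is drawn from a distribution that depends on $n, k, \epsilon$ (and the target success probability) but not on $x$ (non-adaptive linear sketch). The recovery algorithm receives $Ax$ and has access to the randomness used to construct $A$. Running time is measured in the standard RAM model with unit-cost arithmetic on real numbers and on $O(\log n)$-bit words, and the output $x'$ is represented sparsely (as a list of its non-zero coordinates with their values). *)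

theory Defs
  imports "HOL-Probability.Probability_Mass_Function" "Jordan_Normal_Form.Matrix"
begin

definition l2norm :: "real Matrix.vec \<Rightarrow> real" where
  "l2norm v = L2_set (vec_index v) {..<dim_vec v}"

text \<open>The number of coordinates ranked before \<open>i\<close> in the order by decreasing absolute value;
  ties are broken in favour of the smaller index.\<close>

definition abs_rank :: "real Matrix.vec \<Rightarrow> nat \<Rightarrow> nat" where
  "abs_rank x i = card {j. j < dim_vec x \<and>
     (\<bar>vec_index x j\<bar> > \<bar>vec_index x i\<bar> \<or> \<bar>vec_index x j\<bar> = \<bar>vec_index x i\<bar> \<and> j < i)}"

definition tail_vec :: "nat \<Rightarrow> real Matrix.vec \<Rightarrow> real Matrix.vec" where
  "tail_vec k x = Matrix.vec (dim_vec x) (\<lambda>i. if abs_rank x i < k then 0 else vec_index x i)"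

definition col_nnz :: "real mat \<Rightarrow> nat \<Rightarrow> nat" where
  "col_nnz A j = card {i. i < dim_row A \<and> A $$ (i, j) \<noteq> 0}"

definition sparse_repr :: "(nat \<times> real) list \<Rightarrow> real Matrix.vec \<Rightarrow> bool" where
  "sparse_repr out v \<longleftrightarrow> distinct out \<and>
     set out = {(i, vec_index v i) | i. i < dim_vec v \<and> vec_index v i \<noteq> 0}"

text \<open>The memory consists of cells \<open>W[a]\<close> holding words (naturals below \<open>2 ^ w\<close>) and cells
  \<open>R[a]\<close> holding reals. Operands in an instruction are cell addresses, and an indirect access uses
  the content of a word cell as address. There are two read-only arrays, the sketch (reals) and the
  random tape (words). Every instruction takes one time unit. Real arithmetic has no rounding to
  integers and no real constants other than those obtained from words. Reals influence the
  control flow only through comparisons. In an instruction that writes to a cell, the target comes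
  first; division by zero yields zero, and so does reading the sketch out of range.\<close>

datatype word_op = WAdd | WSub | WMul | WDiv | WMod | WAnd | WOr | WXor | WShl | WShr

fun word_fun :: "nat \<Rightarrow> word_op \<Rightarrow> nat \<Rightarrow> nat \<Rightarrow> nat" where
  "word_fun w WAdd a b = (a + b) mod 2 ^ w"
| "word_fun w WSub a b = (a + 2 ^ w - b) mod 2 ^ w"
| "word_fun w WMul a b = (a * b) mod 2 ^ w"
| "word_fun w WDiv a b = a div b"
| "word_fun w WMod a b = a mod b"
| "word_fun w WAnd a b = Bit_Operations.and a b"
| "word_fun w WOr a b = Bit_Operations.or a b"
| "word_fun w WXor a b = Bit_Operations.xor a b"
| "word_fun w WShl a b = push_bit b a mod 2 ^ w"
| "word_fun w WShr a b = drop_bit b a"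

datatype real_op = RAdd | RSub | RMul | RDiv

fun real_fun :: "real_op \<Rightarrow> real \<Rightarrow> real \<Rightarrow> real" where
  "real_fun RAdd a b = a + b"
| "real_fun RSub a b = a - b"
| "real_fun RMul a b = a * b"
| "real_fun RDiv a b = a / b"

datatype instr =
    WConst nat nat
  | WOp word_op nat nat nat
  | WLoad nat nat
  | WStore nat nat
  | ROp real_op nat nat nat
  | ROfWord nat nat
  | RLoad nat nat
  | RStore nat nat
  | ReadSketch nat nat
  | ReadTape nat nat
  | Jump nat
  | WJumpLess nat nat nat
  | RJumpLess nat nat nat
  | Emit nat nat

record ram_state =
  pc :: nat
  wmem :: "nat \<Rightarrow> nat"
  rmem :: "nat \<Rightarrow> real"
  outp :: "(nat \<times> real) list"

definition set_w :: "nat \<Rightarrow> nat \<Rightarrow> ram_state \<Rightarrow> ram_state" where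
  "set_w d v s = s\<lparr>pc := Suc (pc s), wmem := (wmem s)(d := v)\<rparr>"

definition set_r :: "nat \<Rightarrow> real \<Rightarrow> ram_state \<Rightarrow> ram_state" where
  "set_r d v s = s\<lparr>pc := Suc (pc s), rmem := (rmem s)(d := v)\<rparr>"

fun exec_instr ::
  "nat \<Rightarrow> (nat \<Rightarrow> nat) \<Rightarrow> real Matrix.vec \<Rightarrow> instr \<Rightarrow> ram_state \<Rightarrow> ram_state" where
  "exec_instr w \<sigma> y (WConst d c) s = set_w d (c mod 2 ^ w) s"
| "exec_instr w \<sigma> y (WOp f d a b) s = set_w d (word_fun w f (wmem s a) (wmem s b)) s"
| "exec_instr w \<sigma> y (WLoad d a) s = set_w d (wmem s (wmem s a)) s"
| "exec_instr w \<sigma> y (WStore a b) s = set_w (wmem s a) (wmem s b) s"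
| "exec_instr w \<sigma> y (ROp f d a b) s = set_r d (real_fun f (rmem s a) (rmem s b)) s"
| "exec_instr w \<sigma> y (ROfWord d a) s = set_r d (real (wmem s a)) s"
| "exec_instr w \<sigma> y (RLoad d a) s = set_r d (rmem s (wmem s a)) s"
| "exec_instr w \<sigma> y (RStore a b) s = set_r (wmem s a) (rmem s b) s"
| "exec_instr w \<sigma> y (ReadSketch d a) s =
     set_r d (if wmem s a < dim_vec y then vec_index y (wmem s a) else 0) s"
| "exec_instr w \<sigma> y (ReadTape d a) s = set_w d (\<sigma> (wmem s a)) s"
| "exec_instr w \<sigma> y (Jump l) s = s\<lparr>pc := l\<rparr>"
| "exec_instr w \<sigma> y (WJumpLess a b l) s =
     s\<lparr>pc := if wmem s a < wmem s b then l else Suc (pc s)\<rparr>"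
| "exec_instr w \<sigma> y (RJumpLess a b l) s =
     s\<lparr>pc := if rmem s a < rmem s b then l else Suc (pc s)\<rparr>"
| "exec_instr w \<sigma> y (Emit a b) s =
     s\<lparr>pc := Suc (pc s), outp := outp s @ [(wmem s a, rmem s b)]\<rparr>"

text \<open>The machine halts by leaving the program; a halted state is a fixed point of
  \<open>ram_step\<close>, so running for \<open>T\<close> steps means running for at most \<open>T\<close> time units.\<close>

definition halted :: "instr list \<Rightarrow> ram_state \<Rightarrow> bool" where
  "halted P s \<longleftrightarrow> length P \<le> pc s"

definition ram_step ::
  "nat \<Rightarrow> (nat \<Rightarrow> nat) \<Rightarrow> real Matrix.vec \<Rightarrow> instr list \<Rightarrow> ram_state \<Rightarrow> ram_state" where
  "ram_step w \<sigma> y P s = (if halted P s then s else exec_instr w \<sigma> y (P ! pc s) s)"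

definition init_state :: "nat \<Rightarrow> nat \<Rightarrow> real \<Rightarrow> nat \<Rightarrow> ram_state" where
  "init_state n k \<epsilon> m =
     \<lparr>pc = 0, wmem = (\<lambda>_. 0)(0 := n, 1 := k, 2 := m), rmem = (\<lambda>_. 0)(0 := \<epsilon>), outp = []\<rparr>"

text \<open>On parameters \<open>n\<close>, \<open>k\<close>, \<open>\<epsilon>\<close>, sketch \<open>y\<close> and random tape \<open>\<sigma>\<close>, the program \<open>P\<close> halts on the
  machine with \<open>w\<close>-bit words after at most \<open>T\<close> steps, with a sparse representation of \<open>v\<close> as
  its output.\<close>

definition recovers_within ::
  "nat \<Rightarrow> instr list \<Rightarrow> nat \<Rightarrow> nat \<Rightarrow> real \<Rightarrow> (nat \<Rightarrow> nat) \<Rightarrow> real Matrix.vec \<Rightarrow> nat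
     \<Rightarrow> real Matrix.vec \<Rightarrow> bool" where
  "recovers_within w P n k \<epsilon> \<sigma> y T v \<longleftrightarrow>
     (let s = (ram_step w \<sigma> y P ^^ T) (init_state n k \<epsilon> (dim_vec y))
      in halted P s \<and> sparse_repr (outp s) v)"

text \<open>The randomness: one word for every address, all independent and uniform.\<close>

definition tapes :: "nat \<Rightarrow> (nat \<Rightarrow> nat) set" where
  "tapes w = {..<2 ^ w} \<rightarrow>\<^sub>E {..<2 ^ w}"

definition word_length :: "nat \<Rightarrow> nat \<Rightarrow> nat" where
  "word_length b n = b * nat \<lceil>log 2 (real n)\<rceil>"

end

(*
  The sketch hashes the coordinates into B = O(k / epsilon) buckets in O(log n) independent
  repetitions with random signs. A threshold theta is read off a constant number of
  repetitions: it is at most O(tail / sqrt B), and anticoncentration shows that, up to a small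
  fraction of B exceptional coordinates, the vector has energy at most a small fraction of
  B * theta^2. A repetition is therefore good for a given coordinate except with tiny constant
  probability.

  To keep the decoding time linear in the number of rows, the candidates come from two
  sources. Coordinates of size between theta and theta * poly(log n) receive a random label,
  and for every label the index is read off bit by bit, blockwise protected by a
  Gilbert-Varshamov code over words of O(log log n) bits, whose decoding table is precomputed.
  Larger coordinates are found by descending the binary tree over all indices, where uniform
  instead of sign coefficients make it polylogarithmically unlikely that a large coordinate
  cancels. Each candidate is estimated by a random pivot accepted by a majority of the
  repetitions, and reported if it exceeds 6 * theta. The missed energy and the running time
  are bounded in expectation. If the sketch would have at least n rows, the identity matrix is
  used instead, so that otherwise log n exceeds any given constant.
*)
theory Submission
  imports Defs
begin

section \<open>Structured programs for the machine\<close>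

text \<open>Every head coordinate may cost O(\<theta>^2): since \<theta>^2 is O(tail energy / B) and
  B is a large multiple of k / \<epsilon>, all k of them together stay below \<epsilon> times the
  tail energy. Hence no coordinate must be found for certain; x_i only needs a probability of loss
  O(\<theta>^2 / x_i^2). This splits the search. Code words of O(log log n) bits give failure
  probability 1 / polylog n, enough only for energies up to polylog n times \<theta>^2. Beyond that
  the failure has to shrink with the size: a coefficient uniform in [-1, 1] hides x_i with
  probability about \<theta> / |x_i|, and twelve repetitions per tree level raise this to the
  twelfth power. The tree alone would not do, as at moderate size the loss summed over log n levels
  need not be small. The large constants have one origin. The error rate 2^-400 of a repetition must
  beat the union bound over bits and digits of a code word; so only B / 2^411 exceptional
  coordinates are allowed, and a single reading of a bucket is then guaranteed to be large enough
  only with probability 2^-412. Constantly many readings repair this.\<close>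

datatype com =
    Skip
  | Ins instr
  | Seq com com  (infixr ";;" 60)
  | IfW nat nat com com
  | IfR nat nat com com
  | While nat nat com

fun clen :: "com \<Rightarrow> nat" where
  "clen Skip = 0"
| "clen (Ins x) = 1"
| "clen (Seq c d) = clen c + clen d"
| "clen (IfW a b c d) = clen c + clen d + 2"
| "clen (IfR a b c d) = clen c + clen d + 2"
| "clen (While a b c) = clen c + 3"

text \<open>Jump targets of the machine are absolute, so the start address \<open>p\<close> of the
  fragment is passed along. In a conditional the else-branch comes first, reached by falling
  through, and pays for one extra jump.\<close>

fun compile :: "nat \<Rightarrow> com \<Rightarrow> instr list" where
  "compile p Skip = []"
| "compile p (Ins x) = [x]"
| "compile p (Seq c d) = compile p c @ compile (p + clen c) d"
| "compile p (IfW a b c d) = WJumpLess a b (p + 2 + clen d) # compile (p + 1) d @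
     Jump (p + 2 + clen d + clen c) # compile (p + 2 + clen d) c"
| "compile p (IfR a b c d) = RJumpLess a b (p + 2 + clen d) # compile (p + 1) d @
     Jump (p + 2 + clen d + clen c) # compile (p + 2 + clen d) c"
| "compile p (While a b c) = WJumpLess a b (p + 2) # Jump (p + 3 + clen c) #
     compile (p + 2) c @ [Jump p]"

lemma length_compile [simp]: "length (compile p c) = clen c"
  by (induction c arbitrary: p) auto

fun straight :: "instr \<Rightarrow> bool" where
  "straight (Jump l) = False"
| "straight (WJumpLess a b l) = False"
| "straight (RJumpLess a b l) = False"
| "straight _ = True"

text \<open>The costs are exact: each rule charges the jumps that \<open>compile\<close> inserts,
  namely 1 or 2 for a conditional and 2 per test of a loop. The rules never inspect the program
  counter of a state.\<close>

inductive bs :: "nat \<Rightarrow> (nat \<Rightarrow> nat) \<Rightarrow> real Matrix.vec \<Rightarrow> com \<Rightarrow> ram_state \<Rightarrow> nat \<Rightarrow> ram_state \<Rightarrow> bool"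
  for w \<sigma> y where
  bs_Skip: "bs w \<sigma> y Skip s 0 s"
| bs_Ins: "straight x \<Longrightarrow> bs w \<sigma> y (Ins x) s 1 (exec_instr w \<sigma> y x s)"
| bs_Seq: "bs w \<sigma> y c s t s' \<Longrightarrow> bs w \<sigma> y d s' t' s'' \<Longrightarrow> bs w \<sigma> y (Seq c d) s (t + t') s''"
| bs_IfWT: "wmem s a < wmem s b \<Longrightarrow> bs w \<sigma> y c s t s' \<Longrightarrow> bs w \<sigma> y (IfW a b c d) s (t + 1) s'"
| bs_IfWF: "\<not> wmem s a < wmem s b \<Longrightarrow> bs w \<sigma> y d s t s' \<Longrightarrow> bs w \<sigma> y (IfW a b c d) s (t + 2) s'"
| bs_IfRT: "rmem s a < rmem s b \<Longrightarrow> bs w \<sigma> y c s t s' \<Longrightarrow> bs w \<sigma> y (IfR a b c d) s (t + 1) s'"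
| bs_IfRF: "\<not> rmem s a < rmem s b \<Longrightarrow> bs w \<sigma> y d s t s' \<Longrightarrow> bs w \<sigma> y (IfR a b c d) s (t + 2) s'"
| bs_WhileF: "\<not> wmem s a < wmem s b \<Longrightarrow> bs w \<sigma> y (While a b c) s 2 s"
| bs_WhileT: "wmem s a < wmem s b \<Longrightarrow> bs w \<sigma> y c s t s' \<Longrightarrow> bs w \<sigma> y (While a b c) s' t' s'' \<Longrightarrow>
     bs w \<sigma> y (While a b c) s (t + t' + 2) s''"

lemma exec_straight_pc:
  "straight x \<Longrightarrow> exec_instr w \<sigma> y x (s\<lparr>pc := p\<rparr>) = (exec_instr w \<sigma> y x s)\<lparr>pc := Suc p\<rparr>"
  by (cases x) (auto simp: set_w_def set_r_def)

definition code_at :: "instr list \<Rightarrow> nat \<Rightarrow> instr list \<Rightarrow> bool" where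
  "code_at P p c \<longleftrightarrow> (\<exists>u v. P = u @ c @ v \<and> length u = p)"

lemma code_at_append: "code_at P p (c @ d) \<longleftrightarrow> code_at P p c \<and> code_at P (p + length c) d"
proof
  assume "code_at P p (c @ d)"
  then obtain u v where "P = u @ (c @ d) @ v" "length u = p" unfolding code_at_def by blast
  then have "P = u @ c @ (d @ v)" "P = (u @ c) @ d @ v" "length (u @ c) = p + length c" by auto
  then show "code_at P p c \<and> code_at P (p + length c) d"
    unfolding code_at_def using \<open>length u = p\<close> by blast
next
  assume "code_at P p c \<and> code_at P (p + length c) d"
  then obtain u v u' v' where *: "P = u @ c @ v" "length u = p" "P = u' @ d @ v'"
    "length u' = p + length c" unfolding code_at_def by blast
  then have "(u @ c) @ v = u' @ (d @ v')" "length (u @ c) = length u'" by simp_all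
  then have "u @ c = u' \<and> v = d @ v'" using append_eq_append_conv by blast
  then show "code_at P p (c @ d)"
    unfolding code_at_def using * by (intro exI[of _ u] exI[of _ v']) simp
qed

lemma code_at_Cons: "code_at P p (x # d) \<longleftrightarrow> p < length P \<and> P ! p = x \<and> code_at P (Suc p) d"
proof -
  have "code_at P p [x] \<longleftrightarrow> p < length P \<and> P ! p = x"
  proof
    assume "p < length P \<and> P ! p = x"
    then have "P = take p P @ [x] @ drop (Suc p) P" "length (take p P) = p"
      using id_take_nth_drop[of p P] by auto
    then show "code_at P p [x]" unfolding code_at_def by blast
  qed (auto simp: code_at_def)
  then show ?thesis
    using code_at_append[of P p "[x]" d] by simp
qed

text \<open>Counters in big-step states carry no meaning; the position in the compiled program is
  imposed from outside by this update.\<close>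

definition st_at :: "ram_state \<Rightarrow> nat \<Rightarrow> ram_state" where
  "st_at s p = s\<lparr>pc := p\<rparr>"

lemma st_at_simps [simp]: "pc (st_at s p) = p" "wmem (st_at s p) = wmem s" "rmem (st_at s p) = rmem s"
  "outp (st_at s p) = outp s" "(st_at s p)\<lparr>pc := q\<rparr> = st_at s q"
  by (auto simp: st_at_def)

lemma st_at_pc: "pc s = p \<Longrightarrow> st_at s p = s"
  by (cases s) (simp add: st_at_def)

lemma step_jumps:
  assumes "p < length P"
  shows "P ! p = Jump l \<Longrightarrow> ram_step w \<sigma> y P (st_at s p) = st_at s l"
   "P ! p = WJumpLess a b l \<Longrightarrow> ram_step w \<sigma> y P (st_at s p) =
      st_at s (if wmem s a < wmem s b then l else Suc p)"
   "P ! p = RJumpLess a b l \<Longrightarrow> ram_step w \<sigma> y P (st_at s p) =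
      st_at s (if rmem s a < rmem s b then l else Suc p)"
   "straight (P ! p) \<Longrightarrow> ram_step w \<sigma> y P (st_at s p) = st_at (exec_instr w \<sigma> y (P ! p) s) (Suc p)"
  using assms by (auto simp: ram_step_def halted_def st_at_def exec_straight_pc)

lemma funpow_one_more:
  "f x = x' \<Longrightarrow> (f ^^ t) x' = z \<Longrightarrow> (f ^^ (t + 1)) x = z"
  "f x = x' \<Longrightarrow> (f ^^ t) x' = u \<Longrightarrow> f u = z \<Longrightarrow> (f ^^ (t + 2)) x = z"
  by (simp_all add: funpow_swap1)

lemma bs_compile:
  "bs w \<sigma> y c s t s' \<Longrightarrow> code_at P p (compile p c) \<Longrightarrow>
     (ram_step w \<sigma> y P ^^ t) (st_at s p) = st_at s' (p + clen c)"
proof (induction arbitrary: p rule: bs.induct)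
  case (bs_Skip s)
  then show ?case by simp
next
  case (bs_Ins x s)
  then show ?case by (simp add: code_at_Cons step_jumps)
next
  case (bs_Seq c s t s' d t' s'')
  have "code_at P p (compile p c)" "code_at P (p + clen c) (compile (p + clen c) d)"
    using bs_Seq.prems by (auto simp: code_at_append)
  then have "(ram_step w \<sigma> y P ^^ t) (st_at s p) = st_at s' (p + clen c)"
    "(ram_step w \<sigma> y P ^^ t') (st_at s' (p + clen c)) = st_at s'' (p + clen c + clen d)"
    using bs_Seq.IH by auto
  then show ?case
    by (simp add: add.commute[of t t'] funpow_add add.assoc)
next
  case (bs_IfWT s a b c t s' d)
  let ?q = "p + 2 + clen d"
  have "code_at P ?q (compile ?q c)" and p: "p < length P" "P ! p = WJumpLess a b ?q"
    using bs_IfWT.prems by (auto simp: code_at_append code_at_Cons)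
  then have "(ram_step w \<sigma> y P ^^ t) (st_at s ?q) = st_at s' (?q + clen c)"
    using bs_IfWT.IH by blast
  moreover have "ram_step w \<sigma> y P (st_at s p) = st_at s ?q"
    using step_jumps(2)[OF p] bs_IfWT.hyps by simp
  moreover have "?q + clen c = p + (clen c + clen d + 2)" by simp
  ultimately show ?case
    by (intro funpow_one_more(1)) (simp_all add: ac_simps)
next
  case (bs_IfWF s a b d t s' c)
  let ?q = "p + 2 + clen d"
  have d: "code_at P (Suc p) (compile (Suc p) d)" and p: "p < length P" "P ! p = WJumpLess a b ?q"
    and j: "Suc p + clen d < length P" "P ! (Suc p + clen d) = Jump (?q + clen c)"
    using bs_IfWF.prems by (auto simp: code_at_append code_at_Cons add.commute)
  have "(ram_step w \<sigma> y P ^^ t) (st_at s (Suc p)) = st_at s' (Suc p + clen d)"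
    using bs_IfWF.IH d by blast
  moreover have "ram_step w \<sigma> y P (st_at s p) = st_at s (Suc p)"
    using step_jumps(2)[OF p] bs_IfWF.hyps by simp
  moreover have "ram_step w \<sigma> y P (st_at s' (Suc p + clen d)) = st_at s' (?q + clen c)"
    using step_jumps(1)[OF j] by simp
  moreover have "?q + clen c = p + (clen c + clen d + 2)" by simp
  ultimately show ?case
    by (intro funpow_one_more(2)) (simp_all add: ac_simps)
next
  case (bs_IfRT s a b c t s' d)
  let ?q = "p + 2 + clen d"
  have "code_at P ?q (compile ?q c)" and p: "p < length P" "P ! p = RJumpLess a b ?q"
    using bs_IfRT.prems by (auto simp: code_at_append code_at_Cons)
  then have "(ram_step w \<sigma> y P ^^ t) (st_at s ?q) = st_at s' (?q + clen c)"
    using bs_IfRT.IH by blast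
  moreover have "ram_step w \<sigma> y P (st_at s p) = st_at s ?q"
    using step_jumps(3)[OF p] bs_IfRT.hyps by simp
  moreover have "?q + clen c = p + (clen c + clen d + 2)" by simp
  ultimately show ?case
    by (intro funpow_one_more(1)) (simp_all add: ac_simps)
next
  case (bs_IfRF s a b d t s' c)
  let ?q = "p + 2 + clen d"
  have d: "code_at P (Suc p) (compile (Suc p) d)" and p: "p < length P" "P ! p = RJumpLess a b ?q"
    and j: "Suc p + clen d < length P" "P ! (Suc p + clen d) = Jump (?q + clen c)"
    using bs_IfRF.prems by (auto simp: code_at_append code_at_Cons add.commute)
  have "(ram_step w \<sigma> y P ^^ t) (st_at s (Suc p)) = st_at s' (Suc p + clen d)"
    using bs_IfRF.IH d by blast
  moreover have "ram_step w \<sigma> y P (st_at s p) = st_at s (Suc p)"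
    using step_jumps(3)[OF p] bs_IfRF.hyps by simp
  moreover have "ram_step w \<sigma> y P (st_at s' (Suc p + clen d)) = st_at s' (?q + clen c)"
    using step_jumps(1)[OF j] by simp
  moreover have "?q + clen c = p + (clen c + clen d + 2)" by simp
  ultimately show ?case
    by (intro funpow_one_more(2)) (simp_all add: ac_simps)
next
  case (bs_WhileF s a b c)
  have p: "p < length P" "P ! p = WJumpLess a b (p + 2)"
    and j: "Suc p < length P" "P ! (Suc p) = Jump (p + 3 + clen c)"
    using bs_WhileF.prems by (auto simp: code_at_append code_at_Cons)
  show ?case
    using step_jumps(2)[OF p] step_jumps(1)[OF j] bs_WhileF.hyps
    by (simp add: numeral_2_eq_2 algebra_simps)
next
  case (bs_WhileT s a b c t s' t' s'')
  have p: "p < length P" "P ! p = WJumpLess a b (p + 2)"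
    and c: "code_at P (p + 2) (compile (p + 2) c)"
    and j: "p + 2 + clen c < length P" "P ! (p + 2 + clen c) = Jump p"
    using bs_WhileT.prems by (auto simp: code_at_append code_at_Cons)
  have 1: "ram_step w \<sigma> y P (st_at s p) = st_at s (p + 2)"
    using step_jumps(2)[OF p] bs_WhileT.hyps by simp
  have 2: "(ram_step w \<sigma> y P ^^ t) (st_at s (p + 2)) = st_at s' (p + 2 + clen c)"
    using bs_WhileT.IH(1) c by blast
  have 3: "ram_step w \<sigma> y P (st_at s' (p + 2 + clen c)) = st_at s' p"
    using step_jumps(1)[OF j] by simp
  have 4: "(ram_step w \<sigma> y P ^^ t') (st_at s' p) = st_at s'' (p + clen (While a b c))"
    using bs_WhileT.IH(2) bs_WhileT.prems by blast
  have "(ram_step w \<sigma> y P ^^ t') (ram_step w \<sigma> y P ((ram_step w \<sigma> y P ^^ t) (ram_step w \<sigma> y P (st_at s p))))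
      = st_at s'' (p + clen (While a b c))"
    by (simp only: 1 2 3 4)
  moreover have "t + t' + 2 = t' + (1 + (t + 1))" by simp
  ultimately show ?case
    by (simp only: funpow_add) simp
qed

text \<open>Only upper bounds on the time are propagated. This suffices because a halted state is a
  fixed point of the machine.\<close>

definition runs :: "nat \<Rightarrow> (nat \<Rightarrow> nat) \<Rightarrow> real Matrix.vec \<Rightarrow> com \<Rightarrow> ram_state \<Rightarrow> ram_state \<Rightarrow> nat \<Rightarrow> bool" where
  "runs w \<sigma> y c s s' T \<longleftrightarrow> (\<exists>t\<le>T. bs w \<sigma> y c s t s')"

lemma runs_mono: "runs w \<sigma> y c s s' T \<Longrightarrow> T \<le> T' \<Longrightarrow> runs w \<sigma> y c s s' T'"
  unfolding runs_def using le_trans by blast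

lemma runs_Seq: "runs w \<sigma> y c s s' T \<Longrightarrow> runs w \<sigma> y d s' s'' T' \<Longrightarrow> runs w \<sigma> y (c ;; d) s s'' (T + T')"
  unfolding runs_def using bs_Seq add_mono by metis

lemma runs_IfW:
  assumes "wmem s a < wmem s b \<Longrightarrow> runs w \<sigma> y c s s' T"
    and "\<not> wmem s a < wmem s b \<Longrightarrow> runs w \<sigma> y d s s' T"
  shows "runs w \<sigma> y (IfW a b c d) s s' (T + 2)"
proof (cases "wmem s a < wmem s b")
  case True
  with assms(1) obtain t where "t \<le> T" "bs w \<sigma> y c s t s'" by (auto simp: runs_def)
  with True show ?thesis unfolding runs_def by (intro exI[of _ "t + 1"]) (simp add: bs_IfWT[simplified])
next
  case False
  with assms(2) obtain t where "t \<le> T" "bs w \<sigma> y d s t s'" by (auto simp: runs_def)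
  with False show ?thesis unfolding runs_def by (intro exI[of _ "t + 2"]) (simp add: bs_IfWF[simplified])
qed

lemma runs_IfR:
  assumes "rmem s a < rmem s b \<Longrightarrow> runs w \<sigma> y c s s' T"
    and "\<not> rmem s a < rmem s b \<Longrightarrow> runs w \<sigma> y d s s' T"
  shows "runs w \<sigma> y (IfR a b c d) s s' (T + 2)"
proof (cases "rmem s a < rmem s b")
  case True
  with assms(1) obtain t where "t \<le> T" "bs w \<sigma> y c s t s'" by (auto simp: runs_def)
  with True show ?thesis unfolding runs_def by (intro exI[of _ "t + 1"]) (simp add: bs_IfRT[simplified])
next
  case False
  with assms(2) obtain t where "t \<le> T" "bs w \<sigma> y d s t s'" by (auto simp: runs_def)
  with False show ?thesis unfolding runs_def by (intro exI[of _ "t + 2"]) (simp add: bs_IfRF[simplified])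
qed

text \<open>The number \<open>N\<close> of iterations is fixed in advance and indexes the invariant.
  It fits the decoder, whose main loops are cut off by a step budget and idle once their work is
  done.\<close>

lemma runs_While:
  assumes step: "\<And>j s. j < N \<Longrightarrow> I j s \<Longrightarrow> wmem s a < wmem s b \<and> (\<exists>s'. runs w \<sigma> y c s s' T \<and> I (Suc j) s')"
    and stop: "\<And>s. I N s \<Longrightarrow> \<not> wmem s a < wmem s b"
    and init: "I 0 s"
  shows "\<exists>s'. runs w \<sigma> y (While a b c) s s' (N * (T + 2) + 2) \<and> I N s'"
proof -
  have "\<exists>s'. runs w \<sigma> y (While a b c) s s' ((N - j) * (T + 2) + 2) \<and> I N s'" if "j \<le> N" "I j s" for j s
    using that
  proof (induction "N - j" arbitrary: j s)
    case 0
    then have "j = N" by simp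
    then have "bs w \<sigma> y (While a b c) s 2 s" "I N s"
      using 0 stop bs_WhileF by auto
    then show ?case unfolding runs_def using trans_le_add2[OF order_refl] by blast
  next
    case (Suc d)
    then have j: "j < N" by simp
    from step[OF j Suc.prems(2)] obtain s1 t where s1: "wmem s a < wmem s b" "t \<le> T"
      "bs w \<sigma> y c s t s1" "I (Suc j) s1" unfolding runs_def by blast
    have "d = N - Suc j" "Suc j \<le> N" using Suc.hyps(2) j by auto
    from Suc.hyps(1)[OF this s1(4)] obtain s2 t2 where
      s2: "t2 \<le> (N - Suc j) * (T + 2) + 2" "bs w \<sigma> y (While a b c) s1 t2 s2" "I N s2"
      unfolding runs_def by blast
    have "bs w \<sigma> y (While a b c) s (t + t2 + 2) s2" using s1 s2 bs_WhileT by blast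
    moreover have "N - j = Suc (N - Suc j)" using j by simp
    then have "t + t2 + 2 \<le> (N - j) * (T + 2) + 2" using s1 s2 by simp
    ultimately show ?case unfolding runs_def using s2 by blast
  qed
  from this[of 0 s] init show ?thesis by simp
qed

fun loop_free :: "com \<Rightarrow> bool" where
  "loop_free Skip = True"
| "loop_free (Ins x) = straight x"
| "loop_free (Seq c d) = (loop_free c \<and> loop_free d)"
| "loop_free (IfW a b c d) = (loop_free c \<and> loop_free d)"
| "loop_free (IfR a b c d) = (loop_free c \<and> loop_free d)"
| "loop_free (While a b c) = False"

text \<open>The clause for \<open>While\<close> is a dummy; the link to the semantics is made for
  loop-free code only.\<close>

fun xe :: "nat \<Rightarrow> (nat \<Rightarrow> nat) \<Rightarrow> real Matrix.vec \<Rightarrow> com \<Rightarrow> ram_state \<Rightarrow> ram_state" where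
  "xe w \<sigma> y Skip s = s"
| "xe w \<sigma> y (Ins x) s = exec_instr w \<sigma> y x s"
| "xe w \<sigma> y (Seq c d) s = xe w \<sigma> y d (xe w \<sigma> y c s)"
| "xe w \<sigma> y (IfW a b c d) s = (if wmem s a < wmem s b then xe w \<sigma> y c s else xe w \<sigma> y d s)"
| "xe w \<sigma> y (IfR a b c d) s = (if rmem s a < rmem s b then xe w \<sigma> y c s else xe w \<sigma> y d s)"
| "xe w \<sigma> y (While a b c) s = s"

lemma runs_xe: "loop_free c \<Longrightarrow> runs w \<sigma> y c s (xe w \<sigma> y c s) (clen c)"
proof (induction c arbitrary: s)
  case Skip
  then show ?case unfolding runs_def by (auto intro: bs_Skip)
next
  case (Ins x)
  then show ?case unfolding runs_def by (intro exI[of _ 1]) (simp add: bs_Ins[simplified])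
next
  case (Seq c d)
  then show ?case by (auto intro: runs_Seq)
next
  case (IfW a b c d)
  then have "runs w \<sigma> y c s (xe w \<sigma> y c s) (clen c + clen d)" "runs w \<sigma> y d s (xe w \<sigma> y d s) (clen c + clen d)"
    by (auto intro: runs_mono[OF _ le_add1] runs_mono[OF _ le_add2])
  then show ?case by (simp add: runs_IfW[simplified])
next
  case (IfR a b c d)
  then have "runs w \<sigma> y c s (xe w \<sigma> y c s) (clen c + clen d)" "runs w \<sigma> y d s (xe w \<sigma> y d s) (clen c + clen d)"
    by (auto intro: runs_mono[OF _ le_add1] runs_mono[OF _ le_add2])
  then show ?case by (simp add: runs_IfR[simplified])
qed simp

lemma runs_program:
  assumes "runs w \<sigma> y c s s' T" "pc s = 0"
  shows "halted (compile 0 c) ((ram_step w \<sigma> y (compile 0 c) ^^ T) s)"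
    and "outp ((ram_step w \<sigma> y (compile 0 c) ^^ T) s) = outp s'"
proof -
  let ?P = "compile 0 c"
  from assms obtain t where t: "t \<le> T" "bs w \<sigma> y c s t s'" by (auto simp: runs_def)
  have "code_at ?P 0 ?P" unfolding code_at_def by auto
  from bs_compile[OF t(2) this] have 1: "(ram_step w \<sigma> y ?P ^^ t) s = st_at s' (clen c)"
    using st_at_pc[OF assms(2)] by simp
  have "(ram_step w \<sigma> y ?P ^^ d) (st_at s' (clen c)) = st_at s' (clen c)" for d
    by (induction d) (auto simp: ram_step_def halted_def)
  moreover have "(ram_step w \<sigma> y ?P ^^ T) s = (ram_step w \<sigma> y ?P ^^ (T - t)) ((ram_step w \<sigma> y ?P ^^ t) s)"
    using t(1) by (metis comp_apply funpow_add le_add_diff_inverse2)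
  ultimately have "(ram_step w \<sigma> y ?P ^^ T) s = st_at s' (clen c)" using 1 by simp
  then show "halted ?P ((ram_step w \<sigma> y ?P ^^ T) s)" "outp ((ram_step w \<sigma> y ?P ^^ T) s) = outp s'"
    by (auto simp: halted_def)
qed

section \<open>The decoder\<close>

definition clog :: "nat \<Rightarrow> nat" where
  "clog x = (LEAST d. x \<le> 2 ^ d)"

lemma clog_le: "x \<le> 2 ^ clog x"
proof -
  have "x \<le> 2 ^ x" using less_exp[of x] by simp
  then show ?thesis unfolding clog_def by (rule LeastI)
qed

lemma clog_less: "d < clog x \<Longrightarrow> 2 ^ d < x"
  unfolding clog_def using not_less_Least[of d "\<lambda>d. x \<le> 2 ^ d"] by simp

fun wt :: "nat \<Rightarrow> nat" where
  "wt e = (if e = 0 then 0 else wt (e div 2) + e mod 2)"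

declare wt.simps [simp del]

lemma wt_rec: "wt e = wt (e div 2) + e mod 2"
  by (cases "e = 0") (simp_all add: wt.simps)

primrec gv :: "nat \<Rightarrow> nat \<Rightarrow> nat list" where
  "gv r 0 = []"
| "gv r (Suc c) = gv r c @ (if \<exists>u\<in>set (gv r c). wt (xor u c) \<le> r then [] else [c])"

text \<open>The greedy code as a table computation: a word is marked once some codeword covers it,
  so testing a new word needs one look-up instead of a pass through the list of codewords.\<close>

primrec gv_mark :: "nat \<Rightarrow> nat \<Rightarrow> nat \<Rightarrow> nat" where
  "gv_mark r 0 u = 0"
| "gv_mark r (Suc c) u =
     (if gv_mark r c c = 0 \<and> wt (xor u c) \<le> r then 1 else gv_mark r c u)"

text \<open>Entries are positions in the code plus one, leaving 0 for words that are not decodable.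
  The code uses exclusion radius \<open>2 * r\<close>, so that balls of radius \<open>r\<close>
  around codewords are disjoint.\<close>

primrec gv_tab :: "nat \<Rightarrow> nat \<Rightarrow> nat \<Rightarrow> nat" where
  "gv_tab r 0 u = 0"
| "gv_tab r (Suc c) u =
     (if gv_mark (2 * r) c c = 0 \<and> wt (xor u c) \<le> r then length (gv (2 * r) c) + 1 else gv_tab r c u)"

lemma gv_mark: "gv_mark r c u = (if \<exists>v\<in>set (gv r c). wt (xor v u) \<le> r then 1 else 0)"
  by (induction c arbitrary: u) (auto simp: xor.commute)

locale sketch =
  fixes n B c :: nat
begin

text \<open>The \<open>ss\<close> repetitions are laid out as follows: the first \<open>c\<close> of
  the range [0, dd) give the threshold, number dd supplies the hash that defines the labels, [2dd,
  6dd) serve the estimates, [6dd, 10dd) carry the code bits of the labels, and from 10dd on there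
  are 12 for each of the dd + 1 tree levels. The unit \<open>aa\<close> is log log n divided by a
  constant. Digits have 16 aa bits and code words \<open>ell\<close> = 32 aa bits, a code of rate
  one half. The number of labels per bucket is \<open>vv\<close> = 2^(64 aa), roughly at most the
  square root of 2 dd and at the same time at least the fourth root of dd.\<close>

definition "dd = clog n"
definition "nn = (2 :: nat) ^ dd"
definition "ss = 23 * dd"
definition "bh = B div 2"
definition "aa = clog dd div 128"
definition "ell = 32 * aa"
definition "vv = (2 :: nat) ^ (64 * aa)"
definition "gg = (2 :: nat) ^ (16 * aa)"
definition "nb = dd div (16 * aa) + 1"
definition "rr = 4 * dd"
definition "ww = 8 * dd"

text \<open>Even tape cells hold hash values and odd ones coefficients; the cell index determines
  both key and repetition, so distinct uses read independent words.\<close>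

definition hsh :: "(nat \<Rightarrow> nat) \<Rightarrow> nat \<Rightarrow> nat \<Rightarrow> nat" where
  "hsh \<sigma> \<rho> key = \<sigma> (2 * (key * ss + \<rho>))"

definition cw :: "(nat \<Rightarrow> nat) \<Rightarrow> nat \<Rightarrow> nat \<Rightarrow> nat" where
  "cw \<sigma> \<rho> i = \<sigma> (2 * (i * ss + \<rho>) + 1)"

text \<open>Buckets come in pairs. The hash selects the pair and the result is its even member; the
  remaining bit of the bucket number transmits a bit of data.\<close>

definition hb :: "(nat \<Rightarrow> nat) \<Rightarrow> nat \<Rightarrow> nat \<Rightarrow> nat" where
  "hb \<sigma> \<rho> key = 2 * (hsh \<sigma> \<rho> key mod bh)"

definition row :: "real Matrix.vec \<Rightarrow> nat \<Rightarrow> nat \<Rightarrow> real" where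
  "row y \<rho> b = vec_index y (\<rho> * B + b)"

definition arow :: "(nat \<Rightarrow> nat) \<Rightarrow> real Matrix.vec \<Rightarrow> nat \<Rightarrow> nat \<Rightarrow> nat \<Rightarrow> real" where
  "arow \<sigma> y \<rho> key \<beta> = \<bar>row y \<rho> (hb \<sigma> \<rho> key + \<beta>)\<bar>"

text \<open>The square of the factor, \<open>2 ^ 414\<close>, outweighs the ratio \<open>2 ^ 410\<close> between the number of
  buckets and the number of exceptional coordinates allowed in the analysis.\<close>

definition thr :: "real Matrix.vec \<Rightarrow> real" where
  "thr y = 2 ^ 207 * Max ((\<lambda>\<rho>. \<bar>row y \<rho> 0\<bar>) ` {..<c})"

definition "code = gv (2 * aa) (2 ^ ell)"
definition "tab u = gv_tab aa (2 ^ ell) u"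

definition xrep :: "nat \<Rightarrow> nat \<Rightarrow> nat" where
  "xrep t j = 6 * dd + t * ell + j"

definition xword :: "(nat \<Rightarrow> nat) \<Rightarrow> real Matrix.vec \<Rightarrow> nat \<Rightarrow> nat \<Rightarrow> nat" where
  "xword \<sigma> y z t = (\<Sum>j<ell. if arow \<sigma> y (xrep t j) z 0 < arow \<sigma> y (xrep t j) z 1 then 2 ^ j else 0)"

text \<open>Counts the erased bits, where neither bucket of the pair exceeds the threshold. Empty
  labels are recognised by this count.\<close>

definition xera :: "(nat \<Rightarrow> nat) \<Rightarrow> real Matrix.vec \<Rightarrow> real \<Rightarrow> nat \<Rightarrow> nat \<Rightarrow> nat" where
  "xera \<sigma> y \<theta> z t = (\<Sum>j<ell. if \<theta> < arow \<sigma> y (xrep t j) z 0 \<or> \<theta> < arow \<sigma> y (xrep t j) z 1 then 0 else 1)"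

definition xok :: "(nat \<Rightarrow> nat) \<Rightarrow> real Matrix.vec \<Rightarrow> real \<Rightarrow> nat \<Rightarrow> nat \<Rightarrow> bool" where
  "xok \<sigma> y \<theta> z t \<longleftrightarrow> xera \<sigma> y \<theta> z t \<le> aa \<and> tab (xword \<sigma> y z t) > 0"

definition xdig :: "(nat \<Rightarrow> nat) \<Rightarrow> real Matrix.vec \<Rightarrow> nat \<Rightarrow> nat \<Rightarrow> nat" where
  "xdig \<sigma> y z t = tab (xword \<sigma> y z t) - 1"

text \<open>One step reads one digit of one label and costs time proportional to \<open>ell\<close>.
  A label is dropped at its first unreadable digit; only this makes it affordable to look at all
  \<open>B * vv\<close> labels, since most of them end after one step.\<close>

fun stepX :: "(nat \<Rightarrow> nat) \<Rightarrow> real Matrix.vec \<Rightarrow> real \<Rightarrow> nat \<times> nat \<times> nat \<times> nat list \<Rightarrow> nat \<times> nat \<times> nat \<times> nat list" where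
  "stepX \<sigma> y \<theta> (z, t, acc, cs) =
    (if z < B * vv then
       if xok \<sigma> y \<theta> z t then
         let acc' = acc * gg + xdig \<sigma> y z t in
         if t + 1 < nb then (z, t + 1, acc', cs)
         else (z + 1, 0, 0, if acc' < n then cs @ [acc'] else cs)
       else (z + 1, 0, 0, cs)
     else (z, t, acc, cs))"

definition grep :: "nat \<Rightarrow> nat \<Rightarrow> nat" where
  "grep lev r = 10 * dd + 12 * lev + r"

definition gpass :: "(nat \<Rightarrow> nat) \<Rightarrow> real Matrix.vec \<Rightarrow> real \<Rightarrow> nat \<Rightarrow> nat \<Rightarrow> bool" where
  "gpass \<sigma> y \<theta> lev v \<longleftrightarrow> (\<exists>r<12. \<theta> < arow \<sigma> y (grep lev r) v 0)"

text \<open>Nodes are numbered as in a heap: the root is 1, the children of v are 2v and 2v + 1, and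
  the leaf of index i is \<open>nn + i\<close>. Hence \<open>v < nn\<close> characterises inner
  nodes.\<close>

fun stepG :: "(nat \<Rightarrow> nat) \<Rightarrow> real Matrix.vec \<Rightarrow> real \<Rightarrow> nat \<times> (nat \<times> nat) list \<times> nat list \<Rightarrow> nat \<times> (nat \<times> nat) list \<times> nat list" where
  "stepG \<sigma> y \<theta> (h, q, cs) =
    (if h < length q then
       let (lev, v) = q ! h in
       if gpass \<sigma> y \<theta> lev v then
         if v < nn then (h + 1, q @ [(lev + 1, 2 * v), (lev + 1, 2 * v + 1)], cs)
         else (h + 1, q, if v - nn < n then cs @ [v - nn] else cs)
       else (h + 1, q, cs)
     else (h, q, cs))"

definition sg :: "nat \<Rightarrow> real" where
  "sg v = (if even v then 1 else -1)"

definition eval_at :: "(nat \<Rightarrow> nat) \<Rightarrow> real Matrix.vec \<Rightarrow> nat \<Rightarrow> nat \<Rightarrow> real" where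
  "eval_at \<sigma> y i j = sg (cw \<sigma> (2 * dd + j) i) * row y (2 * dd + j) (hb \<sigma> (2 * dd + j) i)"

definition ecnt :: "(nat \<Rightarrow> nat) \<Rightarrow> real Matrix.vec \<Rightarrow> real \<Rightarrow> nat \<Rightarrow> real \<Rightarrow> nat" where
  "ecnt \<sigma> y \<theta> i v = (\<Sum>j<rr. if 2 * \<theta> < \<bar>eval_at \<sigma> y i j - v\<bar> then 0 else 1)"

text \<open>One step tries one pivot at the cost of comparing it with all \<open>rr\<close>
  repetitions. An accepted item counts as seen even if its value is too small to be reported, so
  duplicates of it among the candidates cost one step each.\<close>

fun stepE :: "(nat \<Rightarrow> nat) \<Rightarrow> real Matrix.vec \<Rightarrow> real \<Rightarrow> nat list \<Rightarrow> nat \<times> nat \<times> nat set \<times> (nat \<times> real) list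
    \<Rightarrow> nat \<times> nat \<times> nat set \<times> (nat \<times> real) list" where
  "stepE \<sigma> y \<theta> cs (k, t, seen, out) =
    (if k < length cs then
       let i = cs ! k in
       if i \<in> seen then (k + 1, 0, seen, out)
       else let v = eval_at \<sigma> y i t in
         if rr < 2 * ecnt \<sigma> y \<theta> i v then
           (k + 1, 0, insert i seen, if 6 * \<theta> < \<bar>v\<bar> then out @ [(i, v)] else out)
         else if t + 1 < rr then (k, t + 1, seen, out)
         else (k + 1, 0, seen, out)
     else (k, t, seen, out))"

text \<open>The three budgets are balanced against the cost of a step: \<open>c * B * nb\<close>
  steps of cost O(ell) here, \<open>c * B * dd\<close> steps of constant cost in the tree,
  \<open>c * B\<close> steps of cost O(dd) for the estimates. Each product is O(c * B * dd).\<close>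

definition candX :: "(nat \<Rightarrow> nat) \<Rightarrow> real Matrix.vec \<Rightarrow> real \<Rightarrow> nat list" where
  "candX \<sigma> y \<theta> = snd (snd (snd ((stepX \<sigma> y \<theta> ^^ (c * B * nb)) (0, 0, 0, []))))"

definition candG :: "(nat \<Rightarrow> nat) \<Rightarrow> real Matrix.vec \<Rightarrow> real \<Rightarrow> nat list \<Rightarrow> nat list" where
  "candG \<sigma> y \<theta> cs = snd (snd ((stepG \<sigma> y \<theta> ^^ (c * B * dd)) (0, [(0, 1)], cs)))"

definition outE :: "(nat \<Rightarrow> nat) \<Rightarrow> real Matrix.vec \<Rightarrow> real \<Rightarrow> nat list \<Rightarrow> (nat \<times> real) list" where
  "outE \<sigma> y \<theta> cs = snd (snd (snd ((stepE \<sigma> y \<theta> cs ^^ (c * B)) (0, 0, {}, []))))"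

definition decode :: "(nat \<Rightarrow> nat) \<Rightarrow> real Matrix.vec \<Rightarrow> (nat \<times> real) list" where
  "decode \<sigma> y = outE \<sigma> y (thr y) (candG \<sigma> y (thr y) (candX \<sigma> y (thr y)))"

end

lemma clog_le_self: "clog x \<le> x"
  unfolding clog_def by (rule Least_le) (simp add: less_imp_le)

lemma funpow_inv: "(\<And>m. P m \<Longrightarrow> P (f m)) \<Longrightarrow> P m0 \<Longrightarrow> P ((f ^^ k) m0)"
  by (induction k) auto

context sketch begin

lemma candX_less: "x \<in> set (candX \<sigma> y \<theta>) \<Longrightarrow> x < n"
proof -
  define P where "P m \<longleftrightarrow> (\<forall>x\<in>set (snd (snd (snd m))). x < n)" for m :: "nat \<times> nat \<times> nat \<times> nat list"
  have step: "P (stepX \<sigma> y \<theta> m)" if "P m" for m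
    using that by (cases m) (auto simp: P_def Let_def)
  have "P (0, 0, 0, [])" by (simp add: P_def)
  with step have "P ((stepX \<sigma> y \<theta> ^^ (c * B * nb)) (0, 0, 0, []))"
    by (rule funpow_inv)
  then show "x \<in> set (candX \<sigma> y \<theta>) \<Longrightarrow> x < n" unfolding P_def candX_def by blast
qed

lemma candG_less: "\<forall>x\<in>set cs. x < n \<Longrightarrow> x \<in> set (candG \<sigma> y \<theta> cs) \<Longrightarrow> x < n"
proof -
  assume cs: "\<forall>x\<in>set cs. x < n"
  define P where "P m \<longleftrightarrow> (\<forall>x\<in>set (snd (snd m)). x < n)" for m :: "nat \<times> (nat \<times> nat) list \<times> nat list"
  have step: "P (stepG \<sigma> y \<theta> m)" if "P m" for m
    using that by (cases m) (auto simp: P_def split: prod.splits)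
  have "P (0, [(0, 1)], cs)" using cs by (simp add: P_def)
  with step have "P ((stepG \<sigma> y \<theta> ^^ (c * B * dd)) (0, [(0, 1)], cs))"
    by (rule funpow_inv)
  then show "x \<in> set (candG \<sigma> y \<theta> cs) \<Longrightarrow> x < n" unfolding P_def candG_def by blast
qed

end

text \<open>This is the regime in which hashing is used at all: fewer rows than columns, and n so
  large that the unit \<open>aa\<close> of log log n is positive.\<close>

locale sketch_par = sketch +
  assumes rows_less: "ss * B < n"
    and B_even: "even B" and B_pos: "0 < B"
    and aa_pos: "0 < aa"
    and c_le: "c \<le> dd" and c_pos: "0 < c"
begin

section \<open>Size estimates for the parameters\<close>

lemma n_le_nn: "n \<le> nn" unfolding nn_def dd_def by (rule clog_le)

lemma dd_big: "2 ^ (128 * aa) \<le> 2 * dd" "128 \<le> clog dd"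
proof -
  show "128 \<le> clog dd" using aa_pos unfolding aa_def by linarith
  then have "2 ^ (clog dd - 1) < dd" by (intro clog_less) simp
  then have "2 ^ clog dd < 2 * dd" using \<open>128 \<le> clog dd\<close> by (cases "clog dd") auto
  moreover have "(2::nat) ^ (128 * aa) \<le> 2 ^ clog dd" unfolding aa_def by (intro power_increasing) auto
  ultimately show "2 ^ (128 * aa) \<le> 2 * dd" by linarith
qed

lemma vv_sq: "vv * vv \<le> 2 * dd" "vv = (2 ^ ell) * 2 ^ ell" "gg * gg = 2 ^ ell"
  using dd_big(1) by (auto simp: vv_def ell_def gg_def power_add[symmetric] mult_2[symmetric])

lemma two_ell: "2 \<le> (2::nat) ^ ell"
proof -
  have "(2::nat) ^ 1 \<le> 2 ^ ell" using aa_pos unfolding ell_def by (intro power_increasing) auto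
  then show ?thesis by simp
qed

lemma vv_ge: "128 * aa \<le> vv" "2 ^ 64 \<le> vv"
proof -
  have 1: "x * 2 ^ 7 \<le> (2::nat) ^ (64 * x)" if "0 < x" for x :: nat
    using that
  proof (induction x rule: nat_induct_non_zero)
    case (Suc m)
    have "Suc m * 2 ^ 7 \<le> 2 * (m * 2 ^ 7)" using Suc by simp
    also have "\<dots> \<le> 2 ^ 64 * (2::nat) ^ (64 * m)" using Suc by (intro mult_mono) auto
    also have "\<dots> = 2 ^ (64 * Suc m)" by (simp only: power_add[symmetric] mult_Suc_right)
    finally show ?case .
  qed simp
  from 1[OF aa_pos] show "128 * aa \<le> vv" by (simp add: vv_def)
  show "2 ^ 64 \<le> vv" unfolding vv_def using aa_pos by (intro power_increasing) auto
qed

lemma vv_dd: "vv \<le> dd" "ell \<le> dd" "2 ^ ell \<le> dd" "128 * aa \<le> dd"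
proof -
  have "2 * vv \<le> vv * vv" using vv_ge(2) by (intro mult_le_mono1) simp
  then show "vv \<le> dd" using vv_sq(1) by linarith
  then show "128 * aa \<le> dd" using vv_ge(1) by linarith
  then show "ell \<le> dd" unfolding ell_def by linarith
  have "2 ^ ell \<le> vv" using vv_sq(2) two_ell by simp
  then show "2 ^ ell \<le> dd" using \<open>vv \<le> dd\<close> by linarith
qed

text \<open>The bound \<open>vv \<le> nb\<close> pays for scanning: one step on each of the
  \<open>B * vv\<close> labels fits into \<open>B * nb\<close> steps. It holds because
  \<open>vv\<close> squared is at most 2 dd while \<open>vv\<close> is also at least 128 aa. The
  first bound keeps all label repetitions inside their 4 dd slots.\<close>

lemma nb_ell: "nb * ell \<le> 3 * dd" "nb \<le> dd + 1" "vv \<le> nb" "dd \<le> nb * (16 * aa)"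
proof -
  have "nb * (16 * aa) \<le> dd + 16 * aa" unfolding nb_def
    using div_times_less_eq_dividend[of dd "16 * aa"] by (simp add: add_mult_distrib)
  moreover have "nb * ell = 2 * (nb * (16 * aa))" unfolding ell_def by simp
  ultimately show "nb * ell \<le> 3 * dd" using vv_dd(4) by linarith
  show "nb \<le> dd + 1" unfolding nb_def by simp
  have "dd mod (16 * aa) < 16 * aa" using aa_pos by (intro mod_less_divisor) simp
  then show *: "dd \<le> nb * (16 * aa)" unfolding nb_def
    using div_mult_mod_eq[of dd "16 * aa"] by (simp add: algebra_simps)
  have "vv * (4 * (16 * aa)) \<le> vv * vv" using vv_ge(1) by (intro mult_le_mono2) simp
  then have "vv * (16 * aa) \<le> dd" using vv_sq(1) by linarith
  then have "vv * (16 * aa) \<le> nb * (16 * aa)" using * by (rule le_trans)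
  then show "vv \<le> nb" using aa_pos by simp
qed

lemma dd_pos: "64 \<le> dd" using vv_dd(1) vv_ge(2) by simp

lemma nn_ge: "10000 \<le> nn"
proof -
  have "(2::nat) ^ 64 \<le> 2 ^ dd" using dd_pos by (intro power_increasing) auto
  then show ?thesis unfolding nn_def by simp
qed

lemma bnds: "23 * dd \<le> nn" "B \<le> nn" "23 * (dd * B) \<le> nn" "B * vv \<le> nn"
proof -
  have 1: "23 * (dd * B) \<le> nn" using rows_less n_le_nn unfolding ss_def by (simp add: mult.assoc)
  show "23 * (dd * B) \<le> nn" by (fact 1)
  have "dd * 1 \<le> dd * B" using B_pos by (intro mult_le_mono2) simp
  then show "23 * dd \<le> nn" using 1 by linarith
  have "1 * B \<le> dd * B" using dd_pos by (intro mult_le_mono1) simp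
  then show "B \<le> nn" using 1 by linarith
  have "B * vv \<le> B * dd" using vv_dd(1) by simp
  then show "B * vv \<le> nn" using 1 mult.commute[of B dd] by linarith
qed

lemma PW_eq: "2 ^ ww = nn ^ 8" unfolding ww_def nn_def by (simp add: power_mult[symmetric] mult.commute)

lemma less_PW: "x < nn ^ k \<Longrightarrow> k \<le> 8 \<Longrightarrow> x < 2 ^ ww"
  unfolding PW_eq using power_increasing[of k 8 nn] nn_ge by linarith

lemma nn_Suc: "10000 * nn ^ k \<le> nn ^ Suc k"
  using mult_le_mono1[OF nn_ge, of "nn ^ k"] by (simp only: power_Suc)

text \<open>Powers of \<open>nn\<close> serve as a coarse scale up to the word range
  \<open>nn ^ 8\<close>, with gaps of 10000 absorbing all constants, so that the absence of overflow
  becomes linear arithmetic.\<close>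

lemma nn_pows: "10000 * nn \<le> nn ^ 2" "10000 * nn ^ 2 \<le> nn ^ 3" "10000 * nn ^ 3 \<le> nn ^ 4" "10000 * nn ^ 4 \<le> nn ^ 5"
  "10000 * nn ^ 5 \<le> nn ^ 6" "10000 * nn ^ 6 \<le> nn ^ 7" "10000 * nn ^ 7 \<le> 2 ^ ww"
proof -
  show "10000 * nn \<le> nn ^ 2" using nn_Suc[of 1] by (simp add: power2_eq_square)
  show "10000 * nn ^ 2 \<le> nn ^ 3" "10000 * nn ^ 3 \<le> nn ^ 4" "10000 * nn ^ 4 \<le> nn ^ 5"
    "10000 * nn ^ 5 \<le> nn ^ 6" "10000 * nn ^ 6 \<le> nn ^ 7" "10000 * nn ^ 7 \<le> 2 ^ ww"
    using nn_Suc[of 2] nn_Suc[of 3] nn_Suc[of 4] nn_Suc[of 5] nn_Suc[of 6] nn_Suc[of 7]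
    by (simp_all only: PW_eq Suc_numeral semiring_norm)
qed

lemma key_bound:
  assumes "key \<le> 2 * nn" "\<rho> < ss"
  shows "2 * (key * ss + \<rho>) + 1 < 2 ^ ww"
proof -
  have "key * ss \<le> (2 * nn) * nn" using assms(1) bnds(1) unfolding ss_def by (intro mult_le_mono) auto
  moreover have "\<rho> \<le> nn" using assms(2) bnds(1) unfolding ss_def by linarith
  ultimately have "2 * (key * ss + \<rho>) + 1 \<le> 4 * nn ^ 2 + 2 * nn + 1" by (simp add: power2_eq_square)
  then show ?thesis using nn_pows nn_ge by linarith
qed

lemma bh_eq: "2 * bh = B" "0 < bh" "B \<le> nn"
proof -
  show *: "2 * bh = B" using B_even by (simp add: bh_def)
  show "0 < bh" using * B_pos by linarith
  show "B \<le> nn" by (fact bnds)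
qed

lemma hb_less: "hb \<sigma> \<rho> k + 1 < B"
proof -
  have "hsh \<sigma> \<rho> k mod bh < bh" using bh_eq by simp
  then show ?thesis using bh_eq(1) unfolding hb_def by linarith
qed

end

section \<open>The program\<close>

abbreviation SETW :: "nat \<Rightarrow> nat \<Rightarrow> com" where
  "SETW d v \<equiv> Ins (WConst d v)"
abbreviation ADD :: "nat \<Rightarrow> nat \<Rightarrow> nat \<Rightarrow> com" where
  "ADD d a b \<equiv> Ins (WOp WAdd d a b)"
abbreviation SUB :: "nat \<Rightarrow> nat \<Rightarrow> nat \<Rightarrow> com" where
  "SUB d a b \<equiv> Ins (WOp WSub d a b)"
abbreviation MUL :: "nat \<Rightarrow> nat \<Rightarrow> nat \<Rightarrow> com" where
  "MUL d a b \<equiv> Ins (WOp WMul d a b)"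
abbreviation DIV :: "nat \<Rightarrow> nat \<Rightarrow> nat \<Rightarrow> com" where
  "DIV d a b \<equiv> Ins (WOp WDiv d a b)"
abbreviation MOD :: "nat \<Rightarrow> nat \<Rightarrow> nat \<Rightarrow> com" where
  "MOD d a b \<equiv> Ins (WOp WMod d a b)"
abbreviation INC :: "nat \<Rightarrow> com" where
  "INC d \<equiv> Ins (WOp WAdd d d 3)"

text \<open>Word registers 0--29 hold parameters, 30--63 are scratch; element \<open>j\<close> of array \<open>k\<close>
  lives at address \<open>64 + 8 * j + k\<close>.\<close>

definition ad :: "nat \<Rightarrow> nat \<Rightarrow> nat" where
  "ad k j = 64 + 8 * j + k"

definition ADDR :: "nat \<Rightarrow> nat \<Rightarrow> com" where
  "ADDR k j = (SETW 62 8 ;; MUL 62 62 j ;; SETW 63 (64 + k) ;; ADD 62 62 63)"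

definition LOADA :: "nat \<Rightarrow> nat \<Rightarrow> nat \<Rightarrow> com" where
  "LOADA d k j = (ADDR k j ;; Ins (WLoad d 62))"

definition STOREA :: "nat \<Rightarrow> nat \<Rightarrow> nat \<Rightarrow> com" where
  "STOREA k j v = (ADDR k j ;; Ins (WStore 62 v))"

definition HSH :: "nat \<Rightarrow> nat \<Rightarrow> nat \<Rightarrow> com" where
  "HSH d k r = (MUL d k 6 ;; ADD d d r ;; ADD d d d ;; Ins (ReadTape d d) ;; MOD d d 8 ;; ADD d d d)"

definition ROW :: "nat \<Rightarrow> nat \<Rightarrow> nat \<Rightarrow> com" where
  "ROW r \<rho> b = (MUL 62 \<rho> 7 ;; ADD 62 62 b ;; Ins (ReadSketch r 62))"

definition RABS :: "nat \<Rightarrow> com" where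
  "RABS r = IfR r 1 (Ins (ROp RSub r 1 r)) Skip"

definition CLOG :: "nat \<Rightarrow> nat \<Rightarrow> nat \<Rightarrow> com" where
  "CLOG x d p = ((SETW d 0 ;; SETW p 1) ;; While p x (ADD p p p ;; INC d))"

text \<open>The number of buckets is not an input; it is recovered as the sketch length divided by
  \<open>ss\<close>, and \<open>ss\<close> follows from n.\<close>

definition pInit :: "nat \<Rightarrow> com" where
  "pInit c = (SETW 3 1 ;; CLOG 0 4 5 ;; (SETW 30 23 ;; MUL 6 30 4 ;; DIV 7 2 6 ;; SETW 25 2 ;; DIV 8 7 25) ;;
     CLOG 4 9 10 ;; SETW 30 128 ;; DIV 11 9 30 ;; SETW 30 32 ;; MUL 12 30 11 ;; Ins (WOp WShl 13 3 12) ;;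
     SETW 30 64 ;; MUL 31 30 11 ;; Ins (WOp WShl 31 3 31) ;; MUL 14 7 31 ;;
     SETW 30 16 ;; MUL 31 30 11 ;; Ins (WOp WShl 15 3 31) ;; DIV 16 4 31 ;; INC 16 ;;
     SETW 23 c ;; MUL 19 23 7 ;; MUL 17 19 4 ;; MUL 18 19 16 ;; SETW 30 4 ;; MUL 20 30 4 ;;
     ADD 22 11 3 ;; ADD 21 22 11 ;; SETW 26 12 ;; SETW 30 6 ;; MUL 27 30 4 ;; SETW 30 10 ;; MUL 28 30 4 ;;
     MUL 29 25 4)"

definition pWt :: com where
  "pWt = (SETW 53 0 ;; While 53 13
     (DIV 56 53 25 ;; LOADA 57 0 56 ;; MOD 56 53 25 ;; ADD 57 57 56 ;; STOREA 0 53 57 ;; INC 53))"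

definition pGVin :: com where
  "pGVin = (SETW 55 0 ;; While 55 13
     (Ins (WOp WXor 56 55 53) ;; LOADA 57 0 56 ;;
      IfW 57 21 (STOREA 1 55 3) Skip ;;
      IfW 57 22 (STOREA 2 55 54) Skip ;; INC 55))"

definition pGV :: com where
  "pGV = ((SETW 53 0 ;; SETW 54 0) ;; While 53 13
     (LOADA 57 1 53 ;; IfW 57 3 (INC 54 ;; pGVin) Skip ;; INC 53))"

text \<open>Real constants exist only as images of words, so 2^207 is built as a word first. Real
  registers 2, 3 and 4 receive the threshold, its double and its sixfold.\<close>

definition pThr :: com where
  "pThr = (((SETW 30 (2 ^ 207) ;; Ins (ROfWord 7 30) ;; SETW 30 0 ;; SETW 31 0) ;; While 30 23
     (ROW 5 30 31 ;; RABS 5 ;; IfR 2 5 (Ins (ROp RAdd 2 1 5)) Skip ;; INC 30)) ;;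
     Ins (ROp RMul 2 7 2) ;; Ins (ROp RAdd 3 2 2) ;; Ins (ROp RAdd 4 3 3) ;; Ins (ROp RAdd 4 4 3))"

definition pXin :: com where
  "pXin = ((SETW 34 0 ;; SETW 35 0 ;; SETW 36 1 ;; SETW 37 0) ;; While 37 12
     (MUL 38 32 12 ;; ADD 38 38 27 ;; ADD 38 38 37 ;; HSH 39 31 38 ;; ROW 5 38 39 ;; INC 39 ;; ROW 6 38 39 ;;
      RABS 5 ;; RABS 6 ;; IfR 5 6 (ADD 35 35 36) Skip ;;
      IfR 2 5 Skip (IfR 2 6 Skip (INC 34)) ;; ADD 36 36 36 ;; INC 37))"

definition pXout :: com where
  "pXout = (LOADA 40 2 35 ;; SETW 39 0 ;;
     IfW 34 22 (IfW 39 40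
       (MUL 33 33 15 ;; ADD 33 33 40 ;; SUB 33 33 3 ;; INC 32 ;;
        IfW 32 16 Skip
          (IfW 33 0 (STOREA 3 24 33 ;; INC 24) Skip ;; INC 31 ;; SETW 32 0 ;; SETW 33 0))
       (INC 31 ;; SETW 32 0 ;; SETW 33 0))
     (INC 31 ;; SETW 32 0 ;; SETW 33 0))"

definition pX :: com where
  "pX = ((SETW 30 0 ;; SETW 31 0 ;; SETW 32 0 ;; SETW 33 0 ;; SETW 24 0) ;;
     While 30 18 (IfW 31 14 (pXin ;; pXout) Skip ;; INC 30))"

definition pGin :: com where
  "pGin = ((SETW 45 0 ;; SETW 46 0 ;; SETW 37 0) ;; While 46 26
     (MUL 38 44 26 ;; ADD 38 38 28 ;; ADD 38 38 46 ;; HSH 39 43 38 ;; ROW 5 38 39 ;; RABS 5 ;;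
      IfR 2 5 (SETW 45 1) Skip ;; INC 46))"

definition pGout :: com where
  "pGout = (INC 41 ;; IfW 37 45
     (IfW 43 5
       (ADD 43 43 43 ;; INC 44 ;; STOREA 4 42 43 ;; STOREA 5 42 44 ;; INC 42 ;;
        INC 43 ;; STOREA 4 42 43 ;; STOREA 5 42 44 ;; INC 42)
       (SUB 43 43 5 ;; IfW 43 0 (STOREA 3 24 43 ;; INC 24) Skip))
     Skip)"

definition pG :: com where
  "pG = ((SETW 30 0 ;; SETW 41 0 ;; SETW 42 0 ;; STOREA 4 41 3 ;; STOREA 5 41 42 ;; SETW 42 1) ;;
     While 30 17 (IfW 41 42 ((LOADA 43 4 41 ;; LOADA 44 5 41) ;; pGin ;; pGout) Skip ;; INC 30))"

text \<open>\<open>eval_at\<close> of the item in register 49 at the repetition in register \<open>j\<close>\<close>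

definition VAL :: "nat \<Rightarrow> nat \<Rightarrow> com" where
  "VAL r j = (ADD 38 j 29 ;; HSH 39 49 38 ;; ROW r 38 39 ;;
     MUL 39 49 6 ;; ADD 39 39 38 ;; ADD 39 39 39 ;; INC 39 ;; Ins (ReadTape 39 39) ;; MOD 39 39 25 ;;
     IfW 39 3 Skip (Ins (ROp RSub r 1 r)))"

definition pEin :: com where
  "pEin = ((VAL 5 48 ;; SETW 50 0 ;; SETW 51 0) ;; While 51 20
     (VAL 6 51 ;; Ins (ROp RSub 6 6 5) ;; RABS 6 ;; IfR 3 6 Skip (INC 50) ;; INC 51))"

definition pEout :: com where
  "pEout = (ADD 50 50 50 ;; IfW 20 50
     (STOREA 6 49 3 ;; Ins (ROp RAdd 6 5 1) ;; RABS 6 ;; IfR 4 6 (Ins (Emit 49 5)) Skip ;; INC 47 ;; SETW 48 0)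
     (INC 48 ;; IfW 48 20 Skip (INC 47 ;; SETW 48 0)))"

text \<open>The flags of seen items (array 6) are never cleared: the memory starts at zero, and
  initialising n flags would exceed a time bound linear in the number of rows.\<close>

definition pE :: com where
  "pE = ((SETW 30 0 ;; SETW 47 0 ;; SETW 48 0) ;; While 30 19
     (IfW 47 24 ((LOADA 49 3 47 ;; LOADA 52 6 49) ;;
        IfW 52 3 (pEin ;; pEout) (INC 47 ;; SETW 48 0)) Skip ;; INC 30))"

definition pIdent :: com where
  "pIdent = ((SETW 3 1 ;; SETW 30 0) ;; While 30 0
     (Ins (ReadSketch 5 30) ;; IfR 5 1 (Ins (Emit 30 5)) (IfR 1 5 (Ins (Emit 30 5)) Skip) ;; INC 30))"

text \<open>The sketch length itself tells the two constructions apart: hashing is used only with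
  fewer than n rows, the identity matrix has exactly n.\<close>

definition prog :: "nat \<Rightarrow> com" where
  "prog c = IfW 2 0 (pInit c ;; pWt ;; pGV ;; pThr ;; pX ;; pG ;; pE) pIdent"

section \<open>Disjoint arrays and frame conditions\<close>

lemma ad_eq [simp]: "k < 8 \<Longrightarrow> k' < 8 \<Longrightarrow> ad k j = ad k' j' \<longleftrightarrow> k = k' \<and> j = j'"
proof -
  assume k: "k < 8" "k' < 8"
  have "k = k' \<and> j = j'" if "8 * j + k = 8 * j' + k'"
  proof -
    have "(8 * j + k) div 8 = j" "(8 * j' + k') div 8 = j'" using k by simp_all
    then have "j = j'" using that by simp
    then show ?thesis using that by simp
  qed
  then show ?thesis by (auto simp: ad_def)
qed

lemma ad_reg [simp]: "r < 64 \<Longrightarrow> ad k j \<noteq> r" "r < 64 \<Longrightarrow> r \<noteq> ad k j"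
  by (auto simp: ad_def)

definition same :: "nat set \<Rightarrow> nat set \<Rightarrow> ram_state \<Rightarrow> ram_state \<Rightarrow> bool" where
  "same U R s s' \<longleftrightarrow> (\<forall>r. r \<notin> U \<longrightarrow> wmem s' r = wmem s r) \<and> (\<forall>r. r \<notin> R \<longrightarrow> rmem s' r = rmem s r) \<and>
     outp s' = outp s"

lemma same_refl [simp]: "same U R s s"
  by (simp add: same_def)

lemma same_trans: "same U R s s' \<Longrightarrow> same U R s' s'' \<Longrightarrow> same U R s s''"
  by (simp add: same_def)

lemma same_mono: "same U R s s' \<Longrightarrow> U \<subseteq> U' \<Longrightarrow> R \<subseteq> R' \<Longrightarrow> same U' R' s s'"
  unfolding same_def by blast

lemma sameW: "same U R s s' \<Longrightarrow> r \<notin> U \<Longrightarrow> wmem s' r = wmem s r"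
  and sameR: "same U R s s' \<Longrightarrow> r \<notin> R \<Longrightarrow> rmem s' r = rmem s r"
  and same_outp: "same U R s s' \<Longrightarrow> outp s' = outp s"
  by (auto simp: same_def)

lemma set_w_simps [simp]: "wmem (set_w d v s) = (wmem s)(d := v)" "rmem (set_w d v s) = rmem s"
  "outp (set_w d v s) = outp s"
  by (auto simp: set_w_def)

lemma set_r_simps [simp]: "rmem (set_r d v s) = (rmem s)(d := v)" "wmem (set_r d v s) = wmem s"
  "outp (set_r d v s) = outp s"
  by (auto simp: set_r_def)

locale sketch_run = sketch_par +
  fixes \<sigma> :: "nat \<Rightarrow> nat" and y :: "real Matrix.vec"
  assumes dim_y: "dim_vec y = ss * B"
begin

abbreviation "run \<equiv> runs ww \<sigma> y"
abbreviation "xx \<equiv> xe ww \<sigma> y"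

definition pars :: "ram_state \<Rightarrow> bool" where
  "pars s \<longleftrightarrow> wmem s 0 = n \<and> wmem s 3 = 1 \<and> wmem s 4 = dd \<and> wmem s 5 = nn \<and> wmem s 6 = ss \<and> wmem s 7 = B \<and>
     wmem s 8 = bh \<and> wmem s 11 = aa \<and> wmem s 12 = ell \<and> wmem s 13 = 2 ^ ell \<and> wmem s 14 = B * vv \<and>
     wmem s 15 = gg \<and> wmem s 16 = nb \<and> wmem s 17 = c * B * dd \<and> wmem s 18 = c * B * nb \<and> wmem s 19 = c * B \<and>
     wmem s 20 = rr \<and> wmem s 21 = 2 * aa + 1 \<and> wmem s 22 = aa + 1 \<and> wmem s 23 = c \<and> wmem s 25 = 2 \<and>
     wmem s 26 = 12 \<and> wmem s 27 = 6 * dd \<and> wmem s 28 = 10 * dd \<and> wmem s 29 = 2 * dd \<and> rmem s 1 = 0"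

lemma pars_same:
  assumes "same U R s s'" "pars s" "\<And>r. r \<in> U \<Longrightarrow> r = 24 \<or> 30 \<le> r" "1 \<notin> R"
  shows "pars s'"
proof -
  have "wmem s' r = wmem s r" if "r \<noteq> 24" "r < 30" for r
    using assms(1,3) that by (intro sameW) fastforce+
  moreover have "rmem s' 1 = rmem s 1" using assms by (intro sameR)
  ultimately show "pars s'" using assms(2) unfolding pars_def by simp
qed

section \<open>Symbolic execution of loop-free code\<close>

lemma xe_ADDR:
  assumes "ad k (wmem s j) < 2 ^ ww" "j < 62"
  shows "wmem (xx (ADDR k j) s) = (wmem s)(62 := ad k (wmem s j), 63 := 64 + k)"
    "rmem (xx (ADDR k j) s) = rmem s" "outp (xx (ADDR k j) s) = outp s"
proof -
  have 1: "8 < (2::nat) ^ ww" "64 + k < 2 ^ ww" "8 * wmem s j < 2 ^ ww" "8 * wmem s j + (64 + k) < 2 ^ ww"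
    using assms unfolding ad_def by linarith+
  have 2: "8 * wmem s j + (64 + k) = ad k (wmem s j)" by (simp add: ad_def)
  show "wmem (xx (ADDR k j) s) = (wmem s)(62 := ad k (wmem s j), 63 := 64 + k)"
    using assms(2) by (intro ext) (simp add: ADDR_def 2[symmetric] mod_less[OF 1(1)] mod_less[OF 1(2)]
      mod_less[OF 1(3)] mod_less[OF 1(4)] del: mod_less)
  show "rmem (xx (ADDR k j) s) = rmem s" "outp (xx (ADDR k j) s) = outp s"
    by (auto simp: ADDR_def)
qed

lemma xe_LOADA [simp]:
  assumes "ad k (wmem s j) < 2 ^ ww" "j < 62"
  shows "wmem (xx (LOADA d k j) s) = (wmem s)(62 := ad k (wmem s j), 63 := 64 + k, d := wmem s (ad k (wmem s j)))"
    "rmem (xx (LOADA d k j) s) = rmem s" "outp (xx (LOADA d k j) s) = outp s"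
  unfolding LOADA_def by (simp_all add: xe_ADDR[OF assms])

lemma xe_STOREA [simp]:
  assumes "ad k (wmem s j) < 2 ^ ww" "j < 62" "v < 62"
  shows "wmem (xx (STOREA k j v) s) = (wmem s)(62 := ad k (wmem s j), 63 := 64 + k, ad k (wmem s j) := wmem s v)"
    "rmem (xx (STOREA k j v) s) = rmem s" "outp (xx (STOREA k j v) s) = outp s"
  unfolding STOREA_def using assms(3) by (simp_all add: xe_ADDR[OF assms(1,2)])

lemma xe_HSH [simp]:
  assumes "wmem s 6 = ss" "wmem s 8 = bh" "wmem s k \<le> 2 * nn" "wmem s r < ss" "d \<noteq> 6" "d \<noteq> 8" "d \<noteq> r"
  shows "wmem (xx (HSH d k r) s) = (wmem s)(d := hb \<sigma> (wmem s r) (wmem s k))"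
    "rmem (xx (HSH d k r) s) = rmem s" "outp (xx (HSH d k r) s) = outp s"
proof -
  have b: "2 * (wmem s k * ss + wmem s r) + 1 < 2 ^ ww" using key_bound assms by blast
  then have 1: "wmem s k * ss < 2 ^ ww" "wmem s k * ss + wmem s r < 2 ^ ww"
    "2 * (wmem s k * ss + wmem s r) < 2 ^ ww"
    by (rule order.strict_trans1[rotated], simp)+
  have "\<sigma> (2 * (wmem s k * ss + wmem s r)) mod bh < bh" using bh_eq by simp
  then have 2: "2 * (\<sigma> (2 * (wmem s k * ss + wmem s r)) mod bh) < 2 ^ ww"
    using bh_eq(1,3) nn_pows by linarith
  show "wmem (xx (HSH d k r) s) = (wmem s)(d := hb \<sigma> (wmem s r) (wmem s k))"
    apply (simp only: HSH_def hb_def hsh_def xe.simps exec_instr.simps word_fun.simps set_w_simps fun_upd_same fun_upd_upd)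
    apply (simp only: fun_upd_apply assms(1-2) assms(5-7)[symmetric] if_False)
    apply (simp only: mult_2[symmetric])
    apply (simp only: mod_less[OF 1(1)] mod_less[OF 1(2)])
    apply (simp only: mod_less[OF 1(3)] mod_less[OF 2])
    done
  show "rmem (xx (HSH d k r) s) = rmem s" "outp (xx (HSH d k r) s) = outp s"
    by (simp_all only: HSH_def xe.simps exec_instr.simps set_w_simps)
qed

lemma xe_ROW [simp]:
  assumes "wmem s 7 = B" "wmem s \<rho> < ss" "wmem s b < B" "b < 62"
  shows "wmem (xx (ROW r \<rho> b) s) = (wmem s)(62 := wmem s \<rho> * B + wmem s b)"
    "rmem (xx (ROW r \<rho> b) s) = (rmem s)(r := row y (wmem s \<rho>) (wmem s b))"
    "outp (xx (ROW r \<rho> b) s) = outp s"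
proof -
  have "wmem s \<rho> * B + wmem s b < Suc (wmem s \<rho>) * B" using assms by simp
  also have "\<dots> \<le> ss * B" using assms(2) by (intro mult_le_mono1) simp
  finally have 0: "wmem s \<rho> * B + wmem s b < ss * B" .
  then have 1: "wmem s \<rho> * B + wmem s b < 2 ^ ww" "wmem s \<rho> * B < 2 ^ ww"
    using rows_less n_le_nn nn_pows by linarith+
  show "wmem (xx (ROW r \<rho> b) s) = (wmem s)(62 := wmem s \<rho> * B + wmem s b)"
    "rmem (xx (ROW r \<rho> b) s) = (rmem s)(r := row y (wmem s \<rho>) (wmem s b))"
    "outp (xx (ROW r \<rho> b) s) = outp s"
    using assms(4) 0 dim_y by (simp_all add: ROW_def row_def assms(1) mod_less[OF 1(1)] mod_less[OF 1(2)] del: mod_less)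
qed

lemma xe_RABS [simp]:
  assumes "rmem s 1 = 0"
  shows "wmem (xx (RABS r) s) = wmem s" "rmem (xx (RABS r) s) = (rmem s)(r := \<bar>rmem s r\<bar>)"
    "outp (xx (RABS r) s) = outp s"
  using assms by (auto simp: RABS_def)

lemma xe_word [simp]:
  "v < 2 ^ ww \<Longrightarrow> wmem (xx (SETW d v) s) = (wmem s)(d := v)"
  "wmem s a + wmem s b < 2 ^ ww \<Longrightarrow> wmem (xx (ADD d a b) s) = (wmem s)(d := wmem s a + wmem s b)"
  "wmem s a * wmem s b < 2 ^ ww \<Longrightarrow> wmem (xx (MUL d a b) s) = (wmem s)(d := wmem s a * wmem s b)"
  "wmem s b \<le> wmem s a \<Longrightarrow> wmem s a < 2 ^ ww \<Longrightarrow> wmem (xx (SUB d a b) s) = (wmem s)(d := wmem s a - wmem s b)"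
  "wmem (xx (DIV d a b) s) = (wmem s)(d := wmem s a div wmem s b)"
  "wmem (xx (MOD d a b) s) = (wmem s)(d := wmem s a mod wmem s b)"
  "wmem (xx (Ins (WOp WXor d a b)) s) = (wmem s)(d := xor (wmem s a) (wmem s b))"
  "wmem s a * 2 ^ wmem s b < 2 ^ ww \<Longrightarrow> wmem (xx (Ins (WOp WShl d a b)) s) = (wmem s)(d := wmem s a * 2 ^ wmem s b)"
  "wmem (xx (Ins (ReadTape d a)) s) = (wmem s)(d := \<sigma> (wmem s a))"
  "rmem (xx (Ins (WOp f d a b)) s) = rmem s" "rmem (xx (SETW d v) s) = rmem s" "rmem (xx (Ins (ReadTape d a)) s) = rmem s"
  "outp (xx (Ins (WOp f d a b)) s) = outp s" "outp (xx (SETW d v) s) = outp s" "outp (xx (Ins (ReadTape d a)) s) = outp s"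
proof -
  show "wmem s b \<le> wmem s a \<Longrightarrow> wmem s a < 2 ^ ww \<Longrightarrow> wmem (xx (SUB d a b) s) = (wmem s)(d := wmem s a - wmem s b)"
  proof -
    assume a: "wmem s b \<le> wmem s a" "wmem s a < 2 ^ ww"
    then have "wmem s a + 2 ^ ww - wmem s b = (wmem s a - wmem s b) + 2 ^ ww" by simp
    then have "(wmem s a + 2 ^ ww - wmem s b) mod 2 ^ ww = (wmem s a - wmem s b) mod 2 ^ ww"
      by (simp only: mod_add_self2)
    also have "\<dots> = wmem s a - wmem s b" using a by (intro mod_less) linarith
    finally show ?thesis by simp
  qed
qed (simp_all add: push_bit_eq_mult)

lemma xe_real [simp]:
  "rmem (xx (Ins (ROp f d a b)) s) = (rmem s)(d := real_fun f (rmem s a) (rmem s b))"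
  "rmem (xx (Ins (ROfWord d a)) s) = (rmem s)(d := real (wmem s a))"
  "rmem (xx (Ins (ReadSketch d a)) s) = (rmem s)(d := if wmem s a < dim_vec y then vec_index y (wmem s a) else 0)"
  "rmem (xx (Ins (Emit a b)) s) = rmem s"
  "wmem (xx (Ins (ROp f d a b)) s) = wmem s" "wmem (xx (Ins (ROfWord d a)) s) = wmem s"
  "wmem (xx (Ins (ReadSketch d a)) s) = wmem s" "wmem (xx (Ins (Emit a b)) s) = wmem s"
  "outp (xx (Ins (ROp f d a b)) s) = outp s" "outp (xx (Ins (ROfWord d a)) s) = outp s"
  "outp (xx (Ins (ReadSketch d a)) s) = outp s" "outp (xx (Ins (Emit a b)) s) = outp s @ [(wmem s a, rmem s b)]"
  by simp_all

lemma loop_free_macros [simp]: "loop_free (ADDR k j)" "loop_free (LOADA d k j)" "loop_free (STOREA k j v)"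
  "loop_free (HSH d k r)" "loop_free (ROW r \<rho> b)" "loop_free (RABS r)"
  by (auto simp: ADDR_def LOADA_def STOREA_def HSH_def ROW_def RABS_def)

definition view :: "ram_state \<Rightarrow> (nat \<Rightarrow> nat) \<times> (nat \<Rightarrow> real) \<times> (nat \<times> real) list" where
  "view s = (wmem s, rmem s, outp s)"

text \<open>Acts on memories and output without the program counter. The effect of straight code is
  then a function on triples, which equations can evaluate symbolically once the side conditions on
  overflow are met.\<close>

definition xv :: "com \<Rightarrow> (nat \<Rightarrow> nat) \<times> (nat \<Rightarrow> real) \<times> (nat \<times> real) list \<Rightarrow>
    (nat \<Rightarrow> nat) \<times> (nat \<Rightarrow> real) \<times> (nat \<times> real) list" where
  "xv e v = view (xx e \<lparr>pc = 0, wmem = fst v, rmem = fst (snd v), outp = snd (snd v)\<rparr>)"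

lemma view_exec: "view s = view s' \<Longrightarrow> view (exec_instr ww \<sigma> y x s) = view (exec_instr ww \<sigma> y x s')"
  by (cases x) (auto simp: view_def)

lemma view_cong: "view s = view s' \<Longrightarrow> view (xx e s) = view (xx e s')"
proof (induction e arbitrary: s s')
  case (Ins x)
  then show ?case unfolding xe.simps by (rule view_exec)
next
  case (Seq d e)
  then show ?case unfolding xe.simps by blast
next
  case (IfW a b d e)
  have *: "wmem s = wmem s'" using IfW.prems by (simp add: view_def)
  show ?case unfolding xe.simps * using IfW.IH[OF IfW.prems] by (cases "wmem s' a < wmem s' b") (simp_all only: if_True if_False)
next
  case (IfR a b d e)
  have *: "rmem s = rmem s'" using IfR.prems by (simp add: view_def)
  show ?case unfolding xe.simps * using IfR.IH[OF IfR.prems] by (cases "rmem s' a < rmem s' b") (simp_all only: if_True if_False)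
qed (simp_all only: xe.simps)

lemma view_xx: "view (xx e s) = xv e (wmem s, rmem s, outp s)"
  unfolding xv_def by (rule view_cong) (simp add: view_def)

lemma view_xxD: "P (xv e (wmem s, rmem s, outp s)) \<Longrightarrow> P (wmem (xx e s), rmem (xx e s), outp (xx e s))"
  using view_xx[of e s] by (simp add: view_def)

lemma xv_Seq: "xv (e ;; d) v = xv d (xv e v)"
proof -
  let ?s = "\<lparr>pc = 0, wmem = fst v, rmem = fst (snd v), outp = snd (snd v)\<rparr>"
  have "xv (e ;; d) v = view (xx d (xx e ?s))" by (simp add: xv_def)
  also have "\<dots> = xv d (view (xx e ?s))" unfolding view_xx[of d "xx e ?s"] by (simp only: view_def)
  finally show ?thesis by (simp only: xv_def)
qed

lemma xv_basic:
  "xv Skip V = V"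
  "xv (IfW a b e d) (U, R, Q) = (if U a < U b then xv e (U, R, Q) else xv d (U, R, Q))"
  "xv (IfR a b e d) (U, R, Q) = (if R a < R b then xv e (U, R, Q) else xv d (U, R, Q))"
  "xv e (if P then V else V') = (if P then xv e V else xv e V')"
  by (simp_all add: xv_def view_def)

lemma xv_word:
  "v < 2 ^ ww \<Longrightarrow> xv (SETW d v) (U, R, Q) = (U(d := v), R, Q)"
  "U a + U b < 2 ^ ww \<Longrightarrow> xv (ADD d a b) (U, R, Q) = (U(d := U a + U b), R, Q)"
  "U a * U b < 2 ^ ww \<Longrightarrow> xv (MUL d a b) (U, R, Q) = (U(d := U a * U b), R, Q)"
  "U b \<le> U a \<Longrightarrow> U a < 2 ^ ww \<Longrightarrow> xv (SUB d a b) (U, R, Q) = (U(d := U a - U b), R, Q)"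
  "xv (DIV d a b) (U, R, Q) = (U(d := U a div U b), R, Q)"
  "xv (MOD d a b) (U, R, Q) = (U(d := U a mod U b), R, Q)"
  "xv (Ins (WOp WXor d a b)) (U, R, Q) = (U(d := xor (U a) (U b)), R, Q)"
  "U a * 2 ^ U b < 2 ^ ww \<Longrightarrow> xv (Ins (WOp WShl d a b)) (U, R, Q) = (U(d := U a * 2 ^ U b), R, Q)"
  "xv (Ins (ReadTape d a)) (U, R, Q) = (U(d := \<sigma> (U a)), R, Q)"
  "xv (Ins (ROp f d a b)) (U, R, Q) = (U, R(d := real_fun f (R a) (R b)), Q)"
  "xv (Ins (ROfWord d a)) (U, R, Q) = (U, R(d := real (U a)), Q)"
  "xv (Ins (ReadSketch d a)) (U, R, Q) = (U, R(d := if U a < dim_vec y then vec_index y (U a) else 0), Q)"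
  "xv (Ins (Emit a b)) (U, R, Q) = (U, R, Q @ [(U a, R b)])"
  unfolding xv_def view_def fst_conv snd_conv by (simp_all del: xe.simps(2))

lemma xv_LOADA:
  assumes "ad k (U j) < 2 ^ ww" "j < 62"
  shows "xv (LOADA d k j) (U, R, Q) = (U(62 := ad k (U j), 63 := 64 + k, d := U (ad k (U j))), R, Q)"
  using assms by (simp add: xv_def view_def)

lemma xv_STOREA:
  assumes "ad k (U j) < 2 ^ ww" "j < 62" "v < 62"
  shows "xv (STOREA k j v) (U, R, Q) = (U(62 := ad k (U j), 63 := 64 + k, ad k (U j) := U v), R, Q)"
  using assms by (simp add: xv_def view_def)

lemma xv_HSH:
  assumes "U 6 = ss" "U 8 = bh" "U k \<le> 2 * nn" "U r < ss" "d \<noteq> 6" "d \<noteq> 8" "d \<noteq> r"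
  shows "xv (HSH d k r) (U, R, Q) = (U(d := hb \<sigma> (U r) (U k)), R, Q)"
  using assms by (simp add: xv_def view_def)

lemma xv_ROW:
  assumes "U 7 = B" "U \<rho> < ss" "U b < B" "b < 62"
  shows "xv (ROW r \<rho> b) (U, R, Q) = (U(62 := U \<rho> * B + U b), R(r := row y (U \<rho>) (U b)), Q)"
  using assms by (simp add: xv_def view_def)

lemma xv_RABS:
  assumes "R 1 = 0"
  shows "xv (RABS r) (U, R, Q) = (U, R(r := \<bar>R r\<bar>), Q)"
  using assms by (simp add: xv_def view_def)

lemmas xvs = xv_Seq xv_basic xv_word xv_LOADA xv_STOREA xv_HSH xv_ROW xv_RABS

declare One_nat_def [simp del]

section \<open>Reading indices from labels on the machine\<close>

lemma XBrho: "t < nb \<Longrightarrow> j < ell \<Longrightarrow> xrep t j < 10 * dd"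
proof -
  assume "t < nb" "j < ell"
  then have "t * ell + j < Suc t * ell" by simp
  also have "\<dots> \<le> nb * ell" using \<open>t < nb\<close> by (intro mult_le_mono1) simp
  finally show ?thesis unfolding xrep_def using nb_ell(1) dd_pos by linarith
qed

abbreviation "xscr \<equiv> {34, 35, 36, 37, 38, 39, 62, 63 :: nat}"

lemma xword_less: "(\<Sum>i<j. if P i then 2 ^ i else 0) < (2::nat) ^ j"
  by (induction j) auto

lemma run_pXin:
  assumes p: "pars s" and z: "wmem s 31 < B * vv" and t: "wmem s 32 < nb" and th: "rmem s 2 = \<theta>"
  shows "\<exists>s'. run pXin s s' (ell * 60 + 10) \<and> same xscr {5, 6} s s' \<and>
     wmem s' 34 = xera \<sigma> y \<theta> (wmem s 31) (wmem s 32) \<and> wmem s' 35 = xword \<sigma> y (wmem s 31) (wmem s 32)"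
proof -
  let ?t = "wmem s 32" and ?z = "wmem s 31"
  let ?A = "\<lambda>j \<beta>. arow \<sigma> y (xrep ?t j) ?z \<beta>"
  define wf where "wf j = (\<Sum>i<j. if ?A i 0 < ?A i 1 then (2::nat) ^ i else 0)" for j
  define ef where "ef j = (\<Sum>i<j. if \<theta> < ?A i 0 \<or> \<theta> < ?A i 1 then 0 else (1::nat))" for j
  have wf: "wf 0 = 0" "wf (Suc j) = (if ?A j 0 < ?A j 1 then wf j + 2 ^ j else wf j)" "wf j < 2 ^ j" for j
    unfolding wf_def by (auto simp: xword_less)
  have ef: "ef 0 = 0" "ef (Suc j) = (if \<theta> < ?A j 0 then ef j else if \<theta> < ?A j 1 then ef j else ef j + 1)" "ef j \<le> j" for j
  proof -
    have "ef j \<le> (\<Sum>i<j. 1)" unfolding ef_def by (intro sum_mono) auto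
    then show "ef j \<le> j" by simp
  qed (auto simp: ef_def)
  define Iv where "Iv j v \<longleftrightarrow> (case v of (U, R, Q) \<Rightarrow> same xscr {5, 6} s \<lparr>pc = 0, wmem = U, rmem = R, outp = Q\<rparr> \<and>
     U 37 = j \<and> U 36 = 2 ^ j \<and> U 35 = wf j \<and> U 34 = ef j)" for j v
  define I where "I j s' \<longleftrightarrow> Iv j (wmem s', rmem s', outp s')" for j and s' :: ram_state
  have I: "I j s' \<longleftrightarrow> same xscr {5, 6} s s' \<and> wmem s' 37 = j \<and> wmem s' 36 = 2 ^ j \<and>
     wmem s' 35 = wf j \<and> wmem s' 34 = ef j" for j and s' :: ram_state
    by (simp add: I_def Iv_def same_def)
  let ?init = "SETW 34 0 ;; SETW 35 0 ;; SETW 36 1 ;; SETW 37 0"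
  let ?body = "MUL 38 32 12 ;; ADD 38 38 27 ;; ADD 38 38 37 ;; HSH 39 31 38 ;; ROW 5 38 39 ;; INC 39 ;; ROW 6 38 39 ;;
      RABS 5 ;; RABS 6 ;; IfR 5 6 (ADD 35 35 36) Skip ;;
      IfR 2 5 Skip (IfR 2 6 Skip (INC 34)) ;; ADD 36 36 36 ;; INC 37"
  have P4: "4 < (2::nat) ^ ww" using nn_pows nn_ge by linarith
  have step: "wmem s1 37 < wmem s1 12 \<and> (\<exists>s'. run ?body s1 s' (clen ?body) \<and> I (Suc j) s')"
    if j: "j < ell" and II: "I j s1" for j s1
  proof -
    have p1: "pars s1" using II p unfolding I by (elim conjE pars_same) auto
    have sm: "same xscr {5, 6} s s1" using II unfolding I by blast
    have r: "wmem s1 31 = ?z" "wmem s1 32 = ?t" "rmem s1 2 = \<theta>"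
      using sm th by (auto simp: sameW sameR)
    have rho: "?t * ell + 6 * dd + j = xrep ?t j" by (simp add: xrep_def)
    have b: "xrep ?t j < 10 * dd" using XBrho t j by blast
    have b1: "xrep ?t j < ss" "?z \<le> 2 * nn" using b dd_pos z bnds(4) unfolding ss_def by linarith+
    have b2: "?t * ell < 2 ^ ww" "?t * ell + 6 * dd < 2 ^ ww" "xrep ?t j < 2 ^ ww"
      using rho b bnds(1) nn_pows by linarith+
    have b3: "hb \<sigma> (xrep ?t j) ?z < B" "hb \<sigma> (xrep ?t j) ?z + 1 < B" "hb \<sigma> (xrep ?t j) ?z + 1 < 2 ^ ww"
      using hb_less[of \<sigma> "xrep ?t j" ?z] bnds(2) nn_pows by linarith+
    have b5: "(2::nat) ^ j \<le> 2 ^ ell" using j by (intro power_increasing) auto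
    have b6: "(2::nat) ^ j \<le> nn" using b5 vv_dd(3) bnds(1) by linarith
    have b8: "2 ^ j + 2 ^ j < (2::nat) ^ ww" "j + 1 < 2 ^ ww" "wf j + 2 ^ j < (2::nat) ^ ww" "ef j + 1 < (2::nat) ^ ww"
      using wf(3)[of j] b6 ef(3)[of j] j vv_dd(2) bnds(1) nn_pows by linarith+
    have pr: "wmem s1 12 = ell" "wmem s1 27 = 6 * dd" "wmem s1 6 = ss" "wmem s1 8 = bh" "wmem s1 7 = B" "wmem s1 3 = 1"
      "rmem s1 1 = 0" "wmem s1 37 = j" "wmem s1 36 = 2 ^ j" "wmem s1 35 = wf j" "wmem s1 34 = ef j"
      using II p1 unfolding I pars_def by simp_all
    have "Iv (Suc j) (xv ?body (wmem s1, rmem s1, outp s1))"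
      apply (simp add: xvs pr r b1 b2 b3 b8 rho cong: if_cong split del: if_split)
      using sm by (simp add: Iv_def arow_def wf ef same_def pr r)
    then have "I (Suc j) (xx ?body s1)" unfolding I_def by (rule view_xxD)
    moreover have "run ?body s1 (xx ?body s1) (clen ?body)" by (rule runs_xe) simp
    moreover have "wmem s1 37 < wmem s1 12" using II p1 j unfolding I pars_def by simp
    ultimately show ?thesis by blast
  qed
  have i0: "I 0 (xx ?init s)" unfolding I_def
  proof (rule view_xxD)
    show "Iv 0 (xv ?init (wmem s, rmem s, outp s))"
      using P4 by (simp add: xvs) (simp add: Iv_def same_def wf ef)
  qed
  have stop: "\<not> wmem s1 37 < wmem s1 12" if "I ell s1" for s1
  proof -
    have "pars s1" using that p unfolding I by (elim conjE pars_same) auto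
    then show ?thesis using that unfolding I pars_def by simp
  qed
  obtain s' where s': "run (While 37 12 ?body) (xx ?init s) s' (ell * (clen ?body + 2) + 2)" "I ell s'"
    using runs_While[of ell I 37 12, OF step stop i0] by blast
  have "run (?init ;; While 37 12 ?body) s s' (clen ?init + (ell * (clen ?body + 2) + 2))"
    by (rule runs_Seq[OF runs_xe s'(1)]) simp
  moreover have "clen ?init + (ell * (clen ?body + 2) + 2) \<le> ell * 60 + 10"
    by (simp add: HSH_def ROW_def RABS_def)
  ultimately have "run pXin s s' (ell * 60 + 10)" unfolding pXin_def
    by (rule runs_mono)
  then show ?thesis using s'(2) unfolding I xera_def xword_def wf_def ef_def by blast
qed

declare One_nat_def [simp del]

lemma notin_range_ad [simp]: "r < 64 \<Longrightarrow> r \<notin> range (ad k)"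
  "k < 8 \<Longrightarrow> k' < 8 \<Longrightarrow> ad k i \<in> range (ad k') \<longleftrightarrow> k = k'"
  by (auto simp: image_iff)

text \<open>The instance of the loop rule for loop-free bodies, with the invariant stated on
  memories and output only; the effect of the body is then available by symbolic evaluation.\<close>

lemma for_straight:
  assumes "loop_free body" "loop_free init"
    and step: "\<And>j U R Q. j < N \<Longrightarrow> Iv j (U, R, Q) \<Longrightarrow> U a < U b \<and> Iv (Suc j) (xv body (U, R, Q))"
    and stop: "\<And>U R Q. Iv N (U, R, Q) \<Longrightarrow> \<not> U a < U b"
    and "Iv 0 (xv init (wmem s, rmem s, outp s))"
    and T: "clen init + (N * (clen body + 2) + 2) \<le> T"
  shows "\<exists>s'. run (init ;; While a b body) s s' T \<and> Iv N (wmem s', rmem s', outp s')"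
proof -
  define I where "I j s' \<longleftrightarrow> Iv j (wmem s', rmem s', outp s')" for j and s' :: ram_state
  have "wmem s' a < wmem s' b \<and> (\<exists>s''. run body s' s'' (clen body) \<and> I (Suc j) s'')"
    if "j < N" "I j s'" for j s'
    using step[OF that(1) that(2)[unfolded I_def]] runs_xe[OF assms(1), of ww \<sigma> y s'] view_xxD[of "Iv (Suc j)" body s']
    unfolding I_def by blast
  moreover have "\<not> wmem s' a < wmem s' b" if "I N s'" for s'
    using stop that unfolding I_def by blast
  moreover have "I 0 (xx init s)" unfolding I_def using assms(5) by (rule view_xxD)
  ultimately obtain s' where s': "run (While a b body) (xx init s) s' (N * (clen body + 2) + 2)" "I N s'"
    using runs_While[of N I a b] by blast
  have "run (init ;; While a b body) s s' (clen init + (N * (clen body + 2) + 2))"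
    by (rule runs_Seq[OF runs_xe[OF assms(2)] s'(1)])
  then show ?thesis using s'(2) runs_mono T unfolding I_def by blast
qed

lemma length_gv: "length (gv r k) \<le> k"
  by (induction k) auto

lemma tab_le: "tab u \<le> 2 ^ ell"
proof -
  have "gv_tab r k u \<le> k" for r k
  proof (induction k)
    case (Suc k)
    then show ?case using length_gv[of "2 * r" k] by simp
  qed simp
  then show ?thesis unfolding tab_def by blast
qed

abbreviation "xfr \<equiv> {24, 30, 31, 32, 33, 34, 35, 36, 37, 38, 39, 40, 62, 63} \<union> range (ad 3)"

text \<open>The bound on the accumulator is the clause that prevents overflow. The exponent grows by
  \<open>ell + 1\<close> per digit, one more than the length of a code word, because a digit is
  added after the multiplication.\<close>

definition relX :: "ram_state \<Rightarrow> nat \<Rightarrow> nat \<times> nat \<times> nat \<times> nat list \<Rightarrow> ram_state \<Rightarrow> bool" where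
  "relX s0 it m s \<longleftrightarrow> (case m of (z, t, acc, cs) \<Rightarrow> same xfr {5, 6} s0 s \<and> wmem s 31 = z \<and> wmem s 32 = t \<and> wmem s 33 = acc \<and>
     wmem s 24 = length cs \<and> (\<forall>i<length cs. wmem s (ad 3 i) = cs ! i) \<and>
     z \<le> B * vv \<and> t < nb \<and> acc < 2 ^ ((ell + 1) * t) \<and> length cs \<le> it)"

lemma relX_view: "relX s0 it m s \<longleftrightarrow> relX s0 it m \<lparr>pc = 0, wmem = wmem s, rmem = rmem s, outp = outp s\<rparr>"
  by (simp add: relX_def same_def split: prod.splits)

lemma ad_less: "k < 8 \<Longrightarrow> j \<le> 4 * nn ^ 4 \<Longrightarrow> ad k j < 2 ^ ww"
  using nn_pows nn_ge unfolding ad_def by linarith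

text \<open>The code may have more than \<open>gg\<close> words, so a spurious label can produce
  digits of up to \<open>ell\<close> bits and an accumulator far above n. All digits together still
  need at most (ell + 1) * nb \<le> 5 dd bits, below the word length 8 dd.\<close>

lemma acc_bound:
  assumes "t < nb" "acc < 2 ^ ((ell + 1) * t)" "d \<le> 2 ^ ell" "0 < d"
  shows "acc * gg < 2 ^ ww" "acc * gg + d < 2 ^ ww" "acc * gg + d - 1 < 2 ^ ((ell + 1) * (t + 1))" "1 \<le> acc * gg + d"
proof -
  have "gg \<le> 2 ^ ell" unfolding gg_def ell_def by (intro power_increasing) auto
  then have "acc * gg \<le> acc * 2 ^ ell" by (rule mult_le_mono2)
  then have 1: "acc * gg + d \<le> (acc + 1) * 2 ^ ell" using assms(3) unfolding add_mult_distrib by linarith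
  also have "\<dots> \<le> 2 ^ ((ell + 1) * t) * 2 ^ ell" using assms(2) by (intro mult_le_mono1) simp
  also have "\<dots> \<le> 2 ^ ((ell + 1) * (t + 1))"
    unfolding power_add[symmetric] by (intro power_increasing) (simp_all add: algebra_simps)
  finally have 2: "acc * gg + d \<le> 2 ^ ((ell + 1) * (t + 1))" .
  have "(ell + 1) * (t + 1) \<le> (ell + 1) * nb" using assms(1) by (intro mult_le_mono2) simp
  also have "\<dots> = nb * ell + nb" by (simp only: add_mult_distrib mult.commute[of ell nb] mult_1)
  also have "\<dots> \<le> 5 * dd" using nb_ell(1,2) dd_pos by linarith
  finally have "(2::nat) ^ ((ell + 1) * (t + 1)) \<le> 2 ^ (5 * dd)" by (intro power_increasing) auto
  also have "\<dots> = nn ^ 5" unfolding nn_def by (simp add: power_mult[symmetric] mult.commute)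
  finally have 3: "acc * gg + d \<le> nn ^ 5" using 2 by linarith
  show "acc * gg + d < 2 ^ ww" using 3 nn_pows nn_ge by linarith
  then show "acc * gg < 2 ^ ww" by linarith
  show "acc * gg + d - 1 < 2 ^ ((ell + 1) * (t + 1))" "1 \<le> acc * gg + d" using 2 assms(4) by linarith+
qed

definition tabs :: "ram_state \<Rightarrow> bool" where
  "tabs s \<longleftrightarrow> (\<forall>u<2 ^ ell. wmem s (ad 2 u) = tab u)"

lemma run_pX_step:
  assumes p: "pars s0" and tb: "tabs s0" and th: "rmem s0 2 = \<theta>" and it: "it \<le> nn ^ 3"
    and rel: "relX s0 it m s"
  shows "\<exists>s'. run (IfW 31 14 (pXin ;; pXout) Skip) s s' (ell * 60 + 60) \<and> relX s0 (Suc it) (stepX \<sigma> y \<theta> m) s' \<and>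
    wmem s' 30 = wmem s 30"
proof -
  obtain z t acc cs where m: "m = (z, t, acc, cs)" by (cases m) auto
  have f: "same xfr {5, 6} s0 s" and r: "wmem s 31 = z" "wmem s 32 = t" "wmem s 33 = acc" "wmem s 24 = length cs"
    and cs: "\<And>i. i < length cs \<Longrightarrow> wmem s (ad 3 i) = cs ! i" and b: "z \<le> B * vv" "t < nb" "acc < 2 ^ ((ell + 1) * t)"
    "length cs \<le> it" using rel unfolding m relX_def by auto
  have ps: "pars s" by (rule pars_same[OF f p]) (auto simp: ad_def)
  have th': "rmem s 2 = \<theta>" using sameR[OF f, of 2] th by simp
  show ?thesis
  proof (cases "z < B * vv")
    case False
    have "run (IfW 31 14 (pXin ;; pXout) Skip) s s (0 + 2)"
      by (rule runs_IfW) (use False r ps in \<open>auto simp: pars_def runs_def intro: bs_Skip\<close>)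
    then have "run (IfW 31 14 (pXin ;; pXout) Skip) s s (ell * 60 + 60)" by (rule runs_mono) simp
    moreover have "relX s0 (Suc it) (stepX \<sigma> y \<theta> m) s" using rel False unfolding m relX_def by auto
    ultimately show ?thesis by blast
  next
    case True
    obtain s1 where s1: "run pXin s s1 (ell * 60 + 10)" and f1: "same xscr {5, 6} s s1"
      and e: "wmem s1 34 = xera \<sigma> y \<theta> z t" and w: "wmem s1 35 = xword \<sigma> y z t"
      using run_pXin[OF ps, of \<theta>] True r b th' by blast
    have f2: "same xfr {5, 6} s0 s1" by (rule same_trans[OF f]) (rule same_mono[OF f1], auto)
    have ps1: "pars s1" by (rule pars_same[OF f2 p]) (auto simp: ad_def)
    have r1: "wmem s1 31 = z" "wmem s1 32 = t" "wmem s1 33 = acc" "wmem s1 24 = length cs" "wmem s1 30 = wmem s 30"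
      using f1 r by (simp_all add: same_def)
    have cs1: "\<forall>i<length cs. wmem s1 (ad 3 i) = cs ! i" using f1 cs by (simp add: same_def)
    have xw: "xword \<sigma> y z t < 2 ^ ell" unfolding xword_def by (rule xword_less)
    have tb1: "wmem s1 (ad 2 (xword \<sigma> y z t)) = tab (xword \<sigma> y z t)"
      using f2 tb xw unfolding tabs_def by (simp add: same_def)
    define d where "d = tab (xword \<sigma> y z t)"
    have dl: "d \<le> 2 ^ ell" unfolding d_def by (rule tab_le)
    have pr: "wmem s1 0 = n" "wmem s1 3 = 1" "wmem s1 15 = gg" "wmem s1 16 = nb" "wmem s1 22 = aa + 1" "rmem s1 1 = 0"
      using ps1 by (auto simp: pars_def)
    have adb: "ad 2 (xword \<sigma> y z t) < 2 ^ ww" "ad 3 (length cs) < 2 ^ ww"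
      using xw vv_dd(3) bnds(1) b(4) it nn_pows by (auto intro!: ad_less)
    have lb: "length cs + 1 < 2 ^ ww" "t + 1 < 2 ^ ww" "z + 1 < 2 ^ ww" "0 < (2::nat) ^ ww"
      using b it nn_pows True bnds nb_ell(2) nn_ge by linarith+
    have eq: "xok \<sigma> y \<theta> z t \<longleftrightarrow> xera \<sigma> y \<theta> z t < aa + 1 \<and> 0 < d" "xdig \<sigma> y z t = d - 1"
      unfolding xok_def xdig_def d_def by auto
    define G where "G v \<longleftrightarrow> (case v of (U, R, Q) \<Rightarrow> relX s0 (Suc it) (stepX \<sigma> y \<theta> m) \<lparr>pc = 0, wmem = U, rmem = R, outp = Q\<rparr> \<and>
       U 30 = wmem s 30)" for v
    have "G (xv pXout (wmem s1, rmem s1, outp s1))"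
    proof (cases "0 < d")
      case d0: True
      have e1: "acc * gg + (d - 1) = acc * gg + d - 1" using d0 by simp
      note ab = acc_bound[OF b(2,3) dl d0]
      show ?thesis
        apply (simp add: pXout_def xvs pr r1 e w tb1 adb lb d_def[symmetric] ab ab(2)[simplified] cong: if_cong split del: if_split)
        using f2 cs1 ab(3) b True ab(4)
        apply (simp add: G_def relX_def m eq Let_def pr r1 nth_append less_Suc_eq same_def d0 e1 split: if_split)
        done
    next
      case d0: False
      show ?thesis
        apply (simp add: pXout_def xvs pr r1 e w tb1 adb lb d_def[symmetric] d0 cong: if_cong split del: if_split)
        using f2 cs1 b True d0
        apply (simp add: G_def relX_def m eq Let_def pr r1 nth_append less_Suc_eq same_def split: if_split)
        done
    qed
    then have "G (wmem (xx pXout s1), rmem (xx pXout s1), outp (xx pXout s1))" by (rule view_xxD)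
    then have 1: "relX s0 (Suc it) (stepX \<sigma> y \<theta> m) (xx pXout s1)" "wmem (xx pXout s1) 30 = wmem s 30"
      unfolding G_def by (simp_all only: prod.case relX_view[symmetric])
    have "run (pXin ;; pXout) s (xx pXout s1) (ell * 60 + 10 + clen pXout)"
      by (rule runs_Seq[OF s1 runs_xe]) (simp add: pXout_def)
    then have "run (IfW 31 14 (pXin ;; pXout) Skip) s (xx pXout s1) (ell * 60 + 10 + clen pXout + 2)"
      by (intro runs_IfW) (use True r ps in \<open>auto simp: pars_def\<close>)
    moreover have "ell * 60 + 10 + clen pXout + 2 \<le> ell * 60 + 60"
      by (simp add: pXout_def LOADA_def STOREA_def ADDR_def)
    ultimately show ?thesis using 1 runs_mono by blast
  qed
qed

lemma cB_le: "c * B * dd \<le> nn ^ 2" "c * B * nb \<le> nn ^ 2" "c * B \<le> nn"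
proof -
  have "c * B \<le> dd * B" using c_le by simp
  then show cB: "c * B \<le> nn" using bnds(3) by linarith
  show "c * B * dd \<le> nn ^ 2" using mult_le_mono[OF cB, of dd nn] bnds(1) by (simp add: power2_eq_square)
  show "c * B * nb \<le> nn ^ 2" using mult_le_mono[OF cB, of nb nn] bnds(1) nb_ell(2) dd_pos by (simp add: power2_eq_square)
qed

lemma run_pX:
  assumes p: "pars s" and tb: "tabs s" and th: "rmem s 2 = \<theta>"
  shows "\<exists>s'. run pX s s' (c * B * nb * (ell * 60 + 63) + 7) \<and> same xfr {5, 6} s s' \<and>
    wmem s' 24 = length (candX \<sigma> y \<theta>) \<and> (\<forall>i<length (candX \<sigma> y \<theta>). wmem s' (ad 3 i) = candX \<sigma> y \<theta> ! i) \<and>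
    length (candX \<sigma> y \<theta>) \<le> c * B * nb"
proof -
  let ?N = "c * B * nb"
  define I where "I j s' \<longleftrightarrow> relX s j ((stepX \<sigma> y \<theta> ^^ j) (0, 0, 0, [])) s' \<and> wmem s' 30 = j" for j and s' :: ram_state
  let ?init = "SETW 30 0 ;; SETW 31 0 ;; SETW 32 0 ;; SETW 33 0 ;; SETW 24 0"
  let ?body = "IfW 31 14 (pXin ;; pXout) Skip ;; INC 30"
  have ps: "wmem s' 18 = ?N" "wmem s' 3 = 1" if "I j s'" for j s'
  proof -
    have "same xfr {5, 6} s s'" using that unfolding I_def relX_def by (auto split: prod.splits)
    then have "pars s'" by (rule pars_same[OF _ p]) (auto simp: ad_def)
    then show "wmem s' 18 = ?N" "wmem s' 3 = 1" by (auto simp: pars_def)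
  qed
  have nb0: "0 < nb" "0 < (2::nat) ^ ww" unfolding nb_def by simp_all
  define G where "G v \<longleftrightarrow> (case v of (U, R, Q) \<Rightarrow> relX s 0 (0, 0, 0, []) \<lparr>pc = 0, wmem = U, rmem = R, outp = Q\<rparr> \<and> U 30 = 0)" for v
  have "G (xv ?init (wmem s, rmem s, outp s))"
    using nb0 by (simp add: xvs) (simp add: G_def relX_def same_def)
  then have "G (wmem (xx ?init s), rmem (xx ?init s), outp (xx ?init s))" by (rule view_xxD)
  then have init: "I 0 (xx ?init s)" unfolding I_def G_def by (simp only: prod.case relX_view[symmetric] funpow.simps comp_apply id_apply)
  have step: "wmem s1 30 < wmem s1 18 \<and> (\<exists>s'. run ?body s1 s' (ell * 60 + 61) \<and> I (Suc j) s')"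
    if j: "j < ?N" and I: "I j s1" for j s1
  proof -
    have "j \<le> nn ^ 3" using j cB_le(2) nn_pows by linarith
    from run_pX_step[OF p tb th this] I obtain s2 where s2: "run (IfW 31 14 (pXin ;; pXout) Skip) s1 s2 (ell * 60 + 60)"
      "relX s (Suc j) (stepX \<sigma> y \<theta> ((stepX \<sigma> y \<theta> ^^ j) (0, 0, 0, []))) s2" "wmem s2 30 = j"
      unfolding I_def by blast
    have s23: "wmem s2 3 = 1"
    proof -
      have "same xfr {5, 6} s s2" using s2(2) unfolding relX_def by (auto split: prod.splits)
      then have "pars s2" by (rule pars_same[OF _ p]) (auto simp: ad_def)
      then show ?thesis by (auto simp: pars_def)
    qed
    define G where "G v \<longleftrightarrow> (case v of (U, R, Q) \<Rightarrow> relX s (Suc j) (stepX \<sigma> y \<theta> ((stepX \<sigma> y \<theta> ^^ j) (0, 0, 0, [])))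
       \<lparr>pc = 0, wmem = U, rmem = R, outp = Q\<rparr> \<and> U 30 = Suc j)" for v
    have jb: "j + 1 < 2 ^ ww" using j cB_le(2) nn_pows nn_ge by linarith
    have "G (xv (INC 30) (wmem s2, rmem s2, outp s2))"
      apply (simp add: xvs s2(3) s23 jb)
      using s2(2) apply (simp add: G_def relX_def same_def split: prod.splits)
      done
    then have "G (wmem (xx (INC 30) s2), rmem (xx (INC 30) s2), outp (xx (INC 30) s2))" by (rule view_xxD)
    then have "I (Suc j) (xx (INC 30) s2)" unfolding I_def G_def by (simp only: prod.case relX_view[symmetric] funpow.simps comp_apply id_apply)
    moreover have "run ?body s1 (xx (INC 30) s2) (ell * 60 + 60 + clen (INC 30))"
      by (rule runs_Seq[OF s2(1) runs_xe]) simp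
    moreover have "wmem s1 30 < wmem s1 18" using ps(1)[OF I] I j unfolding I_def by simp
    ultimately show ?thesis by (intro conjI exI[of _ "xx (INC 30) s2"]) (simp_all only: clen.simps add.assoc, simp)
  qed
  have stop: "\<not> wmem s1 30 < wmem s1 18" if "I ?N s1" for s1
    using ps(1)[OF that] that unfolding I_def by simp
  from runs_While[of ?N I 30 18, OF step stop init] obtain s' where
    s': "run (While 30 18 ?body) (xx ?init s) s' (?N * (ell * 60 + 61 + 2) + 2)" "I ?N s'" by blast
  have "run pX s s' (clen ?init + (?N * (ell * 60 + 61 + 2) + 2))" unfolding pX_def
    by (rule runs_Seq[OF runs_xe s'(1)]) simp
  then have "run pX s s' (?N * (ell * 60 + 63) + 7)" by (rule runs_mono) simp
  then show ?thesis using s'(2) unfolding I_def relX_def candX_def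
    by (intro exI[of _ s']) (auto split: prod.splits)
qed

declare One_nat_def [simp del]

lemma xxI:
  assumes "\<And>s'. (wmem s', rmem s', outp s') = xv e (wmem s, rmem s, outp s) \<Longrightarrow> P s'"
  shows "P (xx e s)"
  using assms view_xx[of e s] by (simp only: view_def)

section \<open>Descending the tree on the machine\<close>

abbreviation "ginfr \<equiv> {37, 38, 39, 45, 46, 62 :: nat}"

lemma run_pGin:
  assumes p: "pars s" and v: "wmem s 43 < 2 * nn" and l: "wmem s 44 \<le> dd" and th: "rmem s 2 = \<theta>"
  shows "\<exists>s'. run pGin s s' 500 \<and> same ginfr {5} s s' \<and> wmem s' 37 = 0 \<and>
     wmem s' 45 = (if gpass \<sigma> y \<theta> (wmem s 44) (wmem s 43) then 1 else 0)"
proof -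
  let ?v = "wmem s 43" and ?l = "wmem s 44"
  define Iv where "Iv j v \<longleftrightarrow> (case v of (U, R, Q) \<Rightarrow> (\<forall>r. r \<notin> ginfr \<longrightarrow> U r = wmem s r) \<and> (\<forall>r. r \<noteq> 5 \<longrightarrow> R r = rmem s r) \<and>
     Q = outp s \<and> U 46 = j \<and> U 37 = 0 \<and> U 45 = (if \<exists>r<j. \<theta> < arow \<sigma> y (grep ?l r) ?v 0 then 1 else 0))" for j v
  have pr: "wmem s 26 = 12" "wmem s 28 = 10 * dd" "wmem s 6 = ss" "wmem s 8 = bh" "wmem s 7 = B" "wmem s 3 = 1" "rmem s 1 = 0"
    using p by (auto simp: pars_def)
  have k: "1 < (2::nat) ^ ww" "0 < (2::nat) ^ ww" using nn_pows nn_ge by linarith+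
  have "\<exists>s'. run ((SETW 45 0 ;; SETW 46 0 ;; SETW 37 0) ;; While 46 26
     (MUL 38 44 26 ;; ADD 38 38 28 ;; ADD 38 38 46 ;; HSH 39 43 38 ;; ROW 5 38 39 ;; RABS 5 ;;
      IfR 2 5 (SETW 45 1) Skip ;; INC 46)) s s' 500 \<and> Iv 12 (wmem s', rmem s', outp s')"
  proof (rule for_straight)
    fix j U R Q
    assume j: "j < 12" and "Iv j (U, R, Q)"
    then have I: "\<forall>r. r \<notin> ginfr \<longrightarrow> U r = wmem s r" "\<forall>r. r \<noteq> 5 \<longrightarrow> R r = rmem s r" "Q = outp s" "U 46 = j" "U 37 = 0"
      "U 45 = (if \<exists>r<j. \<theta> < arow \<sigma> y (grep ?l r) ?v 0 then 1 else 0)"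
      unfolding Iv_def by auto
    have g: "?l * 12 + 10 * dd + j = grep ?l j" by (simp add: grep_def)
    have "grep ?l j < ss" using j l dd_pos unfolding grep_def ss_def by linarith
    moreover have "grep ?l j < 2 ^ ww" "?l * 12 < 2 ^ ww" "?l * 12 + 10 * dd < 2 ^ ww" "j + 1 < 2 ^ ww"
      using l j bnds(1) nn_pows dd_pos unfolding grep_def by linarith+
    moreover have "hb \<sigma> (grep ?l j) ?v < B" using hb_less[of \<sigma> "grep ?l j" ?v] by simp
    ultimately have b: "grep ?l j < ss" "grep ?l j < 2 ^ ww" "?l * 12 < 2 ^ ww" "?l * 12 + 10 * dd < 2 ^ ww" "j + 1 < 2 ^ ww"
      "hb \<sigma> (grep ?l j) ?v < B" "?v \<le> 2 * nn" using v by auto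
    have e: "(\<exists>r<Suc j. X r) \<longleftrightarrow> (\<exists>r<j. X r) \<or> X j" for X using less_Suc_eq by auto
    have "Iv (Suc j) (xv (MUL 38 44 26 ;; ADD 38 38 28 ;; ADD 38 38 46 ;; HSH 39 43 38 ;; ROW 5 38 39 ;; RABS 5 ;;
      IfR 2 5 (SETW 45 1) Skip ;; INC 46) (U, R, Q))"
      apply (simp add: xvs pr I(1-5) b g k th cong: if_cong split del: if_split)
      using I(6) by (simp add: Iv_def e I(1-5) arow_def)
    then show "U 46 < U 26 \<and> Iv (Suc j) (xv (MUL 38 44 26 ;; ADD 38 38 28 ;; ADD 38 38 46 ;; HSH 39 43 38 ;; ROW 5 38 39 ;; RABS 5 ;;
      IfR 2 5 (SETW 45 1) Skip ;; INC 46) (U, R, Q))" using j I(1,4) pr by simp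
  next
    fix U R Q assume "Iv 12 (U, R, Q)"
    then show "\<not> U 46 < U 26" using pr unfolding Iv_def by simp
  next
    show "Iv 0 (xv (SETW 45 0 ;; SETW 46 0 ;; SETW 37 0) (wmem s, rmem s, outp s))"
      using k by (simp add: xvs) (simp add: Iv_def)
  qed (simp_all add: HSH_def ROW_def RABS_def)
  then obtain s' where s': "run pGin s s' 500" "Iv 12 (wmem s', rmem s', outp s')" unfolding pGin_def by blast
  have "same ginfr {5} s s'" "wmem s' 37 = 0" "wmem s' 45 = (if gpass \<sigma> y \<theta> ?l ?v then 1 else 0)"
    using s'(2) by (simp_all add: Iv_def same_def gpass_def)
  then show ?thesis using s'(1) by blast
qed

abbreviation "gfr \<equiv> {24, 30, 37, 38, 39, 41, 42, 43, 44, 45, 46, 62, 63} \<union> range (ad 3) \<union> range (ad 4) \<union> range (ad 5)"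

text \<open>The last clause ties the level of a node to its heap number. With the bound
  \<open>2 * nn\<close> it yields that levels never exceed dd, so that the repetitions consulted
  exist. The queue grows by at most two entries per step.\<close>

definition relG :: "ram_state \<Rightarrow> nat \<Rightarrow> nat \<Rightarrow> nat \<times> (nat \<times> nat) list \<times> nat list \<Rightarrow> ram_state \<Rightarrow> bool" where
  "relG s0 L it m s \<longleftrightarrow> (case m of (h, q, cs) \<Rightarrow> same gfr {5} s0 s \<and> wmem s 41 = h \<and> wmem s 42 = length q \<and>
     wmem s 24 = length cs \<and> (\<forall>i<length cs. wmem s (ad 3 i) = cs ! i) \<and>
     (\<forall>i<length q. wmem s (ad 5 i) = fst (q ! i) \<and> wmem s (ad 4 i) = snd (q ! i)) \<and>
     h \<le> length q \<and> length q \<le> 2 * it + 1 \<and> length cs \<le> L + it \<and>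
     (\<forall>i<length q. 2 ^ fst (q ! i) \<le> snd (q ! i) \<and> snd (q ! i) < 2 ^ (fst (q ! i) + 1) \<and> snd (q ! i) < 2 * nn))"

lemma relG_view: "relG s0 L it m s \<longleftrightarrow> relG s0 L it m \<lparr>pc = 0, wmem = wmem s, rmem = rmem s, outp = outp s\<rparr>"
  by (simp add: relG_def same_def split: prod.splits)

lemma run_pG_step:
  assumes p: "pars s0" and th: "rmem s0 2 = \<theta>" and it: "it \<le> nn ^ 3" and L: "L \<le> nn ^ 3"
    and rel: "relG s0 L it m s"
  shows "\<exists>s'. run (IfW 41 42 ((LOADA 43 4 41 ;; LOADA 44 5 41) ;; pGin ;; pGout) Skip) s s' 600 \<and>
    relG s0 L (Suc it) (stepG \<sigma> y \<theta> m) s' \<and> wmem s' 30 = wmem s 30"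
proof -
  obtain h q cs where m: "m = (h, q, cs)" by (cases m) auto
  have f: "same gfr {5} s0 s" and r: "wmem s 41 = h" "wmem s 42 = length q" "wmem s 24 = length cs"
    and cs: "\<And>i. i < length cs \<Longrightarrow> wmem s (ad 3 i) = cs ! i"
    and q: "\<And>i. i < length q \<Longrightarrow> wmem s (ad 5 i) = fst (q ! i)" "\<And>i. i < length q \<Longrightarrow> wmem s (ad 4 i) = snd (q ! i)"
    and b: "h \<le> length q" "length q \<le> 2 * it + 1" "length cs \<le> L + it"
    and qb: "\<And>i. i < length q \<Longrightarrow> 2 ^ fst (q ! i) \<le> snd (q ! i) \<and> snd (q ! i) < 2 ^ (fst (q ! i) + 1) \<and> snd (q ! i) < 2 * nn"
    using rel unfolding m relG_def by auto
  have ps: "pars s" by (rule pars_same[OF f p]) (auto simp: ad_def)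
  show ?thesis
  proof (cases "h < length q")
    case False
    have "run (IfW 41 42 ((LOADA 43 4 41 ;; LOADA 44 5 41) ;; pGin ;; pGout) Skip) s s (0 + 2)"
      by (rule runs_IfW) (use False r ps in \<open>auto simp: pars_def runs_def intro: bs_Skip\<close>)
    then have "run (IfW 41 42 ((LOADA 43 4 41 ;; LOADA 44 5 41) ;; pGin ;; pGout) Skip) s s 600" by (rule runs_mono) simp
    moreover have "relG s0 L (Suc it) (stepG \<sigma> y \<theta> m) s" using rel False unfolding m relG_def by auto
    ultimately show ?thesis by blast
  next
    case True
    define lev v where "lev = fst (q ! h)" and "v = snd (q ! h)"
    have lv: "q ! h = (lev, v)" by (simp add: lev_def v_def)
    have vb: "2 ^ lev \<le> v" "v < 2 ^ (lev + 1)" "v < 2 * nn" using qb[OF True] unfolding lev_def v_def by auto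
    have "(2::nat) ^ lev < 2 * 2 ^ dd" using vb unfolding nn_def by linarith
    then have "(2::nat) ^ lev < 2 ^ Suc dd" by (simp only: power_Suc)
    then have "lev < Suc dd" by (rule power_less_imp_less_exp[rotated]) simp
    then have lb: "lev \<le> dd" by simp
    have adh: "ad k h < 2 ^ ww" if "k < 8" for k using True b it that nn_pows nn_ge by (intro ad_less) linarith+
    have s1: "wmem (xx (LOADA 43 4 41 ;; LOADA 44 5 41) s) 43 = v" "wmem (xx (LOADA 43 4 41 ;; LOADA 44 5 41) s) 44 = lev"
      "same {43, 44, 62, 63} {} s (xx (LOADA 43 4 41 ;; LOADA 44 5 41) s)"
    proof -
      let ?P = "\<lambda>s1. wmem s1 43 = v \<and> wmem s1 44 = lev \<and> same {43, 44, 62, 63} {} s s1"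
      have "?P (xx (LOADA 43 4 41 ;; LOADA 44 5 41) s)"
      proof (rule xxI)
        fix s1 :: ram_state assume "(wmem s1, rmem s1, outp s1) = xv (LOADA 43 4 41 ;; LOADA 44 5 41) (wmem s, rmem s, outp s)"
        then show "?P s1" using q[OF True] by (simp add: xvs r adh same_def lev_def v_def)
      qed
      then show "wmem (xx (LOADA 43 4 41 ;; LOADA 44 5 41) s) 43 = v" "wmem (xx (LOADA 43 4 41 ;; LOADA 44 5 41) s) 44 = lev"
        "same {43, 44, 62, 63} {} s (xx (LOADA 43 4 41 ;; LOADA 44 5 41) s)" by auto
    qed
    define s1 where "s1 = xx (LOADA 43 4 41 ;; LOADA 44 5 41) s"
    note s1 = s1[folded s1_def]
    have f1: "same gfr {5} s0 s1" by (rule same_trans[OF f]) (rule same_mono[OF s1(3)], auto)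
    have ps1: "pars s1" by (rule pars_same[OF f1 p]) (auto simp: ad_def)
    have th1: "rmem s1 2 = \<theta>" using sameR[OF f1, of 2] th by simp
    obtain s2 where s2: "run pGin s1 s2 500" and f12: "same ginfr {5} s1 s2"
      and e: "wmem s2 37 = 0" "wmem s2 45 = (if gpass \<sigma> y \<theta> lev v then 1 else 0)"
      using run_pGin[OF ps1 _ _ th1] s1(1,2) vb(3) lb by auto
    have f2: "same gfr {5} s0 s2" by (rule same_trans[OF f1]) (rule same_mono[OF f12], auto)
    have ps2: "pars s2" by (rule pars_same[OF f2 p]) (auto simp: ad_def)
    have r2: "wmem s2 41 = h" "wmem s2 42 = length q" "wmem s2 24 = length cs" "wmem s2 30 = wmem s 30" "wmem s2 43 = v" "wmem s2 44 = lev"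
      using f12 s1 r by (simp_all add: same_def)
    have mem2: "\<forall>i<length cs. wmem s2 (ad 3 i) = cs ! i" "\<forall>i<length q. wmem s2 (ad 5 i) = fst (q ! i)" "\<forall>i<length q. wmem s2 (ad 4 i) = snd (q ! i)"
      using f12 s1(3) cs q by (simp_all add: same_def)
    have pr: "wmem s2 0 = n" "wmem s2 3 = 1" "wmem s2 5 = nn" using ps2 by (auto simp: pars_def)
    have bb: "h + 1 < 2 ^ ww" "length q + 1 < 2 ^ ww" "length q + 1 + 1 < 2 ^ ww" "v + v < 2 ^ ww" "v + v + 1 < 2 ^ ww" "lev + 1 < 2 ^ ww"
      "v < 2 ^ ww" "length cs + 1 < 2 ^ ww" "length q + 2 < 2 ^ ww" "2 * v < 2 ^ ww" "2 * v + 1 < 2 ^ ww"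
      using True b it L vb lb nn_pows nn_ge bnds(1) by linarith+
    have adb: "ad k (length q) < 2 ^ ww" "ad k (length q + 1) < 2 ^ ww" "ad k (length cs) < 2 ^ ww" if "k < 8" for k
      using b it L that nn_pows nn_ge by (auto intro!: ad_less)
    define G where "G w \<longleftrightarrow> (case w of (U, R, Q) \<Rightarrow> relG s0 L (Suc it) (stepG \<sigma> y \<theta> m) \<lparr>pc = 0, wmem = U, rmem = R, outp = Q\<rparr> \<and>
       U 30 = wmem s 30)" for w
    have "G (xv pGout (wmem s2, rmem s2, outp s2))"
    proof (cases "gpass \<sigma> y \<theta> lev v \<and> v < nn")
      case g: True
      have vb2: "2 * v < 2 ^ (lev + 1 + 1)" "2 * v + 1 < 2 ^ (lev + 1 + 1)" "2 ^ (lev + 1) \<le> 2 * v" "2 ^ (lev + 1) \<le> 2 * v + 1"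
        "2 * v < 2 * nn" "2 * v + 1 < 2 * nn"
      proof -
        have "(2::nat) ^ (x + 1) = 2 * 2 ^ x" for x by (simp only: Suc_eq_plus1[symmetric] power_Suc)
        from this[of lev] this[of "lev + 1"] show "2 * v < 2 ^ (lev + 1 + 1)" "2 * v + 1 < 2 ^ (lev + 1 + 1)" "2 ^ (lev + 1) \<le> 2 * v" "2 ^ (lev + 1) \<le> 2 * v + 1"
          "2 * v < 2 * nn" "2 * v + 1 < 2 * nn" using vb g by linarith+
      qed
      have st: "stepG \<sigma> y \<theta> m = (h + 1, q @ [(lev + 1, 2 * v), (lev + 1, 2 * v + 1)], cs)"
        using g True by (simp add: m lv)
      have "xv pGout (wmem s2, rmem s2, outp s2) = ((wmem s2)(41 := h + 1, 43 := 2 * v + 1, 44 := lev + 1,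
          ad 4 (length q) := 2 * v, ad 5 (length q) := lev + 1, ad 4 (length q + 1) := 2 * v + 1, ad 5 (length q + 1) := lev + 1,
          42 := length q + 2, 62 := ad 5 (length q + 1), 63 := 69), rmem s2, outp s2)"
        using g by (simp add: pGout_def xvs pr r2 e adb bb mult_2[symmetric] fun_eq_iff)
      then show ?thesis
        using f2 mem2 b True qb vb2 unfolding G_def st
        by (simp add: relG_def same_def r2 nth_append less_Suc_eq all_conj_distrib)
    next
      case g: False
      then show ?thesis
        apply (simp add: pGout_def xvs pr r2 e adb bb cong: if_cong split del: if_split)
        using f2 mem2 b True qb g
        apply (auto simp: G_def relG_def m lv pr r2 nth_append less_Suc_eq same_def split: if_splits)
        done
    qed
    then have "G (wmem (xx pGout s2), rmem (xx pGout s2), outp (xx pGout s2))" by (rule view_xxD)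
    then have 1: "relG s0 L (Suc it) (stepG \<sigma> y \<theta> m) (xx pGout s2)" "wmem (xx pGout s2) 30 = wmem s 30"
      unfolding G_def by (simp_all only: prod.case relG_view[symmetric])
    have "run ((LOADA 43 4 41 ;; LOADA 44 5 41) ;; pGin ;; pGout) s (xx pGout s2) (clen (LOADA 43 4 41 ;; LOADA 44 5 41) + (500 + clen pGout))"
      unfolding s1_def by (intro runs_Seq[OF runs_xe] runs_Seq[OF s2[unfolded s1_def] runs_xe]) (simp_all add: pGout_def)
    then have "run (IfW 41 42 ((LOADA 43 4 41 ;; LOADA 44 5 41) ;; pGin ;; pGout) Skip) s (xx pGout s2)
        (clen (LOADA 43 4 41 ;; LOADA 44 5 41) + (500 + clen pGout) + 2)"
      by (intro runs_IfW) (use True r in auto)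
    moreover have "clen (LOADA 43 4 41 ;; LOADA 44 5 41) + (500 + clen pGout) + 2 \<le> 600"
      by (simp add: pGout_def LOADA_def STOREA_def ADDR_def)
    ultimately show ?thesis using 1 runs_mono by blast
  qed
qed

text \<open>Register 30 counts the steps of a budget; the body must leave it unchanged, and the
  invariant must not depend on it.\<close>

lemma run_loop_INC:
  assumes N: "N < 2 ^ ww"
    and step: "\<And>j s. j < N \<Longrightarrow> I j s \<Longrightarrow> \<exists>s'. run body s s' T \<and> I (Suc j) s' \<and> wmem s' 30 = wmem s 30"
    and cong: "\<And>j s s'. I j s \<Longrightarrow> same {30} {} s s' \<Longrightarrow> I j s'"
    and regs: "\<And>j s. I j s \<Longrightarrow> wmem s reg = N \<and> wmem s 3 = 1"
    and init: "I 0 s" "wmem s 30 = 0"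
  shows "\<exists>s'. run (While 30 reg (body ;; INC 30)) s s' (N * (T + 3) + 2) \<and> I N s'"
proof -
  have "\<exists>s'. run (While 30 reg (body ;; INC 30)) s s' (N * (T + 1 + 2) + 2) \<and> I N s' \<and> wmem s' 30 = N"
  proof (rule runs_While)
    fix j s assume j: "j < N" and I: "I j s \<and> wmem s 30 = j"
    obtain s1 where s1: "run body s s1 T" "I (Suc j) s1" "wmem s1 30 = j" using step[OF j] I by metis
    have b: "j + 1 < 2 ^ ww" using j N by linarith
    let ?P = "\<lambda>s2. same {30} {} s1 s2 \<and> wmem s2 30 = Suc j"
    have "?P (xx (INC 30) s1)"
    proof (rule xxI)
      fix s2 :: ram_state assume "(wmem s2, rmem s2, outp s2) = xv (INC 30) (wmem s1, rmem s1, outp s1)"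
      then show "?P s2" using b regs[OF s1(2)] by (simp add: xvs s1(3) same_def)
    qed
    then have "I (Suc j) (xx (INC 30) s1) \<and> wmem (xx (INC 30) s1) 30 = Suc j" using cong[OF s1(2)] by blast
    moreover have "run (body ;; INC 30) s (xx (INC 30) s1) (T + clen (INC 30))"
      by (rule runs_Seq[OF s1(1) runs_xe]) simp
    moreover have "wmem s 30 < wmem s reg" using I j regs by fastforce
    ultimately show "wmem s 30 < wmem s reg \<and> (\<exists>s'. run (body ;; INC 30) s s' (T + 1) \<and> I (Suc j) s' \<and> wmem s' 30 = Suc j)"
      unfolding clen.simps by blast
  next
    fix s assume "I N s \<and> wmem s 30 = N"
    then show "\<not> wmem s 30 < wmem s reg" using regs by fastforce
  qed (use init in auto)
  moreover have "T + 1 + 2 = T + 3" by simp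
  ultimately show ?thesis by metis
qed

lemma run_pG:
  assumes p: "pars s" and th: "rmem s 2 = \<theta>" and L: "length cs \<le> nn ^ 3"
    and cs: "wmem s 24 = length cs" "\<forall>i<length cs. wmem s (ad 3 i) = cs ! i"
  shows "\<exists>s'. run pG s s' (c * B * dd * 603 + 40) \<and> same gfr {5} s s' \<and>
    wmem s' 24 = length (candG \<sigma> y \<theta> cs) \<and> (\<forall>i<length (candG \<sigma> y \<theta> cs). wmem s' (ad 3 i) = candG \<sigma> y \<theta> cs ! i) \<and>
    length (candG \<sigma> y \<theta> cs) \<le> length cs + c * B * dd"
proof -
  let ?N = "c * B * dd" and ?m = "(0, [(0, 1)], cs) :: nat \<times> (nat \<times> nat) list \<times> nat list"
  let ?body = "IfW 41 42 ((LOADA 43 4 41 ;; LOADA 44 5 41) ;; pGin ;; pGout) Skip"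
  let ?init = "SETW 30 0 ;; SETW 41 0 ;; SETW 42 0 ;; STOREA 4 41 3 ;; STOREA 5 41 42 ;; SETW 42 1"
  define I where "I j s' \<longleftrightarrow> relG s (length cs) j ((stepG \<sigma> y \<theta> ^^ j) ?m) s'" for j and s' :: ram_state
  have k: "1 < (2::nat) ^ ww" "0 < (2::nat) ^ ww" "ad 4 0 < 2 ^ ww" "ad 5 0 < 2 ^ ww" "1 < 2 * nn" "(1::nat) < 2 ^ (0 + 1)"
    using nn_pows nn_ge by (auto simp: ad_def)
  have "I 0 (xx ?init s) \<and> wmem (xx ?init s) 30 = 0"
  proof (rule xxI[of _ _ "\<lambda>s1. I 0 s1 \<and> wmem s1 30 = 0"])
    fix s1 :: ram_state assume "(wmem s1, rmem s1, outp s1) = xv ?init (wmem s, rmem s, outp s)"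
    then show "I 0 s1 \<and> wmem s1 30 = 0" using p cs k
      by (simp add: xvs k I_def relG_def same_def pars_def less_Suc_eq)
  qed
  moreover have "\<exists>s'. run (While 30 17 (?body ;; INC 30)) (xx ?init s) s' (?N * (600 + 3) + 2) \<and> I ?N s'"
  proof (rule run_loop_INC)
    show "?N < 2 ^ ww" using cB_le(1) nn_pows nn_ge by linarith
    show "\<exists>s''. run ?body s' s'' 600 \<and> I (Suc j) s'' \<and> wmem s'' 30 = wmem s' 30" if "j < ?N" "I j s'" for j s'
    proof -
      have "j \<le> nn ^ 3" using that(1) cB_le(1) nn_pows by linarith
      from run_pG_step[OF p th this L that(2)[unfolded I_def]] show ?thesis unfolding I_def by simp
    qed
    show "I j s''" if "I j s'" "same {30} {} s' s''" for j s' s''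
      using that unfolding I_def relG_def by (auto simp: same_def split: prod.splits)
    show "wmem s' 17 = ?N \<and> wmem s' 3 = 1" if "I j s'" for j s'
    proof -
      have "same gfr {5} s s'" using that unfolding I_def relG_def by (auto split: prod.splits)
      then have "pars s'" by (rule pars_same[OF _ p]) (auto simp: ad_def)
      then show ?thesis by (auto simp: pars_def)
    qed
  qed (use calculation in auto)
  ultimately obtain s' where s': "run (While 30 17 (?body ;; INC 30)) (xx ?init s) s' (?N * (600 + 3) + 2)" "I ?N s'" by blast
  have "run pG s s' (clen ?init + (?N * (600 + 3) + 2))" unfolding pG_def
    by (rule runs_Seq[OF runs_xe s'(1)]) simp
  then have "run pG s s' (?N * 603 + 40)" by (rule runs_mono) (simp add: STOREA_def ADDR_def)
  then show ?thesis using s'(2) unfolding I_def relG_def candG_def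
    by (intro exI[of _ s']) (auto split: prod.splits)
qed

declare One_nat_def [simp del]

section \<open>Estimating the candidates on the machine\<close>

lemma xv_VAL:
  assumes "U 29 = 2 * dd" "U 6 = ss" "U 8 = bh" "U 7 = B" "U 3 = 1" "U 25 = 2" "R 1 = 0" "U 49 < n" "U j < rr" "j = 48 \<or> j = 51" "r \<noteq> 1"
  shows "xv (VAL r j) (U, R, Q) = (U(38 := 2 * dd + U j, 62 := (2 * dd + U j) * B + hb \<sigma> (2 * dd + U j) (U 49),
     39 := cw \<sigma> (2 * dd + U j) (U 49) mod 2), R(r := eval_at \<sigma> y (U 49) (U j)), Q)"
proof -
  let ?\<rho> = "2 * dd + U j" and ?i = "U 49"
  have \<rho>: "?\<rho> < ss" using assms(9) dd_pos unfolding rr_def ss_def by linarith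
  have i: "?i \<le> 2 * nn" using assms(8) n_le_nn by linarith
  have kb: "2 * (?i * ss + ?\<rho>) + 1 < 2 ^ ww" by (rule key_bound[OF i \<rho>])
  define K where "K = ?i * ss + ?\<rho>"
  have K: "?i * ss + (2 * dd + U j) = K" by (simp add: K_def)
  have b: "?\<rho> < ss" "?\<rho> < 2 ^ ww" "?i * ss < 2 ^ ww" "K < 2 ^ ww" "2 * K < 2 ^ ww" "K + K < 2 ^ ww" "2 * K + 1 < 2 ^ ww" "K + K + 1 < 2 ^ ww"
  proof -
    have kK: "2 * K + 1 < 2 ^ ww" using kb unfolding K_def .
    have "?i * ss \<le> K" "?\<rho> \<le> K" by (simp_all add: K_def)
    then show "?\<rho> < ss" "?\<rho> < 2 ^ ww" "?i * ss < 2 ^ ww" "K < 2 ^ ww" "2 * K < 2 ^ ww" "K + K < 2 ^ ww" "2 * K + 1 < 2 ^ ww" "K + K + 1 < 2 ^ ww"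
      using \<rho> kK by linarith+
  qed
  have h: "hb \<sigma> ?\<rho> ?i < B" using hb_less[of \<sigma> ?\<rho> ?i] by simp
  have b': "U j + 2 * dd = ?\<rho>" by simp
  have cw: "\<sigma> (2 * K + 1) = cw \<sigma> ?\<rho> ?i" "\<sigma> (K + K + 1) = cw \<sigma> ?\<rho> ?i"
    unfolding cw_def K_def by (simp_all only: mult_2)
  have par: "(cw \<sigma> ?\<rho> ?i mod 2 < 1) = even (cw \<sigma> ?\<rho> ?i)" by (simp add: even_iff_mod_2_eq_zero)
  have jj: "j \<noteq> 38" "j \<noteq> 39" "j \<noteq> 62" "j < 62" using assms(10) by auto
  show ?thesis
    unfolding VAL_def
    apply (simp add: xvs assms(1-7) b' K b i h jj cw par cong: if_cong split del: if_split)
    using assms(11) apply (auto simp: eval_at_def sg_def fun_eq_iff even_iff_mod_2_eq_zero)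
    done
qed

abbreviation "einfr \<equiv> {38, 39, 50, 51, 62, 63 :: nat}"

lemma run_pEin:
  assumes p: "pars s" and i: "wmem s 49 < n" and t: "wmem s 48 < rr" and th: "rmem s 3 = 2 * \<theta>"
  shows "\<exists>s'. run pEin s s' (rr * 70 + 60) \<and> same einfr {5, 6} s s' \<and> rmem s' 5 = eval_at \<sigma> y (wmem s 49) (wmem s 48) \<and>
     wmem s' 50 = ecnt \<sigma> y \<theta> (wmem s 49) (eval_at \<sigma> y (wmem s 49) (wmem s 48))"
proof -
  let ?i = "wmem s 49" and ?t = "wmem s 48"
  define v where "v = eval_at \<sigma> y ?i ?t"
  define ct where "ct j = (\<Sum>l<j. if 2 * \<theta> < \<bar>eval_at \<sigma> y ?i l - v\<bar> then 0 else (1::nat))" for j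
  have ct: "ct 0 = 0" "ct (Suc j) = (if 2 * \<theta> < \<bar>eval_at \<sigma> y ?i j - v\<bar> then ct j else ct j + 1)" "ct j \<le> j" for j
  proof -
    have "ct j \<le> (\<Sum>l<j. 1)" unfolding ct_def by (intro sum_mono) auto
    then show "ct j \<le> j" by simp
  qed (auto simp: ct_def)
  define Iv where "Iv j w \<longleftrightarrow> (case w of (U, R, Q) \<Rightarrow> (\<forall>r. r \<notin> einfr \<longrightarrow> U r = wmem s r) \<and> (\<forall>r. r \<noteq> 5 \<and> r \<noteq> 6 \<longrightarrow> R r = rmem s r) \<and>
     Q = outp s \<and> U 51 = j \<and> R 5 = v \<and> U 50 = ct j)" for j w
  have pr: "wmem s 29 = 2 * dd" "wmem s 6 = ss" "wmem s 8 = bh" "wmem s 7 = B" "wmem s 3 = 1" "wmem s 25 = 2" "rmem s 1 = 0" "wmem s 20 = rr"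
    using p by (auto simp: pars_def)
  have k: "0 < (2::nat) ^ ww" by simp
  have "\<exists>s'. run ((VAL 5 48 ;; SETW 50 0 ;; SETW 51 0) ;; While 51 20
     (VAL 6 51 ;; Ins (ROp RSub 6 6 5) ;; RABS 6 ;; IfR 3 6 Skip (INC 50) ;; INC 51)) s s' (rr * 70 + 60) \<and> Iv rr (wmem s', rmem s', outp s')"
  proof (rule for_straight)
    fix j U R Q
    assume j: "j < rr" and "Iv j (U, R, Q)"
    then have I: "\<forall>r. r \<notin> einfr \<longrightarrow> U r = wmem s r" "\<forall>r. r \<noteq> 5 \<and> r \<noteq> 6 \<longrightarrow> R r = rmem s r" "Q = outp s" "U 51 = j" "R 5 = v" "U 50 = ct j"
      unfolding Iv_def by auto
    have b: "j + 1 < 2 ^ ww" "ct j + 1 < 2 ^ ww"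
      using j ct(3)[of j] bnds(1) nn_pows dd_pos unfolding rr_def by linarith+
    have "Iv (Suc j) (xv (VAL 6 51 ;; Ins (ROp RSub 6 6 5) ;; RABS 6 ;; IfR 3 6 Skip (INC 50) ;; INC 51) (U, R, Q))"
      apply (simp add: xvs xv_VAL pr I(1-6) b i j th cong: if_cong split del: if_split)
      apply (simp add: Iv_def ct I(1-6) split: if_split)
      done
    then show "U 51 < U 20 \<and> Iv (Suc j) (xv (VAL 6 51 ;; Ins (ROp RSub 6 6 5) ;; RABS 6 ;; IfR 3 6 Skip (INC 50) ;; INC 51) (U, R, Q))"
      using j I(1,4) pr by simp
  next
    fix U R Q assume "Iv rr (U, R, Q)"
    then show "\<not> U 51 < U 20" using pr unfolding Iv_def by simp
  next
    show "Iv 0 (xv (VAL 5 48 ;; SETW 50 0 ;; SETW 51 0) (wmem s, rmem s, outp s))"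
      using k i t by (simp add: xvs xv_VAL pr) (simp add: Iv_def ct v_def)
  qed (simp_all add: VAL_def HSH_def ROW_def RABS_def)
  then obtain s' where s': "run pEin s s' (rr * 70 + 60)" "Iv rr (wmem s', rmem s', outp s')" unfolding pEin_def by blast
  have "same einfr {5, 6} s s'" "rmem s' 5 = v" "wmem s' 50 = ecnt \<sigma> y \<theta> ?i v"
    using s'(2) by (simp_all add: Iv_def same_def ecnt_def ct_def)
  then show ?thesis using s'(1) unfolding v_def by blast
qed

abbreviation "efr \<equiv> {30, 38, 39, 47, 48, 49, 50, 51, 52, 62, 63} \<union> range (ad 6)"

text \<open>Output cannot be undone, so the abstract output list is matched with what has been
  appended to the initial output. The set of seen items is represented by flags on indices below
  n.\<close>

definition relE :: "ram_state \<Rightarrow> nat list \<Rightarrow> nat \<times> nat \<times> nat set \<times> (nat \<times> real) list \<Rightarrow> ram_state \<Rightarrow> bool" where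
  "relE s0 cs m s \<longleftrightarrow> (case m of (k, t, seen, out) \<Rightarrow> same efr {5, 6} (s0\<lparr>outp := outp s0 @ out\<rparr>) s \<and> wmem s 47 = k \<and> wmem s 48 = t \<and>
     (\<forall>i<n. wmem s (ad 6 i) = (if i \<in> seen then 1 else 0)) \<and> k \<le> length cs \<and> t < rr)"

lemma relE_view: "relE s0 cs m s \<longleftrightarrow> relE s0 cs m \<lparr>pc = 0, wmem = wmem s, rmem = rmem s, outp = outp s\<rparr>"
  by (simp add: relE_def same_def split: prod.splits)

lemma pars_outp [simp]: "pars (s\<lparr>outp := x\<rparr>) = pars s"
  by (simp add: pars_def)

abbreviation "ebody \<equiv> IfW 47 24 ((LOADA 49 3 47 ;; LOADA 52 6 49) ;;
        IfW 52 3 (pEin ;; pEout) (INC 47 ;; SETW 48 0)) Skip"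

lemma run_pE_step:
  assumes p: "pars s0" and th: "rmem s0 3 = 2 * \<theta>" "rmem s0 4 = 6 * \<theta>" and L: "length cs \<le> nn ^ 4"
    and cs: "wmem s0 24 = length cs" "\<forall>i<length cs. wmem s0 (ad 3 i) = cs ! i" "\<forall>x\<in>set cs. x < n"
    and rel: "relE s0 cs m s"
  shows "\<exists>s'. run ebody s s' (rr * 70 + 150) \<and> relE s0 cs (stepE \<sigma> y \<theta> cs m) s' \<and> wmem s' 30 = wmem s 30"
proof -
  obtain k t seen out where m: "m = (k, t, seen, out)" by (cases m) auto
  have f: "same efr {5, 6} (s0\<lparr>outp := outp s0 @ out\<rparr>) s" and r: "wmem s 47 = k" "wmem s 48 = t"
    and se: "\<And>i. i < n \<Longrightarrow> wmem s (ad 6 i) = (if i \<in> seen then 1 else 0)" and b: "k \<le> length cs" "t < rr"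
    using rel unfolding m relE_def by auto
  have ps: "pars s" by (rule pars_same[OF f]) (use p in \<open>auto simp: ad_def\<close>)
  have cs': "wmem s 24 = length cs" "\<forall>i<length cs. wmem s (ad 3 i) = cs ! i"
    using f cs by (simp_all add: same_def)
  show ?thesis
  proof (cases "k < length cs")
    case False
    have "run ebody s s (0 + 2)"
      by (rule runs_IfW) (use False r cs' in \<open>auto simp: runs_def intro: bs_Skip\<close>)
    then have "run ebody s s (rr * 70 + 150)" by (rule runs_mono) simp
    moreover have "relE s0 cs (stepE \<sigma> y \<theta> cs m) s" using rel False unfolding m relE_def by auto
    ultimately show ?thesis by blast
  next
    case True
    define i where "i = cs ! k"
    have i: "i < n" using True cs(3) unfolding i_def by simp
    have adk: "ad 3 k < 2 ^ ww" "ad 6 i < 2 ^ ww"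
      using True L i n_le_nn nn_pows nn_ge by (auto intro!: ad_less)
    let ?ld = "LOADA 49 3 47 ;; LOADA 52 6 49"
    let ?P = "\<lambda>s1. wmem s1 49 = i \<and> wmem s1 52 = (if i \<in> seen then 1 else 0) \<and> same {49, 52, 62, 63} {} s s1"
    have "?P (xx ?ld s)"
    proof (rule xxI)
      fix s1 :: ram_state assume "(wmem s1, rmem s1, outp s1) = xv ?ld (wmem s, rmem s, outp s)"
      then show "?P s1" using cs'(2) True se[OF i] by (simp add: xvs r adk same_def i_def[symmetric])
    qed
    then obtain s1 where s1: "run ?ld s s1 (clen ?ld)" "wmem s1 49 = i" "wmem s1 52 = (if i \<in> seen then 1 else 0)"
      "same {49, 52, 62, 63} {} s s1" using runs_xe[of ?ld ww \<sigma> y s] by auto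
    have f1: "same efr {5, 6} (s0\<lparr>outp := outp s0 @ out\<rparr>) s1" by (rule same_trans[OF f]) (rule same_mono[OF s1(4)], auto)
    have ps1: "pars s1" by (rule pars_same[OF f1]) (use p in \<open>auto simp: ad_def\<close>)
    have r1: "wmem s1 47 = k" "wmem s1 48 = t" "wmem s1 30 = wmem s 30" "rmem s1 3 = 2 * \<theta>" "rmem s1 4 = 6 * \<theta>"
      using s1(4) f r th by (simp_all add: same_def)
    have se1: "\<forall>i<n. wmem s1 (ad 6 i) = (if i \<in> seen then 1 else 0)"
      using s1(4) se by (simp add: same_def)
    have bb: "k + 1 < 2 ^ ww" "t + 1 < 2 ^ ww" "0 < (2::nat) ^ ww"
      using True L b bnds(1) dd_pos nn_pows nn_ge unfolding rr_def by linarith+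
    have rr0: "0 < rr" using b by linarith
    let ?Q = "\<lambda>s2. relE s0 cs (stepE \<sigma> y \<theta> cs m) s2 \<and> wmem s2 30 = wmem s 30"
    have "\<exists>s2. run (IfW 52 3 (pEin ;; pEout) (INC 47 ;; SETW 48 0)) s1 s2 (rr * 70 + 60 + clen pEout + 2) \<and> ?Q s2"
    proof (cases "i \<in> seen")
      case seen: True
      have pr: "wmem s1 3 = 1" using ps1 by (auto simp: pars_def)
      have "?Q (xx (INC 47 ;; SETW 48 0) s1)"
      proof (rule xxI)
        fix s2 :: ram_state assume "(wmem s2, rmem s2, outp s2) = xv (INC 47 ;; SETW 48 0) (wmem s1, rmem s1, outp s1)"
        then show "?Q s2" using f1 se1 True seen rr0 bb
          by (simp add: xvs r1 pr relE_def m i_def[symmetric] same_def)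
      qed
      moreover have "run (IfW 52 3 (pEin ;; pEout) (INC 47 ;; SETW 48 0)) s1 (xx (INC 47 ;; SETW 48 0) s1) (rr * 70 + 60 + clen pEout + 2)"
      proof (rule runs_IfW)
        have "run (INC 47 ;; SETW 48 0) s1 (xx (INC 47 ;; SETW 48 0) s1) (clen (INC 47 ;; SETW 48 0))" by (rule runs_xe) simp
        then show "run (INC 47 ;; SETW 48 0) s1 (xx (INC 47 ;; SETW 48 0) s1) (rr * 70 + 60 + clen pEout)"
          by (rule runs_mono) simp
      qed (use seen s1 pr in auto)
      ultimately show ?thesis by blast
    next
      case seen: False
      obtain s2 where s2: "run pEin s1 s2 (rr * 70 + 60)" and f12: "same einfr {5, 6} s1 s2"
        and v: "rmem s2 5 = eval_at \<sigma> y i t" and ct: "wmem s2 50 = ecnt \<sigma> y \<theta> i (eval_at \<sigma> y i t)"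
        using run_pEin[OF ps1, of \<theta>] s1(2) i r1 b(2) by auto
      define v' where "v' = eval_at \<sigma> y i t"
      define q where "q = ecnt \<sigma> y \<theta> i v'"
      have f2: "same efr {5, 6} (s0\<lparr>outp := outp s0 @ out\<rparr>) s2" by (rule same_trans[OF f1]) (rule same_mono[OF f12], auto)
      have ps2: "pars s2" by (rule pars_same[OF f2]) (use p in \<open>auto simp: ad_def\<close>)
      have r2: "wmem s2 47 = k" "wmem s2 48 = t" "wmem s2 30 = wmem s 30" "rmem s2 3 = 2 * \<theta>" "rmem s2 4 = 6 * \<theta>" "wmem s2 49 = i"
        "rmem s2 5 = v'" "wmem s2 50 = q"
        using f12 r1 s1(2) v ct by (simp_all add: same_def v'_def q_def)
      have se2: "\<forall>i<n. wmem s2 (ad 6 i) = (if i \<in> seen then 1 else 0)"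
        using f12 se1 by (simp add: same_def)
      have pr: "wmem s2 3 = 1" "wmem s2 20 = rr" "rmem s2 1 = 0" using ps2 by (auto simp: pars_def)
      have "q \<le> (\<Sum>j<rr. 1)" unfolding q_def ecnt_def by (intro sum_mono) auto
      then have qb: "q + q < 2 ^ ww" using bnds(1) dd_pos nn_pows unfolding rr_def by simp
      define G where "G w \<longleftrightarrow> (case w of (U, R, Q) \<Rightarrow> ?Q \<lparr>pc = 0, wmem = U, rmem = R, outp = Q\<rparr>)" for w
      have "G (xv pEout (wmem s2, rmem s2, outp s2))"
        apply (simp add: pEout_def xvs pr r2 adk bb qb cong: if_cong split del: if_split)
        using f2 se2 True seen rr0 b
        apply (simp add: G_def relE_def m i_def[symmetric] v'_def[symmetric] q_def[symmetric] Let_def mult_2 r2 same_def split: if_split)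
        done
      then have "G (wmem (xx pEout s2), rmem (xx pEout s2), outp (xx pEout s2))" by (rule view_xxD)
      then have "?Q (xx pEout s2)" unfolding G_def by (simp add: relE_view[symmetric] del: stepE.simps xe.simps)
      moreover have "run (IfW 52 3 (pEin ;; pEout) (INC 47 ;; SETW 48 0)) s1 (xx pEout s2) (rr * 70 + 60 + clen pEout + 2)"
      proof (rule runs_IfW)
        show "run (pEin ;; pEout) s1 (xx pEout s2) (rr * 70 + 60 + clen pEout)"
          by (rule runs_Seq[OF s2 runs_xe]) (simp add: pEout_def)
      qed (use seen s1 ps1 in \<open>auto simp: pars_def\<close>)
      ultimately show ?thesis by blast
    qed
    then obtain s2 where s2: "run (IfW 52 3 (pEin ;; pEout) (INC 47 ;; SETW 48 0)) s1 s2 (rr * 70 + 60 + clen pEout + 2)" "?Q s2" by blast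
    have "run ebody s s2 (clen ?ld + (rr * 70 + 60 + clen pEout + 2) + 2)"
      by (rule runs_IfW) (use True r cs' runs_Seq[OF s1(1) s2(1)] in auto)
    moreover have "clen ?ld + (rr * 70 + 60 + clen pEout + 2) + 2 \<le> rr * 70 + 150"
      by (simp add: pEout_def LOADA_def STOREA_def ADDR_def RABS_def)
    ultimately show ?thesis using s2(2) runs_mono by blast
  qed
qed

lemma run_pE:
  assumes p: "pars s" and th: "rmem s 3 = 2 * \<theta>" "rmem s 4 = 6 * \<theta>" and L: "length cs \<le> nn ^ 4"
    and cs: "wmem s 24 = length cs" "\<forall>i<length cs. wmem s (ad 3 i) = cs ! i" "\<forall>x\<in>set cs. x < n"
    and z: "\<forall>i. wmem s (ad 6 i) = 0"
  shows "\<exists>s'. run pE s s' (c * B * (rr * 70 + 153) + 10) \<and> outp s' = outp s @ outE \<sigma> y \<theta> cs"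
proof -
  let ?N = "c * B" and ?m = "(0, 0, {}, []) :: nat \<times> nat \<times> nat set \<times> (nat \<times> real) list"
  let ?init = "SETW 30 0 ;; SETW 47 0 ;; SETW 48 0"
  define I where "I j s' \<longleftrightarrow> relE s cs ((stepE \<sigma> y \<theta> cs ^^ j) ?m) s'" for j and s' :: ram_state
  have k: "0 < (2::nat) ^ ww" "0 < rr" using dd_pos by (auto simp: rr_def)
  have "I 0 (xx ?init s) \<and> wmem (xx ?init s) 30 = 0"
  proof (rule xxI[of _ _ "\<lambda>s1. I 0 s1 \<and> wmem s1 30 = 0"])
    fix s1 :: ram_state assume "(wmem s1, rmem s1, outp s1) = xv ?init (wmem s, rmem s, outp s)"
    then show "I 0 s1 \<and> wmem s1 30 = 0" using z k
      by (simp add: xvs I_def relE_def same_def)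
  qed
  moreover have "\<exists>s'. run (While 30 19 (ebody ;; INC 30)) (xx ?init s) s' (?N * (rr * 70 + 150 + 3) + 2) \<and> I ?N s'"
  proof (rule run_loop_INC)
    show "?N < 2 ^ ww" using cB_le(3) nn_pows nn_ge by linarith
    show "\<exists>s''. run ebody s' s'' (rr * 70 + 150) \<and> I (Suc j) s'' \<and> wmem s'' 30 = wmem s' 30" if "j < ?N" "I j s'" for j s'
      using run_pE_step[OF p th L cs that(2)[unfolded I_def]] unfolding I_def by simp
    show "I j s''" if "I j s'" "same {30} {} s' s''" for j s' s''
      using that unfolding I_def relE_def by (auto simp: same_def split: prod.splits)
    show "wmem s' 19 = ?N \<and> wmem s' 3 = 1" if "I j s'" for j s'
    proof -
      obtain k t se out where m: "(stepE \<sigma> y \<theta> cs ^^ j) ?m = (k, t, se, out)" by (rule prod_cases4)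
      then have "same efr {5, 6} (s\<lparr>outp := outp s @ out\<rparr>) s'" using that unfolding I_def relE_def by simp
      then have "pars s'" by (rule pars_same) (use p in \<open>auto simp: ad_def\<close>)
      then show ?thesis by (auto simp: pars_def)
    qed
  qed (use calculation in auto)
  ultimately obtain s' where s': "run (While 30 19 (ebody ;; INC 30)) (xx ?init s) s' (?N * (rr * 70 + 150 + 3) + 2)" "I ?N s'" by blast
  have "run pE s s' (clen ?init + (?N * (rr * 70 + 150 + 3) + 2))" unfolding pE_def
    by (rule runs_Seq[OF runs_xe s'(1)]) simp
  then have "run pE s s' (?N * (rr * 70 + 153) + 10)" by (rule runs_mono) (simp add: add.commute[of 153])
  then show ?thesis using s'(2) unfolding I_def relE_def outE_def
    by (intro exI[of _ s']) (auto simp: same_def split: prod.splits)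
qed

declare One_nat_def [simp del]

section \<open>Weights and decoding table on the machine\<close>

lemma wt_le: "wt e \<le> e"
proof (induction e rule: less_induct)
  case (less e)
  show ?case
  proof (cases "e = 0")
    case True
    then show ?thesis by (simp add: wt.simps)
  next
    case False
    then have "wt (e div 2) \<le> e div 2" by (intro less) simp
    then show ?thesis using wt_rec[of e] by linarith
  qed
qed

lemma ell_nn: "2 ^ ell \<le> nn" using vv_dd(3) bnds(1) by linarith

text \<open>The table is filled in increasing order by halving the argument. Entry 0 refers to
  itself, and its value before the loop has to be 0, which is the weight of 0.\<close>

lemma run_pWt:
  assumes p: "pars s" and z: "wmem s (ad 0 0) = 0"
  shows "\<exists>s'. run pWt s s' (2 ^ ell * 30 + 10) \<and> same ({53, 56, 57, 62, 63} \<union> range (ad 0)) {} s s' \<and>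
    (\<forall>u<2 ^ ell. wmem s' (ad 0 u) = wt u)"
proof -
  let ?fr = "{53, 56, 57, 62, 63} \<union> range (ad 0)"
  define Iv where "Iv j v \<longleftrightarrow> (case v of (U, R, Q) \<Rightarrow> (\<forall>r. r \<notin> ?fr \<longrightarrow> U r = wmem s r) \<and> R = rmem s \<and>
     Q = outp s \<and> U 53 = j \<and> (\<forall>u<j. U (ad 0 u) = wt u) \<and> (j = 0 \<longrightarrow> U (ad 0 0) = 0))" for j v
  have pr: "wmem s 13 = 2 ^ ell" "wmem s 25 = 2" "wmem s 3 = 1"
    using p by (auto simp: pars_def)
  have "\<exists>s'. run (SETW 53 0 ;; While 53 13
     (DIV 56 53 25 ;; LOADA 57 0 56 ;; MOD 56 53 25 ;; ADD 57 57 56 ;; STOREA 0 53 57 ;; INC 53)) s s' (2 ^ ell * 30 + 10) \<and>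
       Iv (2 ^ ell) (wmem s', rmem s', outp s')"
  proof (rule for_straight)
    fix j U R Q
    assume j: "j < 2 ^ ell" and "Iv j (U, R, Q)"
    then have I: "\<forall>r. r \<notin> ?fr \<longrightarrow> U r = wmem s r" "R = rmem s" "Q = outp s" "U 53 = j" "\<forall>u<j. U (ad 0 u) = wt u"
      "j = 0 \<Longrightarrow> U (ad 0 0) = 0"
      unfolding Iv_def by auto
    have w: "U (ad 0 (j div 2)) = wt (j div 2)"
      using I(5,6) by (cases "j = 0") (simp_all add: wt.simps)
    have b: "ad 0 (j div 2) < 2 ^ ww" "ad 0 j < 2 ^ ww" "wt (j div 2) + j mod 2 < 2 ^ ww" "j + 1 < 2 ^ ww"
      using j ell_nn nn_pows nn_ge wt_le[of j] wt_rec[of j] by (auto intro!: ad_less)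
    have "Iv (Suc j) (xv (DIV 56 53 25 ;; LOADA 57 0 56 ;; MOD 56 53 25 ;; ADD 57 57 56 ;; STOREA 0 53 57 ;; INC 53) (U, R, Q))"
      apply (simp add: xvs pr I(1-4) b w)
      using I(5) wt_rec[of j] by (simp add: Iv_def I(1-4) less_Suc_eq)
    then show "U 53 < U 13 \<and> Iv (Suc j) (xv (DIV 56 53 25 ;; LOADA 57 0 56 ;; MOD 56 53 25 ;; ADD 57 57 56 ;; STOREA 0 53 57 ;; INC 53) (U, R, Q))"
      using j I(1,4) pr by simp
  next
    fix U R Q assume "Iv (2 ^ ell) (U, R, Q)"
    then show "\<not> U 53 < U 13" using pr unfolding Iv_def by simp
  next
    show "Iv 0 (xv (SETW 53 0) (wmem s, rmem s, outp s))"
      using z by (simp add: xvs) (simp add: Iv_def)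
  qed (simp_all add: LOADA_def STOREA_def ADDR_def)
  then obtain s' where s': "run pWt s s' (2 ^ ell * 30 + 10)" "Iv (2 ^ ell) (wmem s', rmem s', outp s')" unfolding pWt_def by blast
  then show ?thesis by (intro exI[of _ s']) (simp add: Iv_def same_def)
qed

lemma xor_less: "u < 2 ^ k \<Longrightarrow> v < 2 ^ k \<Longrightarrow> xor u v < (2::nat) ^ k"
  by (metis take_bit_nat_eq_self take_bit_xor take_bit_nat_less_exp)

text \<open>One pass per new codeword covers the ball around it. Overwriting earlier entries agrees
  with the recursion of \<open>gv_tab\<close>, which also lets the latest codeword win.\<close>

lemma run_pGVin:
  assumes p: "pars s" and w: "\<forall>u<2 ^ ell. wmem s (ad 0 u) = wt u" and cc: "wmem s 53 < 2 ^ ell"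
  shows "\<exists>s'. run pGVin s s' (2 ^ ell * 50 + 10) \<and> same ({55, 56, 57, 62, 63} \<union> range (ad 1) \<union> range (ad 2)) {} s s' \<and>
    (\<forall>u<2 ^ ell. wmem s' (ad 1 u) = (if wt (xor u (wmem s 53)) \<le> 2 * aa then 1 else wmem s (ad 1 u)) \<and>
      wmem s' (ad 2 u) = (if wt (xor u (wmem s 53)) \<le> aa then wmem s 54 else wmem s (ad 2 u)))"
proof -
  let ?c = "wmem s 53" and ?fr = "{55, 56, 57, 62, 63} \<union> range (ad 1) \<union> range (ad 2)"
  define Iv where "Iv j v \<longleftrightarrow> (case v of (U, R, Q) \<Rightarrow> (\<forall>r. r \<notin> ?fr \<longrightarrow> U r = wmem s r) \<and> R = rmem s \<and>
     Q = outp s \<and> U 55 = j \<and> (\<forall>u. U (ad 1 u) = (if u < j \<and> wt (xor u ?c) \<le> 2 * aa then 1 else wmem s (ad 1 u))) \<and>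
      (\<forall>u. U (ad 2 u) = (if u < j \<and> wt (xor u ?c) \<le> aa then wmem s 54 else wmem s (ad 2 u))))" for j v
  let ?body = "Ins (WOp WXor 56 55 53) ;; LOADA 57 0 56 ;;
      IfW 57 21 (STOREA 1 55 3) Skip ;;
      IfW 57 22 (STOREA 2 55 54) Skip ;; INC 55"
  have pr: "wmem s 13 = 2 ^ ell" "wmem s 21 = 2 * aa + 1" "wmem s 22 = aa + 1" "wmem s 3 = 1"
    using p by (auto simp: pars_def)
  have "\<exists>s'. run (SETW 55 0 ;; While 55 13 ?body) s s' (2 ^ ell * 50 + 10) \<and>
       Iv (2 ^ ell) (wmem s', rmem s', outp s')"
  proof (rule for_straight)
    fix j U R Q
    assume j: "j < 2 ^ ell" and "Iv j (U, R, Q)"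
    then have I: "\<forall>r. r \<notin> ?fr \<longrightarrow> U r = wmem s r" "R = rmem s" "Q = outp s" "U 55 = j"
      "\<forall>u. U (ad 1 u) = (if u < j \<and> wt (xor u ?c) \<le> 2 * aa then 1 else wmem s (ad 1 u))"
      "\<forall>u. U (ad 2 u) = (if u < j \<and> wt (xor u ?c) \<le> aa then wmem s 54 else wmem s (ad 2 u))"
      unfolding Iv_def by auto
    have x: "xor j ?c < 2 ^ ell" using j cc by (rule xor_less)
    then have w': "wmem s (ad 0 (xor j ?c)) = wt (xor j ?c)" using w by simp
    have b: "ad 0 (xor j ?c) < 2 ^ ww" "ad 1 j < 2 ^ ww" "ad 2 j < 2 ^ ww" "j + 1 < 2 ^ ww"
      using j x ell_nn nn_pows nn_ge by (auto intro!: ad_less)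
    have "Iv (Suc j) (xv ?body (U, R, Q))"
      apply (simp add: xvs pr I(1-4) b w' cong: if_cong split del: if_split)
      using I(5,6) apply (simp add: Iv_def I(1-4) less_Suc_eq pr split: if_split)
      done
    then show "U 55 < U 13 \<and> Iv (Suc j) (xv ?body (U, R, Q))"
      using j I(1,4) pr by simp
  next
    fix U R Q assume "Iv (2 ^ ell) (U, R, Q)"
    then show "\<not> U 55 < U 13" using pr unfolding Iv_def by simp
  next
    show "Iv 0 (xv (SETW 55 0) (wmem s, rmem s, outp s))"
      by (simp add: xvs) (simp add: Iv_def)
  qed (simp_all add: LOADA_def STOREA_def ADDR_def)
  then obtain s' where s': "run pGVin s s' (2 ^ ell * 50 + 10)" "Iv (2 ^ ell) (wmem s', rmem s', outp s')" unfolding pGVin_def by blast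
  then show ?thesis by (intro exI[of _ s']) (simp add: Iv_def same_def)
qed

lemma length_gv_Suc: "length (gv r (Suc k)) = (if gv_mark r k k = 0 then length (gv r k) + 1 else length (gv r k))"
  by (auto simp: gv_mark)

abbreviation "gvfr \<equiv> {53, 54, 55, 56, 57, 62, 63} \<union> range (ad 1) \<union> range (ad 2)"

lemma run_pGV:
  assumes p: "pars s" and w: "\<forall>u<2 ^ ell. wmem s (ad 0 u) = wt u" and z: "\<forall>u. wmem s (ad 1 u) = 0" "\<forall>u. wmem s (ad 2 u) = 0"
  shows "\<exists>s'. run pGV s s' (2 ^ ell * (2 ^ ell * 50 + 40) + 10) \<and> same gvfr {} s s' \<and> tabs s'"
proof -
  define I where "I j s' \<longleftrightarrow> same gvfr {} s s' \<and> wmem s' 53 = j \<and> wmem s' 54 = length (gv (2 * aa) j) \<and>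
    (\<forall>u<2 ^ ell. wmem s' (ad 1 u) = gv_mark (2 * aa) j u) \<and> (\<forall>u<2 ^ ell. wmem s' (ad 2 u) = gv_tab aa j u)" for j and s' :: ram_state
  let ?init = "SETW 53 0 ;; SETW 54 0"
  let ?body = "LOADA 57 1 53 ;; IfW 57 3 (INC 54 ;; pGVin) Skip ;; INC 53"
  have ps: "pars s'" if "I j s'" for j s'
  proof -
    have "same gvfr {} s s'" using that unfolding I_def by blast
    then show ?thesis by (rule pars_same[OF _ p]) (auto simp: ad_def)
  qed
  have "\<exists>s'. run (While 53 13 ?body) (xx ?init s) s' (2 ^ ell * (2 ^ ell * 50 + 36 + 2) + 2) \<and> I (2 ^ ell) s'"
  proof (rule runs_While)
    show "I 0 (xx ?init s)"
    proof (rule xxI)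
      fix s1 :: ram_state assume "(wmem s1, rmem s1, outp s1) = xv ?init (wmem s, rmem s, outp s)"
      then show "I 0 s1" using z by (simp add: xvs I_def same_def)
    qed
    show "\<not> wmem s1 53 < wmem s1 13" if "I (2 ^ ell) s1" for s1
      using that ps[OF that] by (simp add: I_def pars_def)
    fix j s1 assume j: "j < 2 ^ ell" and I: "I j s1"
    have f: "same gvfr {} s s1" and r: "wmem s1 53 = j" "wmem s1 54 = length (gv (2 * aa) j)"
      and mk: "\<And>u. u < 2 ^ ell \<Longrightarrow> wmem s1 (ad 1 u) = gv_mark (2 * aa) j u"
      and tb: "\<And>u. u < 2 ^ ell \<Longrightarrow> wmem s1 (ad 2 u) = gv_tab aa j u"
      using I unfolding I_def by auto
    have w1: "\<forall>u<2 ^ ell. wmem s1 (ad 0 u) = wt u" using f w by (simp add: same_def)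
    have pr: "wmem s1 3 = 1" "wmem s1 13 = 2 ^ ell" using ps[OF I] by (auto simp: pars_def)
    have b: "ad 1 j < 2 ^ ww" "length (gv (2 * aa) j) + 1 < 2 ^ ww" "j + 1 < 2 ^ ww"
      using j ell_nn nn_pows nn_ge length_gv[of "2 * aa" j] by (auto intro!: ad_less)
    let ?P = "\<lambda>s2. same {57, 62, 63} {} s1 s2 \<and> wmem s2 57 = gv_mark (2 * aa) j j"
    have "?P (xx (LOADA 57 1 53) s1)"
    proof (rule xxI)
      fix s2 :: ram_state assume "(wmem s2, rmem s2, outp s2) = xv (LOADA 57 1 53) (wmem s1, rmem s1, outp s1)"
      then show "?P s2" using mk[OF j] by (simp add: xvs r b same_def)
    qed
    then obtain s2 where s2: "run (LOADA 57 1 53) s1 s2 5" "same {57, 62, 63} {} s1 s2" "wmem s2 57 = gv_mark (2 * aa) j j"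
      using runs_xe[of "LOADA 57 1 53" ww \<sigma> y s1] by (auto simp: LOADA_def ADDR_def)
    have r2: "wmem s2 53 = j" "wmem s2 54 = length (gv (2 * aa) j)" "wmem s2 3 = 1"
      using s2(2) r pr by (simp_all add: same_def)
    have mem2: "\<forall>u<2 ^ ell. wmem s2 (ad 0 u) = wt u" "\<forall>u<2 ^ ell. wmem s2 (ad 1 u) = gv_mark (2 * aa) j u"
      "\<forall>u<2 ^ ell. wmem s2 (ad 2 u) = gv_tab aa j u"
      using s2(2) w1 mk tb by (simp_all add: same_def)
    let ?R = "\<lambda>s4. same gvfr {} s s4 \<and> wmem s4 53 = j \<and> wmem s4 54 = length (gv (2 * aa) (Suc j)) \<and>
      (\<forall>u<2 ^ ell. wmem s4 (ad 1 u) = gv_mark (2 * aa) (Suc j) u) \<and> (\<forall>u<2 ^ ell. wmem s4 (ad 2 u) = gv_tab aa (Suc j) u)"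
    have f2: "same gvfr {} s s2" by (rule same_trans[OF f]) (rule same_mono[OF s2(2)], auto)
    have "\<exists>s4. run (IfW 57 3 (INC 54 ;; pGVin) Skip) s2 s4 (1 + (2 ^ ell * 50 + 10) + 2) \<and> ?R s4"
    proof (cases "gv_mark (2 * aa) j j = 0")
      case new: True
      let ?P = "\<lambda>s3. same {54} {} s2 s3 \<and> wmem s3 54 = length (gv (2 * aa) j) + 1"
      have "?P (xx (INC 54) s2)"
      proof (rule xxI)
        fix s3 :: ram_state assume "(wmem s3, rmem s3, outp s3) = xv (INC 54) (wmem s2, rmem s2, outp s2)"
        then show "?P s3" by (simp add: xvs r2 b same_def)
      qed
      then obtain s3 where s3: "run (INC 54) s2 s3 1" "same {54} {} s2 s3" "wmem s3 54 = length (gv (2 * aa) j) + 1"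
        using runs_xe[of "INC 54" ww \<sigma> y s2] by auto
      have f3: "same gvfr {} s s3" by (rule same_trans[OF f2]) (rule same_mono[OF s3(2)], auto)
      have ps3: "pars s3" by (rule pars_same[OF f3 p]) (auto simp: ad_def)
      have r3: "wmem s3 53 = j" and mem3: "\<forall>u<2 ^ ell. wmem s3 (ad 0 u) = wt u" "\<forall>u<2 ^ ell. wmem s3 (ad 1 u) = gv_mark (2 * aa) j u"
        "\<forall>u<2 ^ ell. wmem s3 (ad 2 u) = gv_tab aa j u"
        using s3(2) r2 mem2 by (simp_all add: same_def)
      obtain s4 where s4: "run pGVin s3 s4 (2 ^ ell * 50 + 10)" "same ({55, 56, 57, 62, 63} \<union> range (ad 1) \<union> range (ad 2)) {} s3 s4"
        "\<forall>u<2 ^ ell. wmem s4 (ad 1 u) = (if wt (xor u j) \<le> 2 * aa then 1 else wmem s3 (ad 1 u)) \<and>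
           wmem s4 (ad 2 u) = (if wt (xor u j) \<le> aa then wmem s3 54 else wmem s3 (ad 2 u))"
        using run_pGVin[OF ps3 mem3(1)] r3 j by auto
      have f4: "same gvfr {} s s4" by (rule same_trans[OF f3]) (rule same_mono[OF s4(2)], auto)
      have "?R s4" using f4 s4(2,3) mem3 r3 s3(3) new length_gv_Suc[of "2 * aa" j]
        by (simp add: same_def del: gv.simps)
      moreover have "run (IfW 57 3 (INC 54 ;; pGVin) Skip) s2 s4 (1 + (2 ^ ell * 50 + 10) + 2)"
        by (rule runs_IfW) (use new s2(3) r2 runs_Seq[OF s3(1) s4(1)] in auto)
      ultimately show ?thesis by blast
    next
      case old: False
      have "?R s2" using f2 mem2 r2 old length_gv_Suc[of "2 * aa" j]
        by (simp del: gv.simps)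
      moreover have "run (IfW 57 3 (INC 54 ;; pGVin) Skip) s2 s2 (0 + 2)"
        by (rule runs_IfW) (use old s2(3) r2 in \<open>auto simp: runs_def intro: bs_Skip\<close>)
      then have "run (IfW 57 3 (INC 54 ;; pGVin) Skip) s2 s2 (1 + (2 ^ ell * 50 + 10) + 2)" by (rule runs_mono) simp
      ultimately show ?thesis by blast
    qed
    then obtain s4 where s4: "run (IfW 57 3 (INC 54 ;; pGVin) Skip) s2 s4 (1 + (2 ^ ell * 50 + 10) + 2)" "?R s4" by blast
    have r4: "wmem s4 3 = 1"
    proof -
      have "same gvfr {} s s4" using s4(2) by blast
      then have "pars s4" by (rule pars_same[OF _ p]) (auto simp: ad_def)
      then show ?thesis by (simp add: pars_def)
    qed
    have "I (Suc j) (xx (INC 53) s4)"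
    proof (rule xxI)
      fix s5 :: ram_state assume "(wmem s5, rmem s5, outp s5) = xv (INC 53) (wmem s4, rmem s4, outp s4)"
      then show "I (Suc j) s5" using s4(2) r4 b(3) by (simp add: xvs I_def same_def del: gv.simps gv_mark.simps gv_tab.simps)
    qed
    moreover have "run ?body s1 (xx (INC 53) s4) (5 + ((1 + (2 ^ ell * 50 + 10) + 2) + clen (INC 53)))"
      by (intro runs_Seq[OF s2(1) runs_Seq[OF s4(1) runs_xe]]) simp
    then have "run ?body s1 (xx (INC 53) s4) (2 ^ ell * 50 + 36)" by (rule runs_mono) simp
    moreover have "wmem s1 53 < wmem s1 13" using r pr j by simp
    ultimately show "wmem s1 53 < wmem s1 13 \<and> (\<exists>s'. run ?body s1 s' (2 ^ ell * 50 + 36) \<and> I (Suc j) s')" by blast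
  qed
  then obtain s' where s': "run (While 53 13 ?body) (xx ?init s) s' (2 ^ ell * (2 ^ ell * 50 + 36 + 2) + 2)" "I (2 ^ ell) s'" by blast
  have "run pGV s s' (clen ?init + (2 ^ ell * (2 ^ ell * 50 + 36 + 2) + 2))" unfolding pGV_def
    by (rule runs_Seq[OF runs_xe s'(1)]) simp
  then have "run pGV s s' (2 ^ ell * (2 ^ ell * 50 + 40) + 10)" by (rule runs_mono) (simp add: add_mult_distrib2)
  then show ?thesis using s'(2) unfolding I_def tabs_def tab_def by blast
qed

section \<open>Threshold and parameters on the machine\<close>

lemma run_pThr:
  assumes p: "pars s" and z: "rmem s 2 = 0"
  shows "\<exists>s'. run pThr s s' (c * 20 + 20) \<and> same {30, 31, 62} {2, 3, 4, 5, 7} s s' \<and>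
    rmem s' 2 = thr y \<and> rmem s' 3 = 2 * thr y \<and> rmem s' 4 = 6 * thr y"
proof -
  define mx where "mx j = Max (insert 0 ((\<lambda>\<rho>. \<bar>row y \<rho> 0\<bar>) ` {..<j}))" for j
  have mx: "mx 0 = 0" "mx (Suc j) = (if mx j < \<bar>row y j 0\<bar> then \<bar>row y j 0\<bar> else mx j)" for j
  proof -
    have *: "insert 0 ((\<lambda>\<rho>. \<bar>row y \<rho> 0\<bar>) ` {..<Suc j}) = insert (\<bar>row y j 0\<bar>) (insert 0 ((\<lambda>\<rho>. \<bar>row y \<rho> 0\<bar>) ` {..<j}))"
      by (auto simp: lessThan_Suc)
    have "mx (Suc j) = max \<bar>row y j 0\<bar> (mx j)" unfolding mx_def * by (rule Max_insert) auto
    then show "mx (Suc j) = (if mx j < \<bar>row y j 0\<bar> then \<bar>row y j 0\<bar> else mx j)" by (auto simp: max_def)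
  qed (simp add: mx_def)
  have thr: "thr y = 2 ^ 207 * mx c"
  proof -
    have "Max ((\<lambda>\<rho>. \<bar>row y \<rho> 0\<bar>) ` {..<c}) \<ge> 0" using c_pos by (subst Max_ge_iff) auto
    then have "mx c = Max ((\<lambda>\<rho>. \<bar>row y \<rho> 0\<bar>) ` {..<c})"
      unfolding mx_def using c_pos by (subst Max_insert) auto
    then show ?thesis by (simp add: thr_def)
  qed
  define Iv where "Iv j v \<longleftrightarrow> (case v of (U, R, Q) \<Rightarrow> (\<forall>r. r \<notin> {30, 31, 62} \<longrightarrow> U r = wmem s r) \<and> (\<forall>r. r \<notin> {2, 5, 7} \<longrightarrow> R r = rmem s r) \<and>
     Q = outp s \<and> U 30 = j \<and> U 31 = 0 \<and> R 2 = mx j \<and> R 7 = 2 ^ 207)" for j v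
  let ?init = "SETW 30 (2 ^ 207) ;; Ins (ROfWord 7 30) ;; SETW 30 0 ;; SETW 31 0"
  let ?body = "ROW 5 30 31 ;; RABS 5 ;; IfR 2 5 (Ins (ROp RAdd 2 1 5)) Skip ;; INC 30"
  let ?fin = "Ins (ROp RMul 2 7 2) ;; Ins (ROp RAdd 3 2 2) ;; Ins (ROp RAdd 4 3 3) ;; Ins (ROp RAdd 4 4 3)"
  have pr: "wmem s 23 = c" "wmem s 7 = B" "wmem s 3 = 1" "rmem s 1 = 0"
    using p by (auto simp: pars_def)
  \<comment> \<open>Since dd is at least 64, words have at least 512 bits.\<close>
  have "(2::nat) ^ 207 < 2 ^ ww" using dd_pos unfolding ww_def by (intro power_strict_increasing) auto
  then have k: "(2::nat) ^ 207 < 2 ^ ww" "0 < (2::nat) ^ ww" by simp_all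
  have k': "real ((2::nat) ^ 207) = 2 ^ 207" by (simp only: of_nat_power of_nat_numeral)
  have "\<exists>s'. run (?init ;; While 30 23 ?body) s s' (c * 20 + 10) \<and> Iv c (wmem s', rmem s', outp s')"
  proof (rule for_straight)
    fix j U R Q
    assume j: "j < c" and "Iv j (U, R, Q)"
    then have I: "\<forall>r. r \<notin> {30, 31, 62} \<longrightarrow> U r = wmem s r" "\<forall>r. r \<notin> {2, 5, 7} \<longrightarrow> R r = rmem s r" "Q = outp s" "U 30 = j" "U 31 = 0"
      "R 2 = mx j" "R 7 = 2 ^ 207" unfolding Iv_def by auto
    have b: "j < ss" "j + 1 < 2 ^ ww" using j c_le dd_pos bnds(1) nn_pows unfolding ss_def by linarith+
    have "Iv (Suc j) (xv ?body (U, R, Q))"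
      apply (simp add: xvs pr I(1-6) b B_pos cong: if_cong split del: if_split)
      using I(7) apply (simp add: Iv_def I(1-6) mx pr split: if_split)
      done
    then show "U 30 < U 23 \<and> Iv (Suc j) (xv ?body (U, R, Q))"
      using j I(1,4) pr by simp
  next
    fix U R Q assume "Iv c (U, R, Q)"
    then show "\<not> U 30 < U 23" using pr unfolding Iv_def by simp
  next
    show "Iv 0 (xv ?init (wmem s, rmem s, outp s))"
      using z k by (simp only: xvs fun_upd_same) (simp add: Iv_def mx k')
  qed (simp_all add: ROW_def RABS_def)
  then obtain s1 where s1: "run (?init ;; While 30 23 ?body) s s1 (c * 20 + 10)" "Iv c (wmem s1, rmem s1, outp s1)" by blast
  let ?P = "\<lambda>s'. same {30, 31, 62} {2, 3, 4, 5, 7} s s' \<and>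
    rmem s' 2 = thr y \<and> rmem s' 3 = 2 * thr y \<and> rmem s' 4 = 6 * thr y"
  have "?P (xx ?fin s1)"
  proof (rule xxI)
    fix s2 :: ram_state assume "(wmem s2, rmem s2, outp s2) = xv ?fin (wmem s1, rmem s1, outp s1)"
    then show "?P s2" using s1(2) by (simp add: xvs Iv_def same_def thr)
  qed
  moreover have "run ((?init ;; While 30 23 ?body) ;; ?fin) s (xx ?fin s1) (c * 20 + 10 + clen ?fin)"
    by (rule runs_Seq[OF s1(1) runs_xe]) simp
  then have "run pThr s (xx ?fin s1) (c * 20 + 20)" unfolding pThr_def by (rule runs_mono) simp
  ultimately show ?thesis by blast
qed

declare One_nat_def [simp del]

lemma run_CLOG:
  assumes r: "wmem s 3 = 1" "wmem s x = X" "X \<le> nn" "x \<noteq> d" "x \<noteq> p" "d \<noteq> p" "d \<noteq> 3" "p \<noteq> 3"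
  shows "\<exists>s'. run (CLOG x d p) s s' (clog X * 4 + 5) \<and> same {d, p} {} s s' \<and> wmem s' d = clog X \<and> wmem s' p = 2 ^ clog X"
proof -
  define Iv where "Iv j v \<longleftrightarrow> (case v of (U, R, Q) \<Rightarrow> (\<forall>r. r \<notin> {d, p} \<longrightarrow> U r = wmem s r) \<and> R = rmem s \<and>
     Q = outp s \<and> U d = j \<and> U p = 2 ^ j)" for j v
  have k: "1 < (2::nat) ^ ww" "0 < (2::nat) ^ ww" using nn_pows nn_ge by linarith+
  have "\<exists>s'. run ((SETW d 0 ;; SETW p 1) ;; While p x (ADD p p p ;; INC d)) s s' (clog X * 4 + 5) \<and> Iv (clog X) (wmem s', rmem s', outp s')"
  proof (rule for_straight)
    fix j U R Q
    assume j: "j < clog X" and "Iv j (U, R, Q)"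
    then have I: "\<forall>r. r \<notin> {d, p} \<longrightarrow> U r = wmem s r" "R = rmem s" "Q = outp s" "U d = j" "U p = 2 ^ j" unfolding Iv_def by auto
    have U: "U x = X" "U 3 = 1" using I(1) assms by auto
    have lt: "2 ^ j < X" using clog_less[OF j] .
    then have b: "2 * 2 ^ j < (2::nat) ^ ww" "j + 1 < 2 ^ ww"
      using r(3) nn_pows nn_ge less_exp[of j] by linarith+
    have "Iv (Suc j) (xv (ADD p p p ;; INC d) (U, R, Q))"
      using assms b by (simp add: xvs U I(4,5) mult_2[symmetric]) (simp add: Iv_def I(1-5))
    then show "U p < U x \<and> Iv (Suc j) (xv (ADD p p p ;; INC d) (U, R, Q))"
      using lt I(5) U by simp
  next
    fix U R Q assume "Iv (clog X) (U, R, Q)"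
    then show "\<not> U p < U x" using assms clog_le[of X] unfolding Iv_def by (simp add: not_less)
  next
    show "Iv 0 (xv (SETW d 0 ;; SETW p 1) (wmem s, rmem s, outp s))"
      using k assms by (simp add: xvs) (simp add: Iv_def)
  qed simp_all
  then obtain s' where s': "run (CLOG x d p) s s' (clog X * 4 + 5)" "Iv (clog X) (wmem s', rmem s', outp s')" unfolding CLOG_def by blast
  then show ?thesis by (intro exI[of _ s']) (simp add: Iv_def same_def)
qed

lemma run_pInit:
  assumes r: "wmem s 0 = n" "wmem s 2 = ss * B" "rmem s 1 = 0"
  shows "\<exists>s'. run (pInit c) s s' (dd * 8 + 100) \<and> same {3..31} {} s s' \<and> pars s'"
proof -
  have k: "1 < (2::nat) ^ ww" "23 < (2::nat) ^ ww" "2 < (2::nat) ^ ww" "128 < (2::nat) ^ ww" "32 < (2::nat) ^ ww" "64 < (2::nat) ^ ww"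
    "16 < (2::nat) ^ ww" "4 < (2::nat) ^ ww" "12 < (2::nat) ^ ww" "6 < (2::nat) ^ ww" "10 < (2::nat) ^ ww"
    using nn_pows nn_ge by linarith+
  let ?P1 = "\<lambda>s1. same {3} {} s s1 \<and> wmem s1 3 = 1"
  have "?P1 (xx (SETW 3 1) s)"
  proof (rule xxI)
    fix s1 :: ram_state assume "(wmem s1, rmem s1, outp s1) = xv (SETW 3 1) (wmem s, rmem s, outp s)"
    then show "?P1 s1" using k by (simp add: xvs same_def)
  qed
  then obtain s1 where s1: "run (SETW 3 1) s s1 1" "same {3} {} s s1" "wmem s1 3 = 1"
    using runs_xe[of "SETW 3 1" ww \<sigma> y s] by auto
  have "wmem s1 0 = n" using s1(2) r by (simp add: same_def)
  from run_CLOG[OF s1(3) this n_le_nn, of 4 5] obtain s2 where s2: "run (CLOG 0 4 5) s1 s2 (dd * 4 + 5)" "same {4, 5} {} s1 s2"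
    "wmem s2 4 = dd" "wmem s2 5 = nn" by (auto simp: dd_def nn_def)
  let ?mid = "SETW 30 23 ;; MUL 6 30 4 ;; DIV 7 2 6 ;; SETW 25 2 ;; DIV 8 7 25"
  have f2: "same {3, 4, 5} {} s s2" by (rule same_trans[OF same_mono[OF s1(2)] same_mono[OF s2(2)]]) auto
  have r2: "wmem s2 3 = 1" "wmem s2 2 = ss * B" using s1(2,3) s2(2) r by (simp_all add: same_def)
  let ?P3 = "\<lambda>s3. same {3, 4, 5, 6, 7, 8, 25, 30} {} s s3 \<and> wmem s3 3 = 1 \<and> wmem s3 4 = dd \<and> wmem s3 5 = nn \<and> wmem s3 6 = ss \<and>
    wmem s3 7 = B \<and> wmem s3 8 = bh \<and> wmem s3 25 = 2"
  have b3: "23 * dd < 2 ^ ww" using bnds(1) nn_pows nn_ge by linarith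
  have ss: "23 * dd = ss" by (simp add: ss_def)
  have ss0: "0 < ss" using dd_pos by (simp add: ss_def)
  have "?P3 (xx ?mid s2)"
  proof (rule xxI)
    fix s3 :: ram_state assume "(wmem s3, rmem s3, outp s3) = xv ?mid (wmem s2, rmem s2, outp s2)"
    then show "?P3 s3" using f2 s2 r2 k b3 ss0 by (simp add: xvs same_def ss[symmetric] bh_def)
  qed
  then obtain s3 where s3: "run ?mid s2 s3 5" "same {3, 4, 5, 6, 7, 8, 25, 30} {} s s3" "wmem s3 3 = 1" "wmem s3 4 = dd" "wmem s3 5 = nn"
    "wmem s3 6 = ss" "wmem s3 7 = B" "wmem s3 8 = bh" "wmem s3 25 = 2"
    using runs_xe[of ?mid ww \<sigma> y s2] by auto
  have ddn: "dd \<le> nn" using bnds(1) by linarith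
  from run_CLOG[OF s3(3,4) ddn, of 9 10] obtain s4 where s4: "run (CLOG 4 9 10) s3 s4 (clog dd * 4 + 5)" "same {9, 10} {} s3 s4"
    "wmem s4 9 = clog dd" by auto
  let ?rest = "SETW 30 128 ;; DIV 11 9 30 ;; SETW 30 32 ;; MUL 12 30 11 ;; Ins (WOp WShl 13 3 12) ;;
     SETW 30 64 ;; MUL 31 30 11 ;; Ins (WOp WShl 31 3 31) ;; MUL 14 7 31 ;;
     SETW 30 16 ;; MUL 31 30 11 ;; Ins (WOp WShl 15 3 31) ;; DIV 16 4 31 ;; INC 16 ;;
     SETW 23 c ;; MUL 19 23 7 ;; MUL 17 19 4 ;; MUL 18 19 16 ;; SETW 30 4 ;; MUL 20 30 4 ;;
     ADD 22 11 3 ;; ADD 21 22 11 ;; SETW 26 12 ;; SETW 30 6 ;; MUL 27 30 4 ;; SETW 30 10 ;; MUL 28 30 4 ;;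
     MUL 29 25 4"
  have r4: "wmem s4 0 = n" "wmem s4 3 = 1" "wmem s4 4 = dd" "wmem s4 5 = nn"
    "wmem s4 6 = ss" "wmem s4 7 = B" "wmem s4 8 = bh" "wmem s4 25 = 2" "rmem s4 1 = 0"
    using s4(2) s3 r by (simp_all add: same_def)
  have f4: "same {3..31} {} s s4" by (rule same_trans[OF same_mono[OF s3(2)] same_mono[OF s4(2)]]) auto
  have sym: "clog dd div 128 = aa" "32 * aa = ell" "2 ^ (64 * aa) = vv" "2 ^ (16 * aa) = gg" "dd div (16 * aa) + 1 = nb"
    "4 * dd = rr" "aa + 1 + aa = 2 * aa + 1"
    by (simp_all add: aa_def ell_def vv_def gg_def nb_def rr_def)
  have ggb: "gg \<le> 2 ^ ell" unfolding gg_def ell_def by (intro power_increasing) auto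
  have b: "ell < 2 ^ ww" "2 ^ ell < (2::nat) ^ ww" "64 * aa < 2 ^ ww" "vv < 2 ^ ww" "B * vv < 2 ^ ww" "16 * aa < 2 ^ ww" "gg < 2 ^ ww"
    "nb < 2 ^ ww" "c < 2 ^ ww" "c * B < 2 ^ ww" "c * B * dd < 2 ^ ww" "c * B * nb < 2 ^ ww" "rr < 2 ^ ww" "aa + 1 < 2 ^ ww" "2 * aa + 1 < 2 ^ ww"
    "6 * dd < 2 ^ ww" "10 * dd < 2 ^ ww" "2 * dd < 2 ^ ww"
    using vv_dd bnds nn_pows nn_ge nb_ell(2) c_le cB_le ggb dd_pos unfolding rr_def by linarith+
  let ?P5 = "\<lambda>s5. same {3..31} {} s s5 \<and> pars s5"
  have "?P5 (xx ?rest s4)"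
  proof (rule xxI)
    fix s5 :: ram_state assume eq: "(wmem s5, rmem s5, outp s5) = xv ?rest (wmem s4, rmem s4, outp s4)"
    have "xv ?rest (wmem s4, rmem s4, outp s4) = ((wmem s4)(11 := aa, 12 := ell, 13 := 2 ^ ell, 14 := B * vv, 31 := 16 * aa, 15 := gg,
       16 := nb, 23 := c, 19 := c * B, 17 := c * B * dd, 18 := c * B * nb, 20 := rr, 22 := aa + 1, 21 := 2 * aa + 1, 26 := 12,
       27 := 6 * dd, 28 := 10 * dd, 29 := 2 * dd, 30 := 10), rmem s4, outp s4)"
      by (simp add: xvs k r4 s4(3) sym b) (simp add: fun_eq_iff)
    then have "wmem s5 = (wmem s4)(11 := aa, 12 := ell, 13 := 2 ^ ell, 14 := B * vv, 31 := 16 * aa, 15 := gg,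
       16 := nb, 23 := c, 19 := c * B, 17 := c * B * dd, 18 := c * B * nb, 20 := rr, 22 := aa + 1, 21 := 2 * aa + 1, 26 := 12,
       27 := 6 * dd, 28 := 10 * dd, 29 := 2 * dd, 30 := 10)" "rmem s5 = rmem s4" "outp s5 = outp s4"
      using eq by simp_all
    then show "?P5 s5" using f4 r4 by (simp add: same_def pars_def)
  qed
  moreover have "run (pInit c) s (xx ?rest s4) (1 + ((dd * 4 + 5) + (5 + ((clog dd * 4 + 5) + clen ?rest))))"
    unfolding pInit_def by (intro runs_Seq[OF s1(1)] runs_Seq[OF s2(1)] runs_Seq[OF s3(1)] runs_Seq[OF s4(1)] runs_xe) simp
  then have "run (pInit c) s (xx ?rest s4) (dd * 8 + 100)"
    by (rule runs_mono) (use clog_le_self[of dd] in simp)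
  ultimately show ?thesis by blast
qed

section \<open>The whole program and its running time\<close>

lemma run_prog:
  assumes s: "wmem s = (\<lambda>_. 0)(0 := n, 1 := k, 2 := ss * B)" "rmem s = (\<lambda>_. 0)(0 := \<epsilon>)" "outp s = []"
  shows "\<exists>s'. run (prog c) s s' (100 * c * (ss * B)) \<and> outp s' = decode \<sigma> y"
proof -
  obtain s1 where s1: "run (pInit c) s s1 (dd * 8 + 100)" "same {3..31} {} s s1" "pars s1"
    using run_pInit[of s] s by auto
  have z1: "\<forall>u. wmem s1 (ad k u) = 0" for k using s1(2) s by (simp add: same_def ad_def)
  have rz1: "rmem s1 2 = 0" using s1(2) s by (simp add: same_def)
  obtain s2 where s2: "run pWt s1 s2 (2 ^ ell * 30 + 10)" "same ({53, 56, 57, 62, 63} \<union> range (ad 0)) {} s1 s2"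
    "\<forall>u<2 ^ ell. wmem s2 (ad 0 u) = wt u" using run_pWt[OF s1(3)] z1 by auto
  have p2: "pars s2" by (rule pars_same[OF s2(2) s1(3)]) (auto simp: ad_def)
  have z2: "\<forall>u. wmem s2 (ad 1 u) = 0" "\<forall>u. wmem s2 (ad 2 u) = 0" "\<forall>u. wmem s2 (ad 6 u) = 0" "rmem s2 2 = 0"
    using s2(2) z1 rz1 by (simp_all add: same_def)
  obtain s3 where s3: "run pGV s2 s3 (2 ^ ell * (2 ^ ell * 50 + 40) + 10)" "same gvfr {} s2 s3" "tabs s3"
    using run_pGV[OF p2 s2(3) z2(1,2)] by blast
  have p3: "pars s3" by (rule pars_same[OF s3(2) p2]) (auto simp: ad_def)
  have z3: "\<forall>u. wmem s3 (ad 6 u) = 0" "rmem s3 2 = 0" using s3(2) z2 by (simp_all add: same_def)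
  obtain s4 where s4: "run pThr s3 s4 (c * 20 + 20)" "same {30, 31, 62} {2, 3, 4, 5, 7} s3 s4"
    "rmem s4 2 = thr y" "rmem s4 3 = 2 * thr y" "rmem s4 4 = 6 * thr y" using run_pThr[OF p3 z3(2)] by blast
  have p4: "pars s4" by (rule pars_same[OF s4(2) p3]) auto
  have t4: "tabs s4" using s3(3) s4(2) by (simp add: tabs_def same_def)
  have z4: "\<forall>u. wmem s4 (ad 6 u) = 0" using s4(2) z3 by (simp add: same_def)
  let ?X = "candX \<sigma> y (thr y)"
  obtain s5 where s5: "run pX s4 s5 (c * B * nb * (ell * 60 + 63) + 7)" "same xfr {5, 6} s4 s5"
    "wmem s5 24 = length ?X" "\<forall>i<length ?X. wmem s5 (ad 3 i) = ?X ! i" "length ?X \<le> c * B * nb"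
    using run_pX[OF p4 t4 s4(3)] by blast
  have p5: "pars s5" by (rule pars_same[OF s5(2) p4]) (auto simp: ad_def)
  have z5: "\<forall>u. wmem s5 (ad 6 u) = 0" "rmem s5 2 = thr y" "rmem s5 3 = 2 * thr y" "rmem s5 4 = 6 * thr y"
    using s5(2) z4 s4 by (simp_all add: same_def)
  have L5: "length ?X \<le> nn ^ 3" using s5(5) cB_le(2) nn_pows by linarith
  let ?G = "candG \<sigma> y (thr y) ?X"
  obtain s6 where s6: "run pG s5 s6 (c * B * dd * 603 + 40)" "same gfr {5} s5 s6"
    "wmem s6 24 = length ?G" "\<forall>i<length ?G. wmem s6 (ad 3 i) = ?G ! i" "length ?G \<le> length ?X + c * B * dd"
    using run_pG[OF p5 z5(2) L5 s5(3,4)] by blast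
  have p6: "pars s6" by (rule pars_same[OF s6(2) p5]) (auto simp: ad_def)
  have z6: "\<forall>u. wmem s6 (ad 6 u) = 0" "rmem s6 3 = 2 * thr y" "rmem s6 4 = 6 * thr y" "outp s6 = []"
    using s6(2) z5 s5(2) s4(2) s3(2) s2(2) s1(2) s by (simp_all add: same_def)
  have L6: "length ?G \<le> nn ^ 4" using s6(5) L5 cB_le(1) nn_pows by linarith
  have less: "\<forall>x\<in>set ?G. x < n" using candG_less candX_less by blast
  obtain s7 where s7: "run pE s6 s7 (c * B * (rr * 70 + 153) + 10)" "outp s7 = outp s6 @ outE \<sigma> y (thr y) ?G"
    using run_pE[OF p6 z6(2,3) L6 s6(3,4) less z6(1)] by blast
  let ?T = "(dd * 8 + 100) + ((2 ^ ell * 30 + 10) + ((2 ^ ell * (2 ^ ell * 50 + 40) + 10) + ((c * 20 + 20) +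
     ((c * B * nb * (ell * 60 + 63) + 7) + ((c * B * dd * 603 + 40) + (c * B * (rr * 70 + 153) + 10))))))"
  have "run (pInit c ;; pWt ;; pGV ;; pThr ;; pX ;; pG ;; pE) s s7 ?T"
    by (intro runs_Seq[OF s1(1)] runs_Seq[OF s2(1)] runs_Seq[OF s3(1)] runs_Seq[OF s4(1)] runs_Seq[OF s5(1)] runs_Seq[OF s6(1) s7(1)])
  then have "run (prog c) s s7 (?T + 2)" unfolding prog_def
    by (intro runs_IfW) (use s rows_less in auto)
  moreover have "?T + 2 \<le> 100 * c * (ss * B)"
  proof -
    \<comment> \<open>The common unit of all phases. The code table costs O(\<open>vv\<close>)
      because its two nested loops run over 2^ell words each, and \<open>vv\<close> is at most dd.
      In total 2000 units suffice, whereas 100 * c * (ss * B) amounts to 2300.\<close>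
    define X where "X = c * B * dd"
    have X1: "dd \<le> X" "c \<le> X" "c * B \<le> X" unfolding X_def using c_pos B_pos dd_pos by auto
    have e1: "2 ^ ell * (2 ^ ell * 50 + 40) = 50 * vv + 40 * 2 ^ ell" by (simp add: vv_sq(2) algebra_simps)
    have "c * B * nb * (ell * 60 + 63) = c * B * (60 * (nb * ell) + 63 * nb)" by (simp add: algebra_simps)
    also have "\<dots> \<le> c * B * (400 * dd)" using nb_ell(1,2) dd_pos by (intro mult_le_mono2) linarith
    finally have e2: "c * B * nb * (ell * 60 + 63) \<le> 400 * X" by (simp add: X_def)
    have "c * B * (rr * 70 + 153) \<le> c * B * (400 * dd)" unfolding rr_def using dd_pos by (intro mult_le_mono2) linarith
    then have e3: "c * B * (rr * 70 + 153) \<le> 400 * X" by (simp add: X_def)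
    have "?T + 2 \<le> 2000 * X" using e1 e2 e3 X1 vv_dd dd_pos unfolding X_def[symmetric] by linarith
    also have "\<dots> \<le> 100 * c * (ss * B)" unfolding X_def ss_def by simp
    finally show ?thesis .
  qed
  ultimately have "run (prog c) s s7 (100 * c * (ss * B))" by (rule runs_mono)
  then show ?thesis using s7(2) z6(4) unfolding decode_def by auto
qed

end

lemma run_pIdent:
  fixes y :: "real Matrix.vec"
  assumes "dim_vec y = n" "n < 2 ^ w" "1 < w" and s: "wmem s 0 = n" "rmem s 1 = 0" "outp s = []"
  shows "\<exists>s'. runs w \<sigma> y pIdent s s' (n * 10 + 4) \<and>
    outp s' = map (\<lambda>i. (i, vec_index y i)) (filter (\<lambda>i. vec_index y i \<noteq> 0) [0..<n])"
proof -
  define I where "I j s' \<longleftrightarrow> wmem s' 0 = n \<and> wmem s' 3 = 1 \<and> rmem s' 1 = 0 \<and> wmem s' 30 = j \<and>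
    outp s' = map (\<lambda>i. (i, vec_index y i)) (filter (\<lambda>i. vec_index y i \<noteq> 0) [0..<j])" for j and s' :: ram_state
  let ?init = "SETW 3 1 ;; SETW 30 0"
  let ?body = "Ins (ReadSketch 5 30) ;; IfR 5 1 (Ins (Emit 30 5)) (IfR 1 5 (Ins (Emit 30 5)) Skip) ;; INC 30"
  have w: "1 < (2::nat) ^ w" using assms(3) by (intro one_less_power) simp_all
  have "\<exists>s'. runs w \<sigma> y (While 30 0 ?body) (xe w \<sigma> y ?init s) s' (n * (clen ?body + 2) + 2) \<and> I n s'"
  proof (rule runs_While)
    fix j s1 assume j: "j < n" and I: "I j s1"
    have "runs w \<sigma> y ?body s1 (xe w \<sigma> y ?body s1) (clen ?body)" by (rule runs_xe) simp
    moreover have "I (Suc j) (xe w \<sigma> y ?body s1)"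
    proof -
      have "(j + 1) mod 2 ^ w = Suc j" using j assms(2) by simp
      then show ?thesis using I j assms(1) unfolding I_def by auto
    qed
    moreover have "wmem s1 30 < wmem s1 0" using I j unfolding I_def by simp
    ultimately show "wmem s1 30 < wmem s1 0 \<and> (\<exists>s'. runs w \<sigma> y ?body s1 s' (clen ?body) \<and> I (Suc j) s')"
      by blast
  next
    show "I 0 (xe w \<sigma> y ?init s)" using s w assms(3) unfolding I_def by simp
  qed (auto simp: I_def)
  then obtain s' where s': "runs w \<sigma> y (While 30 0 ?body) (xe w \<sigma> y ?init s) s' (n * (clen ?body + 2) + 2)" "I n s'" by blast
  have "runs w \<sigma> y pIdent s s' (clen ?init + (n * (clen ?body + 2) + 2))" unfolding pIdent_def
    by (rule runs_Seq[OF runs_xe s'(1)]) simp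
  then have "runs w \<sigma> y pIdent s s' (n * 10 + 4)" by (rule runs_mono) simp
  then show ?thesis using s'(2) unfolding I_def by blast
qed

section \<open>Averages over random tapes\<close>

text \<open>All probability is done by finite averages over tapes; the passage to
  \<open>pmf_of_set\<close> happens once, at the end.\<close>

definition avg :: "nat \<Rightarrow> ((nat \<Rightarrow> nat) \<Rightarrow> real) \<Rightarrow> real" where
  "avg w f = (\<Sum>\<sigma>\<in>tapes w. f \<sigma>) / real (card (tapes w))"

definition prb :: "nat \<Rightarrow> ((nat \<Rightarrow> nat) \<Rightarrow> bool) \<Rightarrow> real" where
  "prb w P = avg w (\<lambda>\<sigma>. of_bool (P \<sigma>))"

lemma finite_tapes [simp]: "finite (tapes w)"
  unfolding tapes_def by (intro finite_PiE) auto

lemma tapes_nonempty [simp]: "tapes w \<noteq> {}"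
  unfolding tapes_def by (simp add: PiE_eq_empty_iff lessThan_empty_iff)

lemma card_tapes_pos [simp]: "0 < card (tapes w)"
  by (simp add: card_gt_0_iff)

lemma tapes_less: "\<sigma> \<in> tapes w \<Longrightarrow> a < 2 ^ w \<Longrightarrow> \<sigma> a < 2 ^ w"
  unfolding tapes_def by (auto simp: PiE_iff)

lemma avg_add: "avg w (\<lambda>\<sigma>. f \<sigma> + g \<sigma>) = avg w f + avg w g"
  by (simp add: avg_def sum.distrib add_divide_distrib)

lemma avg_cmult: "avg w (\<lambda>\<sigma>. a * f \<sigma>) = a * avg w f"
  by (simp add: avg_def sum_distrib_left[symmetric])

lemma avg_const [simp]: "avg w (\<lambda>_. a) = a"
  using card_tapes_pos[of w] by (simp add: avg_def)

lemma avg_sum: "avg w (\<lambda>\<sigma>. \<Sum>i\<in>I. f i \<sigma>) = (\<Sum>i\<in>I. avg w (f i))"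
  unfolding avg_def sum_divide_distrib[symmetric] by (subst sum.swap) simp

lemma avg_mono: "(\<And>\<sigma>. \<sigma> \<in> tapes w \<Longrightarrow> f \<sigma> \<le> g \<sigma>) \<Longrightarrow> avg w f \<le> avg w g"
  unfolding avg_def by (intro divide_right_mono sum_mono) auto

lemma avg_cong: "(\<And>\<sigma>. \<sigma> \<in> tapes w \<Longrightarrow> f \<sigma> = g \<sigma>) \<Longrightarrow> avg w f = avg w g"
  unfolding avg_def by (intro arg_cong2[where f = "(/)"] sum.cong) auto

lemma avg_nonneg: "(\<And>\<sigma>. \<sigma> \<in> tapes w \<Longrightarrow> 0 \<le> f \<sigma>) \<Longrightarrow> 0 \<le> avg w f"
  unfolding avg_def by (intro divide_nonneg_nonneg sum_nonneg) auto

lemma avg_bound: "(\<And>\<sigma>. \<sigma> \<in> tapes w \<Longrightarrow> f \<sigma> \<le> b) \<Longrightarrow> avg w f \<le> b"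
  using avg_mono[of w f "\<lambda>_. b"] by simp

lemma prb_mono: "(\<And>\<sigma>. \<sigma> \<in> tapes w \<Longrightarrow> P \<sigma> \<Longrightarrow> Q \<sigma>) \<Longrightarrow> prb w P \<le> prb w Q"
  unfolding prb_def by (intro avg_mono) auto

lemma prb_cong: "(\<And>\<sigma>. \<sigma> \<in> tapes w \<Longrightarrow> P \<sigma> = Q \<sigma>) \<Longrightarrow> prb w P = prb w Q"
  unfolding prb_def by (intro avg_cong) auto

lemma prb_nonneg: "0 \<le> prb w P"
  unfolding prb_def by (intro avg_nonneg) auto

lemma prb_le_1: "prb w P \<le> 1"
  unfolding prb_def by (intro avg_bound) auto

lemma prb_False [simp]: "prb w (\<lambda>_. False) = 0"
  by (simp add: prb_def)

lemma prb_disj: "prb w (\<lambda>\<sigma>. P \<sigma> \<or> Q \<sigma>) \<le> prb w P + prb w Q"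
  unfolding prb_def avg_add[symmetric] by (intro avg_mono) auto

lemma prb_bex: "finite I \<Longrightarrow> prb w (\<lambda>\<sigma>. \<exists>i\<in>I. P i \<sigma>) \<le> (\<Sum>i\<in>I. prb w (P i))"
proof (induction I rule: finite_induct)
  case (insert i I)
  have "prb w (\<lambda>\<sigma>. \<exists>i\<in>insert i I. P i \<sigma>) \<le> prb w (P i) + prb w (\<lambda>\<sigma>. \<exists>i\<in>I. P i \<sigma>)"
    using prb_disj[of w "P i" "\<lambda>\<sigma>. \<exists>i\<in>I. P i \<sigma>"] by simp
  then show ?case using insert by simp
qed simp

lemma prb_bex_le: "finite I \<Longrightarrow> (\<And>i. i \<in> I \<Longrightarrow> prb w (P i) \<le> p) \<Longrightarrow> prb w (\<lambda>\<sigma>. \<exists>i\<in>I. P i \<sigma>) \<le> real (card I) * p"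
  using order.trans[OF prb_bex sum_bounded_above] by blast

lemma markov:
  assumes "\<And>\<sigma>. \<sigma> \<in> tapes w \<Longrightarrow> 0 \<le> f \<sigma>" "avg w f \<le> q * t" "0 < t"
  shows "prb w (\<lambda>\<sigma>. t < f \<sigma>) \<le> q"
proof -
  have "t * prb w (\<lambda>\<sigma>. t < f \<sigma>) \<le> avg w f"
    unfolding prb_def avg_cmult[symmetric] using assms by (intro avg_mono) auto
  then have "t * prb w (\<lambda>\<sigma>. t < f \<sigma>) \<le> t * q" using assms(2) by (simp add: mult.commute)
  then show ?thesis using assms(3) by simp
qed

text \<open>Also valid for \<open>t = 0\<close>, which covers sketches of exactly sparse vectors.\<close>

lemma markov0:
  assumes nn: "\<And>\<sigma>. \<sigma> \<in> tapes w \<Longrightarrow> 0 \<le> f \<sigma>" and "avg w f \<le> q * t" "0 \<le> t" "0 \<le> q"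
  shows "prb w (\<lambda>\<sigma>. t < f \<sigma>) \<le> q"
proof (cases "t = 0")
  case True
  have "(\<Sum>\<sigma>\<in>tapes w. f \<sigma>) \<le> 0" using assms(2) True pos_divide_le_eq[of "real (card (tapes w))" "\<Sum>\<sigma>\<in>tapes w. f \<sigma>" 0] by (simp add: avg_def)
  then have "(\<Sum>\<sigma>\<in>tapes w. f \<sigma>) = 0" using sum_nonneg[of "tapes w" f] nn by force
  then have "\<forall>\<sigma>\<in>tapes w. f \<sigma> = 0" using nn by (subst (asm) sum_nonneg_eq_0_iff) auto
  then have "prb w (\<lambda>\<sigma>. t < f \<sigma>) = prb w (\<lambda>_. False)" using True by (intro prb_cong) auto
  then show ?thesis using assms(4) by simp
qed (use assms markov in auto)

lemma chebyshev:
  assumes "avg w (\<lambda>\<sigma>. (f \<sigma>)\<^sup>2) \<le> q * t\<^sup>2" "0 \<le> t" "0 \<le> q"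
  shows "prb w (\<lambda>\<sigma>. t < \<bar>f \<sigma>\<bar>) \<le> q"
proof -
  have "prb w (\<lambda>\<sigma>. t < \<bar>f \<sigma>\<bar>) \<le> prb w (\<lambda>\<sigma>. t\<^sup>2 < (f \<sigma>)\<^sup>2)"
    using assms(2) by (intro prb_mono) (metis abs_le_square_iff abs_of_nonneg not_less)
  also have "\<dots> \<le> q" using assms by (intro markov0) auto
  finally show ?thesis .
qed

lemma sum_fst: "(\<Sum>p\<in>A \<times> B. g (fst p)) = real (card B) * (\<Sum>a\<in>A. g a :: real)"
proof -
  have "(\<Sum>p\<in>A \<times> B. g (fst p)) = (\<Sum>(a, b)\<in>A \<times> B. g a)" by (simp add: case_prod_beta)
  also have "\<dots> = (\<Sum>a\<in>A. \<Sum>b\<in>B. g a)" by (rule sum.cartesian_product[symmetric])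
  finally show ?thesis by (simp add: sum_distrib_left)
qed

section \<open>Resampling and independence\<close>

lemma override_tapes: "\<sigma> \<in> tapes w \<Longrightarrow> \<tau> \<in> tapes w \<Longrightarrow> override_on \<sigma> \<tau> S \<in> tapes w"
  unfolding tapes_def by (auto simp: PiE_iff override_on_def extensional_def)

text \<open>Exchanging the cells in S between two tapes is an involution on pairs of tapes, so
  replacing them by fresh ones does not change the average. This takes the place of conditioning on
  the cells outside S and of Fubini's theorem.\<close>

lemma avg_resample: "avg w f = avg w (\<lambda>\<sigma>. avg w (\<lambda>\<tau>. f (override_on \<sigma> \<tau> S)))"
proof -
  let ?T = "tapes w" and ?h = "\<lambda>(\<sigma>, \<tau>). (override_on \<sigma> \<tau> S, override_on \<tau> \<sigma> S)"
  have inv: "?h (?h p) = p" for p :: "(nat \<Rightarrow> nat) \<times> (nat \<Rightarrow> nat)"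
    by (cases p) (auto simp: override_on_def fun_eq_iff)
  have bij: "bij_betw ?h (?T \<times> ?T) (?T \<times> ?T)"
    by (rule bij_betw_byWitness[where f' = ?h]) (use inv override_tapes in auto)
  have "(\<Sum>\<sigma>\<in>?T. \<Sum>\<tau>\<in>?T. f (override_on \<sigma> \<tau> S)) = (\<Sum>p\<in>?T \<times> ?T. f (fst (?h p)))"
    by (simp add: sum.cartesian_product case_prod_beta)
  also have "\<dots> = (\<Sum>p\<in>?T \<times> ?T. f (fst p))"
    using sum.reindex_bij_betw[OF bij, of "\<lambda>p. f (fst p)"] by simp
  also have "\<dots> = real (card ?T) * (\<Sum>\<sigma>\<in>?T. f \<sigma>)"
    by (rule sum_fst)
  finally show ?thesis unfolding avg_def by (simp add: sum_divide_distrib[symmetric])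
qed

lemma avg_resample_le:
  assumes "\<And>\<sigma>. \<sigma> \<in> tapes w \<Longrightarrow> avg w (\<lambda>\<tau>. f (override_on \<sigma> \<tau> S)) \<le> g \<sigma>"
  shows "avg w f \<le> avg w g"
  unfolding avg_resample[of w f S] using assms by (rule avg_mono)

lemma prb_resample_le:
  assumes "\<And>\<sigma>. \<sigma> \<in> tapes w \<Longrightarrow> prb w (\<lambda>\<tau>. P (override_on \<sigma> \<tau> S)) \<le> p"
  shows "prb w P \<le> p"
  using avg_resample_le[of w "\<lambda>\<sigma>. of_bool (P \<sigma>)" S "\<lambda>_. p"] assms unfolding prb_def by simp

lemma avg_single: assumes "a < 2 ^ w" shows "avg w (\<lambda>\<tau>. h (\<tau> a)) = (\<Sum>v<2 ^ w. h v) / 2 ^ w"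
proof -
  let ?A = "{..<(2::nat) ^ w}" let ?E = "PiE (?A - {a}) (\<lambda>_. ?A)"
  have ins: "insert a (?A - {a}) = ?A" using assms by auto
  have T: "tapes w = (\<lambda>(y, g). g(a := y)) ` (?A \<times> ?E)"
    using PiE_insert_eq[of a "?A - {a}" "\<lambda>_. ?A"] unfolding tapes_def ins by simp
  have inj: "inj_on (\<lambda>(y, g). g(a := y)) (?A \<times> ?E)"
    using inj_combinator[of a "?A - {a}" "\<lambda>_. ?A"] by simp
  have s: "(\<Sum>\<tau>\<in>tapes w. k (\<tau> a)) = real (card ?E) * (\<Sum>v<2 ^ w. k v)" for k :: "nat \<Rightarrow> real"
    unfolding T by (subst sum.reindex[OF inj]) (simp add: case_prod_beta sum_fst)
  have "real (card (tapes w)) = real (card ?E) * 2 ^ w" using s[of "\<lambda>_. 1"] by simp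
  moreover from this have "card ?E \<noteq> 0" using card_tapes_pos[of w] by (metis mult_eq_0_iff of_nat_0_eq_iff less_irrefl)
  ultimately show ?thesis unfolding avg_def s by simp
qed

lemma avg_at: assumes "a < 2 ^ w"
  shows "avg w f = avg w (\<lambda>\<sigma>. (\<Sum>v<2 ^ w. f (\<sigma>(a := v))) / 2 ^ w)"
proof -
  have "override_on \<sigma> \<tau> {a} = \<sigma>(a := \<tau> a)" for \<sigma> \<tau> :: "nat \<Rightarrow> nat"
    by (auto simp: override_on_def)
  then show ?thesis
    unfolding avg_resample[of w f "{a}"] using avg_single[OF assms, of "\<lambda>v. f (\<sigma>(a := v))" for \<sigma>] by simp
qed

text \<open>Independence is expressed operationally: resampling the block of j leaves every other
  event alone, and makes event j have probability at most p whatever the rest of the tape is.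
  Peeling off one block at a time multiplies the bounds.\<close>

lemma prb_all_indep:
  assumes "finite J" "0 \<le> p"
    and "\<And>j \<sigma>. j \<in> J \<Longrightarrow> \<sigma> \<in> tapes w \<Longrightarrow> prb w (\<lambda>\<tau>. A j (override_on \<sigma> \<tau> (S j))) \<le> p"
    and "\<And>i j \<sigma> \<tau>. i \<in> J \<Longrightarrow> j \<in> J \<Longrightarrow> i \<noteq> j \<Longrightarrow> A i (override_on \<sigma> \<tau> (S j)) = A i \<sigma>"
  shows "prb w (\<lambda>\<sigma>. \<forall>j\<in>J. A j \<sigma>) \<le> p ^ card J"
  using assms(1,3,4)
proof (induction J rule: finite_induct)
  case empty
  show ?case using prb_le_1 by simp
next
  case (insert j J)
  let ?B = "\<lambda>\<sigma>. \<forall>i\<in>J. A i \<sigma>"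
  have "prb w (\<lambda>\<sigma>. \<forall>i\<in>insert j J. A i \<sigma>) \<le> avg w (\<lambda>\<sigma>. p * of_bool (?B \<sigma>))"
    unfolding prb_def
  proof (rule avg_resample_le[where S = "S j"])
    fix \<sigma> assume \<sigma>: "\<sigma> \<in> tapes w"
    have B: "?B (override_on \<sigma> \<tau> (S j)) = ?B \<sigma>" for \<tau>
    proof (rule ball_cong[OF refl])
      fix i assume "i \<in> J"
      then show "A i (override_on \<sigma> \<tau> (S j)) = A i \<sigma>" using insert.hyps(2) by (intro insert.prems(2)) auto
    qed
    have "avg w (\<lambda>\<tau>. of_bool (\<forall>i\<in>insert j J. A i (override_on \<sigma> \<tau> (S j))))
      = of_bool (?B \<sigma>) * prb w (\<lambda>\<tau>. A j (override_on \<sigma> \<tau> (S j)))"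
      unfolding prb_def avg_cmult[symmetric] using B by (intro avg_cong) (simp add: of_bool_conj[symmetric] conj_commute)
    also have "\<dots> \<le> of_bool (?B \<sigma>) * p" using insert.prems(1)[OF _ \<sigma>, of j] by (intro mult_left_mono) auto
    finally show "avg w (\<lambda>\<tau>. of_bool (\<forall>i\<in>insert j J. A i (override_on \<sigma> \<tau> (S j)))) \<le> p * of_bool (?B \<sigma>)"
      by (simp add: mult.commute)
  qed
  also have "\<dots> = p * prb w ?B" by (simp add: avg_cmult prb_def)
  also have "\<dots> \<le> p * p ^ card J" using insert assms(2) by (intro mult_left_mono) auto
  finally show ?case using insert by simp
qed

text \<open>Union bound over the sets of r indices; their number is bounded crudely by that of all
  subsets, which the tiny p will absorb.\<close>

lemma prb_many:
  assumes "finite J" "0 \<le> p"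
    and "\<And>j \<sigma>. j \<in> J \<Longrightarrow> \<sigma> \<in> tapes w \<Longrightarrow> prb w (\<lambda>\<tau>. A j (override_on \<sigma> \<tau> (S j))) \<le> p"
    and "\<And>i j \<sigma> \<tau>. i \<in> J \<Longrightarrow> j \<in> J \<Longrightarrow> i \<noteq> j \<Longrightarrow> A i (override_on \<sigma> \<tau> (S j)) = A i \<sigma>"
  shows "prb w (\<lambda>\<sigma>. r \<le> card {j\<in>J. A j \<sigma>}) \<le> 2 ^ card J * p ^ r"
proof -
  let ?K = "{K. K \<subseteq> J \<and> card K = r}"
  have fin: "finite ?K" using assms(1) by (intro finite_subset[of ?K "Pow J"]) auto
  have "prb w (\<lambda>\<sigma>. r \<le> card {j\<in>J. A j \<sigma>}) \<le> prb w (\<lambda>\<sigma>. \<exists>K\<in>?K. \<forall>j\<in>K. A j \<sigma>)"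
  proof (rule prb_mono)
    fix \<sigma> assume "r \<le> card {j\<in>J. A j \<sigma>}"
    then obtain K where "K \<subseteq> {j\<in>J. A j \<sigma>}" "card K = r" by (metis obtain_subset_with_card_n)
    then show "\<exists>K\<in>?K. \<forall>j\<in>K. A j \<sigma>" by auto
  qed
  also have "\<dots> \<le> real (card ?K) * p ^ r"
  proof (rule prb_bex_le[OF fin])
    fix K assume K: "K \<in> ?K"
    then have "finite K" using assms(1) finite_subset by blast
    then have "prb w (\<lambda>\<sigma>. \<forall>j\<in>K. A j \<sigma>) \<le> p ^ card K"
    proof (rule prb_all_indep[OF _ assms(2), where S = S])
      show "prb w (\<lambda>\<tau>. A j (override_on \<sigma> \<tau> (S j))) \<le> p" if "j \<in> K" "\<sigma> \<in> tapes w" for j \<sigma>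
        using that K assms(3) by blast
      show "A i (override_on \<sigma> \<tau> (S j)) = A i \<sigma>" if "i \<in> K" "j \<in> K" "i \<noteq> j" for i j \<sigma> \<tau>
        by (rule assms(4)) (use that K in auto)
    qed
    then show "prb w (\<lambda>\<sigma>. \<forall>j\<in>K. A j \<sigma>) \<le> p ^ r" using K by simp
  qed
  also have "\<dots> \<le> 2 ^ card J * p ^ r"
  proof (rule mult_right_mono)
    have "card ?K \<le> card (Pow J)" using assms(1) by (intro card_mono) auto
    then show "real (card ?K) \<le> 2 ^ card J" using assms(1) by (simp add: card_Pow)
  qed (use assms(2) in simp)
  finally show ?thesis .
qed

text \<open>Cross terms vanish when averaged over the coefficient cell of one of the two indices.
  The factors \<open>k\<close> may depend on the tape in any way outside the coefficient cells, and
  so may contain all collision indicators.\<close>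

lemma second_moment:
  fixes s :: "nat \<Rightarrow> real"
  assumes "finite I" "inj_on a I" "\<And>i. i \<in> I \<Longrightarrow> a i < 2 ^ w"
    and c: "\<And>i j \<sigma> v. i \<in> I \<Longrightarrow> j \<in> I \<Longrightarrow> k i (\<sigma>(a j := v)) = k i \<sigma>"
    and s: "(\<Sum>v<2 ^ w. s v) = 0" "\<And>v. v < 2 ^ w \<Longrightarrow> (s v)\<^sup>2 \<le> 1"
  shows "avg w (\<lambda>\<sigma>. (\<Sum>i\<in>I. s (\<sigma> (a i)) * k i \<sigma>)\<^sup>2) \<le> (\<Sum>i\<in>I. avg w (\<lambda>\<sigma>. (k i \<sigma>)\<^sup>2))"
proof -
  let ?f = "\<lambda>i \<sigma>. s (\<sigma> (a i)) * k i \<sigma>"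
  have off: "avg w (\<lambda>\<sigma>. ?f i \<sigma> * ?f j \<sigma>) = 0" if "i \<in> I" "j \<in> I" "i \<noteq> j" for i j
  proof -
    have ne: "a i \<noteq> a j" using that assms(2) by (auto dest: inj_onD)
    have "(\<Sum>v<2 ^ w. ?f i (\<sigma>(a i := v)) * ?f j (\<sigma>(a i := v))) = 0" for \<sigma>
    proof -
      have "(\<Sum>v<2 ^ w. ?f i (\<sigma>(a i := v)) * ?f j (\<sigma>(a i := v))) = (\<Sum>v<2 ^ w. s v * (k i \<sigma> * ?f j \<sigma>))"
        using that ne c by (intro sum.cong) auto
      also have "\<dots> = 0" using s(1) by (simp add: sum_distrib_right[symmetric])
      finally show ?thesis .
    qed
    then show ?thesis using avg_at[OF assms(3)[OF that(1)], of "\<lambda>\<sigma>. ?f i \<sigma> * ?f j \<sigma>"] by simp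
  qed
  have "avg w (\<lambda>\<sigma>. (\<Sum>i\<in>I. ?f i \<sigma>)\<^sup>2) = (\<Sum>i\<in>I. \<Sum>j\<in>I. avg w (\<lambda>\<sigma>. ?f i \<sigma> * ?f j \<sigma>))"
    by (simp add: power2_eq_square sum_product avg_sum)
  also have "\<dots> = (\<Sum>i\<in>I. avg w (\<lambda>\<sigma>. ?f i \<sigma> * ?f i \<sigma>))"
  proof (rule sum.cong[OF refl])
    fix i assume i: "i \<in> I"
    have "(\<Sum>j\<in>I. avg w (\<lambda>\<sigma>. ?f i \<sigma> * ?f j \<sigma>)) = (\<Sum>j\<in>I. if j = i then avg w (\<lambda>\<sigma>. ?f i \<sigma> * ?f i \<sigma>) else 0)"
      using off i by (intro sum.cong) auto
    then show "(\<Sum>j\<in>I. avg w (\<lambda>\<sigma>. ?f i \<sigma> * ?f j \<sigma>)) = avg w (\<lambda>\<sigma>. ?f i \<sigma> * ?f i \<sigma>)"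
      using assms(1) i by simp
  qed
  also have "\<dots> \<le> (\<Sum>i\<in>I. avg w (\<lambda>\<sigma>. (k i \<sigma>)\<^sup>2))"
  proof (intro sum_mono avg_mono)
    fix i \<sigma> assume "i \<in> I" "\<sigma> \<in> tapes w"
    then have "(s (\<sigma> (a i)))\<^sup>2 \<le> 1" using s(2) tapes_less assms(3) by blast
    then have "(s (\<sigma> (a i)))\<^sup>2 * (k i \<sigma>)\<^sup>2 \<le> 1 * (k i \<sigma>)\<^sup>2" by (intro mult_right_mono) auto
    then show "?f i \<sigma> * ?f i \<sigma> \<le> (k i \<sigma>)\<^sup>2" by (simp add: power2_eq_square algebra_simps)
  qed
  finally show ?thesis .
qed

text \<open>As the modulus divides the number of words, reduction is exactly uniform. This is why
  bucket and label numbers are powers of two.\<close>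

lemma card_mod_eq:
  assumes "d dvd (2::nat) ^ w" "r < d"
  shows "card {v. v < 2 ^ w \<and> v mod d = r} * d = 2 ^ w"
proof -
  obtain q where q: "2 ^ w = d * q" using assms(1) by (auto elim: dvdE)
  have "{v. v < 2 ^ w \<and> v mod d = r} = (\<lambda>t. t * d + r) ` {..<q}"
  proof (intro equalityI subsetI)
    fix v assume v: "v \<in> {v. v < 2 ^ w \<and> v mod d = r}"
    have "v div d < q" using v q assms(2) by (simp add: less_mult_imp_div_less mult.commute)
    moreover have "v = v div d * d + r" using v by (metis (mono_tags, lifting) div_mult_mod_eq mem_Collect_eq)
    ultimately show "v \<in> (\<lambda>t. t * d + r) ` {..<q}" by blast
  next
    fix v assume "v \<in> (\<lambda>t. t * d + r) ` {..<q}"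
    then obtain t where t: "t < q" "v = t * d + r" by auto
    have "t * d + r < Suc t * d" using assms(2) by simp
    also have "\<dots> \<le> q * d" using t(1) by (intro mult_le_mono1) simp
    finally show "v \<in> {v. v < 2 ^ w \<and> v mod d = r}" using t assms(2) q by (simp add: mult.commute)
  qed
  moreover have "inj_on (\<lambda>t. t * d + r) {..<q}" using assms(2) by (auto simp: inj_on_def)
  ultimately have "card {v. v < 2 ^ w \<and> v mod d = r} = q" by (simp add: card_image)
  then show ?thesis using q by (simp add: mult.commute)
qed

lemma sum_mod_eq:
  assumes "d dvd (2::nat) ^ w" "r < d"
  shows "(\<Sum>v<2 ^ w. of_bool (v mod d = r)) / 2 ^ w = 1 / real d"
proof -
  have "(\<Sum>v<2 ^ w. of_bool (v mod d = r)) = (\<Sum>v\<in>{v. v < 2 ^ w \<and> v mod d = r}. 1::real)"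
    by (intro sum.mono_neutral_cong_right) auto
  also have "\<dots> = real (card {v. v < 2 ^ w \<and> v mod d = r})" by simp
  finally have "(\<Sum>v<2 ^ w. of_bool (v mod d = r)) * real d = 2 ^ w"
    using card_mod_eq[OF assms] by (metis of_nat_mult of_nat_numeral of_nat_power)
  then show ?thesis using assms(2) by (simp add: field_simps)
qed

lemma prb_collide:
  assumes "a < 2 ^ w" "a \<noteq> b" "d dvd (2::nat) ^ w" "0 < d"
  shows "prb w (\<lambda>\<sigma>. \<sigma> a mod d = \<sigma> b mod d) = 1 / real d"
proof -
  have "prb w (\<lambda>\<sigma>. \<sigma> a mod d = \<sigma> b mod d) = avg w (\<lambda>\<sigma>. (\<Sum>v<2 ^ w. of_bool (v mod d = \<sigma> b mod d)) / 2 ^ w)"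
    unfolding prb_def by (subst avg_at[OF assms(1)]) (use assms(2) in simp)
  also have "\<dots> = 1 / real d" using sum_mod_eq[OF assms(3)] assms(4) by simp
  finally show ?thesis .
qed

text \<open>The midpoints of 2^w equal cells of [-1, 1]: a symmetric discrete substitute for a
  uniform real coefficient.\<close>

definition gam :: "nat \<Rightarrow> nat \<Rightarrow> real" where
  "gam w v = (2 * real v + 1 - 2 ^ w) / 2 ^ w"

lemma gam_sum: "(\<Sum>v<2 ^ w. gam w v) = 0"
proof -
  have "(\<Sum>v<m. 2 * real v + 1) = real m * real m" for m :: nat
    by (induction m) (auto simp: algebra_simps)
  from this[of "2 ^ w"] show ?thesis
    unfolding gam_def sum_divide_distrib[symmetric] by (simp add: sum_subtractf)
qed

lemma gam_sq: "v < 2 ^ w \<Longrightarrow> (gam w v)\<^sup>2 \<le> 1"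
proof -
  assume "v < 2 ^ w"
  then have "real v + 1 \<le> 2 ^ w" by (metis Suc_eq_plus1 Suc_leI of_nat_1 of_nat_add of_nat_le_iff of_nat_numeral of_nat_power)
  then have "\<bar>2 * real v + 1 - 2 ^ w\<bar> \<le> 2 ^ w" by linarith
  then have "\<bar>gam w v\<bar> \<le> 1" unfolding gam_def abs_divide by simp
  then show ?thesis by (simp add: abs_square_le_1)
qed

text \<open>The values v * x are spaced 2 |x| / 2^w apart, so an interval of length 2\<theta>
  contains at most \<theta> 2^w / |x| + 1 of them, wherever r shifts it. The remainder 1 / 2^w is
  the price of discreteness.\<close>

lemma gam_concentration:
  assumes "x \<noteq> 0" "0 \<le> \<theta>"
  shows "(\<Sum>v<2 ^ w. of_bool (\<bar>gam w v * x + r\<bar> \<le> \<theta>)) / 2 ^ w \<le> \<theta> / \<bar>x\<bar> + 1 / 2 ^ w"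
proof -
  let ?V = "{v. v < 2 ^ w \<and> \<bar>gam w v * x + r\<bar> \<le> \<theta>}" and ?L = "\<theta> * 2 ^ w / \<bar>x\<bar>"
  have fin: "finite ?V" by simp
  have card: "real (card ?V) \<le> ?L + 1"
  proof (cases "?V = {}")
    case False
    let ?lo = "Min ?V" and ?hi = "Max ?V"
    have mem: "?lo \<in> ?V" "?hi \<in> ?V" using Min_in[OF fin False] Max_in[OF fin False] by auto
    have "?lo \<le> ?hi" using mem fin by (simp add: Min_le)
    have "\<bar>(gam w ?hi - gam w ?lo) * x\<bar> \<le> 2 * \<theta>" using mem by (simp add: left_diff_distrib abs_le_iff)
    moreover have "gam w ?hi - gam w ?lo = 2 * (real ?hi - real ?lo) / 2 ^ w" unfolding gam_def by (simp add: diff_divide_distrib[symmetric])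
    ultimately have "2 * (real ?hi - real ?lo) / 2 ^ w * \<bar>x\<bar> \<le> 2 * \<theta>"
      using \<open>?lo \<le> ?hi\<close> by (simp add: abs_mult)
    then have "real ?hi - real ?lo \<le> ?L" using assms(1) by (simp add: field_simps)
    moreover have "?V \<subseteq> {?lo..?hi}" using fin by auto
    then have "card ?V \<le> ?hi + 1 - ?lo" using card_mono[of "{?lo..?hi}" ?V] by simp
    then have "real (card ?V) \<le> real ?hi + 1 - real ?lo" using \<open>?lo \<le> ?hi\<close> by linarith
    ultimately show ?thesis by linarith
  next
    case True
    have "card ?V = 0" by (subst True) simp
    then show ?thesis unfolding \<open>card ?V = 0\<close> using assms by simp
  qed
  have "(\<Sum>v<2 ^ w. of_bool (\<bar>gam w v * x + r\<bar> \<le> \<theta>)) = (\<Sum>v\<in>?V. 1::real)"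
    by (intro sum.mono_neutral_cong_right) auto
  then have "(\<Sum>v<2 ^ w. of_bool (\<bar>gam w v * x + r\<bar> \<le> \<theta>)) / 2 ^ w \<le> (?L + 1) / 2 ^ w"
    using card by (intro divide_right_mono) auto
  also have "\<dots> = \<theta> / \<bar>x\<bar> + 1 / 2 ^ w" by (simp add: add_divide_distrib)
  finally show ?thesis .
qed

section \<open>The Gilbert--Varshamov code\<close>

lemma wt_0 [simp]: "wt 0 = 0" by (simp add: wt.simps)

lemma wt_xor_le: "wt (xor a b) \<le> wt a + wt b"
proof (induction a arbitrary: b rule: less_induct)
  case (less a)
  show ?case
  proof (cases "a = 0")
    case False
    have d: "xor a b div 2 = xor (a div 2) (b div 2)" by (rule bit_eqI) (simp add: bit_simps flip: bit_Suc)
    have m: "xor a b mod 2 \<le> a mod 2 + b mod 2" by (simp add: mod_2_eq_odd even_xor_iff)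
    have "wt (xor (a div 2) (b div 2)) \<le> wt (a div 2) + wt (b div 2)" using False by (intro less) simp
    then show ?thesis using wt_rec[of "xor a b", unfolded d] wt_rec[of a] wt_rec[of b] m by linarith
  qed simp
qed

lemma wt_triangle: "wt (xor u w) \<le> wt (xor u v) + wt (xor v w)"
proof -
  have "xor (xor u v) (xor v w) = xor u w" by (rule bit_eqI) (auto simp: bit_simps)
  then show ?thesis using wt_xor_le[of "xor u v" "xor v w"] by simp
qed

lemma wt_card: "e < 2 ^ l \<Longrightarrow> wt e = card {j. j < l \<and> bit e j}"
proof (induction l arbitrary: e)
  case (Suc l)
  have "{j. j < Suc l \<and> bit e j} = (if odd e then {0} else {}) \<union> Suc ` {j. j < l \<and> bit (e div 2) j}"
    by (auto simp: bit_Suc bit_0 image_iff less_Suc_eq_0_disj split: if_splits)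
  then have "card {j. j < Suc l \<and> bit e j} = e mod 2 + card {j. j < l \<and> bit (e div 2) j}"
    by (simp add: card_Un_disjoint card_image mod_2_eq_odd card_insert_if image_iff)
  then show ?case using Suc wt_rec[of e] by simp
qed simp

lemma sum_double: "(\<Sum>e<2 * m. f e) = (\<Sum>e<m. f (2 * e) + f (2 * e + 1))" for f :: "nat \<Rightarrow> real"
  by (induction m) (auto simp: algebra_simps)

text \<open>The weight enumerator of all words of length l, by splitting off the last bit.\<close>

lemma sum_wt: "(\<Sum>e<2 ^ l. y ^ wt e) = (1 + y) ^ l" for y :: real
proof (induction l)
  case (Suc l)
  have "(\<Sum>e<2 ^ Suc l. y ^ wt e) = (\<Sum>e<2 ^ l. y ^ wt (2 * e) + y ^ wt (2 * e + 1))"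
    using sum_double[of "\<lambda>e. y ^ wt e" "2 ^ l"] by simp
  also have "\<dots> = (\<Sum>e<2 ^ l. (1 + y) * y ^ wt e)"
  proof (rule sum.cong[OF refl])
    fix e :: nat
    have "wt (2 * e) = wt e" "wt (2 * e + 1) = Suc (wt e)" using wt_rec[of "2 * e"] wt_rec[of "2 * e + 1"] by simp_all
    then show "y ^ wt (2 * e) + y ^ wt (2 * e + 1) = (1 + y) * y ^ wt e" by (simp only: power_Suc) (simp add: distrib_right)
  qed
  also have "\<dots> = (1 + y) * (\<Sum>e<2 ^ l. y ^ wt e)" by (simp only: sum_distrib_left)
  finally show ?case using Suc by simp
qed simp

text \<open>The exponential moment bound for a Hamming ball: words of weight at most d have y^wt at
  least y^d.\<close>

lemma card_wt_le:
  assumes "0 < y" "y \<le> (1::real)"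
  shows "real (card {e. e < 2 ^ l \<and> wt e \<le> d}) * y ^ d \<le> (1 + y) ^ l"
proof -
  let ?E = "{e. e < (2::nat) ^ l \<and> wt e \<le> d}"
  have "real (card ?E) * y ^ d \<le> (\<Sum>e\<in>?E. y ^ wt e)"
    using assms by (intro sum_bounded_below) (auto intro: power_decreasing)
  also have "\<dots> \<le> (\<Sum>e<2 ^ l. y ^ wt e)" using assms by (intro sum_mono2) auto
  finally show ?thesis by (simp add: sum_wt)
qed

lemma gv_less: "u \<in> set (gv r N) \<Longrightarrow> u < N"
  by (induction N) (auto split: if_splits simp: less_Suc_eq)

lemma gv_maximal: "u < N \<Longrightarrow> \<exists>v\<in>set (gv r N). wt (xor v u) \<le> r"
proof (induction N)
  case (Suc N)
  then show ?case by (cases "u = N") (auto simp: less_Suc_eq)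
qed simp

text \<open>Uniqueness of decoding. Should a later codeword also lie within r of u, the triangle
  inequality puts it within 2r of the earlier one, and the greedy choice would have rejected
  it.\<close>

lemma gv_tab:
  assumes "k < length (gv (2 * r) N)" "wt (xor u (gv (2 * r) N ! k)) \<le> r"
  shows "gv_tab r N u = k + 1"
  using assms
proof (induction N)
  case (Suc N)
  let ?g = "gv (2 * r) N"
  show ?case
  proof (cases "k < length ?g")
    case True
    then have u: "wt (xor u (?g ! k)) \<le> r" using Suc.prems by (simp add: nth_append split: if_splits)
    have "\<not> (gv_mark (2 * r) N N = 0 \<and> wt (xor u N) \<le> r)"
    proof
      assume a: "gv_mark (2 * r) N N = 0 \<and> wt (xor u N) \<le> r"
      have "wt (xor (?g ! k) N) \<le> wt (xor (?g ! k) u) + wt (xor u N)" by (rule wt_triangle)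
      then have "wt (xor (?g ! k) N) \<le> 2 * r" using a u by (simp add: xor.commute[of _ u])
      then show False using a True by (auto simp: gv_mark split: if_splits)
    qed
    then have "gv_tab r (Suc N) u = gv_tab r N u" unfolding gv_tab.simps by (rule if_not_P)
    then show ?thesis using Suc.IH[OF True u] by (rule trans)
  next
    case False
    then show ?thesis using Suc.prems by (auto simp: gv_mark nth_append split: if_splits)
  qed
qed simp

text \<open>By maximality the balls of radius d around codewords cover all words, so the number of
  codewords is at least 2^l divided by the size of a ball.\<close>

lemma gv_length:
  assumes "0 < y" "y \<le> (1::real)"
  shows "2 ^ l * y ^ d \<le> real (length (gv d (2 ^ l))) * (1 + y) ^ l"
proof -
  let ?C = "set (gv d (2 ^ l))" and ?E = "{e. e < (2::nat) ^ l \<and> wt e \<le> d}"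
  have lt: "xor v u < 2 ^ l" if "v < 2 ^ l" "u < (2::nat) ^ l" for u v
    using that by (simp flip: take_bit_nat_eq_self_iff add: take_bit_xor)
  have "{..<2 ^ l} \<subseteq> (\<Union>v\<in>?C. (\<lambda>e. xor v e) ` ?E)"
  proof
    fix u assume u: "u \<in> {..<(2::nat) ^ l}"
    then obtain v where v: "v \<in> ?C" "wt (xor v u) \<le> d" using gv_maximal by blast
    have "u = xor v (xor v u)" by (rule bit_eqI) (auto simp: bit_simps)
    moreover have "xor v u \<in> ?E" using v lt gv_less u by auto
    ultimately show "u \<in> (\<Union>v\<in>?C. (\<lambda>e. xor v e) ` ?E)" using v(1) by blast
  qed
  then have "card {..<(2::nat) ^ l} \<le> card (\<Union>v\<in>?C. (\<lambda>e. xor v e) ` ?E)" by (intro card_mono) auto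
  also have "\<dots> \<le> (\<Sum>v\<in>?C. card ((\<lambda>e. xor v e) ` ?E))" by (intro card_UN_le) simp
  also have "\<dots> \<le> (\<Sum>v\<in>?C. card ?E)" by (intro sum_mono card_image_le) simp
  also have "\<dots> \<le> length (gv d (2 ^ l)) * card ?E" by (simp add: card_length)
  finally have "(2::real) ^ l \<le> real (length (gv d (2 ^ l)) * card ?E)"
    by (metis card_lessThan of_nat_le_iff of_nat_numeral of_nat_power)
  then have "2 ^ l * y ^ d \<le> real (length (gv d (2 ^ l)) * card ?E) * y ^ d"
    using assms by (intro mult_right_mono) auto
  also have "\<dots> = real (length (gv d (2 ^ l))) * (real (card ?E) * y ^ d)" by simp
  also have "\<dots> \<le> real (length (gv d (2 ^ l))) * (1 + y) ^ l"
    using card_wt_le[OF assms] by (intro mult_left_mono) auto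
  finally show ?thesis .
qed

lemma sum_bits:
  fixes P :: "nat \<Rightarrow> bool"
  defines "s l \<equiv> (\<Sum>j<l. if P j then 2 ^ j else 0 :: nat)"
  shows "s l < 2 ^ l" "bit (s l) j \<longleftrightarrow> j < l \<and> P j"
proof -
  have "s l = horner_sum of_bool 2 (map P [0..<l])"
    unfolding s_def horner_sum_eq_sum by (intro sum.cong) auto
  then show "bit (s l) j \<longleftrightarrow> j < l \<and> P j" by (auto simp: bit_horner_sum_bit_iff)
  show "s l < 2 ^ l" unfolding s_def by (induction l) auto
qed

context sketch_par
begin

text \<open>The parameter 1/16 is the relative radius 2 aa / (32 aa). Since (17/16)^32 \<le> 8, the
  covering bound leaves (2^32 / (2^8 * 2^3))^aa = 2^(21 aa) codewords, more than the 2^(16 aa)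
  digits.\<close>

lemma length_code: "gg \<le> length code"
proof -
  let ?L = "real (length code)"
  have 0: "(2::real) ^ ell * (1 / 16) ^ (2 * aa) \<le> ?L * (1 + 1 / 16) ^ ell"
    unfolding code_def by (rule gv_length) auto
  have 1: "((17 / 16) ^ 32 :: real) \<le> 8" by (simp add: power_divide)
  have "(1 + 1 / 16 :: real) ^ ell = ((17 / 16) ^ 32) ^ aa" unfolding ell_def power_mult by simp
  also have "\<dots> \<le> 8 ^ aa" using 1 by (intro power_mono) auto
  finally have "?L * (1 + 1 / 16) ^ ell \<le> ?L * 8 ^ aa" by (intro mult_left_mono) auto
  then have "(2::real) ^ ell * (1 / 16) ^ (2 * aa) \<le> ?L * 8 ^ aa" using 0 by linarith
  moreover have "(2::real) ^ ell * (1 / 16) ^ (2 * aa) = (2 ^ 32 * (1 / 16) ^ 2) ^ aa"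
    unfolding ell_def power_mult power_mult_distrib ..
  moreover have "(2 ^ 32 * (1 / 16) ^ 2 :: real) ^ aa = (2 ^ 21) ^ aa * 8 ^ aa"
    unfolding power_mult_distrib[symmetric] by (simp add: power_divide)
  ultimately have "(2 ^ 21 :: real) ^ aa \<le> ?L" by simp
  moreover have "(2 ^ 16 :: real) ^ aa \<le> (2 ^ 21) ^ aa" by (intro power_mono) auto
  ultimately have "(2 ^ 16 :: real) ^ aa \<le> ?L" by linarith
  then have "real ((2 ^ 16) ^ aa) \<le> ?L" by simp
  then show ?thesis unfolding gg_def power_mult of_nat_le_iff .
qed

lemma code_nth: "v < gg \<Longrightarrow> code ! v < 2 ^ ell"
  using length_code gv_less[of "code ! v" "2 * aa" "2 ^ ell"] unfolding code_def by simp

lemma tab_word: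
  assumes v: "v < gg" and "card {j. j < ell \<and> P j \<noteq> bit (code ! v) j} \<le> aa"
  shows "tab (\<Sum>j<ell. if P j then 2 ^ j else 0) = v + 1"
proof -
  let ?s = "\<Sum>j<ell. if P j then 2 ^ j else 0 :: nat"
  have "xor ?s (code ! v) < 2 ^ ell"
    using sum_bits(1)[of P ell] code_nth[OF v] by (simp flip: take_bit_nat_eq_self_iff add: take_bit_xor)
  then have "wt (xor ?s (code ! v)) = card {j. j < ell \<and> bit (xor ?s (code ! v)) j}" by (rule wt_card)
  also have "{j. j < ell \<and> bit (xor ?s (code ! v)) j} = {j. j < ell \<and> P j \<noteq> bit (code ! v) j}"
    by (auto simp: bit_xor_iff sum_bits(2))
  finally show ?thesis unfolding tab_def
    using assms length_code by (intro gv_tab) (auto simp: code_def)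
qed

end

section \<open>Candidates and budgets\<close>

context sketch_par
begin

context
  fixes \<sigma> :: "nat \<Rightarrow> nat" and y :: "real Matrix.vec" and \<theta> :: real
begin

section \<open>The scan of the labels and its budget\<close>

primrec xval :: "nat \<Rightarrow> nat \<Rightarrow> nat" where
  "xval z 0 = 0"
| "xval z (Suc t) = xval z t * gg + xdig \<sigma> y z t"

text \<open>Only these labels cost more than one step, so their number controls both the length of
  the scan and the number of candidates.\<close>

definition "nok m = card {z. z < m \<and> xok \<sigma> y \<theta> z 0}"

lemma nok_Suc: "nok (Suc m) = nok m + of_bool (xok \<sigma> y \<theta> m 0)"
proof -
  have "{z. z < Suc m \<and> xok \<sigma> y \<theta> z 0} = (if xok \<sigma> y \<theta> m 0 then {m} else {}) \<union> {z. z < m \<and> xok \<sigma> y \<theta> z 0}"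
    by (auto simp: less_Suc_eq)
  then show ?thesis unfolding nok_def by (simp add: card_insert_if)
qed

lemma nok_mono: "m \<le> m' \<Longrightarrow> nok m \<le> nok m'"
  unfolding nok_def by (intro card_mono) auto

lemma nb_pos: "0 < nb" by (simp add: nb_def)

text \<open>The potential \<open>z + nb * nok z + t\<close> accounts for the steps: each label pays
  1, and \<open>nb\<close> more if its first digit is readable. After the last label the bound is
  suspended, as further steps idle.\<close>

definition invX :: "nat \<Rightarrow> nat \<times> nat \<times> nat \<times> nat list \<Rightarrow> bool" where
  "invX N s \<longleftrightarrow> (case s of (z, t, acc, cs) \<Rightarrow> z \<le> B * vv \<and> t < nb \<and> (z = B * vv \<longrightarrow> t = 0) \<and>
     (z = B * vv \<or> N \<le> z + nb * nok z + t) \<and> acc = xval z t \<and> (\<forall>t'<t. xok \<sigma> y \<theta> z t') \<and>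
     (\<forall>z'<z. (\<forall>t<nb. xok \<sigma> y \<theta> z' t) \<longrightarrow> xval z' nb < n \<longrightarrow> xval z' nb \<in> set cs) \<and> length cs \<le> nok z)"

lemma invX_step:
  assumes "invX N s"
  shows "invX (Suc N) (stepX \<sigma> y \<theta> s)"
proof -
  obtain z t acc cs where s: "s = (z, t, acc, cs)" by (cases s) auto
  note I = assms[unfolded invX_def s, simplified]
  have zlt: "z = B * vv \<or> z < B * vv" using I by auto
  show ?thesis
  proof (cases "z < B * vv")
    case False
    then have "stepX \<sigma> y \<theta> s = s" by (simp add: s)
    then show ?thesis using False zlt assms unfolding invX_def s by auto
  next
    case z: True
    have IN: "N \<le> z + nb * nok z + t" using I z by auto
    have ok0: "0 < t \<Longrightarrow> xok \<sigma> y \<theta> z 0" using I by auto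
    show ?thesis
    proof (cases "xok \<sigma> y \<theta> z t")
      case False
      have st: "stepX \<sigma> y \<theta> s = (z + 1, 0, 0, cs)" using z False by (simp add: s)
      have 1: "z + nb * nok z + t \<le> z + nb * nok (Suc z)"
        using I ok0 by (cases "t = 0") (auto simp: nok_Suc)
      have 2: "\<not> (\<forall>t<nb. xok \<sigma> y \<theta> z t)" using False I by auto
      show ?thesis unfolding st invX_def using I z IN 1 2 nb_pos nok_mono[of z "Suc z"]
        by (auto simp: less_Suc_eq)
    next
      case ok: True
      show ?thesis
      proof (cases "t + 1 < nb")
        case True
        have st: "stepX \<sigma> y \<theta> s = (z, t + 1, acc * gg + xdig \<sigma> y z t, cs)" using z ok True by (simp add: s Let_def)
        show ?thesis unfolding st invX_def using I z IN ok True by (auto simp: less_Suc_eq)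
      next
        case False
        then have t: "nb = Suc t" using I by auto
        have st: "stepX \<sigma> y \<theta> s = (z + 1, 0, 0, if xval z nb < n then cs @ [xval z nb] else cs)"
        proof -
          have xv: "xval z nb = acc * gg + xdig \<sigma> y z t" using I unfolding t by simp
          show ?thesis unfolding s stepX.simps xv Let_def using z ok False by simp
        qed
        have o: "xok \<sigma> y \<theta> z 0" using ok ok0 by (cases "t = 0") auto
        have 1: "Suc (z + nb * nok z + t) \<le> Suc z + nb * nok (Suc z)" using o t by (simp add: nok_Suc)
        show ?thesis unfolding st invX_def using I z IN 1 nb_pos o by (auto simp: less_Suc_eq nok_Suc)
      qed
    qed
  qed
qed

lemma invX_run: "invX N ((stepX \<sigma> y \<theta> ^^ N) (0, 0, 0, []))"
proof (induction N)
  case 0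
  show ?case unfolding invX_def using nb_pos by (auto simp: nok_def)
next
  case (Suc N)
  then show ?case using invX_step by simp
qed

lemma length_candX: "length (candX \<sigma> y \<theta>) \<le> nok (B * vv)"
proof -
  obtain z t acc cs where s: "(stepX \<sigma> y \<theta> ^^ (c * B * nb)) (0, 0, 0, []) = (z, t, acc, cs)"
    by (cases "(stepX \<sigma> y \<theta> ^^ (c * B * nb)) (0, 0, 0, [])") auto
  note I = invX_run[of "c * B * nb", unfolded s invX_def, simplified]
  then have "length cs \<le> nok z" "nok z \<le> nok (B * vv)" using nok_mono by auto
  then show ?thesis unfolding candX_def s by simp
qed

text \<open>The budget exceeds the potential of a complete scan, so the last label has been passed
  and every readable index is present.\<close>

lemma candX_model:
  assumes "B * vv + nb * nok (B * vv) \<le> c * B * nb"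
  shows "z < B * vv \<Longrightarrow> (\<And>t. t < nb \<Longrightarrow> xok \<sigma> y \<theta> z t) \<Longrightarrow> xval z nb < n \<Longrightarrow> xval z nb \<in> set (candX \<sigma> y \<theta>)"
proof -
  obtain z t acc cs where s: "(stepX \<sigma> y \<theta> ^^ (c * B * nb)) (0, 0, 0, []) = (z, t, acc, cs)"
    by (cases "(stepX \<sigma> y \<theta> ^^ (c * B * nb)) (0, 0, 0, [])") auto
  note I = invX_run[of "c * B * nb", unfolded s invX_def, simplified]
  have cs: "candX \<sigma> y \<theta> = cs" unfolding candX_def s by simp
  have zz: "z = B * vv"
  proof (rule ccontr)
    assume "z \<noteq> B * vv"
    then have z: "z < B * vv" "c * B * nb \<le> z + nb * nok z + t" using I by auto
    have "nb * nok z + t \<le> nb * nok (Suc z)" using I by (cases "t = 0") (auto simp: nok_Suc)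
    also have "\<dots> \<le> nb * nok (B * vv)" using z(1) by (intro mult_le_mono2 nok_mono) auto
    finally show False using z assms by linarith
  qed
  show "xval z nb \<in> set (candX \<sigma> y \<theta>)" if "z < B * vv" "\<And>t. t < nb \<Longrightarrow> xok \<sigma> y \<theta> z t" "xval z nb < n" for z
    using I that zz cs by simp
qed

section \<open>The queue of tree nodes and its budget\<close>

primrec Act :: "nat \<Rightarrow> nat set" where
  "Act 0 = {1}"
| "Act (Suc t) = (\<Union>v\<in>{v\<in>Act t. gpass \<sigma> y \<theta> t v}. {2 * v, 2 * v + 1})"

lemma Act_bounds: "v \<in> Act t \<Longrightarrow> 2 ^ t \<le> v \<and> v < 2 * 2 ^ t"
proof (induction t arbitrary: v)
  case (Suc t)
  then obtain u where "u \<in> Act t" "v = 2 * u \<or> v = 2 * u + 1" by auto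
  then show ?case using Suc.IH[of u] by auto
qed simp

lemma finite_Act: "finite (Act t)"
  by (induction t) auto

lemma card_Act_Suc: "card (Act (Suc t)) \<le> 2 * card {v\<in>Act t. gpass \<sigma> y \<theta> t v}"
proof -
  have "card (Act (Suc t)) \<le> (\<Sum>v\<in>{v\<in>Act t. gpass \<sigma> y \<theta> t v}. card {2 * v, 2 * v + 1})"
    unfolding Act.simps using finite_Act by (intro card_UN_le) simp
  then show ?thesis by simp
qed

lemma Act_less_nn: "v \<in> Act t \<Longrightarrow> t \<le> dd \<Longrightarrow> v < nn \<longleftrightarrow> t < dd"
proof -
  assume v: "v \<in> Act t" and t: "t \<le> dd"
  show ?thesis
  proof (cases "t < dd")
    case True
    then have "(2::nat) ^ Suc t \<le> 2 ^ dd" by (intro power_increasing) auto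
    then show ?thesis using Act_bounds[OF v] True unfolding nn_def by simp
  next
    case False
    then have "t = dd" using t by simp
    then show ?thesis using Act_bounds[OF v] unfolding nn_def by simp
  qed
qed

text \<open>That the parent of every queued node already lies before the head keeps the queue free
  of repetitions: the children of the node at the head cannot be present yet. Distinctness in turn
  bounds the queue by the total size of the sets \<open>Act t\<close>.\<close>

definition invG :: "nat list \<Rightarrow> nat \<Rightarrow> nat \<times> (nat \<times> nat) list \<times> nat list \<Rightarrow> bool" where
  "invG cs0 N s \<longleftrightarrow> (case s of (h, q, cs) \<Rightarrow> h \<le> length q \<and> (N \<le> h \<or> h = length q) \<and> distinct q \<and>
     (\<forall>(t, v)\<in>set q. t \<le> dd \<and> v \<in> Act t) \<and> (0, 1) \<in> set q \<and>
     (\<forall>(t, v)\<in>set (take h q). gpass \<sigma> y \<theta> t v \<longrightarrow>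
        (v < nn \<longrightarrow> (t + 1, 2 * v) \<in> set q \<and> (t + 1, 2 * v + 1) \<in> set q) \<and> (nn \<le> v \<longrightarrow> v - nn < n \<longrightarrow> v - nn \<in> set cs)) \<and>
     (\<forall>(t, v)\<in>set q. 0 < t \<longrightarrow> (t - 1, v div 2) \<in> set (take h q)) \<and>
     set cs0 \<subseteq> set cs \<and> length cs \<le> length cs0 + card {p\<in>set (take h q). fst p = dd})"

lemma invG_step:
  assumes "invG cs0 N s"
  shows "invG cs0 (Suc N) (stepG \<sigma> y \<theta> s)"
proof -
  obtain h q cs where s: "s = (h, q, cs)" by (cases s) auto
  note I = assms[unfolded invG_def s prod.case]
  show ?thesis
  proof (cases "h < length q")
    case False
    then have "stepG \<sigma> y \<theta> s = s" by (simp add: s)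
    then show ?thesis using False assms unfolding invG_def s by auto
  next
    case h: True
    obtain t v where tv: "q ! h = (t, v)" by (cases "q ! h") auto
    have tk: "take (Suc h) q = take h q @ [(t, v)]" using h tv by (simp add: take_Suc_conv_app_nth)
    have tk': "take (Suc h) (q @ r) = take h q @ [(t, v)]" for r using h tk by simp
    have inq: "(t, v) \<in> set q" using h tv by (metis nth_mem)
    then have A: "t \<le> dd" "v \<in> Act t" using I by auto
    have nt: "(t, v) \<notin> set (take h q)"
    proof
      assume "(t, v) \<in> set (take h q)"
      then obtain j where "j < h" "q ! j = (t, v)" using h by (auto simp: in_set_conv_nth)
      then show False using I tv h nth_eq_iff_index_eq[of q j h] by auto
    qed
    have sub: "set (take h q) \<subseteq> set q" by (rule set_take_subset)
    have cle: "card {p\<in>set (take h q). fst p = dd} \<le> card {p\<in>set (take (Suc h) q). fst p = dd}"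
      unfolding tk by (intro card_mono) auto
    show ?thesis
    proof (cases "gpass \<sigma> y \<theta> t v")
      case False
      have st: "stepG \<sigma> y \<theta> s = (Suc h, q, cs)" using h tv False by (simp add: s)
      show ?thesis unfolding st invG_def prod.case using I h cle False unfolding tk by auto
    next
      case gp: True
      show ?thesis
      proof (cases "v < nn")
        case True
        let ?r = "[(t + 1, 2 * v), (t + 1, 2 * v + 1)]"
        have st: "stepG \<sigma> y \<theta> s = (Suc h, q @ ?r, cs)" using h tv gp True by (simp add: s)
        have td: "t < dd" using True Act_less_nn A by simp
        have nq: "(t + 1, u) \<notin> set q" if "u div 2 = v" for u
        proof
          assume "(t + 1, u) \<in> set q"
          then have "(t, u div 2) \<in> set (take h q)" using I by fastforce
          then show False using nt that by simp
        qed
        have A': "2 * v \<in> Act (t + 1)" "2 * v + 1 \<in> Act (t + 1)" using A gp by auto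
        have "distinct (q @ ?r)" using I nq[of "2 * v"] nq[of "2 * v + 1"] by simp
        moreover have "\<forall>(t', u)\<in>set (q @ ?r). t' \<le> dd \<and> u \<in> Act t'" using I A' td by auto
        moreover have "\<forall>(t', u)\<in>set (take h q @ [(t, v)]). gpass \<sigma> y \<theta> t' u \<longrightarrow>
            (u < nn \<longrightarrow> (t' + 1, 2 * u) \<in> set (q @ ?r) \<and> (t' + 1, 2 * u + 1) \<in> set (q @ ?r)) \<and> (nn \<le> u \<longrightarrow> u - nn < n \<longrightarrow> u - nn \<in> set cs)"
          using I True by auto
        moreover have "\<forall>(t', u)\<in>set (q @ ?r). 0 < t' \<longrightarrow> (t' - 1, u div 2) \<in> set (take h q @ [(t, v)])"
          using I by auto
        ultimately show ?thesis unfolding st invG_def prod.case tk' using I h cle unfolding tk by auto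
      next
        case False
        have st: "stepG \<sigma> y \<theta> s = (Suc h, q, if v - nn < n then cs @ [v - nn] else cs)" using h tv gp False by (simp add: s)
        have "t = dd" using False Act_less_nn A by auto
        then have "{p\<in>set (take (Suc h) q). fst p = dd} = insert (t, v) {p\<in>set (take h q). fst p = dd}" unfolding tk by auto
        then have c1: "card {p\<in>set (take (Suc h) q). fst p = dd} = Suc (card {p\<in>set (take h q). fst p = dd})" using nt by simp
        show ?thesis unfolding st invG_def prod.case using I h c1 False unfolding tk by auto
      qed
    qed
  qed
qed

lemma gnode_Suc: "t < dd \<Longrightarrow> (nn + i) div 2 ^ (dd - Suc t) div 2 = (nn + i) div 2 ^ (dd - t)"
  by (simp add: div_mult2_eq[symmetric] Suc_diff_Suc flip: power_Suc2)

lemma invG_run: "invG cs0 N ((stepG \<sigma> y \<theta> ^^ N) (0, [(0, 1)], cs0))"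
proof (induction N)
  case 0
  show ?case unfolding invG_def by auto
next
  case (Suc N)
  then show ?case using invG_step by simp
qed

lemma length_candG: "length (candG \<sigma> y \<theta> cs0) \<le> length cs0 + card (Act dd)" and set_candG: "set cs0 \<subseteq> set (candG \<sigma> y \<theta> cs0)"
proof -
  obtain h q cs where s: "(stepG \<sigma> y \<theta> ^^ (c * B * dd)) (0, [(0, 1)], cs0) = (h, q, cs)"
    by (cases "(stepG \<sigma> y \<theta> ^^ (c * B * dd)) (0, [(0, 1)], cs0)") auto
  note I = invG_run[of cs0 "c * B * dd", unfolded s invG_def prod.case]
  have cs: "candG \<sigma> y \<theta> cs0 = cs" unfolding candG_def s by simp
  have "{p\<in>set (take h q). fst p = dd} \<subseteq> (\<lambda>v. (dd, v)) ` Act dd"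
  proof
    fix p assume p: "p \<in> {p\<in>set (take h q). fst p = dd}"
    then have "p \<in> set q" using set_take_subset by fast
    then show "p \<in> (\<lambda>v. (dd, v)) ` Act dd" using I p by (cases p) auto
  qed
  then have "card {p\<in>set (take h q). fst p = dd} \<le> card ((\<lambda>v. (dd, v)) ` Act dd)"
    using finite_Act by (intro card_mono) auto
  also have "\<dots> \<le> card (Act dd)" using finite_Act by (rule card_image_le)
  finally have l1: "card {p\<in>set (take h q). fst p = dd} \<le> card (Act dd)" .
  have "length cs \<le> length cs0 + card {p\<in>set (take h q). fst p = dd}" using I by blast
  then show "length (candG \<sigma> y \<theta> cs0) \<le> length cs0 + card (Act dd)" unfolding cs using l1 by (rule order.trans[OF _ add_left_mono])
  show "set cs0 \<subseteq> set (candG \<sigma> y \<theta> cs0)" using I cs by simp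
qed

text \<open>With a large enough budget the head reaches the end of the queue. Then the ancestors of
  a leaf enter it one after the other, as each of them passes.\<close>

lemma candG_model:
  assumes "(\<Sum>t\<le>dd. card (Act t)) \<le> c * B * dd"
  shows "i < n \<Longrightarrow> (\<And>t. t \<le> dd \<Longrightarrow> gpass \<sigma> y \<theta> t ((nn + i) div 2 ^ (dd - t))) \<Longrightarrow> i \<in> set (candG \<sigma> y \<theta> cs0)"
proof -
  obtain h q cs where s: "(stepG \<sigma> y \<theta> ^^ (c * B * dd)) (0, [(0, 1)], cs0) = (h, q, cs)"
    by (cases "(stepG \<sigma> y \<theta> ^^ (c * B * dd)) (0, [(0, 1)], cs0)") auto
  note I = invG_run[of cs0 "c * B * dd", unfolded s invG_def prod.case]
  have cs: "candG \<sigma> y \<theta> cs0 = cs" unfolding candG_def s by simp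
  have "set q \<subseteq> Sigma {..dd} Act" using I by auto
  then have "card (set q) \<le> card (Sigma {..dd} Act)" using finite_Act by (intro card_mono) auto
  then have "length q \<le> c * B * dd" using I assms finite_Act by (simp add: distinct_card)
  then have h: "h = length q" using I by linarith
  assume i: "i < n" and p: "\<And>t. t \<le> dd \<Longrightarrow> gpass \<sigma> y \<theta> t ((nn + i) div 2 ^ (dd - t))"
  let ?g = "\<lambda>t. (nn + i) div 2 ^ (dd - t)"
  have inn: "i < nn" using i n_le_nn by simp
  have cl: "gpass \<sigma> y \<theta> t v \<longrightarrow> (v < nn \<longrightarrow> (t + 1, 2 * v) \<in> set q \<and> (t + 1, 2 * v + 1) \<in> set q) \<and> (nn \<le> v \<longrightarrow> v - nn < n \<longrightarrow> v - nn \<in> set cs)"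
    if "(t, v) \<in> set q" for t v using I that h by auto
  have "(t, ?g t) \<in> set q" if "t \<le> dd" for t
    using that
  proof (induction t)
    case 0
    have "(nn + i) div nn = 1" using inn by (simp add: div_add_self1)
    then show ?case using I unfolding nn_def[symmetric] by (simp add: nn_def)
  next
    case (Suc t)
    then have q: "(t, ?g t) \<in> set q" by simp
    have "?g t < nn" using Act_less_nn[of "?g t" t] I q Suc.prems by auto
    then have "(t + 1, 2 * ?g t) \<in> set q" "(t + 1, 2 * ?g t + 1) \<in> set q" using cl[OF q] p[of t] Suc.prems by auto
    moreover have "?g (Suc t) div 2 = ?g t" using gnode_Suc Suc.prems by simp
    then have "?g (Suc t) = 2 * ?g t \<or> ?g (Suc t) = 2 * ?g t + 1" by linarith
    ultimately show ?case by auto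
  qed
  from cl[OF this[of dd]] p[of dd] i show "i \<in> set (candG \<sigma> y \<theta> cs0)" unfolding cs by simp
qed

section \<open>Pivots and their budget\<close>

definition "acE i t \<longleftrightarrow> rr < 2 * ecnt \<sigma> y \<theta> i (eval_at \<sigma> y i t)"

text \<open>Bounds the steps spent on one occurrence of i: the initial run of rejected pivots and
  one more step, which also covers an occurrence that is skipped because i was seen.\<close>

definition "TE i = 1 + card {t. t < rr \<and> (\<forall>t'\<le>t. \<not> acE i t')}"

text \<open>A seen item has some accepted value v, not necessarily a reported one; that it is
  reported whenever v exceeds the output threshold is the form in which completeness is
  used.\<close>

definition invE :: "nat list \<Rightarrow> nat \<Rightarrow> nat \<times> nat \<times> nat set \<times> (nat \<times> real) list \<Rightarrow> bool" where
  "invE cs N s \<longleftrightarrow> (case s of (k, t, seen, out) \<Rightarrow> k \<le> length cs \<and> t < rr \<and>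
     (k = length cs \<or> N \<le> (\<Sum>j<k. TE (cs ! j)) + t) \<and> (k < length cs \<longrightarrow> (\<forall>t'<t. \<not> acE (cs ! k) t')) \<and>
     (\<forall>(i, v)\<in>set out. i \<in> seen \<and> i \<in> set cs \<and> 6 * \<theta> < \<bar>v\<bar> \<and> rr < 2 * ecnt \<sigma> y \<theta> i v) \<and> distinct (map fst out) \<and>
     (\<forall>i\<in>seen. \<exists>v. rr < 2 * ecnt \<sigma> y \<theta> i v \<and> (6 * \<theta> < \<bar>v\<bar> \<longrightarrow> (i, v) \<in> set out)) \<and>
     (\<forall>j<k. cs ! j \<in> seen \<or> (\<forall>t<rr. \<not> acE (cs ! j) t)))"

lemma rr_pos: "0 < rr" using dd_pos by (simp add: rr_def)

lemma TE_ge: "t < rr \<Longrightarrow> (\<forall>t'<t. \<not> acE i t') \<Longrightarrow> t + 1 \<le> TE i"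
proof -
  assume "t < rr" "\<forall>t'<t. \<not> acE i t'"
  then have "card {..<t} \<le> card {t. t < rr \<and> (\<forall>t'\<le>t. \<not> acE i t')}" by (intro card_mono) auto
  then show ?thesis by (simp add: TE_def)
qed

lemma invE_step:
  assumes "invE cs N s"
  shows "invE cs (Suc N) (stepE \<sigma> y \<theta> cs s)"
proof -
  obtain k t seen out where s: "s = (k, t, seen, out)" by (cases s) auto
  note I = assms[unfolded invE_def s prod.case]
  show ?thesis
  proof (cases "k < length cs")
    case False
    then have "stepE \<sigma> y \<theta> cs s = s" by (simp add: s)
    then show ?thesis using False assms unfolding invE_def s by auto
  next
    case k: True
    let ?i = "cs ! k" let ?v = "eval_at \<sigma> y ?i t"
    have T: "t + 1 \<le> TE ?i" using I k by (intro TE_ge) auto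
    have inc: "?i \<in> set cs" using k by simp
    have N: "Suc N \<le> (\<Sum>j<Suc k. TE (cs ! j)) + 0" using I k T by auto
    show ?thesis
    proof (cases "?i \<in> seen")
      case True
      have st: "stepE \<sigma> y \<theta> cs s = (k + 1, 0, seen, out)" using k True by (simp add: s)
      show ?thesis unfolding st invE_def prod.case using I k N True rr_pos by (auto simp: less_Suc_eq)
    next
      case ns: False
      show ?thesis
      proof (cases "rr < 2 * ecnt \<sigma> y \<theta> ?i ?v")
        case True
        have st: "stepE \<sigma> y \<theta> cs s = (k + 1, 0, insert ?i seen, if 6 * \<theta> < \<bar>?v\<bar> then out @ [(?i, ?v)] else out)"
          using k ns True by (simp add: s Let_def)
        have ni: "?i \<notin> fst ` set out" using I ns by auto
        show ?thesis
        proof (cases "6 * \<theta> < \<bar>?v\<bar>")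
          case t6: True
          have "\<forall>i\<in>insert ?i seen. \<exists>v. rr < 2 * ecnt \<sigma> y \<theta> i v \<and> (6 * \<theta> < \<bar>v\<bar> \<longrightarrow> (i, v) \<in> set (out @ [(?i, ?v)]))"
            using I True by fastforce
          moreover have "distinct (map fst (out @ [(?i, ?v)]))" using I ni by simp
          ultimately show ?thesis unfolding st invE_def prod.case using I k N True rr_pos t6 inc
            by (auto simp: less_Suc_eq)
        next
          case t6: False
          have "\<forall>i\<in>insert ?i seen. \<exists>v. rr < 2 * ecnt \<sigma> y \<theta> i v \<and> (6 * \<theta> < \<bar>v\<bar> \<longrightarrow> (i, v) \<in> set out)"
            using I True t6 by blast
          then show ?thesis unfolding st invE_def prod.case using I k N True rr_pos t6
            by (auto simp: less_Suc_eq)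
        qed
      next
        case nac: False
        show ?thesis
        proof (cases "t + 1 < rr")
          case True
          have st: "stepE \<sigma> y \<theta> cs s = (k, t + 1, seen, out)" using k ns nac True by (simp add: s Let_def)
          show ?thesis unfolding st invE_def prod.case using I k nac True by (auto simp: less_Suc_eq acE_def)
        next
          case False
          have st: "stepE \<sigma> y \<theta> cs s = (k + 1, 0, seen, out)" using k ns nac False by (simp add: s Let_def)
          have "\<forall>t<rr. \<not> acE ?i t"
          proof (intro allI impI)
            fix t' assume "t' < rr"
            then have "t' < t \<or> t' = t" using False by auto
            then show "\<not> acE ?i t'" using I k nac by (auto simp: acE_def)
          qed
          then show ?thesis unfolding st invE_def prod.case using I k N rr_pos by (auto simp: less_Suc_eq)
        qed
      qed
    qed
  qed
qed

lemma invE_run: "invE cs N ((stepE \<sigma> y \<theta> cs ^^ N) (0, 0, {}, []))"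
proof (induction N)
  case 0
  show ?case unfolding invE_def using rr_pos by auto
next
  case (Suc N)
  then show ?case using invE_step by simp
qed

lemma outE_sound:
  shows "distinct (map fst (outE \<sigma> y \<theta> cs))"
    and "(i, v) \<in> set (outE \<sigma> y \<theta> cs) \<Longrightarrow> i \<in> set cs \<and> 6 * \<theta> < \<bar>v\<bar> \<and> rr < 2 * ecnt \<sigma> y \<theta> i v"
  using invE_run[of cs "c * B"] unfolding outE_def invE_def by (auto split: prod.splits)

lemma outE_complete:
  assumes "(\<Sum>i\<leftarrow>cs. TE i) \<le> c * B" "i \<in> set cs" "t < rr" "acE i t"
  shows "\<exists>v. rr < 2 * ecnt \<sigma> y \<theta> i v \<and> (6 * \<theta> < \<bar>v\<bar> \<longrightarrow> (i, v) \<in> set (outE \<sigma> y \<theta> cs))"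
proof -
  obtain k t' seen out where s: "(stepE \<sigma> y \<theta> cs ^^ (c * B)) (0, 0, {}, []) = (k, t', seen, out)"
    by (cases "(stepE \<sigma> y \<theta> cs ^^ (c * B)) (0, 0, {}, [])") auto
  note I = invE_run[of cs "c * B", unfolded s invE_def prod.case]
  have k: "k = length cs"
  proof (rule ccontr)
    assume "k \<noteq> length cs"
    then have k: "k < length cs" "c * B \<le> (\<Sum>j<k. TE (cs ! j)) + t'" "t' + 1 \<le> TE (cs ! k)" using I TE_ge by auto
    have "(\<Sum>j<Suc k. TE (cs ! j)) \<le> (\<Sum>j<length cs. TE (cs ! j))" using k(1) by (intro sum_mono2) auto
    also have "\<dots> = (\<Sum>i\<leftarrow>cs. TE i)" by (simp add: sum_list_sum_nth atLeast0LessThan)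
    finally show False using k assms(1) by simp
  qed
  obtain j where j: "j < length cs" "cs ! j = i" using assms(2) by (auto simp: in_set_conv_nth)
  then have "i \<in> seen" using I k assms(3,4) by auto
  then show ?thesis using I unfolding outE_def s by simp
qed

end

end

section \<open>Good repetitions\<close>

context sketch begin

text \<open>The cells owned by the repetitions in J, as halving and reducing an address recovers its
  repetition. Resampling \<open>RS J\<close> gives these repetitions fresh randomness.\<close>

definition RS :: "nat set \<Rightarrow> nat set" where
  "RS J = {a. (a div 2) mod ss \<in> J}"

lemma hsh_ov: "\<rho> < ss \<Longrightarrow> hsh (override_on \<sigma> \<tau> (RS J)) \<rho> k = (if \<rho> \<in> J then hsh \<tau> \<rho> k else hsh \<sigma> \<rho> k)"
  by (simp add: hsh_def override_on_def RS_def)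

lemma cw_ov: "\<rho> < ss \<Longrightarrow> cw (override_on \<sigma> \<tau> (RS J)) \<rho> k = (if \<rho> \<in> J then cw \<tau> \<rho> k else cw \<sigma> \<rho> k)"
  by (simp add: cw_def override_on_def RS_def)

definition zl :: "(nat \<Rightarrow> nat) \<Rightarrow> nat \<Rightarrow> nat" where
  "zl \<sigma> i = hsh \<sigma> dd i mod (B * vv)"

text \<open>Digits to the base \<open>gg\<close>, the most significant one first, matching the order
  in which the decoder accumulates them.\<close>

definition msg :: "nat \<Rightarrow> nat \<Rightarrow> nat" where
  "msg t i = (i div gg ^ (nb - 1 - t)) mod gg"

definition cbit :: "nat \<Rightarrow> nat \<Rightarrow> nat \<Rightarrow> nat" where
  "cbit t j i = of_bool (bit (code ! msg t i) j)"

definition gnode :: "nat \<Rightarrow> nat \<Rightarrow> nat" where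
  "gnode t i = (nn + i) div 2 ^ (dd - t)"

text \<open>The key by which a repetition hashes item i: the item itself, its label, or its ancestor
  on a tree level. Items with equal keys always share a bucket pair. The labels z are an argument so
  that they can be held fixed while the rest of the tape is averaged.\<close>

definition nd :: "(nat \<Rightarrow> nat) \<Rightarrow> nat \<Rightarrow> nat \<Rightarrow> nat" where
  "nd z \<rho> i = (if \<rho> < 6 * dd then i else if \<rho> < 10 * dd then z i else gnode ((\<rho> - 10 * dd) div 12) i)"

definition bt :: "nat \<Rightarrow> nat \<Rightarrow> nat" where
  "bt \<rho> i = (if 6 * dd \<le> \<rho> \<and> \<rho> < 10 * dd then cbit ((\<rho> - 6 * dd) div ell) ((\<rho> - 6 * dd) mod ell) i else 0)"

text \<open>Signs preserve the size of a coordinate, as estimates and labels require. The tree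
  repetitions need uniform coefficients, since several coordinates below a node might cancel with
  constant probability under signs.\<close>

definition cf :: "nat \<Rightarrow> nat \<Rightarrow> real" where
  "cf \<rho> v = (if \<rho> < 10 * dd then sg v else gam ww v)"

lemma bt_less: "bt \<rho> i < 2"
  by (simp add: bt_def cbit_def)

definition Yf :: "(nat \<Rightarrow> real) \<Rightarrow> (nat \<Rightarrow> nat) \<Rightarrow> nat \<Rightarrow> nat \<Rightarrow> real" where
  "Yf x \<sigma> \<rho> b = (\<Sum>i<n. if hb \<sigma> \<rho> (nd (zl \<sigma>) \<rho> i) + bt \<rho> i = b then cf \<rho> (cw \<sigma> \<rho> i) * x i else 0)"

lemma hb_ov: "\<rho> < ss \<Longrightarrow> hb (override_on \<sigma> \<tau> (RS J)) \<rho> k = (if \<rho> \<in> J then hb \<tau> \<rho> k else hb \<sigma> \<rho> k)"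
  by (simp add: hb_def hsh_ov)

end

locale sketch_prob = sketch_par +
  fixes x :: "nat \<Rightarrow> real" and bexp :: nat
  assumes B_pow: "B = 2 ^ bexp" and bexp: "412 \<le> bexp"
begin

text \<open>\<open>q0\<close> is the error rate of a repetition that the label code can stand, see
  \<open>small_q0\<close>. \<open>p1\<close> bounds, in units of \<theta>^2, the energy that light
  items with the same key as the target may have; it is small enough for the estimate 2 * 4 * (p1 +
  2^-410) + 2^-410 \<le> q0 of \<open>prb_Bad\<close>.\<close>

abbreviation "q0 \<equiv> (1 / 2 :: real) ^ 400"
abbreviation "p1 \<equiv> (1 / 2 :: real) ^ 404"

text \<open>The number of exceptional coordinates allowed. Half of B divided by \<open>kap\<close>
  is 2^410, so one of them disturbs a given bucket pair with probability at most 2^-410.\<close>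

definition "kap = B div 2 ^ 411"

lemma kap: "kap * 2 ^ 411 = B" "0 < kap"
proof -
  have "(2::nat) ^ 411 dvd B" unfolding B_pow using bexp by (intro le_imp_power_dvd) simp
  then show "kap * 2 ^ 411 = B" unfolding kap_def by simp
  then show "0 < kap" using B_pos by (cases kap) auto
qed

lemma bh_kap: "real kap / real bh = (1 / 2) ^ 410"
proof -
  have "real kap * 2 ^ 411 = 2 * real bh" using kap(1) bh_eq(1) by (metis of_nat_mult of_nat_numeral of_nat_power)
  then have "real bh = real kap * 2 ^ 410" by simp
  then show ?thesis using kap(2) by (simp add: field_simps)
qed

lemma bexp_le: "bexp \<le> dd"
proof -
  have "(2::nat) ^ bexp \<le> 2 ^ dd" using bnds(2) unfolding B_pow nn_def .
  then show ?thesis by (simp add: power_le_imp_le_exp)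
qed

lemma bh_pow: "bh = 2 ^ (bexp - 1)"
proof -
  have "B = 2 * 2 ^ (bexp - 1)" unfolding B_pow power_Suc[symmetric] using bexp by simp
  then show ?thesis using bh_eq(1) by linarith
qed

lemma bh_dvd: "bh dvd 2 ^ ww"
  unfolding bh_pow ww_def using bexp_le by (intro le_imp_power_dvd) simp

lemma BV_dvd: "B * vv dvd 2 ^ ww"
proof -
  have "64 * aa \<le> dd" using vv_dd(4) by linarith
  then show ?thesis unfolding B_pow vv_def ww_def power_add[symmetric] using bexp_le by (intro le_imp_power_dvd) simp
qed

lemma addr_less: "k \<le> 2 * nn \<Longrightarrow> \<rho> < ss \<Longrightarrow> 2 * (k * ss + \<rho>) < 2 ^ ww"
  "k \<le> 2 * nn \<Longrightarrow> \<rho> < ss \<Longrightarrow> 2 * (k * ss + \<rho>) + 1 < 2 ^ ww"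
  using key_bound[of k \<rho>] by simp_all

lemma ss_pos: "0 < ss" unfolding ss_def using dd_pos by simp

lemma prb_hsh_collide:
  assumes "u \<noteq> v" "u \<le> 2 * nn" "\<rho> < ss" "d dvd 2 ^ ww" "0 < d"
  shows "prb ww (\<lambda>\<sigma>. hsh \<sigma> \<rho> u mod d = hsh \<sigma> \<rho> v mod d) = 1 / real d"
  unfolding hsh_def using assms ss_pos by (intro prb_collide addr_less) auto

lemma sg_sum: "(\<Sum>v<2 ^ ww. sg v) = 0"
proof -
  have "(\<Sum>v<2 * m. sg v) = 0" for m
    by (induction m) (auto simp: sg_def)
  moreover have "(2::nat) ^ ww = 2 * 2 ^ (ww - 1)" unfolding power_Suc[symmetric] ww_def using dd_pos by simp
  ultimately show ?thesis by metis
qed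

lemma cf_sum: "(\<Sum>v<2 ^ ww. cf \<rho> v) = 0"
  using sg_sum gam_sum[of ww] by (cases "\<rho> < 10 * dd") (simp_all add: cf_def)

lemma cf_sq: "v < 2 ^ ww \<Longrightarrow> (cf \<rho> v)\<^sup>2 \<le> 1"
  using gam_sq[of v ww] by (simp add: cf_def sg_def)

text \<open>The noise that the items in I put into one bucket of the pair of key v0. Sharing the key
  is listed apart from a collision of hashes, since only the latter is rare.\<close>

definition Zf :: "nat set \<Rightarrow> (nat \<Rightarrow> nat) \<Rightarrow> nat \<Rightarrow> nat \<Rightarrow> (nat \<Rightarrow> nat) \<Rightarrow> nat \<Rightarrow> real" where
  "Zf I z \<rho> v0 \<sigma> \<beta> = (\<Sum>i\<in>I. cf \<rho> (cw \<sigma> \<rho> i) *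
     (if bt \<rho> i = \<beta> \<and> (nd z \<rho> i = v0 \<or> hsh \<sigma> \<rho> (nd z \<rho> i) mod bh = hsh \<sigma> \<rho> v0 mod bh) then x i else 0))"

text \<open>Items with the key v0 itself contribute their full energy, all others only when the
  hashes collide, which has probability 1 / bh.\<close>

lemma second_moment_Zf:
  assumes \<rho>: "\<rho> < ss" and I: "finite I" "I \<subseteq> {..<n}" and nd: "\<And>i. i \<in> I \<Longrightarrow> nd z \<rho> i \<le> 2 * nn"
  shows "avg ww (\<lambda>\<sigma>. (Zf I z \<rho> v0 \<sigma> \<beta>)\<^sup>2) \<le> (\<Sum>i\<in>{i\<in>I. nd z \<rho> i = v0}. (x i)\<^sup>2) + (\<Sum>i\<in>I. (x i)\<^sup>2) / real bh"
proof -
  let ?k = "\<lambda>i \<sigma>. if bt \<rho> i = \<beta> \<and> (nd z \<rho> i = v0 \<or> hsh \<sigma> \<rho> (nd z \<rho> i) mod bh = hsh \<sigma> \<rho> v0 mod bh) then x i else 0"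
  let ?a = "\<lambda>i. 2 * (i * ss + \<rho>) + 1"
  have hs: "hsh (\<sigma>(?a j := v)) \<rho> u = hsh \<sigma> \<rho> u" for \<sigma> j v u
  proof -
    have "2 * (u * ss + \<rho>) \<noteq> ?a j" by presburger
    then show ?thesis unfolding hsh_def by simp
  qed
  have "avg ww (\<lambda>\<sigma>. (Zf I z \<rho> v0 \<sigma> \<beta>)\<^sup>2) = avg ww (\<lambda>\<sigma>. (\<Sum>i\<in>I. cf \<rho> (\<sigma> (?a i)) * ?k i \<sigma>)\<^sup>2)"
    by (simp add: Zf_def cw_def)
  also have "\<dots> \<le> (\<Sum>i\<in>I. avg ww (\<lambda>\<sigma>. (?k i \<sigma>)\<^sup>2))"
  proof (rule second_moment)
    show "inj_on ?a I" using ss_pos by (auto simp: inj_on_def)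
    show "?a i < 2 ^ ww" if "i \<in> I" for i using that I n_le_nn \<rho> by (intro addr_less) auto
  qed (use I cf_sum cf_sq hs in auto)
  also have "\<dots> \<le> (\<Sum>i\<in>I. (if nd z \<rho> i = v0 then (x i)\<^sup>2 else 0) + (x i)\<^sup>2 / real bh)"
  proof (rule sum_mono)
    fix i assume i: "i \<in> I"
    show "avg ww (\<lambda>\<sigma>. (?k i \<sigma>)\<^sup>2) \<le> (if nd z \<rho> i = v0 then (x i)\<^sup>2 else 0) + (x i)\<^sup>2 / real bh"
    proof (cases "nd z \<rho> i = v0")
      case True
      then show ?thesis by (intro avg_bound) auto
    next
      case False
      have "avg ww (\<lambda>\<sigma>. (?k i \<sigma>)\<^sup>2) \<le> avg ww (\<lambda>\<sigma>. (x i)\<^sup>2 * of_bool (hsh \<sigma> \<rho> (nd z \<rho> i) mod bh = hsh \<sigma> \<rho> v0 mod bh))"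
        using False by (intro avg_mono) auto
      also have "\<dots> = (x i)\<^sup>2 * prb ww (\<lambda>\<sigma>. hsh \<sigma> \<rho> (nd z \<rho> i) mod bh = hsh \<sigma> \<rho> v0 mod bh)"
        by (simp add: avg_cmult prb_def)
      also have "\<dots> = (x i)\<^sup>2 / real bh"
        using prb_hsh_collide[OF False nd[OF i] \<rho> bh_dvd bh_eq(2)] by simp
      finally show ?thesis using False by simp
    qed
  qed
  also have "\<dots> = (\<Sum>i\<in>{i\<in>I. nd z \<rho> i = v0}. (x i)\<^sup>2) + (\<Sum>i\<in>I. (x i)\<^sup>2) / real bh"
    using I(1) by (simp add: sum.distrib sum_divide_distrib sum.inter_filter)
  finally show ?thesis .
qed

end

text \<open>The situation after the threshold has been read: \<theta> is a fixed number, and up to a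
  set S0 of \<open>kap\<close> exceptions the vector has energy at most kap * \<theta>^2. Then the
  noise in a bucket has standard deviation much smaller than \<theta>. The case \<theta> = 0 is
  included.\<close>

locale sketch_thr = sketch_prob +
  fixes \<theta> :: real and S0 :: "nat set"
  assumes \<theta>_nonneg: "0 \<le> \<theta>" and S0: "S0 \<subseteq> {..<n}" "card S0 \<le> kap"
    and light: "(\<Sum>i\<in>{..<n} - S0. (x i)\<^sup>2) \<le> real kap * \<theta>\<^sup>2"
begin

abbreviation "lt e \<equiv> {..<n} - S0 - {e}"

text \<open>Failure of repetition \<rho> for the key v0 and the target item e, whose own
  contribution is left out of the noise. For a key without a target, e = n excludes nothing.\<close>

definition Bad :: "(nat \<Rightarrow> nat) \<Rightarrow> nat \<Rightarrow> nat \<Rightarrow> nat \<Rightarrow> (nat \<Rightarrow> nat) \<Rightarrow> bool" where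
  "Bad z \<rho> v0 e \<sigma> \<longleftrightarrow> (\<exists>l\<in>S0 - {e}. nd z \<rho> l \<noteq> v0 \<and> hsh \<sigma> \<rho> (nd z \<rho> l) mod bh = hsh \<sigma> \<rho> v0 mod bh) \<or>
     (\<exists>\<beta>\<in>{..<2}. \<theta> / 2 < \<bar>Zf (lt e) z \<rho> v0 \<sigma> \<beta>\<bar>)"

lemma fin_S0: "finite S0" using S0(1) finite_subset by blast

lemma light_e: "(\<Sum>i\<in>lt e. (x i)\<^sup>2) \<le> real kap * \<theta>\<^sup>2"
  by (rule order.trans[OF sum_mono2 light]) auto

text \<open>Collisions with exceptions are handled by a union bound, the light noise by Chebyshev at
  level \<theta>/2, which costs the factor 4, once for either bucket of the pair.\<close>

lemma prb_Bad:
  assumes \<rho>: "\<rho> < ss" and nd: "\<And>i. i < n \<Longrightarrow> nd z \<rho> i \<le> 2 * nn"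
    and own: "(\<Sum>i\<in>{i\<in>lt e. nd z \<rho> i = v0}. (x i)\<^sup>2) \<le> p1 * \<theta>\<^sup>2"
  shows "prb ww (Bad z \<rho> v0 e) \<le> q0"
proof -
  have 1: "prb ww (\<lambda>\<sigma>. \<exists>l\<in>S0 - {e}. nd z \<rho> l \<noteq> v0 \<and> hsh \<sigma> \<rho> (nd z \<rho> l) mod bh = hsh \<sigma> \<rho> v0 mod bh) \<le> (1 / 2) ^ 410"
  proof -
    have "prb ww (\<lambda>\<sigma>. \<exists>l\<in>S0 - {e}. nd z \<rho> l \<noteq> v0 \<and> hsh \<sigma> \<rho> (nd z \<rho> l) mod bh = hsh \<sigma> \<rho> v0 mod bh)
        \<le> real (card (S0 - {e})) * (1 / real bh)"
    proof (rule prb_bex_le)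
      fix l assume l: "l \<in> S0 - {e}"
      show "prb ww (\<lambda>\<sigma>. nd z \<rho> l \<noteq> v0 \<and> hsh \<sigma> \<rho> (nd z \<rho> l) mod bh = hsh \<sigma> \<rho> v0 mod bh) \<le> 1 / real bh"
        using prb_hsh_collide[of "nd z \<rho> l" v0 \<rho> bh] nd[of l] l S0(1) \<rho> bh_dvd bh_eq(2)
        by (cases "nd z \<rho> l = v0") auto
    qed (use fin_S0 in auto)
    also have "\<dots> \<le> real kap * (1 / real bh)"
      using S0(2) card_mono[OF fin_S0, of "S0 - {e}"] by (intro mult_right_mono) auto
    finally show ?thesis using bh_kap by simp
  qed
  have 2: "prb ww (\<lambda>\<sigma>. \<theta> / 2 < \<bar>Zf (lt e) z \<rho> v0 \<sigma> \<beta>\<bar>) \<le> 4 * (p1 + (1 / 2) ^ 410)" for \<beta>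
  proof (rule chebyshev)
    have "avg ww (\<lambda>\<sigma>. (Zf (lt e) z \<rho> v0 \<sigma> \<beta>)\<^sup>2) \<le> (\<Sum>i\<in>{i\<in>lt e. nd z \<rho> i = v0}. (x i)\<^sup>2) + (\<Sum>i\<in>lt e. (x i)\<^sup>2) / real bh"
      using nd by (intro second_moment_Zf[OF \<rho>]) auto
    also have "\<dots> \<le> p1 * \<theta>\<^sup>2 + real kap * \<theta>\<^sup>2 / real bh"
      using own light_e by (intro add_mono divide_right_mono) auto
    also have "\<dots> = (p1 + real kap / real bh) * \<theta>\<^sup>2" by (simp add: algebra_simps)
    also have "\<dots> = 4 * (p1 + (1 / 2) ^ 410) * (\<theta> / 2)\<^sup>2" unfolding bh_kap by (simp add: power2_eq_square)
    finally show "avg ww (\<lambda>\<sigma>. (Zf (lt e) z \<rho> v0 \<sigma> \<beta>)\<^sup>2) \<le> 4 * (p1 + (1 / 2) ^ 410) * (\<theta> / 2)\<^sup>2" .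
  qed (use \<theta>_nonneg in auto)
  have 3: "prb ww (\<lambda>\<sigma>. \<exists>\<beta>\<in>{..<2::nat}. \<theta> / 2 < \<bar>Zf (lt e) z \<rho> v0 \<sigma> \<beta>\<bar>) \<le> real (card {..<2::nat}) * (4 * (p1 + (1 / 2) ^ 410))"
    by (rule prb_bex_le) (use 2 in auto)
  have "prb ww (Bad z \<rho> v0 e) \<le> (1 / 2) ^ 410 + real (card {..<2::nat}) * (4 * (p1 + (1 / 2) ^ 410))"
    unfolding Bad_def by (rule order.trans[OF prb_disj add_mono[OF 1 3]])
  also have "\<dots> \<le> q0" by (simp add: power_divide)
  finally show ?thesis .
qed

lemma Bad_ov: "\<rho> < ss \<Longrightarrow> Bad z \<rho> v0 e (override_on \<sigma> \<tau> (RS J)) = (if \<rho> \<in> J then Bad z \<rho> v0 e \<tau> else Bad z \<rho> v0 e \<sigma>)"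
  unfolding Bad_def Zf_def by (simp add: hsh_ov cw_ov)

lemma prb_many_Bad:
  assumes "finite J" "inj_on f J" "\<And>j. j \<in> J \<Longrightarrow> f j < ss" and nd: "\<And>i j. j \<in> J \<Longrightarrow> i < n \<Longrightarrow> nd z (f j) i \<le> 2 * nn"
    and own: "\<And>j. j \<in> J \<Longrightarrow> (\<Sum>i\<in>{i\<in>lt e. nd z (f j) i = v0}. (x i)\<^sup>2) \<le> p1 * \<theta>\<^sup>2"
  shows "prb ww (\<lambda>\<sigma>. r \<le> card {j\<in>J. Bad z (f j) v0 e \<sigma>}) \<le> 2 ^ card J * q0 ^ r"
    and "prb ww (\<lambda>\<sigma>. \<forall>j\<in>J. Bad z (f j) v0 e \<sigma>) \<le> q0 ^ card J"
proof -
  have a: "prb ww (\<lambda>\<tau>. Bad z (f j) v0 e (override_on \<sigma> \<tau> (RS {f j}))) \<le> q0" if "j \<in> J" for j \<sigma>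
    using prb_Bad[OF assms(3)[OF that] nd[OF that] own[OF that]] Bad_ov[OF assms(3)[OF that]] by simp
  have b: "Bad z (f i) v0 e (override_on \<sigma> \<tau> (RS {f j})) = Bad z (f i) v0 e \<sigma>" if "i \<in> J" "j \<in> J" "i \<noteq> j" for i j \<sigma> \<tau>
    using Bad_ov[OF assms(3)[OF that(1)]] inj_onD[OF assms(2) _ that(1,2)] that(3) by auto
  show "prb ww (\<lambda>\<sigma>. r \<le> card {j\<in>J. Bad z (f j) v0 e \<sigma>}) \<le> 2 ^ card J * q0 ^ r"
    by (rule prb_many[OF assms(1), where S = "\<lambda>j. RS {f j}"]) (use a b in auto)
  show "prb ww (\<lambda>\<sigma>. \<forall>j\<in>J. Bad z (f j) v0 e \<sigma>) \<le> q0 ^ card J"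
    by (rule prb_all_indep[OF assms(1), where S = "\<lambda>j. RS {f j}"]) (use a b in auto)
qed

text \<open>The row splits into light noise, exceptions and the target. In a good repetition
  exceptions with other keys are absent; those with the key v0 have to be ruled out by
  assumption.\<close>

lemma Yf_good:
  assumes "\<not> Bad (zl \<sigma>) \<rho> v0 e \<sigma>" "\<beta> < 2" and S: "\<And>l. l \<in> S0 - {e} \<Longrightarrow> nd (zl \<sigma>) \<rho> l \<noteq> v0" and e: "e < n \<Longrightarrow> nd (zl \<sigma>) \<rho> e = v0"
  shows "\<bar>Yf x \<sigma> \<rho> (hb \<sigma> \<rho> v0 + \<beta>) - (if e < n \<and> bt \<rho> e = \<beta> then cf \<rho> (cw \<sigma> \<rho> e) * x e else 0)\<bar> \<le> \<theta> / 2"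
proof -
  let ?nd = "nd (zl \<sigma>) \<rho>"
  let ?t = "\<lambda>i. if hb \<sigma> \<rho> (?nd i) + bt \<rho> i = hb \<sigma> \<rho> v0 + \<beta> then cf \<rho> (cw \<sigma> \<rho> i) * x i else 0"
  have eq: "hb \<sigma> \<rho> u + b = hb \<sigma> \<rho> v0 + \<beta> \<longleftrightarrow> hsh \<sigma> \<rho> u mod bh = hsh \<sigma> \<rho> v0 mod bh \<and> b = \<beta>" if "b < 2" for u b
  proof -
    have "2 * p + b = 2 * q + \<beta> \<longleftrightarrow> p = q \<and> b = \<beta>" for p q :: nat using that assms(2) by presburger
    then show ?thesis unfolding hb_def by simp
  qed
  have split: "{..<n} = lt e \<union> (S0 - {e}) \<union> ({e} \<inter> {..<n})" using S0(1) by auto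
  have "Yf x \<sigma> \<rho> (hb \<sigma> \<rho> v0 + \<beta>) = (\<Sum>i\<in>lt e. ?t i) + (\<Sum>i\<in>S0 - {e}. ?t i) + (\<Sum>i\<in>{e} \<inter> {..<n}. ?t i)"
    unfolding Yf_def using fin_S0
    by (subst split) (subst sum.union_disjoint; auto)+
  moreover have "(\<Sum>i\<in>lt e. ?t i) = Zf (lt e) (zl \<sigma>) \<rho> v0 \<sigma> \<beta>"
    unfolding Zf_def using bt_less by (intro sum.cong) (auto simp: eq)
  moreover have "(\<Sum>i\<in>S0 - {e}. ?t i) = 0"
    using assms(1) S bt_less unfolding Bad_def by (intro sum.neutral) (auto simp: eq)
  moreover have "(\<Sum>i\<in>{e} \<inter> {..<n}. ?t i) = (if e < n \<and> bt \<rho> e = \<beta> then cf \<rho> (cw \<sigma> \<rho> e) * x e else 0)"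
    using e eq[of "bt \<rho> e" v0] bt_less by (cases "e < n") auto
  moreover have "\<bar>Zf (lt e) (zl \<sigma>) \<rho> v0 \<sigma> \<beta>\<bar> \<le> \<theta> / 2"
    using assms(1,2) unfolding Bad_def by (auto simp: not_less)
  ultimately show ?thesis by simp
qed

definition heavy :: "(nat \<Rightarrow> nat) \<Rightarrow> nat \<Rightarrow> nat set" where
  "heavy z \<rho> = {v. (\<exists>l\<in>S0. nd z \<rho> l = v) \<or> p1 * \<theta>\<^sup>2 < (\<Sum>i\<in>{i\<in>lt n. nd z \<rho> i = v}. (x i)\<^sup>2)}"

text \<open>Classes of energy above p1 * \<theta>^2 number at most 2^404 * kap, since the light
  energy is at most kap * \<theta>^2. With the kap exceptions this stays below 2^411 * kap =
  B.\<close>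

lemma card_heavy: "finite (heavy z \<rho>)" "card (heavy z \<rho>) \<le> B"
proof -
  let ?N = "nd z \<rho>"
  let ?w = "\<lambda>v. \<Sum>i\<in>{i\<in>lt n. ?N i = v}. (x i)\<^sup>2"
  let ?H = "{v\<in>?N ` lt n. p1 * \<theta>\<^sup>2 < ?w v}"
  have sub: "heavy z \<rho> \<subseteq> ?N ` S0 \<union> ?H"
  proof
    fix v assume v: "v \<in> heavy z \<rho>"
    show "v \<in> ?N ` S0 \<union> ?H"
    proof (cases "\<exists>l\<in>S0. ?N l = v")
      case False
      then have w: "p1 * \<theta>\<^sup>2 < ?w v" using v unfolding heavy_def by blast
      have "v \<in> ?N ` lt n"
      proof (rule ccontr)
        assume "v \<notin> ?N ` lt n"
        then have "{i\<in>lt n. ?N i = v} = {}" by blast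
        then have "?w v = 0" by (simp only: sum.empty)
        moreover have "0 \<le> p1 * \<theta>\<^sup>2" by simp
        ultimately show False using w by linarith
      qed
      then show ?thesis using w by blast
    qed blast
  qed
  have finH: "finite ?H" by simp
  show "finite (heavy z \<rho>)" by (rule finite_subset[OF sub]) (use fin_S0 in auto)
  have "(\<Sum>v\<in>?N ` lt n. ?w v) = (\<Sum>i\<in>lt n. (x i)\<^sup>2)" by (rule sum.image_gen[symmetric]) simp
  moreover have "(\<Sum>v\<in>?H. ?w v) \<le> (\<Sum>v\<in>?N ` lt n. ?w v)" by (rule sum_mono2) (auto intro: sum_nonneg)
  ultimately have tot: "(\<Sum>v\<in>?H. ?w v) \<le> real kap * \<theta>\<^sup>2" using light_e[of n] by linarith
  have cH: "real (card ?H) * p1 \<le> real kap"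
  \<comment> \<open>For a zero threshold counting by energy is void; then the light energy vanishes
    and there are no heavy classes besides those of exceptions.\<close>
  proof (cases "\<theta> = 0")
    case True
    have "?H = {}"
    proof (rule ccontr)
      assume "?H \<noteq> {}"
      have z: "p1 * \<theta>\<^sup>2 = 0" using True by simp
      have "0 < ?w v" if "v \<in> ?H" for v
      proof -
        have "p1 * \<theta>\<^sup>2 < ?w v" using that by blast
        then show ?thesis using z by linarith
      qed
      then have "0 < (\<Sum>v\<in>?H. ?w v)" by (rule sum_pos[OF finH \<open>?H \<noteq> {}\<close>])
      then show False using tot True by simp
    qed
    then show ?thesis by (simp only: card.empty)
  next
    case False
    have "real (card ?H) * (p1 * \<theta>\<^sup>2) \<le> (\<Sum>v\<in>?H. ?w v)" by (rule sum_bounded_below) auto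
    then have "(real (card ?H) * p1) * \<theta>\<^sup>2 \<le> real kap * \<theta>\<^sup>2" using tot by (simp add: mult.assoc)
    then show ?thesis using False by simp
  qed
  have "card (heavy z \<rho>) \<le> card (?N ` S0 \<union> ?H)" by (rule card_mono[OF _ sub]) (use fin_S0 in auto)
  also have "\<dots> \<le> card (?N ` S0) + card ?H" by (rule card_Un_le)
  also have "\<dots> \<le> kap + card ?H" using card_image_le[OF fin_S0, of ?N] S0(2) by simp
  finally have 1: "real (card (heavy z \<rho>)) \<le> real kap + real (card ?H)"
    unfolding of_nat_add[symmetric] of_nat_le_iff .
  have "(real (card ?H) * p1) * 2 ^ 404 \<le> real kap * 2 ^ 404" by (rule mult_right_mono[OF cH]) simp
  then have "real (card ?H) \<le> real kap * 2 ^ 404" by (simp add: power_divide del: card_image)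
  then have "real (card (heavy z \<rho>)) \<le> real kap * 2 ^ 411" using 1 by simp
  also have "\<dots> = real B" using kap(1) by (metis of_nat_mult of_nat_numeral of_nat_power)
  finally show "card (heavy z \<rho>) \<le> B" by simp
qed

end

context sketch_par
begin

section \<open>The layout of the repetitions\<close>

lemma xrep_facts:
  assumes "t < nb" "j < ell"
  shows "xrep t j < 10 * dd" "6 * dd \<le> xrep t j" "xrep t j < ss" "nd z (xrep t j) = z" "bt (xrep t j) i = cbit t j i"
proof -
  have "t * ell + j < Suc t * ell" using assms(2) by simp
  also have "\<dots> \<le> nb * ell" using assms(1) by (intro mult_le_mono1) simp
  also have "\<dots> \<le> 3 * dd" by (fact nb_ell)
  finally have l: "t * ell + j < 3 * dd" .
  show x: "xrep t j < 10 * dd" "6 * dd \<le> xrep t j" using l by (auto simp: xrep_def)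
  then show "xrep t j < ss" unfolding ss_def by simp
  show "nd z (xrep t j) = z" using x by (auto simp: nd_def fun_eq_iff)
  have "(xrep t j - 6 * dd) div ell = t" "(xrep t j - 6 * dd) mod ell = j" using assms(2) by (simp_all add: xrep_def)
  then show "bt (xrep t j) i = cbit t j i" using x by (simp add: bt_def)
qed

lemma grep_facts:
  assumes "t \<le> dd" "r < 12"
  shows "10 * dd \<le> grep t r" "grep t r < ss" "nd z (grep t r) = gnode t" "bt (grep t r) i = 0" "cf (grep t r) = gam ww"
proof -
  show 1: "10 * dd \<le> grep t r" by (simp add: grep_def)
  show "grep t r < ss" using assms dd_pos by (simp add: grep_def ss_def)
  have "(grep t r - 10 * dd) div 12 = t" using assms(2) by (simp add: grep_def)
  then show "nd z (grep t r) = gnode t" using 1 by (auto simp: nd_def fun_eq_iff)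
  show "bt (grep t r) i = 0" "cf (grep t r) = gam ww" using 1 by (auto simp: bt_def cf_def fun_eq_iff)
qed

lemma erep_facts:
  assumes "j < rr"
  shows "2 * dd + j < 6 * dd" "2 * dd + j < ss" "nd z (2 * dd + j) i = i" "bt (2 * dd + j) i = 0"
  using assms by (auto simp: rr_def ss_def nd_def bt_def)

lemma gnode_le: "i < n \<Longrightarrow> gnode t i \<le> 2 * nn"
  using n_le_nn div_le_dividend[of "nn + i" "2 ^ (dd - t)"] unfolding gnode_def by linarith

lemma zl_less: "zl \<sigma> i < B * vv"
  unfolding zl_def using B_pos vv_ge(2) by (intro mod_less_divisor) simp

lemma zl_le: "zl \<sigma> i \<le> 2 * nn"
  using zl_less[of \<sigma> i] bnds(4) by linarith

lemma nd_le: "i < n \<Longrightarrow> z i \<le> 2 * nn \<Longrightarrow> nd z \<rho> i \<le> 2 * nn"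
  using gnode_le[of i] n_le_nn by (simp add: nd_def)

lemma dd_ss: "dd < ss" using dd_pos by (simp add: ss_def)

lemma zl_ov: "zl (override_on \<sigma> \<tau> (RS J)) = (if dd \<in> J then zl \<tau> else zl \<sigma>)"
  by (auto simp: zl_def hsh_ov dd_ss)

text \<open>Rounding in \<open>aa\<close> loses less than a factor 2 in the exponent because
  \<open>aa\<close> is positive. So \<open>vv\<close> is a true power of log n, and a bound 1 /
  \<open>vv\<close> is polylogarithmic.\<close>

lemma dd_le_vv: "dd \<le> vv ^ 4" "nb \<le> 2 * vv ^ 4"
proof -
  have "clog dd \<le> 256 * aa" unfolding aa_def using aa_pos unfolding aa_def by linarith
  then have "(2::nat) ^ clog dd \<le> 2 ^ (256 * aa)" by (intro power_increasing) auto
  moreover have "vv ^ 4 = (2::nat) ^ (256 * aa)" unfolding vv_def power_mult[symmetric] by simp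
  ultimately show d: "dd \<le> vv ^ 4" using clog_le[of dd] by linarith
  have "1 \<le> vv ^ 4" using vv_ge(2) by simp
  then show "nb \<le> 2 * vv ^ 4" using d nb_ell(2) by linarith
qed

end

context sketch_prob
begin

section \<open>What the decoder depends on\<close>

definition yv :: "(nat \<Rightarrow> nat) \<Rightarrow> real Matrix.vec" where
  "yv \<sigma> = Matrix.vec (ss * B) (\<lambda>r. Yf x \<sigma> (r div B) (r mod B))"

lemma row_yv: "\<rho> < ss \<Longrightarrow> b < B \<Longrightarrow> row (yv \<sigma>) \<rho> b = Yf x \<sigma> \<rho> b"
proof -
  assume \<rho>: "\<rho> < ss" and b: "b < B"
  have "\<rho> * B + b < Suc \<rho> * B" using b by simp
  also have "\<dots> \<le> ss * B" using \<rho> by (intro mult_le_mono1) simp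
  finally show ?thesis using b by (simp add: row_def yv_def)
qed

lemma arow_yv: "\<rho> < ss \<Longrightarrow> \<beta> < 2 \<Longrightarrow> arow \<sigma> (yv \<sigma>) \<rho> k \<beta> = \<bar>Yf x \<sigma> \<rho> (hb \<sigma> \<rho> k + \<beta>)\<bar>"
  using hb_less[of \<sigma> \<rho> k] unfolding arow_def by (subst row_yv) auto

text \<open>A label repetition uses the hash of repetition dd besides its own cells, so both must be
  resampled together or not at all.\<close>

lemma Yf_ov:
  assumes "\<rho> < ss" "\<rho> < 6 * dd \<or> 10 * dd \<le> \<rho> \<or> (\<rho> \<in> J \<longleftrightarrow> dd \<in> J)"
  shows "Yf x (override_on \<sigma> \<tau> (RS J)) \<rho> b = Yf x (if \<rho> \<in> J then \<tau> else \<sigma>) \<rho> b"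
proof -
  have "nd (zl (override_on \<sigma> \<tau> (RS J))) \<rho> = nd (zl (if \<rho> \<in> J then \<tau> else \<sigma>)) \<rho>"
    using assms(2) by (auto simp: nd_def zl_ov fun_eq_iff)
  then show ?thesis unfolding Yf_def using assms(1) by (cases "\<rho> \<in> J") (simp_all add: hb_ov cw_ov cong: if_cong)
qed

lemma arow_ov:
  assumes "\<rho> < ss" "\<rho> < 6 * dd \<or> 10 * dd \<le> \<rho> \<or> (\<rho> \<in> J \<longleftrightarrow> dd \<in> J)" "\<beta> < 2"
  shows "arow (override_on \<sigma> \<tau> (RS J)) (yv (override_on \<sigma> \<tau> (RS J))) \<rho> k \<beta> = (if \<rho> \<in> J then arow \<tau> (yv \<tau>) \<rho> k \<beta> else arow \<sigma> (yv \<sigma>) \<rho> k \<beta>)"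
  using assms by (simp add: arow_yv Yf_ov hb_ov)

lemma gpass_cong:
  assumes "t \<le> dd" "\<And>r. r < 12 \<Longrightarrow> arow \<sigma> y (grep t r) v 0 = arow \<sigma>' y' (grep t r) v 0"
  shows "gpass \<sigma> y \<theta> t v = gpass \<sigma>' y' \<theta> t v"
  using assms unfolding gpass_def by auto

lemma xok_cong:
  assumes "t < nb" "\<And>j \<beta>. j < ell \<Longrightarrow> \<beta> < 2 \<Longrightarrow> arow \<sigma> y (xrep t j) z \<beta> = arow \<sigma>' y' (xrep t j) z \<beta>"
  shows "xword \<sigma> y z t = xword \<sigma>' y' z t" "xok \<sigma> y \<theta> z t = xok \<sigma>' y' \<theta> z t"
proof -
  show 1: "xword \<sigma> y z t = xword \<sigma>' y' z t" unfolding xword_def using assms by (intro sum.cong) auto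
  have "xera \<sigma> y \<theta> z t = xera \<sigma>' y' \<theta> z t" unfolding xera_def using assms by (intro sum.cong) auto
  then show "xok \<sigma> y \<theta> z t = xok \<sigma>' y' \<theta> z t" unfolding xok_def 1 by simp
qed

text \<open>The search sees the sketch only through absolute bucket values of the repetitions from 6
  dd on. The invariants of the runs guarantee that digit numbers and levels never leave the
  layout.\<close>

lemma cand_cong:
  assumes A: "\<And>\<rho> k \<beta>. 6 * dd \<le> \<rho> \<Longrightarrow> \<rho> < ss \<Longrightarrow> \<beta> < 2 \<Longrightarrow> arow \<sigma> y \<rho> k \<beta> = arow \<sigma>' y' \<rho> k \<beta>"
  shows "candX \<sigma> y \<theta> = candX \<sigma>' y' \<theta>" "candG \<sigma> y \<theta> cs = candG \<sigma>' y' \<theta> cs"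
proof -
  have "(stepX \<sigma> y \<theta> ^^ N) (0, 0, 0, []) = (stepX \<sigma>' y' \<theta> ^^ N) (0, 0, 0, [])" for N
  proof (induction N)
    case (Suc N)
    obtain z t acc cs where s: "(stepX \<sigma> y \<theta> ^^ N) (0, 0, 0, []) = (z, t, acc, cs)"
      by (cases "(stepX \<sigma> y \<theta> ^^ N) (0, 0, 0, [])") auto
    have t: "t < nb" using invX_run[of \<sigma> y \<theta> N] unfolding s invX_def by simp
    have "arow \<sigma> y (xrep t j) z \<beta> = arow \<sigma>' y' (xrep t j) z \<beta>" if "j < ell" "\<beta> < 2" for j \<beta>
      using xrep_facts[OF t that(1)] that by (intro A) auto
    from xok_cong[OF t this] have "stepX \<sigma> y \<theta> (z, t, acc, cs) = stepX \<sigma>' y' \<theta> (z, t, acc, cs)"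
      by (simp add: xdig_def)
    then show ?case using s Suc by simp
  qed simp
  then show "candX \<sigma> y \<theta> = candX \<sigma>' y' \<theta>" unfolding candX_def by simp
  have "(stepG \<sigma> y \<theta> ^^ N) (0, [(0, 1)], cs) = (stepG \<sigma>' y' \<theta> ^^ N) (0, [(0, 1)], cs)" for N
  proof (induction N)
    case (Suc N)
    obtain h q cs' where s: "(stepG \<sigma> y \<theta> ^^ N) (0, [(0, 1)], cs) = (h, q, cs')"
      by (cases "(stepG \<sigma> y \<theta> ^^ N) (0, [(0, 1)], cs)") auto
    note I = invG_run[of \<sigma> y \<theta> cs N, unfolded s invG_def prod.case]
    have "stepG \<sigma> y \<theta> (h, q, cs') = stepG \<sigma>' y' \<theta> (h, q, cs')"
    proof (cases "h < length q")
      case True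
      obtain t v where tv: "q ! h = (t, v)" by (cases "q ! h") auto
      then have "t \<le> dd" using I True nth_mem[OF True] by auto
      then have "gpass \<sigma> y \<theta> t v = gpass \<sigma>' y' \<theta> t v"
      proof (rule gpass_cong)
        fix r :: nat assume r: "r < 12"
        show "arow \<sigma> y (grep t r) v 0 = arow \<sigma>' y' (grep t r) v 0"
          using grep_facts(1,2)[OF \<open>t \<le> dd\<close> r] by (intro A) auto
      qed
      then show ?thesis using True tv by simp
    qed simp
    then show ?case unfolding funpow.simps o_apply Suc.IH[symmetric] s .
  qed simp
  then show "candG \<sigma> y \<theta> cs = candG \<sigma>' y' \<theta> cs" unfolding candG_def by simp
qed

lemma outE_cong:
  assumes "\<And>i j. j < rr \<Longrightarrow> eval_at \<sigma> y i j = eval_at \<sigma>' y' i j"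
  shows "outE \<sigma> y \<theta> cs = outE \<sigma>' y' \<theta> cs"
proof -
  have e: "ecnt \<sigma> y \<theta> i v = ecnt \<sigma>' y' \<theta> i v" for i v
    unfolding ecnt_def using assms by (intro sum.cong) auto
  have "(stepE \<sigma> y \<theta> cs ^^ N) (0, 0, {}, []) = (stepE \<sigma>' y' \<theta> cs ^^ N) (0, 0, {}, [])" for N
  proof (induction N)
    case (Suc N)
    obtain k t seen out where s: "(stepE \<sigma> y \<theta> cs ^^ N) (0, 0, {}, []) = (k, t, seen, out)"
      by (cases "(stepE \<sigma> y \<theta> cs ^^ N) (0, 0, {}, [])") auto
    have t: "t < rr" using invE_run[of \<sigma> y \<theta> cs N] unfolding s invE_def by simp
    have "stepE \<sigma> y \<theta> cs (k, t, seen, out) = stepE \<sigma>' y' \<theta> cs (k, t, seen, out)"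
      by (simp add: Let_def e assms[OF t])
    then show ?case using s Suc by simp
  qed simp
  then show ?thesis unfolding outE_def by simp
qed

lemma eval_at_ov:
  assumes "j < rr"
  shows "eval_at (override_on \<sigma> \<tau> (RS J)) (yv (override_on \<sigma> \<tau> (RS J))) i j
    = (if 2 * dd + j \<in> J then eval_at \<tau> (yv \<tau>) i j else eval_at \<sigma> (yv \<sigma>) i j)"
proof -
  have h: "hb \<sigma> \<rho> k < B" for \<sigma> \<rho> k using hb_less[of \<sigma> \<rho> k] by simp
  show ?thesis using erep_facts(1,2)[OF assms] unfolding eval_at_def by (simp add: cw_ov hb_ov row_yv Yf_ov h)
qed

definition cands :: "real \<Rightarrow> (nat \<Rightarrow> nat) \<Rightarrow> nat list" where
  "cands \<theta> \<sigma> = candG \<sigma> (yv \<sigma>) \<theta> (candX \<sigma> (yv \<sigma>) \<theta>)"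

text \<open>Candidates are independent of the repetitions used for estimating them. This allows the
  number of trials to be averaged for a fixed candidate list.\<close>

lemma cands_ov_E: "cands \<theta> (override_on \<sigma> \<tau> (RS {2 * dd..<6 * dd})) = cands \<theta> \<sigma>"
proof -
  have "arow (override_on \<sigma> \<tau> (RS {2 * dd..<6 * dd})) (yv (override_on \<sigma> \<tau> (RS {2 * dd..<6 * dd}))) \<rho> k \<beta> = arow \<sigma> (yv \<sigma>) \<rho> k \<beta>"
    if "6 * dd \<le> \<rho>" "\<rho> < ss" "\<beta> < 2" for \<rho> k \<beta>
    using that dd_pos by (subst arow_ov) auto
  from cand_cong[OF this] show ?thesis unfolding cands_def by simp
qed

definition dec :: "real \<Rightarrow> (nat \<Rightarrow> nat) \<Rightarrow> (nat \<times> real) list" where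
  "dec \<theta> \<sigma> = outE \<sigma> (yv \<sigma>) \<theta> (cands \<theta> \<sigma>)"

text \<open>Once \<theta> is fixed, decoding uses repetitions from dd on only, whereas the threshold
  stems from earlier ones. Hence \<theta> may be treated as a constant.\<close>

lemma dec_ov: "dec \<theta> (override_on \<sigma> \<tau> (RS {dd..<ss})) = dec \<theta> \<tau>"
proof -
  let ?o = "override_on \<sigma> \<tau> (RS {dd..<ss})"
  have A: "arow ?o (yv ?o) \<rho> k \<beta> = arow \<tau> (yv \<tau>) \<rho> k \<beta>" if "6 * dd \<le> \<rho>" "\<rho> < ss" "\<beta> < 2" for \<rho> k \<beta>
    using that dd_pos dd_ss by (subst arow_ov) auto
  have C: "candX ?o (yv ?o) \<theta> = candX \<tau> (yv \<tau>) \<theta>" "candG ?o (yv ?o) \<theta> cs = candG \<tau> (yv \<tau>) \<theta> cs" for cs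
    by (rule cand_cong, rule A; assumption)+
  have "outE ?o (yv ?o) \<theta> cs = outE \<tau> (yv \<tau>) \<theta> cs" for cs
  proof (rule outE_cong)
    fix i j assume "j < rr"
    then show "eval_at ?o (yv ?o) i j = eval_at \<tau> (yv \<tau>) i j" using eval_at_ov erep_facts(2) by simp
  qed
  then show ?thesis unfolding dec_def cands_def C .
qed

end

context sketch_thr
begin

lemma vv_real: "(2::real) ^ 64 \<le> real vv" "real vv = ((2::real) ^ 64) ^ aa"
proof -
  have "real (2 ^ 64) \<le> real vv" using vv_ge(2) by (simp only: of_nat_le_iff)
  then show "(2::real) ^ 64 \<le> real vv" by simp
  show "real vv = ((2::real) ^ 64) ^ aa" unfolding vv_def by (simp add: power_mult)
qed

lemma Bad_nd: "nd z \<rho> = nd z' \<rho> \<Longrightarrow> Bad z \<rho> v e \<sigma> = Bad z' \<rho> v e \<sigma>"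
  unfolding Bad_def Zf_def by simp

lemma arow_light:
  assumes "\<rho> < ss" "\<not> Bad (zl \<sigma>) \<rho> v n \<sigma>" "\<beta> < 2" "\<And>l. l \<in> S0 \<Longrightarrow> nd (zl \<sigma>) \<rho> l \<noteq> v"
  shows "arow \<sigma> (yv \<sigma>) \<rho> v \<beta> \<le> \<theta> / 2"
  using Yf_good[OF assms(2,3)] assms arow_yv[OF assms(1,3)] by simp

section \<open>Moderate coordinates: labels\<close>

definition lit :: "nat \<Rightarrow> nat \<Rightarrow> (nat \<Rightarrow> nat) \<Rightarrow> bool" where
  "lit t v \<sigma> \<longleftrightarrow> 31 * aa \<le> card {j\<in>{..<ell}. Bad (zl \<sigma>) (xrep t j) v n \<sigma>}"

text \<open>Acceptance leaves at most aa of the 32 aa bits erased. At least 31 aa bits then show a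
  value above \<theta> where a good repetition would show at most \<theta>/2.\<close>

lemma xok_light:
  assumes t: "t < nb" and ok: "xok \<sigma> (yv \<sigma>) \<theta> v t" and S: "\<And>l. l \<in> S0 \<Longrightarrow> zl \<sigma> l \<noteq> v"
  shows "lit t v \<sigma>"
proof -
  let ?a = "\<lambda>j. arow \<sigma> (yv \<sigma>) (xrep t j) v"
  let ?E = "{j\<in>{..<ell}. \<not> (\<theta> < ?a j 0 \<or> \<theta> < ?a j 1)}" and ?N = "{j\<in>{..<ell}. \<theta> < ?a j 0 \<or> \<theta> < ?a j 1}"
  have "xera \<sigma> (yv \<sigma>) \<theta> v t = (\<Sum>j\<in>?E. 1)"
    unfolding xera_def by (intro sum.mono_neutral_cong_right) auto
  then have E: "card ?E \<le> aa" using ok unfolding xok_def by simp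
  have "?E \<union> ?N = {..<ell}" "?E \<inter> ?N = {}" by auto
  then have "card ?E + card ?N = ell" using card_Un_disjoint[of ?E ?N] by simp
  then have "31 * aa \<le> card ?N" using E unfolding ell_def by linarith
  also have "card ?N \<le> card {j\<in>{..<ell}. Bad (zl \<sigma>) (xrep t j) v n \<sigma>}"
  proof (intro card_mono subsetI)
    fix j assume j: "j \<in> ?N"
    then have X: "j < ell" by simp
    note f = xrep_facts[OF t X]
    have "Bad (zl \<sigma>) (xrep t j) v n \<sigma>"
    proof (rule ccontr)
      assume "\<not> ?thesis"
      then have "?a j \<beta> \<le> \<theta> / 2" if "\<beta> < 2" for \<beta> using that f(3) S by (intro arow_light) (auto simp: f(4))
      from this[of 0] this[of 1] show False using j \<theta>_nonneg by auto
    qed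
    then show "j \<in> {j\<in>{..<ell}. Bad (zl \<sigma>) (xrep t j) v n \<sigma>}" using X by simp
  qed simp
  finally show ?thesis unfolding lit_def .
qed

abbreviation "XR \<equiv> {6 * dd..<10 * dd}"

lemma zl_XR [simp]: "zl (override_on \<sigma> \<tau> (RS XR)) = zl \<sigma>"
  using dd_pos by (simp add: zl_ov)

lemma Bad_XR:
  assumes "t < nb" "j < ell"
  shows "Bad (zl (override_on \<sigma> \<tau> (RS XR))) (xrep t j) v e (override_on \<sigma> \<tau> (RS XR)) = Bad (zl \<sigma>) (xrep t j) v e \<tau>"
  using xrep_facts[OF assms] by (simp add: Bad_ov)

lemma inj_xrep: "inj_on (xrep t) {..<ell}"
  by (auto simp: inj_on_def xrep_def)

text \<open>Both are union bounds over the subsets of the \<open>ell\<close> bits. The second one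
  fixes the size of \<open>q0\<close>: it has to beat 2^(32 aa) subsets, a number of digits up to 2
  vv^4, and one more factor \<open>vv\<close>, that is 2^32 * (2^64)^5 = 2^352 per unit of aa,
  against 2^400.\<close>

lemma small_q0: "(2::real) ^ ell * q0 ^ (31 * aa) \<le> 1 / real vv" "real nb * ((2::real) ^ ell * q0 ^ (aa + 1)) \<le> 1 / real vv"
proof -
  have le: "(2 ^ 32 * q0 ^ 31 * 2 ^ 64 :: real) ^ aa \<le> 1"
    by (intro power_le_one) (simp_all add: power_divide)
  have "(2::real) ^ ell * q0 ^ (31 * aa) * real vv = (2 ^ 32 * q0 ^ 31 * 2 ^ 64) ^ aa"
    unfolding vv_real ell_def by (simp only: power_mult power_mult_distrib)
  then show "(2::real) ^ ell * q0 ^ (31 * aa) \<le> 1 / real vv" using le vv_real(1) by (simp add: pos_le_divide_eq)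
  have le: "(2 ^ 32 * q0 * (2 ^ 64) ^ 5 :: real) ^ aa \<le> 1"
    by (intro power_le_one) (simp_all add: power_divide)
  have "real nb \<le> 2 * real vv ^ 4" using dd_le_vv(2) by (metis of_nat_le_iff of_nat_mult of_nat_numeral of_nat_power)
  then have "real nb * ((2::real) ^ ell * q0 ^ (aa + 1)) * real vv \<le> (2 * real vv ^ 4) * ((2::real) ^ ell * q0 ^ (aa + 1)) * real vv"
    by (intro mult_right_mono) auto
  also have "\<dots> = (2 * q0) * (2 ^ ell * q0 ^ aa * real vv ^ 5)" by (simp add: algebra_simps eval_nat_numeral)
  also have "2 ^ ell * q0 ^ aa * real vv ^ 5 = (2 ^ 32 * q0 * (2 ^ 64) ^ 5) ^ aa"
    unfolding vv_real ell_def by (simp only: power_mult power_mult_distrib power_mult[symmetric, of _ aa] mult.commute[of aa] power_mult)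
  also have "(2 * q0) * \<dots> \<le> 1 * 1" using le by (intro mult_mono) (simp_all add: power_divide)
  finally show "real nb * ((2::real) ^ ell * q0 ^ (aa + 1)) \<le> 1 / real vv" using vv_real(1) by (simp add: pos_le_divide_eq)
qed

lemma nb0: "0 < nb" by (simp add: nb_def)

text \<open>With the labels fixed, at most B of them are heavy. Each of the other labels, at most
  \<open>B * vv\<close> in number, is accepted with probability at most 1 / vv, which adds B in
  expectation.\<close>

lemma avg_nok: "avg ww (\<lambda>\<sigma>. real (nok \<sigma> (yv \<sigma>) \<theta> (B * vv))) \<le> 2 * real B"
proof -
  have "avg ww (\<lambda>\<sigma>. real (nok \<sigma> (yv \<sigma>) \<theta> (B * vv))) \<le> avg ww (\<lambda>_. 2 * real B)"
  proof (rule avg_resample_le[where S = "RS XR"])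
    fix \<sigma> assume "\<sigma> \<in> tapes ww"
    define ov where "ov \<tau> = override_on \<sigma> \<tau> (RS XR)" for \<tau>
    let ?z = "zl \<sigma>"
    let ?H = "heavy ?z (xrep 0 0)"
    have ell0: "0 < ell" using aa_pos by (simp add: ell_def)
    have zo: "zl (ov \<tau>) = ?z" for \<tau> unfolding ov_def by simp
    have pt: "real (nok (ov \<tau>) (yv (ov \<tau>)) \<theta> (B * vv)) \<le> real B + (\<Sum>v\<in>{..<B * vv} - ?H. of_bool (lit 0 v (ov \<tau>)))" for \<tau>
    proof -
      have "{v. v < B * vv \<and> xok (ov \<tau>) (yv (ov \<tau>)) \<theta> v 0} \<subseteq> ?H \<union> {v\<in>{..<B * vv} - ?H. lit 0 v (ov \<tau>)}"
      proof
        fix v assume v: "v \<in> {v. v < B * vv \<and> xok (ov \<tau>) (yv (ov \<tau>)) \<theta> v 0}"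
        show "v \<in> ?H \<union> {v\<in>{..<B * vv} - ?H. lit 0 v (ov \<tau>)}"
        proof (cases "v \<in> ?H")
          case False
          then have "zl (ov \<tau>) l \<noteq> v" if "l \<in> S0" for l
            using that xrep_facts(4)[OF nb0 ell0] unfolding heavy_def zo by auto
          then have "lit 0 v (ov \<tau>)" using v nb0 by (intro xok_light) auto
          then show ?thesis using False v by simp
        qed simp
      qed
      then have "nok (ov \<tau>) (yv (ov \<tau>)) \<theta> (B * vv) \<le> card (?H \<union> {v\<in>{..<B * vv} - ?H. lit 0 v (ov \<tau>)})"
        unfolding nok_def using card_heavy(1) by (intro card_mono) auto
      also have "\<dots> \<le> B + card {v\<in>{..<B * vv} - ?H. lit 0 v (ov \<tau>)}"
        using card_Un_le card_heavy(2) add_le_mono1 le_trans by blast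
      finally have "real (nok (ov \<tau>) (yv (ov \<tau>)) \<theta> (B * vv)) \<le> real B + real (card {v\<in>{..<B * vv} - ?H. lit 0 v (ov \<tau>)})"
        unfolding of_nat_add[symmetric] of_nat_le_iff .
      also have "real (card {v\<in>{..<B * vv} - ?H. lit 0 v (ov \<tau>)}) = (\<Sum>v\<in>{..<B * vv} - ?H. of_bool (lit 0 v (ov \<tau>)))"
        by (simp add: of_bool_def sum.If_cases Int_def)
      finally show ?thesis .
    qed
    have pl: "avg ww (\<lambda>\<tau>. of_bool (lit 0 v (ov \<tau>))) \<le> 1 / real vv" if v: "v \<in> {..<B * vv} - ?H" for v
    proof -
      have "avg ww (\<lambda>\<tau>. of_bool (lit 0 v (ov \<tau>))) = prb ww (\<lambda>\<tau>. 31 * aa \<le> card {j\<in>{..<ell}. Bad ?z (xrep 0 j) v n \<tau>})"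
        unfolding prb_def lit_def ov_def using Bad_XR[OF nb0] by (intro avg_cong arg_cong[where f = of_bool] arg_cong2[where f = "(\<le>)"] arg_cong[where f = card]) auto
      also have "\<dots> \<le> 2 ^ card {..<ell} * q0 ^ (31 * aa)"
      proof (rule prb_many_Bad(1))
        show "xrep 0 j < ss" if "j \<in> {..<ell}" for j using that xrep_facts[OF nb0] by simp
        show "nd ?z (xrep 0 j) i \<le> 2 * nn" if "i < n" for i j using that nd_le zl_le by blast
        show "(\<Sum>i | i \<in> lt n \<and> nd ?z (xrep 0 j) i = v. (x i)\<^sup>2) \<le> p1 * \<theta>\<^sup>2" if "j \<in> {..<ell}" for j
        proof -
          have "nd ?z (xrep 0 j) = nd ?z (xrep 0 0)" using that xrep_facts(4)[OF nb0] ell0 by simp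
          then show ?thesis using v unfolding heavy_def by (auto simp: not_less)
        qed
      qed (use inj_xrep in auto)
      also have "\<dots> \<le> 1 / real vv" using small_q0(1) by simp
      finally show ?thesis .
    qed
    have "avg ww (\<lambda>\<tau>. real (nok (ov \<tau>) (yv (ov \<tau>)) \<theta> (B * vv))) \<le> avg ww (\<lambda>\<tau>. real B + (\<Sum>v\<in>{..<B * vv} - ?H. of_bool (lit 0 v (ov \<tau>))))"
      using pt by (intro avg_mono) auto
    also have "\<dots> = real B + (\<Sum>v\<in>{..<B * vv} - ?H. avg ww (\<lambda>\<tau>. of_bool (lit 0 v (ov \<tau>))))"
      by (simp only: avg_add avg_const avg_sum)
    also have "\<dots> \<le> real B + real (card ({..<B * vv} - ?H)) * (1 / real vv)"
      using pl by (intro add_left_mono sum_bounded_above) auto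
    also have "\<dots> \<le> real B + real (B * vv) * (1 / real vv)"
    proof (intro add_left_mono mult_right_mono)
      have "card ({..<B * vv} - ?H) \<le> B * vv" using card_mono[of "{..<B * vv}" "{..<B * vv} - ?H"] by simp
      then show "real (card ({..<B * vv} - ?H)) \<le> real (B * vv)" by (simp only: of_nat_le_iff)
    qed simp
    also have "\<dots> = 2 * real B" using vv_real(1) by simp
    finally show "avg ww (\<lambda>\<tau>. real (nok (override_on \<sigma> \<tau> (RS XR)) (yv (override_on \<sigma> \<tau> (RS XR))) \<theta> (B * vv))) \<le> 2 * real B"
      unfolding ov_def .
  qed
  then show ?thesis by simp
qed

definition missX :: "nat \<Rightarrow> (nat \<Rightarrow> nat) \<Rightarrow> bool" where
  "missX i \<sigma> \<longleftrightarrow> (\<exists>t<nb. \<not> (xok \<sigma> (yv \<sigma>) \<theta> (zl \<sigma> i) t \<and> xdig \<sigma> (yv \<sigma>) (zl \<sigma> i) t = msg t i))"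

text \<open>A defect of the label of i that no repetition can repair: sharing it with an exception
  or with too much light energy.\<close>

definition unclean :: "nat \<Rightarrow> (nat \<Rightarrow> nat) \<Rightarrow> bool" where
  "unclean i z \<longleftrightarrow> (\<exists>l\<in>S0 - {i}. z l = z i) \<or> p1 * \<theta>\<^sup>2 < (\<Sum>l\<in>lt i. if z l = z i then (x l)\<^sup>2 else 0)"

text \<open>Two items share a label with probability 1 / (B * vv), and kap / B = 2^-411. This gives
  2^-411 / vv for the exceptions, and by Markov's inequality with level p1 * \<theta>^2 another 2^-7
  / vv for the light energy.\<close>

lemma prb_unclean: assumes i: "i < n" shows "prb ww (\<lambda>\<sigma>. unclean i (zl \<sigma>)) \<le> 1 / real vv"
proof -
  let ?d = "real B * real vv"
  have dpos: "0 < B * vv" using B_pos vv_ge(2) by simp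
  have col: "prb ww (\<lambda>\<sigma>. zl \<sigma> l = zl \<sigma> i) = 1 / ?d" if "l < n" "l \<noteq> i" for l
    unfolding zl_def using that prb_hsh_collide[OF that(2) _ dd_ss BV_dvd dpos] n_le_nn by simp
  have kB: "real kap / real B = (1 / 2) ^ 411"
    using kap(1) kap(2) B_pos by (metis nonzero_divide_mult_cancel_left of_nat_0_less_iff of_nat_mult of_nat_numeral of_nat_power power_one_over less_irrefl)
  have "prb ww (\<lambda>\<sigma>. \<exists>l\<in>S0 - {i}. zl \<sigma> l = zl \<sigma> i) \<le> real (card (S0 - {i})) * (1 / ?d)"
    using S0(1) col by (intro prb_bex_le) (use fin_S0 in auto)
  also have "\<dots> \<le> real kap * (1 / ?d)"
    using S0(2) card_mono[OF fin_S0, of "S0 - {i}"] by (intro mult_right_mono) auto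
  also have "\<dots> = (real kap / real B) * (1 / real vv)" by simp
  finally have 1: "prb ww (\<lambda>\<sigma>. \<exists>l\<in>S0 - {i}. zl \<sigma> l = zl \<sigma> i) \<le> (1 / 2) ^ 411 * (1 / real vv)" unfolding kB .
  have 2: "prb ww (\<lambda>\<sigma>. p1 * \<theta>\<^sup>2 < (\<Sum>l\<in>lt i. if zl \<sigma> l = zl \<sigma> i then (x l)\<^sup>2 else 0)) \<le> (1 / 2) ^ 7 * (1 / real vv)"
  proof (rule markov0)
    have "avg ww (\<lambda>\<sigma>. \<Sum>l\<in>lt i. if zl \<sigma> l = zl \<sigma> i then (x l)\<^sup>2 else 0) = (\<Sum>l\<in>lt i. avg ww (\<lambda>\<sigma>. (x l)\<^sup>2 * of_bool (zl \<sigma> l = zl \<sigma> i)))"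
      unfolding avg_sum by (intro sum.cong avg_cong) auto
    also have "\<dots> = (\<Sum>l\<in>lt i. (x l)\<^sup>2 * (1 / ?d))"
      using col by (intro sum.cong) (auto simp: avg_cmult prb_def)
    also have "\<dots> = (\<Sum>l\<in>lt i. (x l)\<^sup>2) * (1 / ?d)" by (simp only: sum_distrib_right)
    also have "\<dots> \<le> (real kap * \<theta>\<^sup>2) * (1 / ?d)" using light_e by (intro mult_right_mono) auto
    also have "\<dots> = (real kap / real B) * (1 / real vv) * \<theta>\<^sup>2" by simp
    also have "\<dots> = (1 / 2) ^ 7 * (1 / real vv) * (p1 * \<theta>\<^sup>2)" unfolding kB by (simp add: power_divide)
    finally show "avg ww (\<lambda>\<sigma>. \<Sum>l\<in>lt i. if zl \<sigma> l = zl \<sigma> i then (x l)\<^sup>2 else 0) \<le> (1 / 2) ^ 7 * (1 / real vv) * (p1 * \<theta>\<^sup>2)" .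
  qed (simp_all add: sum_nonneg)
  have "prb ww (\<lambda>\<sigma>. unclean i (zl \<sigma>)) \<le> (1 / 2) ^ 411 * (1 / real vv) + (1 / 2) ^ 7 * (1 / real vv)"
    unfolding unclean_def by (rule order.trans[OF prb_disj add_mono[OF 1 2]])
  also have "\<dots> = ((1 / 2) ^ 411 + (1 / 2) ^ 7) * (1 / real vv)" by (rule distrib_right[symmetric])
  also have "\<dots> \<le> 1 * (1 / real vv)" by (intro mult_right_mono) (simp_all add: power_divide)
  finally show ?thesis by simp
qed

lemma msg_less: "msg t i < gg"
  unfolding msg_def gg_def by simp

text \<open>A good repetition transmits its bit correctly and without erasure. At most aa bad ones
  therefore cause at most aa errors, within the decoding radius, and at most aa erasures, within the
  allowance.\<close>

lemma clean_decode:
  assumes i: "i < n" "2 * \<theta> < \<bar>x i\<bar>" and cl: "\<not> unclean i (zl \<sigma>)" and t: "t < nb"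
    and b: "card {j\<in>{..<ell}. Bad (zl \<sigma>) (xrep t j) (zl \<sigma> i) i \<sigma>} \<le> aa"
  shows "xok \<sigma> (yv \<sigma>) \<theta> (zl \<sigma> i) t \<and> xdig \<sigma> (yv \<sigma>) (zl \<sigma> i) t = msg t i"
proof -
  let ?v = "zl \<sigma> i"
  let ?a = "\<lambda>j. arow \<sigma> (yv \<sigma>) (xrep t j) ?v" and ?bit = "\<lambda>j. bit (code ! msg t i) j"
  let ?BB = "{j\<in>{..<ell}. Bad (zl \<sigma>) (xrep t j) ?v i \<sigma>}"
  have good: "(?a j 0 < ?a j 1 \<longleftrightarrow> ?bit j) \<and> (\<theta> < ?a j 0 \<or> \<theta> < ?a j 1)" if j: "j < ell" "j \<notin> ?BB" for j
  proof -
    note f = xrep_facts[OF t j(1)]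
    have nb: "\<not> Bad (zl \<sigma>) (xrep t j) ?v i \<sigma>" using j by simp
    have c1: "\<bar>cf (xrep t j) v * x i\<bar> = \<bar>x i\<bar>" for v using f(1) by (simp add: cf_def sg_def abs_mult)
    have Y: "\<bar>Yf x \<sigma> (xrep t j) (hb \<sigma> (xrep t j) ?v + \<beta>) - (if cbit t j i = \<beta> then cf (xrep t j) (cw \<sigma> (xrep t j) i) * x i else 0)\<bar> \<le> \<theta> / 2" if "\<beta> < 2" for \<beta>
      using Yf_good[OF nb that] cl i(1) unfolding f(4,5) unclean_def by auto
    \<comment> \<open>The bucket that contains x_i reads more than 3\<theta>/2 if \<theta> is
      positive, its partner at most \<theta>/2. The second inequality also settles the case \<theta>
      = 0.\<close>
    have far: "\<theta> < \<bar>r\<bar> \<and> \<theta> / 2 < \<bar>r\<bar>" if "\<bar>r - u\<bar> \<le> \<theta> / 2" "\<bar>u\<bar> = \<bar>x i\<bar>" for r u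
      using that i(2) \<theta>_nonneg by linarith
    have big: "\<theta> < ?a j \<beta> \<and> \<theta> / 2 < ?a j \<beta>" if "\<beta> < 2" "cbit t j i = \<beta>" for \<beta>
      unfolding arow_yv[OF f(3) that(1)] by (rule far[OF _ c1]) (use Y[OF that(1)] that(2) in simp)
    have sm: "?a j \<beta> \<le> \<theta> / 2" if "\<beta> < 2" "cbit t j i \<noteq> \<beta>" for \<beta>
      unfolding arow_yv[OF f(3) that(1)] using Y[OF that(1)] that(2) by auto
    show ?thesis
    proof (cases "?bit j")
      case True
      then have "cbit t j i = 1" by (simp add: cbit_def)
      then show ?thesis using big[of 1] sm[of 0] True by auto
    next
      case False
      then have "cbit t j i = 0" by (simp add: cbit_def)
      then show ?thesis using big[of 0] sm[of 1] False by auto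
    qed
  qed
  have "card {j. j < ell \<and> (?a j 0 < ?a j 1) \<noteq> ?bit j} \<le> card ?BB" using good by (intro card_mono) auto
  then have tw: "tab (xword \<sigma> (yv \<sigma>) ?v t) = msg t i + 1"
    unfolding xword_def using b by (intro tab_word msg_less) auto
  have "xera \<sigma> (yv \<sigma>) \<theta> ?v t = (\<Sum>j\<in>{j\<in>{..<ell}. \<not> (\<theta> < ?a j 0 \<or> \<theta> < ?a j 1)}. 1)"
    unfolding xera_def by (intro sum.mono_neutral_cong_right) auto
  also have "\<dots> = card {j\<in>{..<ell}. \<not> (\<theta> < ?a j 0 \<or> \<theta> < ?a j 1)}" by simp
  also have "\<dots> \<le> card ?BB" using good by (intro card_mono) auto
  finally show ?thesis using tw b unfolding xok_def xdig_def by simp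
qed

text \<open>The labels are fixed first and the bit repetitions resampled. Clean labels are misread
  with probability at most 1 / vv by the union bound over digits, and unclean ones have probability
  1 / vv.\<close>

lemma prb_missX:
  assumes i: "i < n" "2 * \<theta> < \<bar>x i\<bar>"
  shows "prb ww (missX i) \<le> 2 / real vv"
proof -
  let ?F = "\<lambda>\<sigma>. \<not> unclean i (zl \<sigma>) \<and> (\<exists>t\<in>{..<nb}. aa + 1 \<le> card {j\<in>{..<ell}. Bad (zl \<sigma>) (xrep t j) (zl \<sigma> i) i \<sigma>})"
  have "prb ww ?F \<le> 1 / real vv"
  proof (rule prb_resample_le[where S = "RS XR"])
    fix \<sigma> assume "\<sigma> \<in> tapes ww"
    let ?z = "zl \<sigma>"
    let ?Q = "\<lambda>\<tau>. \<exists>t\<in>{..<nb}. aa + 1 \<le> card {j\<in>{..<ell}. Bad ?z (xrep t j) (?z i) i \<tau>}"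
    have e: "{j\<in>{..<ell}. Bad ?z (xrep t j) (?z i) i (override_on \<sigma> \<tau> (RS XR))} = {j\<in>{..<ell}. Bad ?z (xrep t j) (?z i) i \<tau>}"
      if "t \<in> {..<nb}" for t \<tau> using that Bad_XR[unfolded zl_XR] by (intro Collect_cong conj_cong refl) auto
    show "prb ww (\<lambda>\<tau>. ?F (override_on \<sigma> \<tau> (RS XR))) \<le> 1 / real vv"
    proof (cases "unclean i ?z")
      case True
      then show ?thesis by simp
    next
      case False
      have "prb ww (\<lambda>\<tau>. ?F (override_on \<sigma> \<tau> (RS XR))) \<le> prb ww ?Q"
        by (intro prb_mono) (simp only: zl_XR e cong: bex_cong)
      also have "\<dots> \<le> real (card {..<nb}) * (2 ^ ell * q0 ^ (aa + 1))"
      proof (rule prb_bex_le)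
        fix t assume t: "t \<in> {..<nb}"
        have "prb ww (\<lambda>\<tau>. aa + 1 \<le> card {j\<in>{..<ell}. Bad ?z (xrep t j) (?z i) i \<tau>}) \<le> 2 ^ card {..<ell} * q0 ^ (aa + 1)"
        proof (rule prb_many_Bad(1))
          show "xrep t j < ss" if "j \<in> {..<ell}" for j using that t xrep_facts by simp
          show "nd ?z (xrep t j) i \<le> 2 * nn" if "i < n" for i j using that nd_le zl_le by blast
          show "(\<Sum>l | l \<in> lt i \<and> nd ?z (xrep t j) l = ?z i. (x l)\<^sup>2) \<le> p1 * \<theta>\<^sup>2" if "j \<in> {..<ell}" for j
          proof -
            have "nd ?z (xrep t j) = ?z" using that t xrep_facts(4) by simp
            moreover have "(\<Sum>l | l \<in> lt i \<and> ?z l = ?z i. (x l)\<^sup>2) = (\<Sum>l\<in>lt i. if ?z l = ?z i then (x l)\<^sup>2 else 0)"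
              by (rule sum.inter_filter) simp
            ultimately show ?thesis using False unfolding unclean_def by simp
          qed
        qed (use inj_xrep in auto)
        then show "prb ww (\<lambda>\<tau>. aa + 1 \<le> card {j\<in>{..<ell}. Bad ?z (xrep t j) (?z i) i \<tau>}) \<le> 2 ^ ell * q0 ^ (aa + 1)" by simp
      qed simp
      also have "\<dots> \<le> 1 / real vv" using small_q0(2) by simp
      finally show ?thesis .
    qed
  qed
  moreover have "prb ww (missX i) \<le> prb ww (\<lambda>\<sigma>. unclean i (zl \<sigma>) \<or> ?F \<sigma>)"
  proof (rule prb_mono)
    fix \<sigma> assume m: "missX i \<sigma>"
    show "unclean i (zl \<sigma>) \<or> ?F \<sigma>"
    proof (rule ccontr)
      assume "\<not> ?thesis"
      then have "\<not> unclean i (zl \<sigma>)" "\<forall>t<nb. card {j\<in>{..<ell}. Bad (zl \<sigma>) (xrep t j) (zl \<sigma> i) i \<sigma>} \<le> aa" by (auto simp: not_le less_Suc_eq_le)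
      then show False using m clean_decode[OF i] unfolding missX_def by blast
    qed
  qed
  ultimately show ?thesis using prb_disj[of ww "\<lambda>\<sigma>. unclean i (zl \<sigma>)" ?F] prb_unclean[OF i(1)] by simp
qed

text \<open>After t digits the accumulator holds the leading part of i. All of i is covered, as
  \<open>gg ^ nb\<close> is at least \<open>nn\<close>.\<close>

lemma xval_eq:
  assumes "i < n" "\<not> missX i \<sigma>"
  shows "xval \<sigma> (yv \<sigma>) (zl \<sigma> i) nb = i"
proof -
  have "nn \<le> gg ^ nb" unfolding nn_def gg_def power_mult[symmetric] using nb_ell(4) by (intro power_increasing) (auto simp: mult.commute)
  then have lt: "i < gg ^ nb" using assms(1) n_le_nn by simp
  have "xval \<sigma> (yv \<sigma>) (zl \<sigma> i) t = i div gg ^ (nb - t)" if "t \<le> nb" for t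
    using that
  proof (induction t)
    case 0
    then show ?case using lt by simp
  next
    case (Suc t)
    have e: "nb - t = Suc (nb - 1 - t)" "nb - Suc t = nb - 1 - t" using Suc.prems by auto
    have "xdig \<sigma> (yv \<sigma>) (zl \<sigma> i) t = msg t i" using assms(2) Suc.prems unfolding missX_def by auto
    then have "xval \<sigma> (yv \<sigma>) (zl \<sigma> i) (Suc t) = i div (gg ^ (nb - 1 - t)) div gg * gg + (i div gg ^ (nb - 1 - t)) mod gg"
      using Suc unfolding e(1) by (simp add: msg_def div_mult2_eq[symmetric] mult.commute)
    then show ?case unfolding e(2) by simp
  qed
  from this[of nb] show ?thesis by simp
qed

lemma candX_hit:
  assumes "i < n" "\<not> missX i \<sigma>" "B * vv + nb * nok \<sigma> (yv \<sigma>) \<theta> (B * vv) \<le> c * B * nb"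
  shows "i \<in> set (candX \<sigma> (yv \<sigma>) \<theta>)"
proof -
  have "xval \<sigma> (yv \<sigma>) (zl \<sigma> i) nb \<in> set (candX \<sigma> (yv \<sigma>) \<theta>)"
    by (rule candX_model[OF assms(3) zl_less]) (use assms(1,2) xval_eq[OF assms(1,2)] in \<open>auto simp: missX_def\<close>)
  then show ?thesis unfolding xval_eq[OF assms(1,2)] .
qed

text \<open>Placeholder for the labels: outside the label repetitions keys do not depend on
  them.\<close>

abbreviation "z0 \<equiv> \<lambda>_ :: nat. 0 :: nat"

section \<open>Large coordinates: the tree\<close>

lemma gpass_light:
  assumes t: "t \<le> dd" and v: "v \<notin> heavy z0 (grep t 0)" and g: "gpass \<sigma> (yv \<sigma>) \<theta> t v"
  shows "\<exists>r\<in>{..<12}. Bad z0 (grep t r) v n \<sigma>"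
proof -
  obtain r where r: "r < 12" "\<theta> < arow \<sigma> (yv \<sigma>) (grep t r) v 0" using g unfolding gpass_def by blast
  note f = grep_facts[OF t r(1)] and f0 = grep_facts[OF t, of 0]
  have "Bad (zl \<sigma>) (grep t r) v n \<sigma>"
  proof (rule ccontr)
    assume b: "\<not> Bad (zl \<sigma>) (grep t r) v n \<sigma>"
    have "arow \<sigma> (yv \<sigma>) (grep t r) v 0 \<le> \<theta> / 2"
      using v f0(3)[of z0] unfolding heavy_def by (intro arow_light[OF f(2) b]) (auto simp: f(3))
    then show False using r(2) \<theta>_nonneg by simp
  qed
  moreover have "nd (zl \<sigma>) (grep t r) = nd z0 (grep t r)" using f(3) by simp
  ultimately show ?thesis using r(1) Bad_nd by blast
qed

abbreviation "GR t \<equiv> grep t ` {..<12}"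

lemma grep_GR: "r < 12 \<Longrightarrow> grep t r \<in> GR t' \<longleftrightarrow> t = t'"
  unfolding grep_def image_iff by (auto; presburger)

lemma gpass_ov:
  assumes "t \<le> dd" "t \<noteq> t'"
  shows "gpass (override_on \<sigma> \<tau> (RS (GR t'))) (yv (override_on \<sigma> \<tau> (RS (GR t')))) \<theta> t v = gpass \<sigma> (yv \<sigma>) \<theta> t v"
proof (rule gpass_cong[OF assms(1)])
  fix r :: nat assume r: "r < 12"
  show "arow (override_on \<sigma> \<tau> (RS (GR t'))) (yv (override_on \<sigma> \<tau> (RS (GR t')))) (grep t r) v 0 = arow \<sigma> (yv \<sigma>) (grep t r) v 0"
    using grep_facts(1,2)[OF assms(1) r] grep_GR[OF r, of t t'] assms(2) by (subst arow_ov) auto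
qed

text \<open>The nodes on a level are determined by the repetitions of strictly smaller levels, so
  those of the level itself are still fresh when its nodes are tested.\<close>

lemma Act_ov: "t \<le> t' \<Longrightarrow> t' \<le> dd \<Longrightarrow>
  Act (override_on \<sigma> \<tau> (RS (GR t'))) (yv (override_on \<sigma> \<tau> (RS (GR t')))) \<theta> t = Act \<sigma> (yv \<sigma>) \<theta> t"
proof (induction t)
  case (Suc t)
  then show ?case using gpass_ov[of t t' \<sigma> \<tau>] by simp
qed simp

text \<open>At most B nodes of a level are heavy; any other one passes with probability at most 12 *
  q0 \<le> 1/4 and has two children. The expectation thus obeys a' \<le> 2B + a/2, and 4B is the
  fixed point of this recursion.\<close>

lemma avg_Act: "t \<le> dd \<Longrightarrow> avg ww (\<lambda>\<sigma>. real (card (Act \<sigma> (yv \<sigma>) \<theta> t))) \<le> 4 * real B"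
proof (induction t)
  case 0
  then show ?case using B_pos by simp
next
  case (Suc t)
  then have t: "t \<le> dd" by simp
  have "avg ww (\<lambda>\<sigma>. real (card (Act \<sigma> (yv \<sigma>) \<theta> (Suc t)))) \<le> avg ww (\<lambda>\<sigma>. 2 * real B + 1 / 2 * real (card (Act \<sigma> (yv \<sigma>) \<theta> t)))"
  proof (rule avg_resample_le[where S = "RS (GR t)"])
    fix \<sigma> assume "\<sigma> \<in> tapes ww"
    define ov where "ov \<tau> = override_on \<sigma> \<tau> (RS (GR t))" for \<tau>
    let ?A = "Act \<sigma> (yv \<sigma>) \<theta> t" and ?H = "heavy z0 (grep t 0)"
    let ?L = "\<lambda>v \<tau>. \<exists>r\<in>{..<12}. Bad z0 (grep t r) v n \<tau>"
    have fA: "finite ?A" by (rule finite_Act)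
    have pt: "real (card (Act (ov \<tau>) (yv (ov \<tau>)) \<theta> (Suc t))) \<le> 2 * real B + (\<Sum>v\<in>?A - ?H. 2 * of_bool (?L v \<tau>))" for \<tau>
    proof -
      have "card (Act (ov \<tau>) (yv (ov \<tau>)) \<theta> (Suc t)) \<le> 2 * card {v\<in>?A. gpass (ov \<tau>) (yv (ov \<tau>)) \<theta> t v}"
        using card_Act_Suc[of "ov \<tau>" "yv (ov \<tau>)" \<theta> t] Act_ov[of t t \<sigma> \<tau>] t unfolding ov_def by simp
      also have "{v\<in>?A. gpass (ov \<tau>) (yv (ov \<tau>)) \<theta> t v} \<subseteq> ?H \<union> {v\<in>?A - ?H. ?L v \<tau>}"
      proof
        fix v assume v: "v \<in> {v\<in>?A. gpass (ov \<tau>) (yv (ov \<tau>)) \<theta> t v}"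
        show "v \<in> ?H \<union> {v\<in>?A - ?H. ?L v \<tau>}"
        proof (cases "v \<in> ?H")
          case False
          then have "?L v (ov \<tau>)" using v gpass_light[OF t False] by simp
          then have "?L v \<tau>" using grep_facts(2)[OF t] unfolding ov_def by (auto simp: Bad_ov)
          then show ?thesis using v False by simp
        qed simp
      qed
      then have "card {v\<in>?A. gpass (ov \<tau>) (yv (ov \<tau>)) \<theta> t v} \<le> card (?H \<union> {v\<in>?A - ?H. ?L v \<tau>})"
        using card_heavy(1) fA by (intro card_mono) auto
      also have "\<dots> \<le> B + card {v\<in>?A - ?H. ?L v \<tau>}"
        using card_Un_le card_heavy(2) add_le_mono1 le_trans by blast
      finally have 1: "card (Act (ov \<tau>) (yv (ov \<tau>)) \<theta> (Suc t)) \<le> 2 * (B + card {v\<in>?A - ?H. ?L v \<tau>})" by simp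
      have "real (card (Act (ov \<tau>) (yv (ov \<tau>)) \<theta> (Suc t))) \<le> real (2 * (B + card {v\<in>?A - ?H. ?L v \<tau>}))"
        using 1 by (simp only: of_nat_le_iff)
      also have "\<dots> = 2 * real B + 2 * (\<Sum>v\<in>?A - ?H. of_bool (?L v \<tau>))"
        using fA by (simp add: of_bool_def sum.If_cases Int_def)
      finally show ?thesis by (simp only: sum_distrib_left)
    qed
    have pl: "avg ww (\<lambda>\<tau>. 2 * of_bool (?L v \<tau>)) \<le> 1 / 2" if v: "v \<in> ?A - ?H" for v
    proof -
      have "prb ww (?L v) \<le> real (card {..<12::nat}) * q0"
      proof (rule prb_bex_le)
        fix r :: nat assume r: "r \<in> {..<12}"
        show "prb ww (Bad z0 (grep t r) v n) \<le> q0"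
        proof (rule prb_Bad)
          show "grep t r < ss" using r grep_facts[OF t] by simp
          show "nd z0 (grep t r) i \<le> 2 * nn" if "i < n" for i using that nd_le by simp
          have "nd z0 (grep t r) = nd z0 (grep t 0)" using r grep_facts(3)[OF t] by simp
          then show "(\<Sum>i | i \<in> lt n \<and> nd z0 (grep t r) i = v. (x i)\<^sup>2) \<le> p1 * \<theta>\<^sup>2"
            using v unfolding heavy_def by (auto simp: not_less)
        qed
      qed simp
      also have "\<dots> \<le> 1 / 4" by (simp add: power_divide)
      finally show ?thesis by (simp add: avg_cmult prb_def)
    qed
    have "avg ww (\<lambda>\<tau>. real (card (Act (ov \<tau>) (yv (ov \<tau>)) \<theta> (Suc t)))) \<le> avg ww (\<lambda>\<tau>. 2 * real B + (\<Sum>v\<in>?A - ?H. 2 * of_bool (?L v \<tau>)))"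
      using pt by (intro avg_mono) auto
    also have "\<dots> = 2 * real B + (\<Sum>v\<in>?A - ?H. avg ww (\<lambda>\<tau>. 2 * of_bool (?L v \<tau>)))"
      by (simp only: avg_add avg_const avg_sum)
    also have "\<dots> \<le> 2 * real B + real (card (?A - ?H)) * (1 / 2)"
      using pl by (intro add_left_mono sum_bounded_above) auto
    also have "\<dots> \<le> 2 * real B + 1 / 2 * real (card ?A)"
      using card_mono[of ?A "?A - ?H"] fA by simp
    finally show "avg ww (\<lambda>\<tau>. real (card (Act (override_on \<sigma> \<tau> (RS (GR t))) (yv (override_on \<sigma> \<tau> (RS (GR t)))) \<theta> (Suc t)))) \<le> 2 * real B + 1 / 2 * real (card ?A)"
      unfolding ov_def .
  qed
  also have "\<dots> = 2 * real B + 1 / 2 * avg ww (\<lambda>\<sigma>. real (card (Act \<sigma> (yv \<sigma>) \<theta> t)))"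
    by (simp only: avg_add avg_const avg_cmult)
  finally show ?case using Suc.IH[OF t] by simp
qed

definition missG :: "nat \<Rightarrow> (nat \<Rightarrow> nat) \<Rightarrow> bool" where
  "missG i \<sigma> \<longleftrightarrow> (\<exists>t\<in>{..dd}. \<not> gpass \<sigma> (yv \<sigma>) \<theta> t (gnode t i))"

lemma cw_addr:
  assumes "\<rho> < ss" "\<rho>' < ss"
  shows "2 * (j * ss + \<rho>') + 1 = 2 * (i * ss + \<rho>) + 1 \<longleftrightarrow> j = i \<and> \<rho>' = \<rho>"
proof -
  have "j * ss + \<rho>' = i * ss + \<rho> \<longleftrightarrow> j = i \<and> \<rho>' = \<rho>"
  proof
    assume e: "j * ss + \<rho>' = i * ss + \<rho>"
    have "(j * ss + \<rho>') div ss = j" "(i * ss + \<rho>) div ss = i" using assms by simp_all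
    then show "j = i \<and> \<rho>' = \<rho>" using e by simp
  qed simp
  moreover have "2 * p + 1 = 2 * q + 1 \<longleftrightarrow> p = q" for p q :: nat by presburger
  ultimately show ?thesis by (simp only:)
qed

text \<open>Only the coefficient of i itself is averaged. Whatever else lies in the bucket acts as a
  shift, which anticoncentration ignores; so neither the hashes nor coordinates of comparable size
  below the node matter, and the twelve repetitions are independent.\<close>

lemma prb_missG:
  assumes i: "i < n" "x i \<noteq> 0"
  shows "prb ww (missG i) \<le> real (dd + 1) * (\<theta> / \<bar>x i\<bar> + 1 / 2 ^ ww) ^ 12"
proof -
  let ?p = "\<theta> / \<bar>x i\<bar> + 1 / 2 ^ ww"
  have p0: "0 \<le> ?p" using \<theta>_nonneg by simp
  have "prb ww (missG i) \<le> real (card {..dd}) * ?p ^ 12"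
    unfolding missG_def
  proof (rule prb_bex_le)
    fix t assume "t \<in> {..dd}"
    then have t: "t \<le> dd" by simp
    let ?A = "\<lambda>r \<sigma>. arow \<sigma> (yv \<sigma>) (grep t r) (gnode t i) 0 \<le> \<theta>"
    define a where "a r = 2 * (i * ss + grep t r) + 1" for r
    note F = grep_facts[OF t]
    have hs: "hsh (override_on \<sigma> \<tau> {a r}) \<rho> k = hsh \<sigma> \<rho> k" for \<sigma> \<tau> r \<rho> k
    proof -
      have "2 * (k * ss + \<rho>) \<noteq> a r" unfolding a_def by presburger
      then show ?thesis by (simp add: hsh_def override_on_def)
    qed
    have hbs: "hb (override_on \<sigma> \<tau> {a r}) \<rho> k = hb \<sigma> \<rho> k" for \<sigma> \<tau> r \<rho> k by (simp add: hb_def hs)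
    have cws: "cw (override_on \<sigma> \<tau> {a r}) (grep t r') j = (if j = i \<and> r' = r then \<tau> (a r) else cw \<sigma> (grep t r') j)"
      if "r < 12" "r' < 12" for \<sigma> \<tau> r r' j
      using cw_addr[OF F(2)[OF that(1)] F(2)[OF that(2)], of j i] that
      by (auto simp: cw_def override_on_def grep_def a_def simp del: One_nat_def)
    have Ar: "?A r \<sigma> \<longleftrightarrow> \<bar>gam ww (cw \<sigma> (grep t r) i) * x i +
        (\<Sum>j\<in>{..<n} - {i}. if hb \<sigma> (grep t r) (gnode t j) = hb \<sigma> (grep t r) (gnode t i) then gam ww (cw \<sigma> (grep t r) j) * x j else 0)\<bar> \<le> \<theta>"
      if "r < 12" for r \<sigma>
    proof -
      have "Yf x \<sigma> (grep t r) (hb \<sigma> (grep t r) (gnode t i) + 0) = gam ww (cw \<sigma> (grep t r) i) * x i +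
        (\<Sum>j\<in>{..<n} - {i}. if hb \<sigma> (grep t r) (gnode t j) = hb \<sigma> (grep t r) (gnode t i) then gam ww (cw \<sigma> (grep t r) j) * x j else 0)"
        unfolding Yf_def F(3,4,5)[OF that] using i(1) by (subst sum.remove[of _ i]) auto
      then show ?thesis using arow_yv[OF F(2)[OF that], of 0 \<sigma> "gnode t i"] by simp
    qed
    have "prb ww (\<lambda>\<sigma>. \<forall>r\<in>{..<12::nat}. ?A r \<sigma>) \<le> ?p ^ card {..<12::nat}"
    \<comment> \<open>The resampled block is a single tape cell, the coefficient of i in one
      repetition.\<close>
    proof (rule prb_all_indep[where S = "\<lambda>r. {a r}"])
      fix r :: nat and \<sigma> assume r: "r \<in> {..<12}" and "\<sigma> \<in> tapes ww"
      let ?R = "\<Sum>j\<in>{..<n} - {i}. if hb \<sigma> (grep t r) (gnode t j) = hb \<sigma> (grep t r) (gnode t i) then gam ww (cw \<sigma> (grep t r) j) * x j else 0"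
      have al: "a r < 2 ^ ww" unfolding a_def using r F(2) i n_le_nn by (intro addr_less) auto
      have "prb ww (\<lambda>\<tau>. ?A r (override_on \<sigma> \<tau> {a r})) = prb ww (\<lambda>\<tau>. \<bar>gam ww (\<tau> (a r)) * x i + ?R\<bar> \<le> \<theta>)"
      proof (rule prb_cong)
        fix \<tau>
        have "(\<Sum>j\<in>{..<n} - {i}. if hb (override_on \<sigma> \<tau> {a r}) (grep t r) (gnode t j) = hb (override_on \<sigma> \<tau> {a r}) (grep t r) (gnode t i)
            then gam ww (cw (override_on \<sigma> \<tau> {a r}) (grep t r) j) * x j else 0) = ?R"
          using r by (intro sum.cong) (simp_all only: hbs, auto simp: cws)
        then show "?A r (override_on \<sigma> \<tau> {a r}) = (\<bar>gam ww (\<tau> (a r)) * x i + ?R\<bar> \<le> \<theta>)"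
          using r Ar[of r] cws[of r r \<sigma> \<tau> i] by simp
      qed
      also have "\<dots> = (\<Sum>v<2 ^ ww. of_bool (\<bar>gam ww v * x i + ?R\<bar> \<le> \<theta>)) / 2 ^ ww"
        unfolding prb_def by (rule avg_single[OF al])
      also have "\<dots> \<le> ?p" by (rule gam_concentration[OF i(2) \<theta>_nonneg])
      finally show "prb ww (\<lambda>\<tau>. ?A r (override_on \<sigma> \<tau> {a r})) \<le> ?p" .
    next
      fix r' r :: nat and \<sigma> \<tau> assume r: "r' \<in> {..<12}" "r \<in> {..<12}" "r' \<noteq> r"
      have "(\<Sum>j\<in>{..<n} - {i}. if hb (override_on \<sigma> \<tau> {a r}) (grep t r') (gnode t j) = hb (override_on \<sigma> \<tau> {a r}) (grep t r') (gnode t i)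
            then gam ww (cw (override_on \<sigma> \<tau> {a r}) (grep t r') j) * x j else 0)
         = (\<Sum>j\<in>{..<n} - {i}. if hb \<sigma> (grep t r') (gnode t j) = hb \<sigma> (grep t r') (gnode t i) then gam ww (cw \<sigma> (grep t r') j) * x j else 0)"
        using r by (intro sum.cong) (simp_all only: hbs, auto simp: cws)
      then show "?A r' (override_on \<sigma> \<tau> {a r}) = ?A r' \<sigma>"
        using r Ar[of r'] cws[of r r' \<sigma> \<tau> i] by simp
    qed (use p0 in auto)
    moreover have "prb ww (\<lambda>\<sigma>. \<not> gpass \<sigma> (yv \<sigma>) \<theta> t (gnode t i)) \<le> prb ww (\<lambda>\<sigma>. \<forall>r\<in>{..<12::nat}. ?A r \<sigma>)"
      unfolding gpass_def by (rule prb_mono) (metis lessThan_iff not_less)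
    ultimately show "prb ww (\<lambda>\<sigma>. \<not> gpass \<sigma> (yv \<sigma>) \<theta> t (gnode t i)) \<le> ?p ^ 12" by simp
  qed simp
  then show ?thesis by simp
qed

lemma candG_hit:
  assumes "i < n" "\<not> missG i \<sigma>" "(\<Sum>t\<le>dd. card (Act \<sigma> (yv \<sigma>) \<theta> t)) \<le> c * B * dd"
  shows "i \<in> set (cands \<theta> \<sigma>)"
  unfolding cands_def using assms(2) by (intro candG_model[OF assms(3,1)]) (auto simp: missG_def gnode_def)

section \<open>Estimates and the number of trials\<close>

definition badE :: "nat \<Rightarrow> nat \<Rightarrow> (nat \<Rightarrow> nat) \<Rightarrow> bool" where
  "badE i j \<sigma> = Bad z0 (2 * dd + j) i i \<sigma>"

definition egood :: "(nat \<Rightarrow> nat) \<Rightarrow> bool" where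
  "egood \<sigma> \<longleftrightarrow> (\<forall>i\<in>{..<n}. \<not> 2 * dd \<le> card {j\<in>{..<rr}. badE i j \<sigma>})"

lemma inj_E: "inj_on (\<lambda>j. 2 * dd + j) A" by (simp add: inj_on_def)

lemma own_E: "(\<Sum>l | l \<in> lt i \<and> nd z0 (2 * dd + j) l = i. (x l)\<^sup>2) \<le> p1 * \<theta>\<^sup>2" if "j < rr"
proof -
  have "{l. l \<in> lt i \<and> nd z0 (2 * dd + j) l = i} = {}" using erep_facts(3)[OF that] by auto
  then have "(\<Sum>l | l \<in> lt i \<and> nd z0 (2 * dd + j) l = i. (x l)\<^sup>2) = 0" by (simp only: sum.empty)
  then show ?thesis by simp
qed

text \<open>At least half of 4 dd repetitions are bad with probability at most (2^4 * q0^2)^dd,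
  which is small enough for a union bound over all indices. The estimates are therefore reliable for
  every candidate at once.\<close>

lemma prb_egood: "prb ww (\<lambda>\<sigma>. \<not> egood \<sigma>) \<le> 1 / real vv"
proof -
  have "prb ww (\<lambda>\<sigma>. \<not> egood \<sigma>) \<le> prb ww (\<lambda>\<sigma>. \<exists>i\<in>{..<n}. 2 * dd \<le> card {j\<in>{..<rr}. badE i j \<sigma>})"
    unfolding egood_def by (intro prb_mono) blast
  also have "\<dots> \<le> real (card {..<n}) * (2 ^ rr * q0 ^ (2 * dd))"
  proof (rule prb_bex_le)
    fix i assume i: "i \<in> {..<n}"
    have "prb ww (\<lambda>\<sigma>. 2 * dd \<le> card {j\<in>{..<rr}. badE i j \<sigma>}) \<le> 2 ^ card {..<rr} * q0 ^ (2 * dd)"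
      unfolding badE_def
      by (rule prb_many_Bad(1)) (use inj_E erep_facts own_E nd_le n_le_nn in auto)
    then show "prb ww (\<lambda>\<sigma>. 2 * dd \<le> card {j\<in>{..<rr}. badE i j \<sigma>}) \<le> 2 ^ rr * q0 ^ (2 * dd)" by simp
  qed simp
  also have "\<dots> \<le> real nn * (2 ^ rr * q0 ^ (2 * dd))" using n_le_nn by (intro mult_right_mono) auto
  also have "\<dots> = (2 * 2 ^ 4 * q0 ^ 2) ^ dd"
    unfolding nn_def rr_def by (simp only: of_nat_power of_nat_numeral power_mult power_mult_distrib mult.assoc)
  also have "\<dots> \<le> (1 / 2) ^ dd" by (intro power_mono) (simp_all add: power_divide)
  also have "\<dots> \<le> 1 / real vv"
  proof -
    have "vv < 2 ^ dd" using vv_dd(1) less_exp[of dd] by linarith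
    then have "real vv \<le> real (2 ^ dd)" by (simp only: of_nat_le_iff less_imp_le)
    then show ?thesis using vv_real(1) by (simp add: power_divide frac_le)
  qed
  finally show ?thesis .
qed

lemma eval_close:
  assumes i: "i < n" and j: "j < rr" and nb: "\<not> badE i j \<sigma>"
  shows "\<bar>eval_at \<sigma> (yv \<sigma>) i j - x i\<bar> \<le> \<theta> / 2"
proof -
  let ?\<rho> = "2 * dd + j"
  note f = erep_facts[OF j]
  have "nd (zl \<sigma>) ?\<rho> = nd z0 ?\<rho>" using f(3) by (simp add: fun_eq_iff)
  then have b: "\<not> Bad (zl \<sigma>) ?\<rho> i i \<sigma>" using nb Bad_nd unfolding badE_def by blast
  have cf: "cf ?\<rho> = sg" using f(1) by (simp add: cf_def fun_eq_iff)
  have "\<bar>Yf x \<sigma> ?\<rho> (hb \<sigma> ?\<rho> i + 0) - (if i < n \<and> bt ?\<rho> i = 0 then cf ?\<rho> (cw \<sigma> ?\<rho> i) * x i else 0)\<bar> \<le> \<theta> / 2"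
    by (rule Yf_good[OF b]) (use f in auto)
  then have Y: "\<bar>Yf x \<sigma> ?\<rho> (hb \<sigma> ?\<rho> i) - sg (cw \<sigma> ?\<rho> i) * x i\<bar> \<le> \<theta> / 2" using i f(4) cf by simp
  have h: "hb \<sigma> ?\<rho> i < B" using hb_less[of \<sigma> ?\<rho> i] by simp
  have "eval_at \<sigma> (yv \<sigma>) i j = sg (cw \<sigma> ?\<rho> i) * Yf x \<sigma> ?\<rho> (hb \<sigma> ?\<rho> i)"
    unfolding eval_at_def row_yv[OF f(2) h] ..
  moreover have "sg (cw \<sigma> ?\<rho> i) = 1 \<or> sg (cw \<sigma> ?\<rho> i) = -1" by (simp add: sg_def)
  moreover have "\<bar>s * u - r\<bar> \<le> \<theta> / 2" if "\<bar>u - s * r\<bar> \<le> \<theta> / 2" "s = 1 \<or> s = -1" for s u r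
    using that(2)
  proof
    assume s: "s = -1"
    then have "\<bar>u + r\<bar> \<le> \<theta> / 2" using that(1) by simp
    then have "\<bar>- u - r\<bar> \<le> \<theta> / 2" by linarith
    then show ?thesis unfolding s by simp
  qed (use that(1) in simp)
  ultimately show ?thesis using Y by simp
qed

lemma ecnt_card: "ecnt \<sigma> y \<theta> i v = card {j\<in>{..<rr}. \<bar>eval_at \<sigma> y i j - v\<bar> \<le> 2 * \<theta>}"
proof -
  have "ecnt \<sigma> y \<theta> i v = (\<Sum>j\<in>{j\<in>{..<rr}. \<bar>eval_at \<sigma> y i j - v\<bar> \<le> 2 * \<theta>}. 1)"
    unfolding ecnt_def by (intro sum.mono_neutral_cong_right) auto
  then show ?thesis by simp
qed

lemma egood_card:
  assumes "egood \<sigma>" "i < n"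
  shows "rr < 2 * card {j\<in>{..<rr}. \<not> badE i j \<sigma>}"
proof -
  have "card ({j\<in>{..<rr}. badE i j \<sigma>} \<union> {j\<in>{..<rr}. \<not> badE i j \<sigma>}) = card {j\<in>{..<rr}. badE i j \<sigma>} + card {j\<in>{..<rr}. \<not> badE i j \<sigma>}"
    by (rule card_Un_disjoint) auto
  moreover have "{j\<in>{..<rr}. badE i j \<sigma>} \<union> {j\<in>{..<rr}. \<not> badE i j \<sigma>} = {..<rr}" by blast
  ultimately have "card {j\<in>{..<rr}. badE i j \<sigma>} + card {j\<in>{..<rr}. \<not> badE i j \<sigma>} = rr" by (simp only: card_lessThan)
  moreover have "card {j\<in>{..<rr}. badE i j \<sigma>} < 2 * dd" using assms unfolding egood_def by (meson lessThan_iff not_le)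
  ultimately show ?thesis unfolding rr_def by linarith
qed

text \<open>Two majorities meet: some good repetition agrees with v up to 2\<theta> and is itself
  within \<theta>/2 of the truth.\<close>

lemma accept_close:
  assumes e: "egood \<sigma>" and i: "i < n" and a: "rr < 2 * ecnt \<sigma> (yv \<sigma>) \<theta> i v"
  shows "\<bar>v - x i\<bar> \<le> 3 * \<theta>"
proof -
  let ?G = "{j\<in>{..<rr}. \<not> badE i j \<sigma>}" and ?C = "{j\<in>{..<rr}. \<bar>eval_at \<sigma> (yv \<sigma>) i j - v\<bar> \<le> 2 * \<theta>}"
  have "?G \<inter> ?C \<noteq> {}"
  proof
    assume "?G \<inter> ?C = {}"
    then have "card ?G + card ?C = card (?G \<union> ?C)" by (simp add: card_Un_disjoint)
    also have "\<dots> \<le> card {..<rr}" by (intro card_mono) auto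
    finally show False using egood_card[OF e i] a unfolding ecnt_card by simp
  qed
  then obtain j where "j < rr" "\<not> badE i j \<sigma>" "\<bar>eval_at \<sigma> (yv \<sigma>) i j - v\<bar> \<le> 2 * \<theta>" by blast
  then show ?thesis using eval_close[OF i, of j \<sigma>] \<theta>_nonneg by linarith
qed

text \<open>Two good repetitions differ by at most \<theta>, so all good ones, a majority, agree
  with a good pivot.\<close>

lemma good_accept:
  assumes e: "egood \<sigma>" and i: "i < n" and t: "t < rr" "\<not> badE i t \<sigma>"
  shows "acE \<sigma> (yv \<sigma>) \<theta> i t"
proof -
  have "card {j\<in>{..<rr}. \<not> badE i j \<sigma>} \<le> ecnt \<sigma> (yv \<sigma>) \<theta> i (eval_at \<sigma> (yv \<sigma>) i t)"
    unfolding ecnt_card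
  proof (intro card_mono subsetI)
    fix j assume "j \<in> {j\<in>{..<rr}. \<not> badE i j \<sigma>}"
    then have "j < rr" "\<bar>eval_at \<sigma> (yv \<sigma>) i j - x i\<bar> \<le> \<theta> / 2" using eval_close[OF i] by auto
    moreover from this have "\<bar>eval_at \<sigma> (yv \<sigma>) i j - eval_at \<sigma> (yv \<sigma>) i t\<bar> \<le> 2 * \<theta>"
      using eval_close[OF i t] \<theta>_nonneg by linarith
    ultimately show "j \<in> {j\<in>{..<rr}. \<bar>eval_at \<sigma> (yv \<sigma>) i j - eval_at \<sigma> (yv \<sigma>) i t\<bar> \<le> 2 * \<theta>}" by simp
  qed simp
  then show ?thesis using egood_card[OF e i] unfolding acE_def by linarith
qed

definition tE :: "nat \<Rightarrow> (nat \<Rightarrow> nat) \<Rightarrow> nat" where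
  "tE i \<sigma> = 1 + card {t\<in>{..<rr}. \<forall>t'\<in>{..t}. badE i t' \<sigma>}"

lemma TE_le:
  assumes "egood \<sigma>" "i < n"
  shows "TE \<sigma> (yv \<sigma>) \<theta> i \<le> tE i \<sigma>"
  unfolding TE_def tE_def
proof (intro add_left_mono card_mono subsetI)
  fix t assume t: "t \<in> {t. t < rr \<and> (\<forall>t'\<le>t. \<not> acE \<sigma> (yv \<sigma>) \<theta> i t')}"
  have "badE i t' \<sigma>" if "t' \<le> t" for t'
  proof (rule ccontr)
    assume b: "\<not> badE i t' \<sigma>"
    have "t' < rr" using t that by simp
    then show False using good_accept[OF assms _ b] t that by blast
  qed
  then show "t \<in> {t\<in>{..<rr}. \<forall>t'\<in>{..t}. badE i t' \<sigma>}" using t by simp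
qed simp

text \<open>The first t + 1 pivots are all bad with probability at most q0^(t+1), so the expected
  number of trials is dominated by a geometric series.\<close>

lemma avg_tE: assumes "i < n" shows "avg ww (\<lambda>\<sigma>. real (tE i \<sigma>)) \<le> 2"
proof -
  have "avg ww (\<lambda>\<sigma>. real (tE i \<sigma>)) = avg ww (\<lambda>\<sigma>. 1 + (\<Sum>t\<in>{..<rr}. of_bool (\<forall>t'\<in>{..t}. badE i t' \<sigma>)))"
    unfolding tE_def by (intro avg_cong) (simp add: of_bool_def sum.If_cases Int_def)
  also have "\<dots> = 1 + (\<Sum>t\<in>{..<rr}. prb ww (\<lambda>\<sigma>. \<forall>t'\<in>{..t}. badE i t' \<sigma>))"
    by (simp only: avg_add avg_const avg_sum prb_def)
  also have "\<dots> \<le> 1 + (\<Sum>t\<in>{..<rr}. (1 / 2) ^ Suc t)"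
  proof (intro add_left_mono sum_mono)
    fix t assume t: "t \<in> {..<rr}"
    have "prb ww (\<lambda>\<sigma>. \<forall>t'\<in>{..t}. badE i t' \<sigma>) \<le> q0 ^ card {..t}"
      unfolding badE_def
      by (rule prb_many_Bad(2)) (use t inj_E erep_facts own_E nd_le n_le_nn in auto)
    also have "\<dots> \<le> (1 / 2) ^ card {..t}" by (intro power_mono) (simp_all add: power_divide)
    finally show "prb ww (\<lambda>\<sigma>. \<forall>t'\<in>{..t}. badE i t' \<sigma>) \<le> (1 / 2) ^ Suc t" by simp
  qed
  also have "(\<Sum>t<m. (1 / 2 :: real) ^ Suc t) = 1 - (1 / 2) ^ m" for m by (induction m) simp_all
  then have "1 + (\<Sum>t\<in>{..<rr}. (1 / 2 :: real) ^ Suc t) \<le> 2" by simp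
  finally show ?thesis .
qed

lemma cands_less: "i \<in> set (cands \<theta> \<sigma>) \<Longrightarrow> i < n"
  unfolding cands_def using candG_less candX_less by blast

lemma avg_cands: "avg ww (\<lambda>\<sigma>. real (length (cands \<theta> \<sigma>))) \<le> 6 * real B"
proof -
  have "avg ww (\<lambda>\<sigma>. real (length (cands \<theta> \<sigma>))) \<le> avg ww (\<lambda>\<sigma>. real (nok \<sigma> (yv \<sigma>) \<theta> (B * vv)) + real (card (Act \<sigma> (yv \<sigma>) \<theta> dd)))"
  proof (rule avg_mono)
    fix \<sigma>
    have "length (cands \<theta> \<sigma>) \<le> nok \<sigma> (yv \<sigma>) \<theta> (B * vv) + card (Act \<sigma> (yv \<sigma>) \<theta> dd)"
      unfolding cands_def by (rule order.trans[OF length_candG add_right_mono[OF length_candX]])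
    then show "real (length (cands \<theta> \<sigma>)) \<le> real (nok \<sigma> (yv \<sigma>) \<theta> (B * vv)) + real (card (Act \<sigma> (yv \<sigma>) \<theta> dd))"
      unfolding of_nat_add[symmetric] of_nat_le_iff .
  qed
  also have "\<dots> \<le> 2 * real B + 4 * real B" unfolding avg_add by (intro add_mono avg_nok avg_Act) simp
  finally show ?thesis by simp
qed

lemma sum_list_real: "real (\<Sum>i\<leftarrow>cs. f i) = (\<Sum>i\<leftarrow>cs. real (f i))" for f :: "nat \<Rightarrow> nat"
  by (induction cs) auto

lemma avg_sum_list: "avg ww (\<lambda>\<sigma>. \<Sum>i\<leftarrow>cs. f i \<sigma>) = (\<Sum>i\<leftarrow>cs. avg ww (f i))"
  by (induction cs) (simp_all add: avg_add)

text \<open>Resampling the estimate repetitions leaves the candidate list fixed, hence the expected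
  total is at most twice the expected length of the list, 2 * 6 B.\<close>

lemma avg_trials: "avg ww (\<lambda>\<sigma>. real (\<Sum>i\<leftarrow>cands \<theta> \<sigma>. tE i \<sigma>)) \<le> 12 * real B"
proof -
  have "avg ww (\<lambda>\<sigma>. real (\<Sum>i\<leftarrow>cands \<theta> \<sigma>. tE i \<sigma>)) \<le> avg ww (\<lambda>\<sigma>. 2 * real (length (cands \<theta> \<sigma>)))"
  proof (rule avg_resample_le[where S = "RS {2 * dd..<6 * dd}"])
    fix \<sigma> assume "\<sigma> \<in> tapes ww"
    have tE: "tE i (override_on \<sigma> \<tau> (RS {2 * dd..<6 * dd})) = tE i \<tau>" for i \<tau>
    proof -
      have "badE i j (override_on \<sigma> \<tau> (RS {2 * dd..<6 * dd})) = badE i j \<tau>" if "j < rr" for j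
        unfolding badE_def using erep_facts(1,2)[OF that] by (simp add: Bad_ov)
      then show ?thesis unfolding tE_def by (intro arg_cong[where f = "\<lambda>A. 1 + card A"]) auto
    qed
    have "avg ww (\<lambda>\<tau>. real (\<Sum>i\<leftarrow>cands \<theta> (override_on \<sigma> \<tau> (RS {2 * dd..<6 * dd})). tE i (override_on \<sigma> \<tau> (RS {2 * dd..<6 * dd}))))
      = (\<Sum>i\<leftarrow>cands \<theta> \<sigma>. avg ww (\<lambda>\<tau>. real (tE i \<tau>)))"
      unfolding cands_ov_E tE sum_list_real avg_sum_list ..
    also have "\<dots> \<le> (\<Sum>i\<leftarrow>cands \<theta> \<sigma>. 2)" using avg_tE cands_less by (intro sum_list_mono) auto
    finally show "avg ww (\<lambda>\<tau>. real (\<Sum>i\<leftarrow>cands \<theta> (override_on \<sigma> \<tau> (RS {2 * dd..<6 * dd})). tE i (override_on \<sigma> \<tau> (RS {2 * dd..<6 * dd}))))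
      \<le> 2 * real (length (cands \<theta> \<sigma>))" by (simp add: sum_list_triv mult.commute)
  qed
  also have "\<dots> \<le> 2 * (6 * real B)" unfolding avg_cmult using avg_cands by simp
  finally show ?thesis by simp
qed

end

section \<open>Combining the failures\<close>

lemma sum_if_subset: "finite H \<Longrightarrow> A \<subseteq> H \<Longrightarrow> (\<Sum>i\<in>H. if i \<in> A then f i else 0) = sum f A"
  for f :: "'a \<Rightarrow> real"
  by (simp add: sum.inter_restrict[symmetric] Int_absorb1)

context sketch_prob
begin

text \<open>Reported values err by at most 3\<theta> and exceed 6\<theta>, so a reported coordinate
  has size at least 3\<theta>, and one above 9\<theta> is reported if it is examined successfully.
  This accounts for 81 \<theta>^2 per unreported coordinate; the part 3 c bounds the energy that the
  searches lose, 2c for the moderate and c for the large coordinates.\<close>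

definition gout :: "nat set \<Rightarrow> nat \<Rightarrow> real \<Rightarrow> (nat \<times> real) list \<Rightarrow> bool" where
  "gout H k \<theta> out \<longleftrightarrow> distinct (map fst out) \<and> (\<forall>(i, v)\<in>set out. i < n \<and> 6 * \<theta> < \<bar>v\<bar> \<and> \<bar>v - x i\<bar> \<le> 3 * \<theta>) \<and>
     (\<Sum>i\<in>H - fst ` set out. (x i)\<^sup>2) \<le> (81 + 3 * real c) * (real k * \<theta>\<^sup>2)"

end

context sketch_thr
begin

text \<open>Coordinates beyond \<theta> * 2^ww are out of reach of the energy argument, because the
  discreteness of the coefficients dominates the failure probability; for \<theta> = 0 this concerns
  every nonzero coordinate. A union bound over all of them is affordable.\<close>

lemma ultra_small: "real n * (real (dd + 1) * (2 / 2 ^ ww) ^ 12) \<le> 1 / real vv"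
proof -
  have N: "(1::real) \<le> real nn" using nn_ge by simp
  have p: "(2::real) ^ ww = real nn ^ 8" using PW_eq by (metis of_nat_numeral of_nat_power)
  have "2 * nn \<le> nn ^ 8" using nn_pows nn_ge PW_eq by linarith
  then have "2 * real nn \<le> real nn ^ 8" by (metis of_nat_le_iff of_nat_mult of_nat_numeral of_nat_power)
  then have q: "2 / 2 ^ ww \<le> 1 / real nn" unfolding p using N by (simp add: divide_le_eq pos_le_divide_eq mult.commute)
  have d: "real (dd + 1) \<le> real nn" "real vv \<le> real nn" "real n \<le> real nn"
    using bnds(1) vv_dd(1) n_le_nn dd_pos by simp_all
  have "real n * (real (dd + 1) * (2 / 2 ^ ww) ^ 12) * real vv \<le> real nn * (real nn * (1 / real nn) ^ 12) * real nn"
    using d q N by (intro mult_mono power_mono) auto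
  also have "\<dots> = (1 / real nn) ^ 9" using N by (simp add: power_divide eval_nat_numeral)
  also have "\<dots> \<le> 1" using N by (intro power_le_one) auto
  finally show ?thesis using vv_real(1) by (simp add: pos_le_divide_eq)
qed

text \<open>Origin of the twelve repetitions. With u = \<theta> / |x_i| the failure is at most (dd +
  1) (2u)^12. Two factors u turn x_i^2 into \<theta>^2; the other ten equal (u^2)^5 and, as vv * u^2
  \<le> 1, cancel dd + 1 \<le> 2 vv^4 and one more \<open>vv\<close>, which swallows the constant
  2^13.\<close>

lemma giant_small:
  assumes g: "real vv * \<theta>\<^sup>2 < (x i)\<^sup>2" "\<bar>x i\<bar> \<le> \<theta> * 2 ^ ww" and i: "i < n"
  shows "(x i)\<^sup>2 * prb ww (missG i) \<le> \<theta>\<^sup>2"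
proof -
  have "0 \<le> real vv * \<theta>\<^sup>2" by simp
  have x0: "x i \<noteq> 0"
  proof
    assume "x i = 0"
    then have "(x i)\<^sup>2 = 0" by simp
    then show False using g(1) \<open>0 \<le> real vv * \<theta>\<^sup>2\<close> by linarith
  qed
  define u where "u = \<theta> / \<bar>x i\<bar>"
  have u0: "0 \<le> u" using \<theta>_nonneg by (simp add: u_def)
  have u1: "1 / 2 ^ ww \<le> u" using g(2) x0 by (simp add: u_def field_simps)
  have xu: "(x i)\<^sup>2 * u\<^sup>2 = \<theta>\<^sup>2" using x0 by (simp add: u_def power_divide)
  have "real vv * u\<^sup>2 * (x i)\<^sup>2 \<le> 1 * (x i)\<^sup>2" using g(1) xu by (simp add: mult.assoc mult.commute[of "u\<^sup>2"])
  then have vu: "real vv * u\<^sup>2 \<le> 1" using x0 by simp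
  have "prb ww (missG i) \<le> real (dd + 1) * (u + 1 / 2 ^ ww) ^ 12" unfolding u_def by (rule prb_missG[OF i x0])
  also have "\<dots> \<le> real (dd + 1) * (2 * u) ^ 12" using u0 u1 by (intro mult_left_mono power_mono) auto
  also have "\<dots> \<le> (2 * real vv ^ 4) * (2 * u) ^ 12"
  proof (intro mult_right_mono)
    have "1 \<le> vv ^ 4" using vv_ge(2) by simp
    then have "dd + 1 \<le> 2 * vv ^ 4" using dd_le_vv(1) by linarith
    then have "real (dd + 1) \<le> real (2 * vv ^ 4)" by (simp only: of_nat_le_iff)
    then show "real (dd + 1) \<le> 2 * real vv ^ 4" by simp
  qed (use u0 in simp)
  finally have "(x i)\<^sup>2 * prb ww (missG i) \<le> (x i)\<^sup>2 * ((2 * real vv ^ 4) * (2 * u) ^ 12)" by (intro mult_left_mono) auto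
  also have "\<dots> = 2 ^ 13 * (real vv ^ 4 * (u\<^sup>2) ^ 5) * ((x i)\<^sup>2 * u\<^sup>2)"
    by (simp add: power_mult_distrib power_mult[symmetric] power_add[symmetric])
  also have "2 ^ 13 * (real vv ^ 4 * (u\<^sup>2) ^ 5) \<le> real vv * (real vv ^ 4 * (u\<^sup>2) ^ 5)"
    using vv_real(1) by (intro mult_right_mono) auto
  also have "real vv * (real vv ^ 4 * (u\<^sup>2) ^ 5) = (real vv * u\<^sup>2) ^ 5" by (simp add: power_mult_distrib eval_nat_numeral)
  also have "\<dots> \<le> 1" using vu by (intro power_le_one) auto
  finally show ?thesis unfolding xu by (simp add: mult_right_mono)
qed

text \<open>The expected loss is at most 2\<theta>^2 for a head coordinate of moderate size, whose
  energy is at most vv * \<theta>^2 while its failure probability is at most 2 / vv, and at most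
  \<theta>^2 for a large one. Markov's inequality turns these and the expected costs into failure
  probabilities O(1 / c).\<close>

lemma prb_gout:
  assumes H: "H \<subseteq> {..<n}" "card H \<le> k" and c2: "2 \<le> c" "c \<le> vv"
  shows "prb ww (\<lambda>\<sigma>. \<not> gout H k \<theta> (dec \<theta> \<sigma>)) \<le> 28 / real c"
proof -
  let ?nok = "\<lambda>\<sigma>. nok \<sigma> (yv \<sigma>) \<theta> (B * vv)" and ?act = "\<lambda>\<sigma>. \<Sum>t\<le>dd. card (Act \<sigma> (yv \<sigma>) \<theta> t)"
  let ?tr = "\<lambda>\<sigma>. \<Sum>i\<leftarrow>cands \<theta> \<sigma>. tE i \<sigma>"
  let ?Hm = "{i\<in>H. 2 * \<theta> < \<bar>x i\<bar> \<and> (x i)\<^sup>2 \<le> real vv * \<theta>\<^sup>2}"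
  let ?Hg = "{i\<in>H. real vv * \<theta>\<^sup>2 < (x i)\<^sup>2 \<and> \<bar>x i\<bar> \<le> \<theta> * 2 ^ ww}"
  let ?U = "{i\<in>{..<n}. \<theta> * 2 ^ ww < \<bar>x i\<bar>}"
  let ?LM = "\<lambda>\<sigma>. \<Sum>i\<in>?Hm. (x i)\<^sup>2 * of_bool (missX i \<sigma>)" and ?LG = "\<lambda>\<sigma>. \<Sum>i\<in>?Hg. (x i)\<^sup>2 * of_bool (missG i \<sigma>)"
  \<comment> \<open>In this order: unreliable estimates, exhausted budget of the labels, of the
    tree, of the trials, a lost coordinate of extreme size, too much lost energy of moderate and of
    large size. Their bounds 1, 4, 8, 12, 1, 1, 1 over c add up to 28 / c.\<close>
  define E where "E = [\<lambda>\<sigma>. \<not> egood \<sigma>, \<lambda>\<sigma>. real ((c - 1) * B) < real (?nok \<sigma>), \<lambda>\<sigma>. real (c * B * dd) < real (?act \<sigma>),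
    \<lambda>\<sigma>. real (c * B) < real (?tr \<sigma>), \<lambda>\<sigma>. \<exists>i\<in>?U. missG i \<sigma>, \<lambda>\<sigma>. 2 * real c * (real k * \<theta>\<^sup>2) < ?LM \<sigma>, \<lambda>\<sigma>. real c * (real k * \<theta>\<^sup>2) < ?LG \<sigma>]"
  have c0: "0 < real c" and B0: "0 < real B" using c2 B_pos by auto
  have finH: "finite H" using H(1) finite_subset by blast
  have vc: "1 / real vv \<le> 1 / real c" using c2 c0 by (intro divide_left_mono) auto
  have p0: "prb ww (E ! 0) \<le> 1 / real c" using prb_egood vc by (simp add: E_def)
  have "prb ww (\<lambda>\<sigma>. real ((c - 1) * B) < real (?nok \<sigma>)) \<le> 4 / real c"
  proof (rule markov)
    have "real (c - 1) = real c - 1" using c2(1) by simp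
    moreover have "2 * real B * real c \<le> 4 * ((real c - 1) * real B)"
    proof -
      have "real B * (2 * real c) \<le> real B * (4 * (real c - 1))" using c2(1) by (intro mult_left_mono) auto
      then show ?thesis by (simp add: algebra_simps)
    qed
    ultimately have "2 * real B \<le> 4 / real c * real ((c - 1) * B)" using c0 by (simp add: pos_le_divide_eq)
    then show "avg ww (\<lambda>\<sigma>. real (?nok \<sigma>)) \<le> 4 / real c * real ((c - 1) * B)" using avg_nok by linarith
    show "0 < real ((c - 1) * B)" using c2(1) B_pos by simp
  qed simp
  then have p1': "prb ww (E ! 1) \<le> 4 / real c" unfolding E_def by simp
  have p2: "prb ww (E ! 2) \<le> 8 / real c"
    unfolding E_def numeral_2_eq_2 nth_Cons_Suc nth_Cons_0
  proof (rule markov)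
    have "avg ww (\<lambda>\<sigma>. real (?act \<sigma>)) = (\<Sum>t\<le>dd. avg ww (\<lambda>\<sigma>. real (card (Act \<sigma> (yv \<sigma>) \<theta> t))))"
      by (simp only: of_nat_sum avg_sum)
    also have "\<dots> \<le> real (card {..dd}) * (4 * real B)" using avg_Act by (intro sum_bounded_above) simp
    also have "\<dots> \<le> (2 * real dd) * (4 * real B)" using dd_pos by (intro mult_right_mono) auto
    also have "\<dots> = 8 / real c * real (c * B * dd)" using c0 by simp
    finally show "avg ww (\<lambda>\<sigma>. real (?act \<sigma>)) \<le> 8 / real c * real (c * B * dd)" .
    show "0 < real (c * B * dd)" using c0 B0 dd_pos by simp
  qed (simp_all add: sum_nonneg)
  have p3: "prb ww (E ! 3) \<le> 12 / real c"
    unfolding E_def numeral_3_eq_3 nth_Cons_Suc nth_Cons_0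
  proof (rule markov)
    show "avg ww (\<lambda>\<sigma>. real (?tr \<sigma>)) \<le> 12 / real c * real (c * B)" using avg_trials c0 by simp
    show "0 < real (c * B)" using c0 B0 by simp
  qed simp
  have p4: "prb ww (E ! 4) \<le> 1 / real c"
  proof -
    have "prb ww (\<lambda>\<sigma>. \<exists>i\<in>?U. missG i \<sigma>) \<le> real (card ?U) * (real (dd + 1) * (2 / 2 ^ ww) ^ 12)"
    proof (rule prb_bex_le)
      fix i assume "i \<in> ?U"
      then have i: "i < n" "\<theta> * 2 ^ ww < \<bar>x i\<bar>" by auto
      have "0 \<le> \<theta> * 2 ^ ww" using \<theta>_nonneg by simp
      then have x0: "x i \<noteq> 0" using i(2) by auto
      have "\<theta> / \<bar>x i\<bar> \<le> 1 / 2 ^ ww" using i(2) x0 by (simp add: field_simps)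
      then have "(\<theta> / \<bar>x i\<bar> + 1 / 2 ^ ww) ^ 12 \<le> (2 / 2 ^ ww) ^ 12" using \<theta>_nonneg by (intro power_mono) auto
      then have "real (dd + 1) * (\<theta> / \<bar>x i\<bar> + 1 / 2 ^ ww) ^ 12 \<le> real (dd + 1) * (2 / 2 ^ ww) ^ 12" by (intro mult_left_mono) auto
      then show "prb ww (missG i) \<le> real (dd + 1) * (2 / 2 ^ ww) ^ 12" using prb_missG[of i] i(1) x0 by linarith
    qed simp
    also have "\<dots> \<le> real n * (real (dd + 1) * (2 / 2 ^ ww) ^ 12)"
    proof (rule mult_right_mono)
      have "card ?U \<le> card {..<n}" by (intro card_mono) auto
      then show "real (card ?U) \<le> real n" by simp
    qed simp
    finally show ?thesis using ultra_small vc by (simp add: E_def)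
  qed
  have p5: "prb ww (E ! 5) \<le> 1 / real c"
  proof -
    have "avg ww ?LM = (\<Sum>i\<in>?Hm. (x i)\<^sup>2 * prb ww (missX i))" by (simp only: avg_sum avg_cmult prb_def)
    also have "\<dots> \<le> real (card ?Hm) * (2 * \<theta>\<^sup>2)"
    proof (rule sum_bounded_above)
      fix i assume i: "i \<in> ?Hm"
      then have "prb ww (missX i) \<le> 2 / real vv" using H(1) by (intro prb_missX) auto
      then have "(x i)\<^sup>2 * prb ww (missX i) \<le> (real vv * \<theta>\<^sup>2) * (2 / real vv)"
        using i by (intro mult_mono) (auto simp: prb_nonneg)
      then show "(x i)\<^sup>2 * prb ww (missX i) \<le> 2 * \<theta>\<^sup>2" using vv_real(1) by simp
    qed
    also have "\<dots> \<le> real k * (2 * \<theta>\<^sup>2)"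
    proof (rule mult_right_mono)
      have "card ?Hm \<le> card H" using finH by (intro card_mono) auto
      then show "real (card ?Hm) \<le> real k" using H(2) by simp
    qed simp
    also have "\<dots> = 1 / real c * (2 * real c * (real k * \<theta>\<^sup>2))" using c0 by simp
    finally have "prb ww (\<lambda>\<sigma>. 2 * real c * (real k * \<theta>\<^sup>2) < ?LM \<sigma>) \<le> 1 / real c"
      by (intro markov0) (auto intro!: sum_nonneg)
    then show ?thesis by (simp add: E_def)
  qed
  have p6: "prb ww (E ! 6) \<le> 1 / real c"
  proof -
    have "avg ww ?LG = (\<Sum>i\<in>?Hg. (x i)\<^sup>2 * prb ww (missG i))" by (simp only: avg_sum avg_cmult prb_def)
    also have "\<dots> \<le> real (card ?Hg) * \<theta>\<^sup>2"
      using giant_small H(1) by (intro sum_bounded_above) auto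
    also have "\<dots> \<le> real k * \<theta>\<^sup>2"
    proof (rule mult_right_mono)
      have "card ?Hg \<le> card H" using finH by (intro card_mono) auto
      then show "real (card ?Hg) \<le> real k" using H(2) by simp
    qed simp
    also have "\<dots> = 1 / real c * (real c * (real k * \<theta>\<^sup>2))" using c0 by simp
    finally have "prb ww (\<lambda>\<sigma>. real c * (real k * \<theta>\<^sup>2) < ?LG \<sigma>) \<le> 1 / real c"
      by (intro markov0) (auto intro!: sum_nonneg)
    then show ?thesis by (simp add: E_def)
  qed
  have "prb ww (\<lambda>\<sigma>. \<not> gout H k \<theta> (dec \<theta> \<sigma>)) \<le> prb ww (\<lambda>\<sigma>. \<exists>j\<in>{..<7}. (E ! j) \<sigma>)"
  proof (rule prb_mono)
    fix \<sigma> assume ng: "\<not> gout H k \<theta> (dec \<theta> \<sigma>)"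
    show "\<exists>j\<in>{..<7}. (E ! j) \<sigma>"
    proof (rule ccontr)
      assume "\<not> ?thesis"
      then have nE: "\<not> (E ! j) \<sigma>" if "j < 7" for j using that by blast
      have e0: "egood \<sigma>" and e1: "?nok \<sigma> \<le> (c - 1) * B" and e2: "?act \<sigma> \<le> c * B * dd" and e3: "?tr \<sigma> \<le> c * B"
        and e4: "\<not> (\<exists>i\<in>?U. missG i \<sigma>)" and e5: "?LM \<sigma> \<le> 2 * real c * (real k * \<theta>\<^sup>2)" and e6: "?LG \<sigma> \<le> real c * (real k * \<theta>\<^sup>2)"
        using nE[of 0] nE[of 1] nE[of 2] nE[of 3] nE[of 4] nE[of 5] nE[of 6] unfolding E_def
        by (simp_all only: nth_Cons_numeral nth_Cons_0 nth_Cons_Suc One_nat_def of_nat_less_iff not_less not_not numeral_2_eq_2 numeral_3_eq_3 eval_nat_numeral BitM.simps pred_numeral_simps not_le simp_thms)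
      \<comment> \<open>One share \<open>B * nb\<close> of the budget is reserved for the single
        step on every label; this is why the event above compares with c - 1 and not with c.\<close>
      have XB: "B * vv + nb * ?nok \<sigma> \<le> c * B * nb"
      proof -
        have "B * vv \<le> B * nb" using nb_ell(3) by simp
        moreover have "nb * ?nok \<sigma> \<le> nb * ((c - 1) * B)" using e1 by (rule mult_le_mono2)
        ultimately have "B * vv + nb * ?nok \<sigma> \<le> B * nb + nb * ((c - 1) * B)" by (rule add_mono)
        also have "B * nb + nb * ((c - 1) * B) = c * B * nb" using c2(1) by (cases c) (auto simp: algebra_simps)
        finally show ?thesis .
      qed
      have TB: "(\<Sum>i\<leftarrow>cands \<theta> \<sigma>. TE \<sigma> (yv \<sigma>) \<theta> i) \<le> c * B"
      proof -
        have "(\<Sum>i\<leftarrow>cands \<theta> \<sigma>. TE \<sigma> (yv \<sigma>) \<theta> i) \<le> ?tr \<sigma>" using TE_le[OF e0] cands_less by (intro sum_list_mono) auto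
        then show ?thesis using e3 by linarith
      qed
      have out: "i < n \<and> 6 * \<theta> < \<bar>v\<bar> \<and> \<bar>v - x i\<bar> \<le> 3 * \<theta>" if "(i, v) \<in> set (dec \<theta> \<sigma>)" for i v
        using outE_sound(2)[OF that[unfolded dec_def]] cands_less accept_close[OF e0] by blast
      have hit: "i \<in> fst ` set (dec \<theta> \<sigma>)" if ci: "i \<in> set (cands \<theta> \<sigma>)" and big: "9 * \<theta> < \<bar>x i\<bar>" for i
      proof -
        have i: "i < n" using ci cands_less by blast
        have "0 < card {j\<in>{..<rr}. \<not> badE i j \<sigma>}" using egood_card[OF e0 i] rr_pos by linarith
        then have "{j\<in>{..<rr}. \<not> badE i j \<sigma>} \<noteq> {}" by (metis card.empty less_irrefl)
        then obtain t where t: "t < rr" "\<not> badE i t \<sigma>" by blast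
        obtain v where v: "rr < 2 * ecnt \<sigma> (yv \<sigma>) \<theta> i v" "6 * \<theta> < \<bar>v\<bar> \<longrightarrow> (i, v) \<in> set (outE \<sigma> (yv \<sigma>) \<theta> (cands \<theta> \<sigma>))"
          using outE_complete[OF TB ci t(1) good_accept[OF e0 i t]] by blast
        have "6 * \<theta> < \<bar>v\<bar>" using accept_close[OF e0 i v(1)] big \<theta>_nonneg by linarith
        then show ?thesis using v(2) unfolding dec_def by force
      qed
      let ?b = "\<lambda>i. 81 * \<theta>\<^sup>2 + (if i \<in> ?Hm then (x i)\<^sup>2 * of_bool (missX i \<sigma>) else 0) + (if i \<in> ?Hg then (x i)\<^sup>2 * of_bool (missG i \<sigma>) else 0)"
      have b0: "0 \<le> ?b i" for i by simp
      have pt: "(x i)\<^sup>2 \<le> ?b i" if i: "i \<in> H - fst ` set (dec \<theta> \<sigma>)" for i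
      proof (cases "9 * \<theta> < \<bar>x i\<bar>")
        case False
        then have "\<bar>x i\<bar>\<^sup>2 \<le> (9 * \<theta>)\<^sup>2" by (intro power_mono) auto
        then have "(x i)\<^sup>2 \<le> 81 * \<theta>\<^sup>2" by (simp add: power_mult_distrib)
        moreover have "0 \<le> (if i \<in> ?Hm then (x i)\<^sup>2 * of_bool (missX i \<sigma>) else 0)" "0 \<le> (if i \<in> ?Hg then (x i)\<^sup>2 * of_bool (missG i \<sigma>) else 0)" by simp_all
        ultimately show ?thesis by linarith
      next
        case True
        then have nc: "i \<notin> set (cands \<theta> \<sigma>)" using hit i by blast
        have n: "i < n" using i H(1) by auto
        have two: "2 * \<theta> < \<bar>x i\<bar>" using True \<theta>_nonneg by linarith
        have mG: "missG i \<sigma>" using candG_hit[OF n _ e2] nc by blast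
        have mX: "missX i \<sigma>"
        proof (rule ccontr)
          assume "\<not> missX i \<sigma>"
          then have "i \<in> set (candX \<sigma> (yv \<sigma>) \<theta>)" by (rule candX_hit[OF n _ XB])
          then show False using nc set_candG unfolding cands_def by blast
        qed
        show ?thesis
        proof (cases "(x i)\<^sup>2 \<le> real vv * \<theta>\<^sup>2")
          case True
          then have "i \<in> ?Hm" using i two by blast
          then show ?thesis using mX by simp
        next
          case False
          moreover have "\<bar>x i\<bar> \<le> \<theta> * 2 ^ ww"
          proof (rule ccontr)
            assume "\<not> ?thesis"
            then have "i \<in> ?U" using n by simp
            then show False using e4 mG by blast
          qed
          ultimately have "i \<in> ?Hg" using i by simp
          then show ?thesis using mG by simp
        qed
      qed
      have Hm: "?Hm \<subseteq> H" and Hg: "?Hg \<subseteq> H" by auto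
      have "(\<Sum>i\<in>H - fst ` set (dec \<theta> \<sigma>). (x i)\<^sup>2) \<le> (\<Sum>i\<in>H - fst ` set (dec \<theta> \<sigma>). ?b i)" by (rule sum_mono) (rule pt)
      also have "\<dots> \<le> (\<Sum>i\<in>H. ?b i)" using finH b0 by (intro sum_mono2) auto
      also have "\<dots> = real (card H) * (81 * \<theta>\<^sup>2) + ?LM \<sigma> + ?LG \<sigma>"
        by (simp only: sum.distrib sum_constant sum_if_subset[OF finH Hm] sum_if_subset[OF finH Hg])
      also have "\<dots> \<le> real k * (81 * \<theta>\<^sup>2) + 2 * real c * (real k * \<theta>\<^sup>2) + real c * (real k * \<theta>\<^sup>2)"
        using e5 e6 H(2) by (intro add_mono mult_right_mono) auto
      also have "\<dots> = (81 + 3 * real c) * (real k * \<theta>\<^sup>2)" by (simp add: algebra_simps)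
      finally have "gout H k \<theta> (dec \<theta> \<sigma>)"
        unfolding gout_def using outE_sound(1)[of \<sigma> "yv \<sigma>" \<theta> "cands \<theta> \<sigma>"] out unfolding dec_def by auto
      then show False using ng by simp
    qed
  qed
  also have "\<dots> \<le> (\<Sum>j\<in>{..<7}. prb ww (E ! j))" by (rule prb_bex) simp
  also have "\<dots> = prb ww (E ! 0) + prb ww (E ! 1) + prb ww (E ! 2) + prb ww (E ! 3) + prb ww (E ! 4) + prb ww (E ! 5) + prb ww (E ! 6)"
    by (simp add: eval_nat_numeral)
  also have "\<dots> \<le> 1 / real c + 4 / real c + 8 / real c + 12 / real c + 1 / real c + 1 / real c + 1 / real c"
    by (intro add_mono p0 p1' p2 p3 p4 p5 p6)
  also have "\<dots> = 28 / real c" by (simp add: add_divide_distrib[symmetric])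
  finally show ?thesis .
qed

end

section \<open>The threshold\<close>

lemma complement_ge: "p \<le> q \<Longrightarrow> q \<le> 1 - r \<Longrightarrow> e = 1 - p \<Longrightarrow> r \<le> (e :: real)"
  by linarith

text \<open>The Paley-Zygmund inequality before averaging. If |r| \<ge> s, expand (r^2 - 4V)^2 \<ge>
  0; otherwise r^2 \<le> s^2 \<le> V/16. Averaging bounds the probability of |r| \<ge> s from below
  in terms of second and fourth moments.\<close>

lemma paley_zygmund_pointwise:
  fixes r s V :: real
  assumes "0 < V" "16 * s\<^sup>2 \<le> V"
  shows "r\<^sup>2 \<le> V / 16 + (1 / (8 * V) * r ^ 4 + (2 * V) * of_bool (s \<le> \<bar>r\<bar>))"
proof -
  have r4: "r ^ 4 = (r\<^sup>2)\<^sup>2" by (simp add: power_mult[symmetric])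
  have p: "0 \<le> 1 / (8 * V) * r ^ 4" using assms(1) unfolding r4 by (intro mult_nonneg_nonneg) auto
  show ?thesis
  proof (cases "s \<le> \<bar>r\<bar>")
    case True
    have "(r\<^sup>2 - 4 * V)\<^sup>2 = r ^ 4 - 8 * V * r\<^sup>2 + 16 * V\<^sup>2" unfolding r4 by (simp add: power2_diff power_mult_distrib)
    then have "8 * V * r\<^sup>2 \<le> r ^ 4 + 16 * V\<^sup>2" using zero_le_power2[of "r\<^sup>2 - 4 * V"] by linarith
    then have "8 * V * r\<^sup>2 / (8 * V) \<le> (r ^ 4 + 16 * V\<^sup>2) / (8 * V)" using assms(1) by (intro divide_right_mono) auto
    also have "(r ^ 4 + 16 * V\<^sup>2) / (8 * V) = 1 / (8 * V) * r ^ 4 + 2 * V" using assms(1) by (simp add: add_divide_distrib power2_eq_square)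
    finally have "r\<^sup>2 \<le> 1 / (8 * V) * r ^ 4 + 2 * V" using assms(1) by simp
    moreover have "of_bool (s \<le> \<bar>r\<bar>) = (1::real)" using True by simp
    moreover have "0 \<le> V / 16" using assms(1) by simp
    ultimately show ?thesis by (simp only: mult_1_right)
  next
    case False
    then have "\<bar>r\<bar>\<^sup>2 \<le> s\<^sup>2" by (intro power_mono) auto
    then have "r\<^sup>2 \<le> V / 16" using assms(2) by simp
    moreover have "of_bool (s \<le> \<bar>r\<bar>) = (0::real)" using False by simp
    ultimately show ?thesis using p by (simp only: mult_zero_right add_0_right)
  qed
qed

context sketch_prob
begin

section \<open>The content of bucket 0\<close>

definition tb :: "nat \<Rightarrow> nat \<Rightarrow> (nat \<Rightarrow> nat) \<Rightarrow> bool" where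
  "tb \<rho> i \<sigma> \<longleftrightarrow> hsh \<sigma> \<rho> i mod bh = 0"

definition Xt :: "nat \<Rightarrow> nat \<Rightarrow> (nat \<Rightarrow> nat) \<Rightarrow> real" where
  "Xt \<rho> i \<sigma> = (if tb \<rho> i \<sigma> then sg (cw \<sigma> \<rho> i) * x i else 0)"

definition Yt :: "nat set \<Rightarrow> nat \<Rightarrow> (nat \<Rightarrow> nat) \<Rightarrow> real" where
  "Yt I \<rho> \<sigma> = (\<Sum>i\<in>I. Xt \<rho> i \<sigma>)"

definition ah :: "nat \<Rightarrow> nat \<Rightarrow> nat" where "ah \<rho> i = 2 * (i * ss + \<rho>)"
definition ac :: "nat \<Rightarrow> nat \<Rightarrow> nat" where "ac \<rho> i = 2 * (i * ss + \<rho>) + 1"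

lemma addr_inj:
  "ah \<rho> i \<noteq> ac \<rho>' j" "ac \<rho>' j \<noteq> ah \<rho> i"
  "\<rho> < ss \<Longrightarrow> ah \<rho> i = ah \<rho> j \<longleftrightarrow> i = j" "\<rho> < ss \<Longrightarrow> ac \<rho> i = ac \<rho> j \<longleftrightarrow> i = j"
proof -
  show "ah \<rho> i \<noteq> ac \<rho>' j" unfolding ah_def ac_def by presburger
  then show "ac \<rho>' j \<noteq> ah \<rho> i" by (rule not_sym)
  show "\<rho> < ss \<Longrightarrow> ah \<rho> i = ah \<rho> j \<longleftrightarrow> i = j" "\<rho> < ss \<Longrightarrow> ac \<rho> i = ac \<rho> j \<longleftrightarrow> i = j"
    using ss_pos by (auto simp: ah_def ac_def)
qed

lemma addr_lt: "i < n \<Longrightarrow> \<rho> < ss \<Longrightarrow> ah \<rho> i < 2 ^ ww" "i < n \<Longrightarrow> \<rho> < ss \<Longrightarrow> ac \<rho> i < 2 ^ ww"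
  using addr_less[of i \<rho>] n_le_nn unfolding ah_def ac_def by auto

lemma tb_addr: "tb \<rho> i \<sigma> \<longleftrightarrow> \<sigma> (ah \<rho> i) mod bh = 0" "cw \<sigma> \<rho> i = \<sigma> (ac \<rho> i)"
  by (simp_all add: tb_def hsh_def ah_def cw_def ac_def)

lemma prb_tb: "i < n \<Longrightarrow> \<rho> < ss \<Longrightarrow> prb ww (tb \<rho> i) = 1 / real bh"
  unfolding prb_def tb_addr using avg_single[OF addr_lt(1), of i \<rho> "\<lambda>v. of_bool (v mod bh = 0)"]
  sum_mod_eq[OF bh_dvd, of 0] bh_eq(2) by simp

lemma row_Yt: "\<rho> < c \<Longrightarrow> row (yv \<sigma>) \<rho> 0 = Yt {..<n} \<rho> \<sigma>"
proof -
  assume "\<rho> < c"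
  then have r: "\<rho> < dd" using c_le by simp
  then have rs: "\<rho> < ss" using dd_ss by simp
  have "Yf x \<sigma> \<rho> 0 = Yt {..<n} \<rho> \<sigma>"
    unfolding Yf_def Yt_def Xt_def tb_def using r by (intro sum.cong) (auto simp: nd_def bt_def cf_def hb_def)
  then show ?thesis using row_yv[OF rs B_pos] by simp
qed

lemma second_moment_Yt:
  assumes "I \<subseteq> {..<n}" "\<rho> < ss"
  shows "avg ww (\<lambda>\<sigma>. (Yt I \<rho> \<sigma>)\<^sup>2) \<le> (\<Sum>i\<in>I. (x i)\<^sup>2) / real bh"
proof -
  let ?k = "\<lambda>i \<sigma>. if tb \<rho> i \<sigma> then x i else 0"
  have fin: "finite I" using assms(1) finite_subset by blast
  have "avg ww (\<lambda>\<sigma>. (Yt I \<rho> \<sigma>)\<^sup>2) = avg ww (\<lambda>\<sigma>. (\<Sum>i\<in>I. sg (\<sigma> (ac \<rho> i)) * ?k i \<sigma>)\<^sup>2)"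
    unfolding Yt_def Xt_def tb_addr(2) by (simp only: if_distrib[of "\<lambda>u. _ * u"] mult_zero_right)
  also have "\<dots> \<le> (\<Sum>i\<in>I. avg ww (\<lambda>\<sigma>. (?k i \<sigma>)\<^sup>2))"
  proof (rule second_moment[OF fin])
    show "inj_on (ac \<rho>) I" using addr_inj(4)[OF assms(2)] by (auto simp: inj_on_def)
    show "ac \<rho> i < 2 ^ ww" if "i \<in> I" for i using that assms addr_lt by auto
    show "(\<Sum>v<2 ^ ww. sg v) = 0" by (rule sg_sum)
  qed (auto simp: sg_def tb_addr addr_inj)
  also have "\<dots> = (\<Sum>i\<in>I. (x i)\<^sup>2 * prb ww (tb \<rho> i))"
    unfolding prb_def avg_cmult[symmetric] by (intro sum.cong avg_cong) auto
  also have "\<dots> = (\<Sum>i\<in>I. (x i)\<^sup>2 / real bh)"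
    using prb_tb assms by (intro sum.cong) auto
  finally show ?thesis by (simp only: sum_divide_distrib)
qed

text \<open>In each of the c repetitions the bucket avoids the head except with probability k / bh,
  and then Chebyshev bounds the tail part, with failure 1 / c^2. The factor 2^414 is the square of
  the scaling in \<open>thr\<close>.\<close>

lemma thr_upper:
  assumes H: "H \<subseteq> {..<n}" "card H \<le> k"
  shows "prb ww (\<lambda>\<sigma>. 2 ^ 414 * ((real c)\<^sup>2 * ((\<Sum>i\<in>{..<n} - H. (x i)\<^sup>2) / real bh)) < (thr (yv \<sigma>))\<^sup>2) \<le> real c * (real k / real bh + 1 / (real c)\<^sup>2)"
proof -
  let ?V = "(\<Sum>i\<in>{..<n} - H. (x i)\<^sup>2) / real bh"
  let ?Q = "\<lambda>\<rho> \<sigma>. (\<exists>i\<in>H. tb \<rho> i \<sigma>) \<or> (real c)\<^sup>2 * ?V < (Yt ({..<n} - H) \<rho> \<sigma>)\<^sup>2"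
  have finH: "finite H" using H(1) finite_subset by blast
  have V0: "0 \<le> ?V" by (simp add: sum_nonneg)
  have "prb ww (\<lambda>\<sigma>. 2 ^ 414 * ((real c)\<^sup>2 * ?V) < (thr (yv \<sigma>))\<^sup>2) \<le> prb ww (\<lambda>\<sigma>. \<exists>\<rho>\<in>{..<c}. ?Q \<rho> \<sigma>)"
  proof (rule prb_mono)
    fix \<sigma> assume t: "2 ^ 414 * ((real c)\<^sup>2 * ?V) < (thr (yv \<sigma>))\<^sup>2"
    have "Max ((\<lambda>\<rho>. \<bar>row (yv \<sigma>) \<rho> 0\<bar>) ` {..<c}) \<in> (\<lambda>\<rho>. \<bar>row (yv \<sigma>) \<rho> 0\<bar>) ` {..<c}"
      using c_pos by (intro Max_in) auto
    then obtain \<rho> where \<rho>: "\<rho> < c" "Max ((\<lambda>\<rho>. \<bar>row (yv \<sigma>) \<rho> 0\<bar>) ` {..<c}) = \<bar>Yt {..<n} \<rho> \<sigma>\<bar>"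
      using row_Yt by auto
    have "(thr (yv \<sigma>))\<^sup>2 = 2 ^ 414 * (Yt {..<n} \<rho> \<sigma>)\<^sup>2"
      unfolding thr_def \<rho>(2) by (simp add: power_mult_distrib power_mult[symmetric])
    then have Y: "(real c)\<^sup>2 * ?V < (Yt {..<n} \<rho> \<sigma>)\<^sup>2" using t by simp
    have "?Q \<rho> \<sigma>"
    proof (cases "\<exists>i\<in>H. tb \<rho> i \<sigma>")
      case False
      then have "(\<Sum>i\<in>H. Xt \<rho> i \<sigma>) = 0" by (intro sum.neutral) (auto simp: Xt_def)
      moreover have "Yt {..<n} \<rho> \<sigma> = (\<Sum>i\<in>{..<n} - H. Xt \<rho> i \<sigma>) + (\<Sum>i\<in>H. Xt \<rho> i \<sigma>)"
        unfolding Yt_def using H(1) by (intro sum.subset_diff) auto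
      ultimately have "Yt {..<n} \<rho> \<sigma> = Yt ({..<n} - H) \<rho> \<sigma>" unfolding Yt_def by simp
      then show ?thesis using Y by simp
    qed simp
    then show "\<exists>\<rho>\<in>{..<c}. ?Q \<rho> \<sigma>" using \<rho>(1) by blast
  qed
  also have "\<dots> \<le> real (card {..<c}) * (real k / real bh + 1 / (real c)\<^sup>2)"
  proof (rule prb_bex_le)
    fix \<rho> assume "\<rho> \<in> {..<c}"
    then have rs: "\<rho> < ss" using c_le dd_ss by simp
    have "prb ww (\<lambda>\<sigma>. \<exists>i\<in>H. tb \<rho> i \<sigma>) \<le> real (card H) * (1 / real bh)"
      using H(1) prb_tb rs by (intro prb_bex_le finH) auto
    also have "\<dots> \<le> real k * (1 / real bh)" using H(2) by (intro mult_right_mono) auto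
    finally have 1: "prb ww (\<lambda>\<sigma>. \<exists>i\<in>H. tb \<rho> i \<sigma>) \<le> real k / real bh" by simp
    have 2: "prb ww (\<lambda>\<sigma>. (real c)\<^sup>2 * ?V < (Yt ({..<n} - H) \<rho> \<sigma>)\<^sup>2) \<le> 1 / (real c)\<^sup>2"
    proof (rule markov0)
      show "avg ww (\<lambda>\<sigma>. (Yt ({..<n} - H) \<rho> \<sigma>)\<^sup>2) \<le> 1 / (real c)\<^sup>2 * ((real c)\<^sup>2 * ?V)"
        using second_moment_Yt[of "{..<n} - H" \<rho>] rs c_pos by simp
    qed (use mult_nonneg_nonneg[OF zero_le_power2[of "real c"] V0] in auto)
    show "prb ww (?Q \<rho>) \<le> real k / real bh + 1 / (real c)\<^sup>2" by (rule order.trans[OF prb_disj add_mono[OF 1 2]])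
  qed simp
  finally show ?thesis by simp
qed

lemma moments_Xt:
  assumes i: "i < n" "\<rho> < ss"
  shows "avg ww (Xt \<rho> i) = 0" "avg ww (\<lambda>\<tau>. (Xt \<rho> i \<tau>) ^ 3) = 0"
    "avg ww (\<lambda>\<tau>. (Xt \<rho> i \<tau>)\<^sup>2) = (x i)\<^sup>2 / real bh" "avg ww (\<lambda>\<tau>. (Xt \<rho> i \<tau>) ^ 4) = (x i) ^ 4 / real bh"
proof -
  have odd: "avg ww (\<lambda>\<tau>. sg (\<tau> (ac \<rho> i)) * (if tb \<rho> i \<tau> then r else 0)) = 0" for r
    by (subst avg_at[OF addr_lt(2)[OF i]]) (simp add: tb_addr addr_inj sum_distrib_right[symmetric] sg_sum)
  have s3: "sg v ^ 3 = sg v" "sg v ^ 2 = 1" "sg v ^ 4 = 1" for v by (auto simp: sg_def)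
  show "avg ww (Xt \<rho> i) = 0"
    using odd[of "x i"] unfolding Xt_def tb_addr(2) by (simp only: if_distrib[of "\<lambda>u. _ * u"] mult_zero_right)
  have "(Xt \<rho> i \<tau>) ^ 3 = sg (\<tau> (ac \<rho> i)) * (if tb \<rho> i \<tau> then (x i) ^ 3 else 0)" for \<tau>
    unfolding Xt_def tb_addr(2) by (simp add: power_mult_distrib s3)
  then show "avg ww (\<lambda>\<tau>. (Xt \<rho> i \<tau>) ^ 3) = 0" using odd by simp
  have "(Xt \<rho> i \<tau>)\<^sup>2 = (x i)\<^sup>2 * of_bool (tb \<rho> i \<tau>)" "(Xt \<rho> i \<tau>) ^ 4 = (x i) ^ 4 * of_bool (tb \<rho> i \<tau>)" for \<tau>
    unfolding Xt_def by (simp_all add: power_mult_distrib s3)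
  then show "avg ww (\<lambda>\<tau>. (Xt \<rho> i \<tau>)\<^sup>2) = (x i)\<^sup>2 / real bh" "avg ww (\<lambda>\<tau>. (Xt \<rho> i \<tau>) ^ 4) = (x i) ^ 4 / real bh"
    using prb_tb[OF i] by (simp_all add: avg_cmult prb_def)
qed

text \<open>Items are added one at a time by resampling their hash and sign. Odd moments of the new
  term vanish by symmetry; in the fourth moment 6uv is absorbed by the growth of 3v^2 to 3(v +
  u)^2.\<close>

lemma moments_Yt:
  assumes "finite K" "K \<subseteq> {..<n}" "\<rho> < ss"
  shows "avg ww (\<lambda>\<sigma>. (Yt K \<rho> \<sigma>)\<^sup>2) = (\<Sum>i\<in>K. (x i)\<^sup>2 / real bh)
    \<and> avg ww (\<lambda>\<sigma>. (Yt K \<rho> \<sigma>) ^ 4) \<le> 3 * (\<Sum>i\<in>K. (x i)\<^sup>2 / real bh)\<^sup>2 + (\<Sum>i\<in>K. (x i) ^ 4 / real bh)"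
  using assms(1,2)
proof (induction K rule: finite_induct)
  case empty
  show ?case by (simp add: Yt_def)
next
  case (insert i K)
  let ?v = "\<Sum>i\<in>K. (x i)\<^sup>2 / real bh" and ?u = "(x i)\<^sup>2 / real bh"
  have i: "i < n" using insert.prems by simp
  let ?S = "{ah \<rho> i, ac \<rho> i}"
  have IH: "avg ww (\<lambda>\<sigma>. (Yt K \<rho> \<sigma>)\<^sup>2) = ?v"
    "avg ww (\<lambda>\<sigma>. (Yt K \<rho> \<sigma>) ^ 4) \<le> 3 * ?v\<^sup>2 + (\<Sum>i\<in>K. (x i) ^ 4 / real bh)" using insert by auto
  have ov: "Yt (insert i K) \<rho> (override_on \<sigma> \<tau> ?S) = Yt K \<rho> \<sigma> + Xt \<rho> i \<tau>" for \<sigma> \<tau>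
  proof -
    have "Xt \<rho> j (override_on \<sigma> \<tau> ?S) = Xt \<rho> j \<sigma>" if "j \<in> K" for j
    proof -
      have "j \<noteq> i" using that insert.hyps by blast
      then show ?thesis unfolding Xt_def tb_addr override_on_def using assms(3) by (simp add: addr_inj)
    qed
    moreover have "Xt \<rho> i (override_on \<sigma> \<tau> ?S) = Xt \<rho> i \<tau>"
      unfolding Xt_def tb_addr override_on_def by simp
    ultimately show ?thesis unfolding Yt_def using insert.hyps by simp
  qed
  note m = moments_Xt[OF i assms(3)]
  have "avg ww (\<lambda>\<sigma>. (Yt (insert i K) \<rho> \<sigma>)\<^sup>2) = avg ww (\<lambda>\<sigma>. avg ww (\<lambda>\<tau>. (Yt K \<rho> \<sigma> + Xt \<rho> i \<tau>)\<^sup>2))"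
    by (subst avg_resample[of _ _ ?S]) (simp only: ov)
  also have "\<dots> = avg ww (\<lambda>\<sigma>. (Yt K \<rho> \<sigma>)\<^sup>2 + ?u)"
  proof (rule avg_cong)
    fix \<sigma>
    have "avg ww (\<lambda>\<tau>. (Yt K \<rho> \<sigma> + Xt \<rho> i \<tau>)\<^sup>2) = avg ww (\<lambda>\<tau>. (Yt K \<rho> \<sigma>)\<^sup>2 + ((2 * Yt K \<rho> \<sigma>) * Xt \<rho> i \<tau> + (Xt \<rho> i \<tau>)\<^sup>2))"
      by (intro avg_cong) (simp add: power2_eq_square algebra_simps)
    then show "avg ww (\<lambda>\<tau>. (Yt K \<rho> \<sigma> + Xt \<rho> i \<tau>)\<^sup>2) = (Yt K \<rho> \<sigma>)\<^sup>2 + ?u"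
      by (simp add: avg_add avg_cmult m(1,3))
  qed
  finally have 1: "avg ww (\<lambda>\<sigma>. (Yt (insert i K) \<rho> \<sigma>)\<^sup>2) = ?v + ?u" by (simp add: avg_add IH)
  have "avg ww (\<lambda>\<sigma>. (Yt (insert i K) \<rho> \<sigma>) ^ 4) = avg ww (\<lambda>\<sigma>. avg ww (\<lambda>\<tau>. (Yt K \<rho> \<sigma> + Xt \<rho> i \<tau>) ^ 4))"
    by (subst avg_resample[of _ _ ?S]) (simp only: ov)
  also have "\<dots> = avg ww (\<lambda>\<sigma>. (Yt K \<rho> \<sigma>) ^ 4 + ((6 * ?u) * (Yt K \<rho> \<sigma>)\<^sup>2 + (x i) ^ 4 / real bh))"
  proof (rule avg_cong)
    fix \<sigma>
    let ?y = "Yt K \<rho> \<sigma>"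
    have "avg ww (\<lambda>\<tau>. (?y + Xt \<rho> i \<tau>) ^ 4) = avg ww (\<lambda>\<tau>. ?y ^ 4 + ((4 * ?y ^ 3) * Xt \<rho> i \<tau> + ((6 * ?y\<^sup>2) * (Xt \<rho> i \<tau>)\<^sup>2 + ((4 * ?y) * (Xt \<rho> i \<tau>) ^ 3 + (Xt \<rho> i \<tau>) ^ 4))))"
      by (intro avg_cong) (simp add: eval_nat_numeral algebra_simps)
    then show "avg ww (\<lambda>\<tau>. (?y + Xt \<rho> i \<tau>) ^ 4) = ?y ^ 4 + ((6 * ?u) * ?y\<^sup>2 + (x i) ^ 4 / real bh)"
      by (simp add: avg_add avg_cmult m)
  qed
  also have "\<dots> = avg ww (\<lambda>\<sigma>. (Yt K \<rho> \<sigma>) ^ 4) + (6 * ?u * ?v + (x i) ^ 4 / real bh)"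
    by (simp only: avg_add avg_cmult avg_const IH(1))
  also have "\<dots> \<le> 3 * ?v\<^sup>2 + (\<Sum>i\<in>K. (x i) ^ 4 / real bh) + (6 * ?u * ?v + (x i) ^ 4 / real bh)" using IH(2) by simp
  also have "\<dots> \<le> 3 * (?v + ?u)\<^sup>2 + ((\<Sum>i\<in>K. (x i) ^ 4 / real bh) + (x i) ^ 4 / real bh)"
  proof -
    have "3 * (v + u)\<^sup>2 = 3 * v\<^sup>2 + 6 * u * v + 3 * u\<^sup>2" for u v :: real by (simp add: power2_eq_square algebra_simps)
    from this[of ?v ?u] show ?thesis using zero_le_power2[of ?u] by linarith
  qed
  finally show ?case using 1 insert.hyps by (simp add: add_ac)
qed

text \<open>Changes the parity of the coefficient words of the items in \<open>g\<close>, which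
  reverses their signs. As \<open>g\<close> is meant to depend on hashes only, applying it twice
  restores the tape.\<close>

definition flip :: "nat \<Rightarrow> ((nat \<Rightarrow> nat) \<Rightarrow> nat set) \<Rightarrow> (nat \<Rightarrow> nat) \<Rightarrow> nat \<Rightarrow> nat" where
  "flip \<rho> g \<sigma> a = (if \<exists>i\<in>g \<sigma>. a = ac \<rho> i then (if even (\<sigma> a) then \<sigma> a + 1 else \<sigma> a - 1) else \<sigma> a)"

text \<open>If one of two numbers a, b has size at least s, so has a + b or a - b. The bucket value
  is a + b on the tape and, up to sign, a - b on the flipped tape, and flipping preserves the
  uniform distribution; hence a loss of only a factor 2.\<close>

lemma prb_flip:
  assumes \<rho>: "\<rho> < ss" and g: "\<And>\<sigma>. g \<sigma> \<subseteq> {..<n}" "\<And>\<sigma> \<tau>. (\<And>i. \<sigma> (ah \<rho> i) = \<tau> (ah \<rho> i)) \<Longrightarrow> g \<sigma> = g \<tau>"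
    and E: "\<And>\<sigma>. E \<sigma> \<Longrightarrow> s \<le> \<bar>Yt (g \<sigma>) \<rho> \<sigma>\<bar> \<or> s \<le> \<bar>Yt ({..<n} - g \<sigma>) \<rho> \<sigma>\<bar>"
  shows "prb ww E \<le> 2 * prb ww (\<lambda>\<sigma>. s \<le> \<bar>Yt {..<n} \<rho> \<sigma>\<bar>)"
proof -
  let ?f = "flip \<rho> g"
  have fh: "?f \<sigma> (ah \<rho> i) = \<sigma> (ah \<rho> i)" for \<sigma> i by (simp add: flip_def addr_inj)
  have gf: "g (?f \<sigma>) = g \<sigma>" for \<sigma> by (rule g(2)) (rule fh)
  have inv: "?f (?f \<sigma>) = \<sigma>" for \<sigma>
  proof
    fix a show "?f (?f \<sigma>) a = \<sigma> a" unfolding flip_def[of \<rho> g "?f \<sigma>"] gf by (auto simp: flip_def)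
  qed
  have tp: "?f \<sigma> \<in> tapes ww" if \<sigma>: "\<sigma> \<in> tapes ww" for \<sigma>
  proof -
    have ev: "even ((2::nat) ^ ww)" using dd_pos by (simp add: ww_def)
    have "?f \<sigma> a < 2 ^ ww" if "a < 2 ^ ww" for a
    proof -
      have "\<sigma> a < 2 ^ ww" using tapes_less[OF \<sigma> that] .
      moreover have "\<sigma> a + 1 < 2 ^ ww" if "even (\<sigma> a)"
      proof -
        have "\<sigma> a + 1 \<noteq> 2 ^ ww" using that ev by (metis even_plus_one_iff)
        then show ?thesis using \<open>\<sigma> a < 2 ^ ww\<close> by linarith
      qed
      ultimately show ?thesis unfolding flip_def by auto
    qed
    moreover have "?f \<sigma> a = undefined" if "\<not> a < 2 ^ ww" for a
    proof -
      have "\<sigma> a = undefined" using \<sigma> that unfolding tapes_def by (auto simp: PiE_iff extensional_def)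
      moreover have "a \<noteq> ac \<rho> i" if "i \<in> g \<sigma>" for i using that g(1) addr_lt(2)[of i \<rho>] \<rho> \<open>\<not> a < 2 ^ ww\<close> by blast
      ultimately show ?thesis unfolding flip_def by auto
    qed
    ultimately show ?thesis unfolding tapes_def by (auto simp: PiE_iff extensional_def)
  qed
  have "bij_betw ?f (tapes ww) (tapes ww)"
    by (rule bij_betw_byWitness[where f' = ?f]) (use inv tp in auto)
  then have avgf: "avg ww (\<lambda>\<sigma>. h (?f \<sigma>)) = avg ww h" for h
    unfolding avg_def using sum.reindex_bij_betw[of ?f "tapes ww" "tapes ww" h] by simp
  have Yf: "Yt {..<n} \<rho> (?f \<sigma>) = Yt ({..<n} - g \<sigma>) \<rho> \<sigma> - Yt (g \<sigma>) \<rho> \<sigma>" for \<sigma>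
  proof -
    have tbf: "tb \<rho> i (?f \<sigma>) = tb \<rho> i \<sigma>" for i unfolding tb_addr fh ..
    have 1: "Xt \<rho> i (?f \<sigma>) = - Xt \<rho> i \<sigma>" if "i \<in> g \<sigma>" for i
    proof -
      have "?f \<sigma> (ac \<rho> i) = (if even (\<sigma> (ac \<rho> i)) then \<sigma> (ac \<rho> i) + 1 else \<sigma> (ac \<rho> i) - 1)" unfolding flip_def using that by auto
      then have "sg (?f \<sigma> (ac \<rho> i)) = - sg (\<sigma> (ac \<rho> i))" by (auto simp: sg_def elim: oddE)
      then show ?thesis unfolding Xt_def tbf tb_addr(2) by simp
    qed
    have 2: "Xt \<rho> i (?f \<sigma>) = Xt \<rho> i \<sigma>" if "i \<notin> g \<sigma>" for i
    proof -
      have "?f \<sigma> (ac \<rho> i) = \<sigma> (ac \<rho> i)" unfolding flip_def using that addr_inj(4)[OF \<rho>] by auto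
      then show ?thesis unfolding Xt_def tbf tb_addr(2) by simp
    qed
    have "Yt {..<n} \<rho> (?f \<sigma>) = (\<Sum>i\<in>{..<n} - g \<sigma>. Xt \<rho> i (?f \<sigma>)) + (\<Sum>i\<in>g \<sigma>. Xt \<rho> i (?f \<sigma>))"
      unfolding Yt_def using g(1) by (intro sum.subset_diff) auto
    then show ?thesis using 1 2 by (simp add: Yt_def sum_negf)
  qed
  have Yn: "Yt {..<n} \<rho> \<sigma> = Yt ({..<n} - g \<sigma>) \<rho> \<sigma> + Yt (g \<sigma>) \<rho> \<sigma>" for \<sigma>
    unfolding Yt_def using g(1) by (intro sum.subset_diff) auto
  have "prb ww E \<le> prb ww (\<lambda>\<sigma>. s \<le> \<bar>Yt {..<n} \<rho> \<sigma>\<bar> \<or> s \<le> \<bar>Yt {..<n} \<rho> (?f \<sigma>)\<bar>)"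
  proof (rule prb_mono)
    fix \<sigma> assume "E \<sigma>"
    then show "s \<le> \<bar>Yt {..<n} \<rho> \<sigma>\<bar> \<or> s \<le> \<bar>Yt {..<n} \<rho> (?f \<sigma>)\<bar>" unfolding Yf using E[of \<sigma>] Yn[of \<sigma>] by linarith
  qed
  also have "\<dots> \<le> prb ww (\<lambda>\<sigma>. s \<le> \<bar>Yt {..<n} \<rho> \<sigma>\<bar>) + prb ww (\<lambda>\<sigma>. s \<le> \<bar>Yt {..<n} \<rho> (?f \<sigma>)\<bar>)" by (rule prb_disj)
  also have "prb ww (\<lambda>\<sigma>. s \<le> \<bar>Yt {..<n} \<rho> (?f \<sigma>)\<bar>) = prb ww (\<lambda>\<sigma>. s \<le> \<bar>Yt {..<n} \<rho> \<sigma>\<bar>)"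
    unfolding prb_def by (rule avgf)
  finally show ?thesis by simp
qed

text \<open>With \<open>kap\<close> coordinates of size at least s, one of them falls into the
  bucket with probability at least 2^-411. Flipping the sign of the first one that does rules out
  its cancellation by the others.\<close>

lemma single_many:
  assumes \<rho>: "\<rho> < ss" and J: "J \<subseteq> {i. i < n \<and> s \<le> \<bar>x i\<bar>}" "card J = kap"
  shows "(1 / 2) ^ 412 \<le> prb ww (\<lambda>\<sigma>. s \<le> \<bar>Yt {..<n} \<rho> \<sigma>\<bar>)"
proof -
  have fin: "finite J" by (rule finite_subset[OF J(1)]) simp
  let ?E = "\<lambda>\<sigma>. \<exists>i\<in>J. tb \<rho> i \<sigma>"
  let ?u = "1 / real bh"
  have u: "0 \<le> ?u" "?u \<le> 1" using bh_eq(2) by auto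
  have "prb ww (\<lambda>\<sigma>. \<forall>i\<in>J. \<not> tb \<rho> i \<sigma>) \<le> (1 - ?u) ^ card J"
  proof (rule prb_all_indep[OF fin, where S = "\<lambda>i. {ah \<rho> i}"])
    fix j \<sigma> assume j: "j \<in> J"
    have "prb ww (\<lambda>\<tau>. \<not> tb \<rho> j (override_on \<sigma> \<tau> {ah \<rho> j})) = avg ww (\<lambda>\<tau>. 1 + (-1) * of_bool (tb \<rho> j \<tau>))"
      unfolding prb_def by (intro avg_cong) (simp add: tb_addr override_on_def)
    also have "\<dots> = 1 - ?u" unfolding avg_add avg_cmult avg_const using prb_tb[of j \<rho>] j J(1) \<rho> by (auto simp: prb_def)
    finally show "prb ww (\<lambda>\<tau>. \<not> tb \<rho> j (override_on \<sigma> \<tau> {ah \<rho> j})) \<le> 1 - ?u" by simp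
  next
    show "(\<not> tb \<rho> i (override_on \<sigma> \<tau> {ah \<rho> j})) = (\<not> tb \<rho> i \<sigma>)" if "i \<noteq> j" for i j \<sigma> \<tau>
      using that \<rho> by (simp add: tb_addr override_on_def addr_inj)
  qed (use u in auto)
  then have "prb ww (\<lambda>\<sigma>. \<forall>i\<in>J. \<not> tb \<rho> i \<sigma>) \<le> (1 - ?u) ^ kap" unfolding J(2) .
  \<comment> \<open>From (1 - u)(1 + u) \<le> 1 and Bernoulli's inequality, (1 - u)^kap \<le> 1 / (1
    + kap * u), where kap * u = 2^-410.\<close>
  moreover have "(1 - ?u) ^ kap \<le> 1 - (1 / 2) ^ 411"
  proof -
    have "(1 - ?u) * (1 + ?u) = 1 - ?u\<^sup>2" by (simp add: power2_eq_square algebra_simps)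
    moreover have "?u\<^sup>2 \<le> 1" using u by (intro power_le_one)
    ultimately have "(1 - ?u) ^ kap * (1 + ?u) ^ kap \<le> 1"
      unfolding power_mult_distrib[symmetric] by (intro power_le_one) auto
    moreover have "1 + real kap * ?u \<le> (1 + ?u) ^ kap" using Bernoulli_inequality[of ?u kap] u by simp
    then have "(1 - ?u) ^ kap * (1 + real kap * ?u) \<le> (1 - ?u) ^ kap * (1 + ?u) ^ kap" using u by (intro mult_left_mono) auto
    moreover have "real kap * ?u = (1 / 2) ^ 410" using bh_kap by simp
    ultimately have "(1 - ?u) ^ kap * (1 + (1 / 2) ^ 410) \<le> 1" by simp
    then have "(1 - ?u) ^ kap \<le> 1 / (1 + (1 / 2) ^ 410)" by (simp add: pos_le_divide_eq add_pos_pos)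
    also have "\<dots> \<le> 1 - (1 / 2) ^ 411" by (simp add: power_divide)
    finally show ?thesis .
  qed
  moreover have "prb ww ?E = 1 - prb ww (\<lambda>\<sigma>. \<forall>i\<in>J. \<not> tb \<rho> i \<sigma>)"
  proof -
    have "prb ww ?E = avg ww (\<lambda>\<sigma>. 1 + (-1) * of_bool (\<forall>i\<in>J. \<not> tb \<rho> i \<sigma>))" unfolding prb_def by (intro avg_cong) auto
    then show ?thesis unfolding avg_add avg_cmult avg_const prb_def by simp
  qed
  ultimately have "(1 / 2) ^ 411 \<le> prb ww ?E" by (rule complement_ge)
  moreover have "prb ww ?E \<le> 2 * prb ww (\<lambda>\<sigma>. s \<le> \<bar>Yt {..<n} \<rho> \<sigma>\<bar>)"
  proof (rule prb_flip[OF \<rho>, where g = "\<lambda>\<sigma>. if ?E \<sigma> then {LEAST i. i \<in> J \<and> tb \<rho> i \<sigma>} else {}"])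
    have L: "(LEAST i. i \<in> J \<and> tb \<rho> i \<sigma>) \<in> J \<and> tb \<rho> (LEAST i. i \<in> J \<and> tb \<rho> i \<sigma>) \<sigma>" if "?E \<sigma>" for \<sigma>
      using LeastI_ex[of "\<lambda>i. i \<in> J \<and> tb \<rho> i \<sigma>"] that by blast
    show "(if ?E \<sigma> then {LEAST i. i \<in> J \<and> tb \<rho> i \<sigma>} else {}) \<subseteq> {..<n}" for \<sigma> using L[of \<sigma>] J(1) by auto
    show "(if ?E \<sigma> then {LEAST i. i \<in> J \<and> tb \<rho> i \<sigma>} else {}) = (if ?E \<tau> then {LEAST i. i \<in> J \<and> tb \<rho> i \<tau>} else {})"
      if "\<And>i. \<sigma> (ah \<rho> i) = \<tau> (ah \<rho> i)" for \<sigma> \<tau> unfolding tb_addr that ..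
    fix \<sigma> assume e: "?E \<sigma>"
    let ?i = "LEAST i. i \<in> J \<and> tb \<rho> i \<sigma>"
    have "\<bar>Xt \<rho> ?i \<sigma>\<bar> = \<bar>x ?i\<bar>" using L[OF e] unfolding Xt_def by (simp add: abs_mult sg_def)
    then show "s \<le> \<bar>Yt (if ?E \<sigma> then {?i} else {}) \<rho> \<sigma>\<bar> \<or> s \<le> \<bar>Yt ({..<n} - (if ?E \<sigma> then {?i} else {})) \<rho> \<sigma>\<bar>"
      using e L[OF e] J(1) by (auto simp: Yt_def)
  qed
  moreover have "(1 / 2 :: real) ^ 411 = 2 * (1 / 2) ^ 412" by (simp add: power_divide)
  ultimately have "2 * (1 / 2) ^ 412 \<le> 2 * prb ww (\<lambda>\<sigma>. s \<le> \<bar>Yt {..<n} \<rho> \<sigma>\<bar>)" by (metis order.trans)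
  then show ?thesis by (rule mult_left_le_imp_le) simp
qed

text \<open>For coordinates of size at most s the fourth moment is at most 4 v^2, since s^2 \<le> v.
  The averaged Paley-Zygmund inequality gives 1 \<le> 1/16 + 1/2 + 2P, so P \<ge> 7/32; the items
  outside K are then dealt with by a sign flip.\<close>

lemma single_few:
  assumes \<rho>: "\<rho> < ss" and s: "0 < s" and K: "K \<subseteq> {..<n}" "\<And>i. i \<in> K \<Longrightarrow> \<bar>x i\<bar> \<le> s"
    and v: "16 * s\<^sup>2 \<le> (\<Sum>i\<in>K. (x i)\<^sup>2 / real bh)"
  shows "(1 / 2) ^ 412 \<le> prb ww (\<lambda>\<sigma>. s \<le> \<bar>Yt {..<n} \<rho> \<sigma>\<bar>)"
proof -
  let ?v = "\<Sum>i\<in>K. (x i)\<^sup>2 / real bh"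
  have fin: "finite K" using K(1) finite_subset by blast
  have "0 < s\<^sup>2" using s by simp
  then have v0: "0 < ?v" using v by linarith
  note m = moments_Yt[OF fin K(1) \<rho>]
  have "(\<Sum>i\<in>K. (x i) ^ 4 / real bh) \<le> (\<Sum>i\<in>K. s\<^sup>2 * ((x i)\<^sup>2 / real bh))"
  proof (rule sum_mono)
    fix i assume "i \<in> K"
    then have "(x i)\<^sup>2 \<le> s\<^sup>2" using K(2) abs_le_square_iff[of "x i" s] s by simp
    then have "(x i)\<^sup>2 * (x i)\<^sup>2 \<le> s\<^sup>2 * (x i)\<^sup>2" by (intro mult_right_mono) auto
    then have "(x i) ^ 4 \<le> s\<^sup>2 * (x i)\<^sup>2" by (simp add: eval_nat_numeral mult.assoc)
    then show "(x i) ^ 4 / real bh \<le> s\<^sup>2 * ((x i)\<^sup>2 / real bh)" by (simp add: divide_right_mono)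
  qed
  also have "\<dots> = s\<^sup>2 * ?v" by (simp only: sum_distrib_left)
  also have "\<dots> \<le> ?v * ?v" using v v0 s by (intro mult_right_mono) auto
  finally have m4: "avg ww (\<lambda>\<sigma>. (Yt K \<rho> \<sigma>) ^ 4) \<le> 4 * ?v\<^sup>2" using m by (simp add: power2_eq_square)
  let ?Q = "\<lambda>\<sigma>. s \<le> \<bar>Yt K \<rho> \<sigma>\<bar>"
  have "?v \<le> avg ww (\<lambda>\<sigma>. ?v / 16 + (1 / (8 * ?v) * (Yt K \<rho> \<sigma>) ^ 4 + (2 * ?v) * of_bool (?Q \<sigma>)))"
    unfolding conjunct1[OF m, symmetric]
  proof (rule avg_mono, unfold conjunct1[OF m])
    fix \<sigma>
    show "(Yt K \<rho> \<sigma>)\<^sup>2 \<le> ?v / 16 + (1 / (8 * ?v) * (Yt K \<rho> \<sigma>) ^ 4 + (2 * ?v) * of_bool (?Q \<sigma>))"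
      using v v0 by (intro paley_zygmund_pointwise) auto
  qed
  also have "\<dots> = ?v / 16 + (1 / (8 * ?v) * avg ww (\<lambda>\<sigma>. (Yt K \<rho> \<sigma>) ^ 4) + (2 * ?v) * prb ww ?Q)"
    unfolding prb_def by (simp only: avg_add avg_cmult avg_const)
  also have "\<dots> \<le> ?v / 16 + (1 / (8 * ?v) * (4 * ?v\<^sup>2) + (2 * ?v) * prb ww ?Q)"
    using m4 v0 by (intro add_left_mono add_right_mono mult_left_mono) auto
  also have "1 / (8 * ?v) * (4 * ?v\<^sup>2) = ?v / 2" using v0 by (simp add: power2_eq_square)
  finally have "?v * 1 \<le> ?v * (1 / 16 + 1 / 2 + 2 * prb ww ?Q)" by (simp add: distrib_left)
  then have "7 / 32 \<le> prb ww ?Q" using mult_le_cancel_left_pos[OF v0, of 1 "1 / 16 + 1 / 2 + 2 * prb ww ?Q"] by simp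
  moreover have "prb ww ?Q \<le> 2 * prb ww (\<lambda>\<sigma>. s \<le> \<bar>Yt {..<n} \<rho> \<sigma>\<bar>)"
    by (rule prb_flip[OF \<rho>, where g = "\<lambda>_. K"]) (use K(1) in auto)
  moreover have "(1 / 2 :: real) ^ 412 \<le> 7 / 64" by (simp add: power_divide)
  ultimately show ?thesis by linarith
qed

text \<open>Either many coordinates reach the level s or the energy below it is large, and in both
  cases a single bucket value reaches s with probability at least 2^-412. The c readings are
  independent.\<close>

lemma thr_lower:
  "prb ww (\<lambda>\<sigma>. \<not> (\<exists>S0\<subseteq>{..<n}. card S0 \<le> kap \<and> (\<Sum>i\<in>{..<n} - S0. (x i)\<^sup>2) \<le> real kap * (thr (yv \<sigma>))\<^sup>2)) \<le> (1 - (1 / 2) ^ 412) ^ c"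
proof -
  let ?F = "{S. S \<subseteq> {..<n} \<and> card S \<le> kap}" and ?w = "\<lambda>S. \<Sum>i\<in>{..<n} - S. (x i)\<^sup>2"
  define \<Phi> where "\<Phi> = Min (?w ` ?F)"
  have finF: "finite ?F" "?F \<noteq> {}" by (auto intro: exI[of _ "{}"])
  have "\<Phi> \<in> ?w ` ?F" unfolding \<Phi>_def using finF by (intro Min_in) auto
  then obtain S0 where S0: "S0 \<subseteq> {..<n}" "card S0 \<le> kap" "?w S0 = \<Phi>" by auto
  have \<Phi>_le: "\<Phi> \<le> ?w S" if "S \<subseteq> {..<n}" "card S \<le> kap" for S
    unfolding \<Phi>_def using finF that by (intro Min_le) auto
  have \<Phi>0: "0 \<le> \<Phi>" unfolding S0(3)[symmetric] by (simp add: sum_nonneg)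
  \<comment> \<open>The level at which the threshold, 2^207 times a bucket value, has a square of at
    least \<Phi> / kap, as the conclusion demands for the best exceptional set.\<close>
  define s where "s = sqrt (\<Phi> / real kap) / 2 ^ 207"
  have s0: "0 \<le> s" using \<Phi>0 by (simp add: s_def)
  have s2: "real kap * (2 ^ 414 * s\<^sup>2) = \<Phi>" using \<Phi>0 kap(2) by (simp add: s_def power_divide power_mult[symmetric])
  have one: "(1 / 2) ^ 412 \<le> prb ww (\<lambda>\<sigma>. s \<le> \<bar>Yt {..<n} \<rho> \<sigma>\<bar>)" if \<rho>: "\<rho> < ss" for \<rho>
  proof -
    let ?I = "{i. i < n \<and> s \<le> \<bar>x i\<bar>}"
    show ?thesis
    proof (cases "kap \<le> card ?I")
      case True
      then obtain J where "J \<subseteq> ?I" "card J = kap" by (metis obtain_subset_with_card_n)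
      then show ?thesis by (rule single_many[OF \<rho>])
    next
      case False
      show ?thesis
      proof (cases "s = 0")
        case True
        have "prb ww (\<lambda>\<sigma>. s \<le> \<bar>Yt {..<n} \<rho> \<sigma>\<bar>) = 1" using True by (simp add: prb_def)
        then show ?thesis by (simp add: power_divide)
      next
        case s: False
        have "?w ?I = (\<Sum>i\<in>{..<n} - ?I. (x i)\<^sup>2)" ..
        \<comment> \<open>Fewer than kap coordinates reach s, so their set competes in the minimum.
          Moreover \<Phi> / bh = 2^-410 * 2^414 * s^2 = 16 s^2, which is exactly what
          \<open>single_few\<close> needs and where 2^207 comes from.\<close>
        have "\<Phi> \<le> ?w ?I" using False by (intro \<Phi>_le) auto
        then have "\<Phi> / real bh \<le> ?w ?I / real bh" by (intro divide_right_mono) auto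
        moreover have "\<Phi> / real bh = (real kap / real bh) * 2 ^ 414 * s\<^sup>2" using s2 by (simp add: mult.assoc)
        moreover have "(1 / 2 :: real) ^ 410 * 2 ^ 414 = 16" by (simp add: power_divide)
        ultimately have "16 * s\<^sup>2 \<le> (\<Sum>i\<in>{..<n} - ?I. (x i)\<^sup>2 / real bh)" unfolding bh_kap by (simp only: sum_divide_distrib)
        then show ?thesis using s s0 by (intro single_few[OF \<rho>, of s "{..<n} - ?I"]) auto
      qed
    qed
  qed
  have "prb ww (\<lambda>\<sigma>. \<not> (\<exists>S0\<subseteq>{..<n}. card S0 \<le> kap \<and> ?w S0 \<le> real kap * (thr (yv \<sigma>))\<^sup>2)) \<le> prb ww (\<lambda>\<sigma>. \<forall>\<rho>\<in>{..<c}. \<not> s \<le> \<bar>Yt {..<n} \<rho> \<sigma>\<bar>)"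
  proof (rule prb_mono, rule ballI, rule notI)
    fix \<sigma> \<rho> assume no: "\<not> (\<exists>S0\<subseteq>{..<n}. card S0 \<le> kap \<and> ?w S0 \<le> real kap * (thr (yv \<sigma>))\<^sup>2)" and \<rho>: "\<rho> \<in> {..<c}" and le: "s \<le> \<bar>Yt {..<n} \<rho> \<sigma>\<bar>"
    have "\<bar>row (yv \<sigma>) \<rho> 0\<bar> \<le> Max ((\<lambda>\<rho>. \<bar>row (yv \<sigma>) \<rho> 0\<bar>) ` {..<c})" using \<rho> by (intro Max_ge) auto
    moreover have "s \<le> \<bar>row (yv \<sigma>) \<rho> 0\<bar>" using le row_Yt[of \<rho> \<sigma>] \<rho> by simp
    ultimately have "s \<le> Max ((\<lambda>\<rho>. \<bar>row (yv \<sigma>) \<rho> 0\<bar>) ` {..<c})" by linarith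
    then have "2 ^ 207 * s \<le> thr (yv \<sigma>)" unfolding thr_def by (intro mult_left_mono) auto
    then have "(2 ^ 207 * s)\<^sup>2 \<le> (thr (yv \<sigma>))\<^sup>2" using s0 by (intro power_mono) auto
    then have "2 ^ 414 * s\<^sup>2 \<le> (thr (yv \<sigma>))\<^sup>2" by (simp add: power_mult_distrib power_mult[symmetric])
    then have "\<Phi> \<le> real kap * (thr (yv \<sigma>))\<^sup>2" unfolding s2[symmetric] by (intro mult_left_mono) auto
    then show False using no S0 by auto
  qed
  also have "\<dots> \<le> (1 - (1 / 2) ^ 412) ^ card {..<c}"
  proof (rule prb_all_indep[where S = "\<lambda>\<rho>. RS {\<rho>}"])
    have Yo: "Yt {..<n} \<rho> (override_on \<sigma> \<tau> (RS {\<rho>'})) = Yt {..<n} \<rho> (if \<rho> = \<rho>' then \<tau> else \<sigma>)" if "\<rho> < ss" for \<rho> \<rho>' \<sigma> \<tau>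
      unfolding Yt_def Xt_def tb_def using that by (cases "\<rho> = \<rho>'") (simp_all add: hsh_ov cw_ov cong: if_cong)
    show "prb ww (\<lambda>\<tau>. \<not> s \<le> \<bar>Yt {..<n} \<rho> (override_on \<sigma> \<tau> (RS {\<rho>}))\<bar>) \<le> 1 - (1 / 2) ^ 412" if "\<rho> \<in> {..<c}" for \<rho> \<sigma>
    proof -
      have r: "\<rho> < ss" using that c_le dd_ss by simp
      have "prb ww (\<lambda>\<tau>. \<not> s \<le> \<bar>Yt {..<n} \<rho> (override_on \<sigma> \<tau> (RS {\<rho>}))\<bar>) = avg ww (\<lambda>\<tau>. 1 + (-1) * of_bool (s \<le> \<bar>Yt {..<n} \<rho> \<tau>\<bar>))"
        unfolding prb_def by (intro avg_cong) (simp add: Yo[OF r])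
      then show ?thesis unfolding avg_add avg_cmult avg_const using one[OF r] by (simp add: prb_def)
    qed
    show "(\<not> s \<le> \<bar>Yt {..<n} i (override_on \<sigma> \<tau> (RS {j}))\<bar>) = (\<not> s \<le> \<bar>Yt {..<n} i \<sigma>\<bar>)" if "i \<in> {..<c}" "i \<noteq> j" for i j \<sigma> \<tau>
      using that c_le dd_ss by (simp add: Yo)
  qed (auto simp: power_divide)
  finally show ?thesis by simp
qed

end

section \<open>Recovery guarantee\<close>

context sketch_par
begin

lemma thr_nonneg: "0 \<le> thr y"
proof -
  have "0 \<le> \<bar>row y 0 0\<bar>" by simp
  also have "\<dots> \<le> Max ((\<lambda>\<rho>. \<bar>row y \<rho> 0\<bar>) ` {..<c})" using c_pos by (intro Max_ge) auto
  finally show ?thesis unfolding thr_def by simp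
qed

section \<open>The matrix and the decoded vector\<close>

definition Amat :: "(nat \<Rightarrow> nat) \<Rightarrow> real mat" where
  "Amat \<sigma> = Matrix.mat (ss * B) n (\<lambda>(r, i). if hb \<sigma> (r div B) (nd (zl \<sigma>) (r div B) i) + bt (r div B) i = r mod B
     then cf (r div B) (cw \<sigma> (r div B) i) else 0)"

text \<open>In each repetition a coordinate enters a single bucket.\<close>

lemma col_nnz_Amat: assumes "i < n" shows "col_nnz (Amat \<sigma>) i \<le> ss"
proof -
  let ?b = "\<lambda>\<rho>. hb \<sigma> \<rho> (nd (zl \<sigma>) \<rho> i) + bt \<rho> i"
  have "{r. r < dim_row (Amat \<sigma>) \<and> Amat \<sigma> $$ (r, i) \<noteq> 0} \<subseteq> (\<lambda>\<rho>. \<rho> * B + ?b \<rho>) ` {..<ss}"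
  proof
    fix r assume r: "r \<in> {r. r < dim_row (Amat \<sigma>) \<and> Amat \<sigma> $$ (r, i) \<noteq> 0}"
    then have "r < ss * B" by (simp add: Amat_def)
    moreover from this r assms have "?b (r div B) = r mod B" unfolding Amat_def by (auto split: if_splits)
    moreover have "r = r div B * B + r mod B" by simp
    ultimately show "r \<in> (\<lambda>\<rho>. \<rho> * B + ?b \<rho>) ` {..<ss}"
      by (intro image_eqI[of _ _ "r div B"]) (auto simp: less_mult_imp_div_less)
  qed
  then have "col_nnz (Amat \<sigma>) i \<le> card ((\<lambda>\<rho>. \<rho> * B + ?b \<rho>) ` {..<ss})"
    unfolding col_nnz_def by (intro card_mono) auto
  also have "\<dots> \<le> card {..<ss}" by (rule card_image_le) simp
  finally show ?thesis by simp
qed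

text \<open>Reported values exceed 6\<theta> \<ge> 0 in size and are thus nonzero, and no index is
  reported twice.\<close>

lemma decode_sparse: "sparse_repr (decode \<sigma> y) (Matrix.vec n (\<lambda>i. case map_of (decode \<sigma> y) i of None \<Rightarrow> 0 | Some v \<Rightarrow> v))"
proof -
  let ?out = "decode \<sigma> y"
  have d: "distinct (map fst ?out)" unfolding decode_def by (rule outE_sound(1))
  have s: "i < n \<and> v \<noteq> 0" if "(i, v) \<in> set ?out" for i v
  proof -
    have "i \<in> set (candG \<sigma> y (thr y) (candX \<sigma> y (thr y)))" "6 * thr y < \<bar>v\<bar>"
      using outE_sound(2)[OF that[unfolded decode_def]] by auto
    moreover from this(1) have "i < n" by (rule candG_less[rotated]) (use candX_less in blast)
    ultimately show ?thesis using thr_nonneg[of y] by auto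
  qed
  define V where "V = Matrix.vec n (\<lambda>i. case map_of ?out i of None \<Rightarrow> 0 | Some v \<Rightarrow> v)"
  have mo: "(i, v) \<in> set ?out \<longleftrightarrow> map_of ?out i = Some v" for i v using d by (simp add: map_of_eq_Some_iff)
  have V: "dim_vec V = n" "i < n \<Longrightarrow> vec_index V i = (case map_of ?out i of None \<Rightarrow> 0 | Some v \<Rightarrow> v)" for i by (simp_all add: V_def)
  have "set ?out \<subseteq> {(i, vec_index V i) |i. i < dim_vec V \<and> vec_index V i \<noteq> 0}"
  proof
    fix p assume p: "p \<in> set ?out"
    obtain i v where iv: "p = (i, v)" by (cases p) auto
    then have "i < n" "v \<noteq> 0" "map_of ?out i = Some v" using p s mo by blast+
    then have "i < dim_vec V" "vec_index V i = v" using V by auto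
    then show "p \<in> {(i, vec_index V i) |i. i < dim_vec V \<and> vec_index V i \<noteq> 0}" using iv \<open>v \<noteq> 0\<close> by blast
  qed
  moreover have "{(i, vec_index V i) |i. i < dim_vec V \<and> vec_index V i \<noteq> 0} \<subseteq> set ?out"
  proof
    fix p assume "p \<in> {(i, vec_index V i) |i. i < dim_vec V \<and> vec_index V i \<noteq> 0}"
    then obtain i where i: "p = (i, vec_index V i)" "i < n" "vec_index V i \<noteq> 0" using V(1) by auto
    then have "map_of ?out i = Some (vec_index V i)" using V(2)[OF i(2)] by (auto split: option.splits)
    then show "p \<in> set ?out" using i(1) mo by blast
  qed
  moreover have "distinct ?out" using d by (simp add: distinct_map)
  ultimately show ?thesis unfolding V_def[symmetric] sparse_repr_def by blast
qed

end

context sketch_prob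
begin

lemma Amat_yv:
  assumes X: "X \<in> carrier_vec n" "\<And>i. i < n \<Longrightarrow> vec_index X i = x i"
  shows "Amat \<sigma> *\<^sub>v X = yv \<sigma>"
proof (rule eq_vecI)
  show "dim_vec (Amat \<sigma> *\<^sub>v X) = dim_vec (yv \<sigma>)" by (simp add: Amat_def yv_def)
  fix r assume "r < dim_vec (yv \<sigma>)"
  then have r: "r < ss * B" by (simp add: yv_def)
  have "vec_index (Amat \<sigma> *\<^sub>v X) r = (\<Sum>i\<in>{0..<n}. Amat \<sigma> $$ (r, i) * vec_index X i)"
    using r X(1) by (simp add: Amat_def mult_mat_vec_def scalar_prod_def)
  also have "\<dots> = Yf x \<sigma> (r div B) (r mod B)"
    unfolding Yf_def atLeast0LessThan using r X(2) by (intro sum.cong) (auto simp: Amat_def)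
  finally show "vec_index (Amat \<sigma> *\<^sub>v X) r = vec_index (yv \<sigma>) r" using r by (simp add: yv_def)
qed

lemma thr_yv_ov: "thr (yv (override_on \<sigma> \<tau> (RS {dd..<ss}))) = thr (yv \<sigma>)"
proof -
  have "row (yv (override_on \<sigma> \<tau> (RS {dd..<ss}))) \<rho> 0 = row (yv \<sigma>) \<rho> 0" if "\<rho> < c" for \<rho>
  proof -
    have r: "\<rho> < dd" "\<rho> < ss" using that c_le dd_ss by auto
    show ?thesis unfolding row_yv[OF r(2) B_pos] using r dd_pos by (subst Yf_ov) auto
  qed
  then show ?thesis unfolding thr_def by (intro arg_cong[where f = "\<lambda>A. 2 ^ 207 * Max A"] image_cong) auto
qed

text \<open>The repetitions from dd on are resampled while the threshold stays fixed. When the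
  threshold is large enough the analysis for constant \<theta> applies; otherwise failure is
  conceded.\<close>

lemma prb_decode:
  assumes H: "H \<subseteq> {..<n}" "card H \<le> k" and c2: "2 \<le> c" "c \<le> vv"
  shows "prb ww (\<lambda>\<sigma>. \<not> gout H k (thr (yv \<sigma>)) (decode \<sigma> (yv \<sigma>))) \<le> (1 - (1 / 2) ^ 412) ^ c + 28 / real c"
proof -
  let ?L = "\<lambda>\<sigma>. \<exists>S0\<subseteq>{..<n}. card S0 \<le> kap \<and> (\<Sum>i\<in>{..<n} - S0. (x i)\<^sup>2) \<le> real kap * (thr (yv \<sigma>))\<^sup>2"
  have d: "decode \<sigma> (yv \<sigma>) = dec (thr (yv \<sigma>)) \<sigma>" for \<sigma> unfolding decode_def dec_def cands_def ..
  have "prb ww (\<lambda>\<sigma>. \<not> gout H k (thr (yv \<sigma>)) (decode \<sigma> (yv \<sigma>))) \<le> avg ww (\<lambda>\<sigma>. of_bool (\<not> ?L \<sigma>) + 28 / real c)"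
    unfolding prb_def
  proof (rule avg_resample_le[where S = "RS {dd..<ss}"])
    fix \<sigma> assume "\<sigma> \<in> tapes ww"
    let ?\<theta> = "thr (yv \<sigma>)"
    have e: "avg ww (\<lambda>\<tau>. of_bool (\<not> gout H k (thr (yv (override_on \<sigma> \<tau> (RS {dd..<ss})))) (decode (override_on \<sigma> \<tau> (RS {dd..<ss})) (yv (override_on \<sigma> \<tau> (RS {dd..<ss}))))))
      = prb ww (\<lambda>\<tau>. \<not> gout H k ?\<theta> (dec ?\<theta> \<tau>))"
      unfolding d thr_yv_ov dec_ov prb_def ..
    show "avg ww (\<lambda>\<tau>. of_bool (\<not> gout H k (thr (yv (override_on \<sigma> \<tau> (RS {dd..<ss})))) (decode (override_on \<sigma> \<tau> (RS {dd..<ss})) (yv (override_on \<sigma> \<tau> (RS {dd..<ss}))))))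
      \<le> of_bool (\<not> ?L \<sigma>) + 28 / real c"
    proof (cases "?L \<sigma>")
      case True
      then obtain S0 where S: "S0 \<subseteq> {..<n}" "card S0 \<le> kap" "(\<Sum>i\<in>{..<n} - S0. (x i)\<^sup>2) \<le> real kap * ?\<theta>\<^sup>2" by blast
      have t0: "0 \<le> ?\<theta>" by (rule thr_nonneg)
      interpret T: sketch_thr n B c x bexp ?\<theta> S0
        by unfold_locales (use S t0 in auto)
      show ?thesis unfolding e using T.prb_gout[OF H c2] True by simp
    next
      case False
      have "prb ww (\<lambda>\<tau>. \<not> gout H k ?\<theta> (dec ?\<theta> \<tau>)) \<le> 1" by (rule prb_le_1)
      moreover have "0 \<le> 28 / real c" by simp
      moreover have "of_bool (\<not> ?L \<sigma>) = (1::real)" using False by simp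
      ultimately show ?thesis unfolding e by linarith
    qed
  qed
  also have "\<dots> = prb ww (\<lambda>\<sigma>. \<not> ?L \<sigma>) + 28 / real c" unfolding avg_add avg_const prb_def ..
  also have "\<dots> \<le> (1 - (1 / 2) ^ 412) ^ c + 28 / real c" using thr_lower by (rule add_right_mono)
  finally show ?thesis .
qed

definition xhat :: "(nat \<times> real) list \<Rightarrow> nat \<Rightarrow> real" where
  "xhat out i = (case map_of out i of None \<Rightarrow> 0 | Some v \<Rightarrow> v)"

text \<open>Reporting a coordinate never increases its error beyond its own energy, as the error is
  at most 3\<theta> \<le> |x_i|. So outside the head the tail energy is an upper bound; in the head
  each reported coordinate costs at most 9\<theta>^2.\<close>

lemma gout_error:
  assumes H: "H \<subseteq> {..<n}" "card H \<le> k" and g: "gout H k \<theta> out" and t: "0 \<le> \<theta>"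
  shows "(\<Sum>i<n. (x i - xhat out i)\<^sup>2) \<le> (\<Sum>i\<in>{..<n} - H. (x i)\<^sup>2) + (90 + 3 * real c) * (real k * \<theta>\<^sup>2)"
proof -
  let ?O = "fst ` set out"
  have finH: "finite H" using H(1) finite_subset by blast
  have io: "(x i - xhat out i)\<^sup>2 \<le> 9 * \<theta>\<^sup>2 \<and> 9 * \<theta>\<^sup>2 \<le> (x i)\<^sup>2" if "i \<in> ?O" for i
  proof -
    have "map_of out i \<noteq> None" using that by (simp add: map_of_eq_None_iff)
    then obtain v where v: "map_of out i = Some v" by blast
    then have "(i, v) \<in> set out" by (rule map_of_SomeD)
    then have *: "6 * \<theta> < \<bar>v\<bar>" "\<bar>v - x i\<bar> \<le> 3 * \<theta>" using g unfolding gout_def by auto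
    then have "\<bar>x i - v\<bar> \<le> \<bar>3 * \<theta>\<bar>" "\<bar>3 * \<theta>\<bar> \<le> \<bar>x i\<bar>" by linarith+
    then have "(x i - v)\<^sup>2 \<le> (3 * \<theta>)\<^sup>2" "(3 * \<theta>)\<^sup>2 \<le> (x i)\<^sup>2" by (simp_all only: abs_le_square_iff)
    then show ?thesis using v by (simp add: xhat_def power_mult_distrib)
  qed
  have no: "(x i - xhat out i)\<^sup>2 = (x i)\<^sup>2" if "i \<notin> ?O" for i
  proof -
    have "map_of out i = None" using that by (simp add: map_of_eq_None_iff)
    then show ?thesis by (simp add: xhat_def)
  qed
  have "(\<Sum>i<n. (x i - xhat out i)\<^sup>2) = (\<Sum>i\<in>{..<n} - H. (x i - xhat out i)\<^sup>2) + (\<Sum>i\<in>H. (x i - xhat out i)\<^sup>2)"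
    using H(1) by (intro sum.subset_diff) auto
  moreover have "(\<Sum>i\<in>{..<n} - H. (x i - xhat out i)\<^sup>2) \<le> (\<Sum>i\<in>{..<n} - H. (x i)\<^sup>2)"
  proof (rule sum_mono)
    fix i show "(x i - xhat out i)\<^sup>2 \<le> (x i)\<^sup>2" using io[of i] no[of i] by (cases "i \<in> ?O") auto
  qed
  moreover have "(\<Sum>i\<in>H. (x i - xhat out i)\<^sup>2) = (\<Sum>i\<in>H - ?O. (x i - xhat out i)\<^sup>2) + (\<Sum>i\<in>H \<inter> ?O. (x i - xhat out i)\<^sup>2)"
    using sum.Int_Diff[OF finH, of "\<lambda>i. (x i - xhat out i)\<^sup>2" ?O] by simp
  moreover have "(\<Sum>i\<in>H - ?O. (x i - xhat out i)\<^sup>2) = (\<Sum>i\<in>H - ?O. (x i)\<^sup>2)" using no by (intro sum.cong) auto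
  moreover have "(\<Sum>i\<in>H - ?O. (x i)\<^sup>2) \<le> (81 + 3 * real c) * (real k * \<theta>\<^sup>2)" using g unfolding gout_def by blast
  moreover have "(\<Sum>i\<in>H \<inter> ?O. (x i - xhat out i)\<^sup>2) \<le> real (card (H \<inter> ?O)) * (9 * \<theta>\<^sup>2)"
    using io by (intro sum_bounded_above) auto
  moreover have "real (card (H \<inter> ?O)) * (9 * \<theta>\<^sup>2) \<le> real k * (9 * \<theta>\<^sup>2)"
  proof (rule mult_right_mono)
    have "card (H \<inter> ?O) \<le> card H" using finH by (intro card_mono) auto
    then show "real (card (H \<inter> ?O)) \<le> real k" using H(2) by simp
  qed simp
  moreover have "(90 + 3 * real c) * (real k * \<theta>\<^sup>2) = (81 + 3 * real c) * (real k * \<theta>\<^sup>2) + real k * (9 * \<theta>\<^sup>2)" by (simp add: algebra_simps)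
  ultimately show ?thesis by linarith
qed

text \<open>The bound on \<theta>^2 by 2^414 c^2 * tail energy / bh makes the excess at most
  \<epsilon> times the tail energy; the assumption on \<open>bh\<close> is exactly this requirement.
  The two extra units over c come from \<open>thr_upper\<close>.\<close>

lemma prb_error:
  assumes H: "H \<subseteq> {..<n}" "card H \<le> k" and c2: "2 \<le> c" "c \<le> vv" and \<epsilon>: "0 < \<epsilon>" "\<epsilon> < 1"
    and B: "(90 + 3 * real c) * 2 ^ 414 * (real c)\<^sup>2 * (real k / \<epsilon>) \<le> real bh"
  shows "prb ww (\<lambda>\<sigma>. \<not> (\<Sum>i<n. (x i - xhat (decode \<sigma> (yv \<sigma>)) i)\<^sup>2) \<le> (1 + \<epsilon>) * (\<Sum>i\<in>{..<n} - H. (x i)\<^sup>2))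
    \<le> (1 - (1 / 2) ^ 412) ^ c + 30 / real c"
proof -
  let ?T = "\<Sum>i\<in>{..<n} - H. (x i)\<^sup>2"
  define K where "K = (90 + 3 * real c) * 2 ^ 414 * (real c)\<^sup>2"
  have T0: "0 \<le> ?T" by (simp add: sum_nonneg)
  have bh0: "0 < real bh" using bh_eq(2) by simp
  have c1: "1 \<le> real c" using c2(1) by simp
  have Kk: "K * real k \<le> \<epsilon> * real bh" using B[folded K_def] \<epsilon>(1) by (simp add: pos_divide_le_eq mult.commute)
  let ?P1 = "\<lambda>\<sigma>. \<not> gout H k (thr (yv \<sigma>)) (decode \<sigma> (yv \<sigma>))"
  let ?P2 = "\<lambda>\<sigma>. 2 ^ 414 * ((real c)\<^sup>2 * (?T / real bh)) < (thr (yv \<sigma>))\<^sup>2"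
  have "prb ww (\<lambda>\<sigma>. \<not> (\<Sum>i<n. (x i - xhat (decode \<sigma> (yv \<sigma>)) i)\<^sup>2) \<le> (1 + \<epsilon>) * ?T) \<le> prb ww (\<lambda>\<sigma>. ?P1 \<sigma> \<or> ?P2 \<sigma>)"
  proof (rule prb_mono, rule ccontr)
    fix \<sigma> assume bad: "\<not> (\<Sum>i<n. (x i - xhat (decode \<sigma> (yv \<sigma>)) i)\<^sup>2) \<le> (1 + \<epsilon>) * ?T" and "\<not> (?P1 \<sigma> \<or> ?P2 \<sigma>)"
    then have g: "gout H k (thr (yv \<sigma>)) (decode \<sigma> (yv \<sigma>))" and t: "(thr (yv \<sigma>))\<^sup>2 \<le> 2 ^ 414 * ((real c)\<^sup>2 * (?T / real bh))" by auto
    have "(90 + 3 * real c) * (real k * (thr (yv \<sigma>))\<^sup>2) \<le> (90 + 3 * real c) * (real k * (2 ^ 414 * ((real c)\<^sup>2 * (?T / real bh))))"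
      using t by (intro mult_left_mono) auto
    also have "\<dots> = (K * real k) * (?T / real bh)" unfolding K_def by (simp only: mult_ac)
    also have "\<dots> \<le> (\<epsilon> * real bh) * (?T / real bh)" using Kk T0 by (intro mult_right_mono) auto
    also have "\<dots> = \<epsilon> * ?T" using bh0 by simp
    finally have le: "(90 + 3 * real c) * (real k * (thr (yv \<sigma>))\<^sup>2) \<le> \<epsilon> * ?T" .
    have "(1 + \<epsilon>) * ?T = ?T + \<epsilon> * ?T" by (simp add: algebra_simps)
    then show False using le gout_error[OF H g thr_nonneg] bad by linarith
  qed
  also have "\<dots> \<le> prb ww ?P1 + prb ww ?P2" by (rule prb_disj)
  also have "\<dots> \<le> ((1 - (1 / 2) ^ 412) ^ c + 28 / real c) + real c * (real k / real bh + 1 / (real c)\<^sup>2)"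
    by (rule add_mono[OF prb_decode[OF H c2] thr_upper[OF H]])
  also have "real c * (real k / real bh + 1 / (real c)\<^sup>2) \<le> 2 / real c"
  proof -
    have "1 * 1 \<le> (90 + 3 * real c) * (2 ^ 414 :: real)" using c1 by (intro mult_mono) auto
    then have one: "1 \<le> (90 + 3 * real c) * (2 ^ 414 :: real)" by (simp only: mult_1_left)
    have "1 * (real c)\<^sup>2 \<le> K" unfolding K_def by (rule mult_right_mono[OF one zero_le_power2])
    then have "1 * (real c)\<^sup>2 * real k \<le> K * real k" by (rule mult_right_mono) simp
    then have "(real c)\<^sup>2 * real k \<le> K * real k" by (simp only: mult_1_left)
    also have "\<dots> \<le> \<epsilon> * real bh" by (rule Kk)
    also have "\<dots> \<le> 1 * real bh" using \<epsilon> by (intro mult_right_mono) auto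
    finally have "real c * (real c * real k) \<le> real bh" by (simp add: power2_eq_square mult.assoc)
    then have "real c * (real c * real k) / real bh \<le> 1" using bh0 by simp
    then have "real c * (real c * real k) / real bh / real c \<le> 1 / real c" by (rule divide_right_mono) simp
    moreover have "real c * (real c * real k) / real bh / real c = real c * (real k / real bh)" using c1 by simp
    ultimately have "real c * (real k / real bh) \<le> 1 / real c" by (simp only:)
    moreover have "real c * (1 / (real c)\<^sup>2) = 1 / real c" using c1 by (simp add: power2_eq_square)
    ultimately show ?thesis by (simp add: distrib_left)
  qed
  finally show ?thesis by (simp only: add.assoc add_divide_distrib[symmetric]) simp
qed

end

section \<open>Heads, norms and the passage to the uniform measure\<close>

lemma abs_rank_inj:
  assumes "i < dim_vec X" "j < dim_vec X" "i \<noteq> j"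
  shows "abs_rank X i \<noteq> abs_rank X j"
proof -
  define R where "R a b \<longleftrightarrow> \<bar>vec_index X a\<bar> > \<bar>vec_index X b\<bar> \<or> \<bar>vec_index X a\<bar> = \<bar>vec_index X b\<bar> \<and> a < b" for a b :: nat
  have ar: "abs_rank X a = card {l. l < dim_vec X \<and> R l a}" for a unfolding abs_rank_def R_def ..
  have less: "abs_rank X a < abs_rank X b" if "a < dim_vec X" "R a b" for a b
  proof -
    have "{l. l < dim_vec X \<and> R l a} \<subset> {l. l < dim_vec X \<and> R l b}"
    proof
      show "{l. l < dim_vec X \<and> R l a} \<subseteq> {l. l < dim_vec X \<and> R l b}" using that(2) unfolding R_def by auto
      show "{l. l < dim_vec X \<and> R l a} \<noteq> {l. l < dim_vec X \<and> R l b}" using that unfolding R_def by blast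
    qed
    then show ?thesis unfolding ar by (intro psubset_card_mono) auto
  qed
  have "R i j \<or> R j i" using assms(3) unfolding R_def by linarith
  then show ?thesis using less assms by fastforce
qed

definition head_set :: "nat \<Rightarrow> real Matrix.vec \<Rightarrow> nat set" where
  "head_set k X = {i. i < dim_vec X \<and> abs_rank X i < k}"

lemma card_head_set: "card (head_set k X) \<le> k"
proof -
  have "card (abs_rank X ` head_set k X) \<le> card {..<k}" by (intro card_mono) (auto simp: head_set_def)
  moreover have "inj_on (abs_rank X) (head_set k X)" using abs_rank_inj unfolding inj_on_def head_set_def by blast
  ultimately show ?thesis by (simp add: card_image)
qed

lemma l2norm_sq: "(l2norm v)\<^sup>2 = (\<Sum>i<dim_vec v. (vec_index v i)\<^sup>2)"
  unfolding l2norm_def L2_set_def by (simp add: sum_nonneg)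

lemma l2norm_tail: "(l2norm (tail_vec k X))\<^sup>2 = (\<Sum>i\<in>{..<dim_vec X} - head_set k X. (vec_index X i)\<^sup>2)"
proof -
  have "(l2norm (tail_vec k X))\<^sup>2 = (\<Sum>i<dim_vec X. if abs_rank X i < k then 0 else (vec_index X i)\<^sup>2)"
    unfolding l2norm_sq by (intro sum.cong) (auto simp: tail_vec_def)
  also have "\<dots> = (\<Sum>i\<in>{..<dim_vec X} - head_set k X. (vec_index X i)\<^sup>2)"
    by (intro sum.mono_neutral_cong_right) (auto simp: head_set_def)
  finally show ?thesis .
qed

lemma clog_log: "1 \<le> n \<Longrightarrow> clog n = nat \<lceil>log 2 (real n)\<rceil>"
proof -
  assume n: "1 \<le> n"
  have eq: "n \<le> 2 ^ d \<longleftrightarrow> nat \<lceil>log 2 (real n)\<rceil> \<le> d" for d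
  proof -
    have "n \<le> 2 ^ d \<longleftrightarrow> real n \<le> 2 ^ d" by (metis of_nat_le_iff of_nat_numeral of_nat_power)
    also have "\<dots> \<longleftrightarrow> log 2 (real n) \<le> real d" using n by (simp add: log_le_iff powr_realpow)
    also have "\<dots> \<longleftrightarrow> nat \<lceil>log 2 (real n)\<rceil> \<le> d" by (simp add: nat_le_iff ceiling_le_iff)
    finally show ?thesis .
  qed
  show ?thesis unfolding clog_def eq by (rule Least_equality) simp_all
qed

lemma prob_tapes: "measure_pmf.prob (pmf_of_set (tapes w)) {\<sigma>. P \<sigma>} = prb w P"
proof -
  have "measure_pmf.prob (pmf_of_set (tapes w)) {\<sigma>. P \<sigma>} = real (card (tapes w \<inter> {\<sigma>. P \<sigma>})) / real (card (tapes w))"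
    by (rule measure_pmf_of_set) auto
  also have "real (card (tapes w \<inter> {\<sigma>. P \<sigma>})) = (\<Sum>\<sigma>\<in>tapes w. of_bool (P \<sigma>))"
    by (simp add: of_bool_def sum.If_cases)
  finally show ?thesis unfolding prb_def avg_def .
qed

lemma prb_not: "prb w P = 1 - prb w (\<lambda>\<sigma>. \<not> P \<sigma>)"
proof -
  have "prb w P = avg w (\<lambda>\<sigma>. 1 + (-1) * of_bool (\<not> P \<sigma>))" unfolding prb_def by (intro avg_cong) auto
  then show ?thesis unfolding avg_add avg_cmult avg_const prb_def by simp
qed

lemma recovers_runs:
  assumes "runs w \<sigma> y cm (init_state n k \<epsilon> (dim_vec y)) s' T" "T \<le> T'" "sparse_repr (outp s') v"
  shows "recovers_within w (compile 0 cm) n k \<epsilon> \<sigma> y T' v"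
proof -
  have "runs w \<sigma> y cm (init_state n k \<epsilon> (dim_vec y)) s' T'" using assms(1,2) by (rule runs_mono)
  from runs_program[OF this] assms(3) show ?thesis unfolding recovers_within_def Let_def by (simp add: init_state_def)
qed

text \<open>The conclusion of the theorem for one choice of n, k and \<epsilon>, so that the
  identity sketch and the hashed sketch can be treated apart.\<close>

definition good_sketch :: "nat \<Rightarrow> instr list \<Rightarrow> nat \<Rightarrow> nat \<Rightarrow> real \<Rightarrow> real \<Rightarrow> nat \<Rightarrow> bool" where
  "good_sketch w P n k \<epsilon> \<delta> C \<longleftrightarrow> (\<exists>(m :: nat) (A :: (nat \<Rightarrow> nat) \<Rightarrow> real mat)
      (rec :: (nat \<Rightarrow> nat) \<Rightarrow> real Matrix.vec \<Rightarrow> real Matrix.vec).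
       n < 2 ^ w \<and> m < 2 ^ w \<and>
       real m \<le> real C * (real k / \<epsilon>) * log 2 (real n) \<and>
       (\<forall>\<sigma> \<in> tapes w. A \<sigma> \<in> carrier_mat m n \<and>
          (\<forall>j < n. real (col_nnz (A \<sigma>) j) \<le> real C * log 2 (real n))) \<and>
       (\<forall>x \<in> carrier_vec n.
          (\<forall>\<sigma> \<in> tapes w.
             rec \<sigma> (A \<sigma> *\<^sub>v x) \<in> carrier_vec n \<and>
             recovers_within w P n k \<epsilon> \<sigma> (A \<sigma> *\<^sub>v x) (C * m) (rec \<sigma> (A \<sigma> *\<^sub>v x))) \<and>
          measure_pmf.prob (pmf_of_set (tapes w))
            {\<sigma>. l2norm (x - rec \<sigma> (A \<sigma> *\<^sub>v x)) \<le> (1 + \<epsilon>) * l2norm (tail_vec k x)} \<ge> 1 - \<delta>))"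

lemma good_sketch_identity:
  assumes n: "2 \<le> n" "n < 2 ^ w" "1 < w" and d: "0 < \<delta>" "0 < \<epsilon>"
    and m: "real n \<le> real C * (real k / \<epsilon>) * log 2 (real n)" and C: "16 \<le> C"
  shows "good_sketch w (compile 0 (prog c)) n k \<epsilon> \<delta> C"
proof -
  let ?A = "\<lambda>\<sigma> :: nat \<Rightarrow> nat. 1\<^sub>m n :: real mat" and ?rec = "\<lambda>(\<sigma> :: nat \<Rightarrow> nat) (y :: real Matrix.vec). y"
  have log1: "1 \<le> log 2 (real n)" using n(1) by simp
  have nnz: "real (col_nnz (1\<^sub>m n) j) \<le> real C * log 2 (real n)" if "j < n" for j
  proof -
    have "{i. i < dim_row (1\<^sub>m n :: real mat) \<and> (1\<^sub>m n :: real mat) $$ (i, j) \<noteq> 0} = {j}" using that by (auto split: if_splits)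
    then have "col_nnz (1\<^sub>m n) j = 1" unfolding col_nnz_def by simp
    moreover have "1 * 1 \<le> real C * log 2 (real n)" using log1 C by (intro mult_mono) auto
    ultimately show ?thesis by simp
  qed
  have rec: "recovers_within w (compile 0 (prog c)) n k \<epsilon> \<sigma> x (C * n) x" if x: "x \<in> carrier_vec n" for \<sigma> x
  proof -
    have dx: "dim_vec x = n" using x by simp
    let ?s = "init_state n k \<epsilon> (dim_vec x)"
    obtain s' where s': "runs w \<sigma> x pIdent ?s s' (n * 10 + 4)"
      "outp s' = map (\<lambda>i. (i, vec_index x i)) (filter (\<lambda>i. vec_index x i \<noteq> 0) [0..<n])"
      using run_pIdent[OF dx n(2,3), of ?s \<sigma>] by (auto simp: init_state_def)
    have "\<not> wmem ?s 2 < wmem ?s 0" by (simp add: init_state_def dx)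
    then have "runs w \<sigma> x (prog c) ?s s' (n * 10 + 4 + 2)"
      unfolding prog_def using s'(1) by (intro runs_IfW) auto
    moreover have "n * 10 + 4 + 2 \<le> C * n" using C n(1) mult_le_mono1[OF C, of n] by linarith
    moreover have "sparse_repr (outp s') x" unfolding sparse_repr_def s'(2) dx
      by (auto simp: distinct_map inj_on_def)
    ultimately show ?thesis by (rule recovers_runs)
  qed
  have pr: "1 - \<delta> \<le> measure_pmf.prob (pmf_of_set (tapes w)) {\<sigma>. l2norm (x - x) \<le> (1 + \<epsilon>) * l2norm (tail_vec k x)}" for x
  proof -
    have "(l2norm (x - x))\<^sup>2 = 0" unfolding l2norm_sq by simp
    then have "l2norm (x - x) = 0" by simp
    moreover have "0 \<le> l2norm (tail_vec k x)" unfolding l2norm_def by (rule L2_set_nonneg)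
    ultimately have le: "l2norm (x - x) \<le> (1 + \<epsilon>) * l2norm (tail_vec k x)" using d(2) by simp
    show ?thesis unfolding prob_tapes using le d(1) by (simp add: prb_def)
  qed
  show ?thesis unfolding good_sketch_def
  proof (rule exI[of _ n], rule exI[of _ ?A], rule exI[of _ ?rec], intro conjI ballI allI impI)
    fix x :: "real Matrix.vec" assume x: "x \<in> carrier_vec n"
    have I: "1\<^sub>m n *\<^sub>v x = x" using x by simp
    show "recovers_within w (compile 0 (prog c)) n k \<epsilon> \<sigma> (1\<^sub>m n *\<^sub>v x) (C * n) (1\<^sub>m n *\<^sub>v x)" for \<sigma> unfolding I by (rule rec[OF x])
    show "1 - \<delta> \<le> measure_pmf.prob (pmf_of_set (tapes w)) {\<sigma>. l2norm (x - 1\<^sub>m n *\<^sub>v x) \<le> (1 + \<epsilon>) * l2norm (tail_vec k x)}"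
      unfolding I by (rule pr)
    show "1\<^sub>m n *\<^sub>v x \<in> carrier_vec n" unfolding I by (rule x)
  qed (use n m nnz in auto)
qed

context sketch_par
begin

lemma good_sketch_main:
  assumes B: "B = 2 ^ bexp" "412 \<le> bexp" and c2: "2 \<le> c" "c \<le> vv" and \<epsilon>: "0 < \<epsilon>" "\<epsilon> < 1"
    and bh: "(90 + 3 * real c) * 2 ^ 414 * (real c)\<^sup>2 * (real k / \<epsilon>) \<le> real bh"
    and \<delta>: "(1 - (1 / 2) ^ 412) ^ c + 30 / real c \<le> \<delta>"
    and m: "real (ss * B) \<le> real C * (real k / \<epsilon>) * log 2 (real n)"
    and nz: "real ss \<le> real C * log 2 (real n)" and C: "100 * c \<le> C"
  shows "good_sketch ww (compile 0 (prog c)) n k \<epsilon> \<delta> C"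
proof -
  let ?rec = "\<lambda>\<sigma> y. Matrix.vec n (\<lambda>i. case map_of (decode \<sigma> y) i of None \<Rightarrow> 0 | Some v \<Rightarrow> v)"
  have N: "nn < 2 ^ ww" using less_PW[of nn 2] nn_pows(1) nn_ge by simp
  have nw: "n < 2 ^ ww" "ss * B < 2 ^ ww" using n_le_nn rows_less N by linarith+
  have dA: "Amat \<sigma> \<in> carrier_mat (ss * B) n" for \<sigma> by (simp add: Amat_def)
  have nnz: "real (col_nnz (Amat \<sigma>) j) \<le> real C * log 2 (real n)" if "j < n" for \<sigma> j
    using col_nnz_Amat[OF that, of \<sigma>] nz by linarith
  have rec: "recovers_within ww (compile 0 (prog c)) n k \<epsilon> \<sigma> (Amat \<sigma> *\<^sub>v x) (C * (ss * B)) (?rec \<sigma> (Amat \<sigma> *\<^sub>v x))" for \<sigma> x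
  proof -
    let ?y = "Amat \<sigma> *\<^sub>v x"
    have dy: "dim_vec ?y = ss * B" using dA[of \<sigma>] by simp
    interpret R: sketch_run n B c \<sigma> ?y by unfold_locales (rule dy)
    obtain s' where s': "runs ww \<sigma> ?y (prog c) (init_state n k \<epsilon> (ss * B)) s' (100 * c * (ss * B))" "outp s' = decode \<sigma> ?y"
      using R.run_prog[of "init_state n k \<epsilon> (ss * B)" k \<epsilon>] by (auto simp: init_state_def)
    have "runs ww \<sigma> ?y (prog c) (init_state n k \<epsilon> (dim_vec ?y)) s' (100 * c * (ss * B))" unfolding dy by (rule s'(1))
    moreover have "100 * c * (ss * B) \<le> C * (ss * B)" using C by (rule mult_le_mono1)
    moreover have "sparse_repr (outp s') (?rec \<sigma> ?y)" unfolding s'(2) by (rule decode_sparse)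
    ultimately show ?thesis by (rule recovers_runs)
  qed
  have pr: "1 - \<delta> \<le> measure_pmf.prob (pmf_of_set (tapes ww)) {\<sigma>. l2norm (x - ?rec \<sigma> (Amat \<sigma> *\<^sub>v x)) \<le> (1 + \<epsilon>) * l2norm (tail_vec k x)}"
    if x: "x \<in> carrier_vec n" for x
  proof -
    have dx: "dim_vec x = n" using x by simp
    interpret Q: sketch_prob n B c "vec_index x" bexp by unfold_locales (use B in auto)
    have Ay: "Amat \<sigma> *\<^sub>v x = Q.yv \<sigma>" for \<sigma> by (rule Q.Amat_yv[OF x]) simp
    let ?H = "head_set k x"
    have H: "?H \<subseteq> {..<n}" "card ?H \<le> k" by (auto simp: head_set_def dx) (rule card_head_set[unfolded head_set_def, of x k, unfolded dx])
    let ?G = "\<lambda>\<sigma>. (\<Sum>i<n. (vec_index x i - Q.xhat (decode \<sigma> (Q.yv \<sigma>)) i)\<^sup>2) \<le> (1 + \<epsilon>) * (\<Sum>i\<in>{..<n} - ?H. (vec_index x i)\<^sup>2)"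
    have imp: "l2norm (x - ?rec \<sigma> (Q.yv \<sigma>)) \<le> (1 + \<epsilon>) * l2norm (tail_vec k x)" if g: "?G \<sigma>" for \<sigma>
    proof (rule power2_le_imp_le)
      have "(l2norm (x - ?rec \<sigma> (Q.yv \<sigma>)))\<^sup>2 = (\<Sum>i<n. (vec_index x i - Q.xhat (decode \<sigma> (Q.yv \<sigma>)) i)\<^sup>2)"
        unfolding l2norm_sq using dx by (intro sum.cong) (auto simp: Q.xhat_def)
      also have "\<dots> \<le> (1 + \<epsilon>) * (l2norm (tail_vec k x))\<^sup>2" using g unfolding l2norm_tail dx .
      \<comment> \<open>The squared errors satisfy the guarantee even with the factor 1 + \<epsilon>
        in place of its square.\<close>
      also have "\<dots> \<le> (1 + \<epsilon>)\<^sup>2 * (l2norm (tail_vec k x))\<^sup>2"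
        using \<epsilon>(1) self_le_power[of "1 + \<epsilon>" 2] by (intro mult_right_mono) auto
      finally show "(l2norm (x - ?rec \<sigma> (Q.yv \<sigma>)))\<^sup>2 \<le> ((1 + \<epsilon>) * l2norm (tail_vec k x))\<^sup>2" by (simp add: power_mult_distrib)
      show "0 \<le> (1 + \<epsilon>) * l2norm (tail_vec k x)" using \<epsilon>(1) by (simp add: l2norm_def L2_set_nonneg)
    qed
    have "prb ww (\<lambda>\<sigma>. \<not> ?G \<sigma>) \<le> \<delta>" using Q.prb_error[OF H c2 \<epsilon> bh] \<delta> by linarith
    then have "1 - \<delta> \<le> prb ww ?G" using prb_not[of ww ?G] by linarith
    also have "\<dots> \<le> prb ww (\<lambda>\<sigma>. l2norm (x - ?rec \<sigma> (Amat \<sigma> *\<^sub>v x)) \<le> (1 + \<epsilon>) * l2norm (tail_vec k x))"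
      unfolding Ay by (rule prb_mono) (rule imp)
    finally show ?thesis unfolding prob_tapes .
  qed
  show ?thesis unfolding good_sketch_def
    by (rule exI[of _ "ss * B"], rule exI[of _ Amat], rule exI[of _ ?rec]) (use nw m dA nnz rec pr in auto)
qed

end

text \<open>First c makes the failure probability small, then L exceeds everything depending on c.
  The double exponential is needed because a bucket number of this size, if the sketch still has
  fewer than n rows, forces log log n above 128 c.\<close>

lemma parameters:
  fixes \<delta> :: real
  assumes "0 < \<delta>"
  shows "\<exists>c L :: nat. 2 \<le> c \<and> (1 - (1 / 2) ^ 412) ^ c + 30 / real c \<le> \<delta> \<and> 2 ^ (2 ^ (128 * c)) \<le> L \<and>
    2 * (90 + 3 * real c) * 2 ^ 414 * (real c)\<^sup>2 \<le> real L"
proof -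
  have "(\<lambda>c. (1 - (1 / 2) ^ 412 :: real) ^ c) \<longlonglongrightarrow> 0"
    by (rule LIMSEQ_power_zero) (simp add: power_divide)
  moreover have "(\<lambda>c. 30 / real c) \<longlonglongrightarrow> 0" by (rule lim_const_over_n)
  ultimately have "(\<lambda>c. (1 - (1 / 2) ^ 412 :: real) ^ c + 30 / real c) \<longlonglongrightarrow> 0 + 0" by (rule tendsto_add)
  then have "eventually (\<lambda>c. (1 - (1 / 2) ^ 412 :: real) ^ c + 30 / real c < \<delta>) sequentially"
    using assms by (intro order_tendstoD) auto
  then have "eventually (\<lambda>c. (1 - (1 / 2) ^ 412 :: real) ^ c + 30 / real c < \<delta> \<and> 2 \<le> c) sequentially"
    by (rule eventually_conj) (rule eventually_ge_at_top)
  then obtain c where c: "(1 - (1 / 2) ^ 412 :: real) ^ c + 30 / real c < \<delta>" "2 \<le> c"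
    by (auto simp: eventually_sequentially)
  define a where "a = 2 * (90 + 3 * real c) * 2 ^ 414 * (real c)\<^sup>2"
  obtain L :: nat where L: "a \<le> real L" using real_arch_simple by blast
  let ?p = "2 ^ (2 ^ (128 * c)) :: nat"
  have "a \<le> real (max L ?p)" using L by simp
  moreover have "?p \<le> max L ?p" by (rule max.cobounded2)
  ultimately show ?thesis using c unfolding a_def by (metis less_imp_le)
qed

theorem theorem1p1:
  fixes \<delta> :: real
  assumes "0 < \<delta>"
  shows "\<exists>(P :: instr list) (b :: nat) (C :: nat). \<forall>(n :: nat) (k :: nat) (\<epsilon> :: real).
    1 \<le> k \<and> k \<le> n \<and> 2 \<le> n \<and> 0 < \<epsilon> \<and> \<epsilon> < 1 \<longrightarrow>
    (let w = word_length b n in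
     \<exists>(m :: nat) (A :: (nat \<Rightarrow> nat) \<Rightarrow> real mat)
      (rec :: (nat \<Rightarrow> nat) \<Rightarrow> real Matrix.vec \<Rightarrow> real Matrix.vec).
       n < 2 ^ w \<and> m < 2 ^ w \<and>
       real m \<le> real C * (real k / \<epsilon>) * log 2 (real n) \<and>
       (\<forall>\<sigma> \<in> tapes w. A \<sigma> \<in> carrier_mat m n \<and>
          (\<forall>j < n. real (col_nnz (A \<sigma>) j) \<le> real C * log 2 (real n))) \<and>
       (\<forall>x \<in> carrier_vec n.
          (\<forall>\<sigma> \<in> tapes w.
             rec \<sigma> (A \<sigma> *\<^sub>v x) \<in> carrier_vec n \<and>
             recovers_within w P n k \<epsilon> \<sigma> (A \<sigma> *\<^sub>v x) (C * m) (rec \<sigma> (A \<sigma> *\<^sub>v x))) \<and>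
          measure_pmf.prob (pmf_of_set (tapes w))
            {\<sigma>. l2norm (x - rec \<sigma> (A \<sigma> *\<^sub>v x)) \<le> (1 + \<epsilon>) * l2norm (tail_vec k x)} \<ge> 1 - \<delta>))"
proof -
  obtain c L :: nat where c2: "2 \<le> c" and \<delta>: "(1 - (1 / 2) ^ 412) ^ c + 30 / real c \<le> \<delta>"
    and L1: "2 ^ (2 ^ (128 * c)) \<le> L" and L2: "2 * (90 + 3 * real c) * 2 ^ 414 * (real c)\<^sup>2 \<le> real L"
    using parameters[OF assms] by blast
  define C where "C = 200 * c * L"
  have L0: "1 \<le> L" using L1 one_le_power[of "2::nat" "2 ^ (128 * c)"] by linarith
  have main: "good_sketch (word_length 8 n) (compile 0 (prog c)) n k \<epsilon> \<delta> C"
    if k: "1 \<le> k" "k \<le> n" and n: "2 \<le> n" and \<epsilon>: "0 < \<epsilon>" "\<epsilon> < 1" for n k \<epsilon>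
  proof -
    define q where "q = real k / \<epsilon>"
    have q1: "1 \<le> q" using k(1) \<epsilon> unfolding q_def by (simp add: pos_le_divide_eq)
    \<comment> \<open>The number of buckets is the next power of two above L k / \<epsilon>;
      rounding up twice costs a factor 4 at most.\<close>
    define X where "X = nat \<lceil>real L * q\<rceil>"
    have Lq: "0 \<le> real L * q" using q1 by simp
    have X: "real L * q \<le> real X" "real X \<le> real L * q + 1" unfolding X_def using Lq by linarith+
    define bexp where "bexp = clog X"
    define B where "B = (2::nat) ^ bexp"
    have LX: "L \<le> X"
    proof -
      have "real L * 1 \<le> real L * q" using q1 by (intro mult_left_mono) auto
      then show ?thesis using X(1) by linarith
    qed
    have XB: "X \<le> B" unfolding B_def bexp_def by (rule clog_le)
    have be: "2 ^ (128 * c) \<le> bexp"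
    proof -
      have "(2::nat) ^ (2 ^ (128 * c)) \<le> 2 ^ bexp" using L1 LX XB unfolding B_def by linarith
      then show ?thesis by (simp add: power_le_imp_le_exp)
    qed
    have "(2::nat) ^ 256 \<le> 2 ^ (128 * c)" using c2 by (intro power_increasing) auto
    moreover have "(412::nat) \<le> 2 ^ 256" by simp
    ultimately have be412: "412 \<le> bexp" using be by (meson le_trans)
    have "2 ^ (bexp - 1) < X" unfolding bexp_def using be412 by (intro clog_less) (simp add: bexp_def)
    moreover have B2: "B = 2 * 2 ^ (bexp - 1)" unfolding B_def power_Suc[symmetric] using be412 by simp
    ultimately have "B \<le> 2 * X" by linarith
    then have BX: "real B \<le> 4 * (real L * q)"
    proof -
      have "1 * 1 \<le> real L * q" using L0 q1 by (intro mult_mono) auto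
      then have "real X \<le> 2 * (real L * q)" using X(2) by linarith
      moreover have "real B \<le> real (2 * X)" using \<open>B \<le> 2 * X\<close> by (simp only: of_nat_le_iff)
      ultimately show ?thesis by simp
    qed
    interpret S: sketch n B c .
    have dd: "S.dd = nat \<lceil>log 2 (real n)\<rceil>" unfolding S.dd_def using n by (intro clog_log) simp
    have log1: "1 \<le> log 2 (real n)" using n by simp
    have dl: "real S.dd \<le> 2 * log 2 (real n)" unfolding dd using log1 by linarith
    have dd1: "1 \<le> S.dd" unfolding dd using log1 by linarith
    have w: "word_length 8 n = S.ww" unfolding word_length_def S.ww_def dd ..
    have ssl: "real S.ss \<le> 46 * log 2 (real n)" unfolding S.ss_def using dl by simp
    have mB: "real (S.ss * B) \<le> real C * q * log 2 (real n)"
    proof -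
      have "real (S.ss * B) \<le> (46 * log 2 (real n)) * (4 * (real L * q))"
        unfolding of_nat_mult using ssl BX log1 by (intro mult_mono) auto
      also have "\<dots> = 184 * (real L * q * log 2 (real n))" by simp
      also have "\<dots> \<le> (200 * real c) * (real L * q * log 2 (real n))"
      proof (rule mult_right_mono)
        show "0 \<le> real L * q * log 2 (real n)" using Lq log1 by (intro mult_nonneg_nonneg[of "real L * q"]) auto
      qed (use c2 in simp)
      also have "\<dots> = real C * q * log 2 (real n)" unfolding C_def by simp
      finally show ?thesis .
    qed
    have C16: "16 \<le> C" "100 * c \<le> C"
    proof -
      have "200 * c * 1 \<le> 200 * c * L" using L0 by (rule mult_le_mono2)
      then show "16 \<le> C" "100 * c \<le> C" unfolding C_def using c2 by linarith+
    qed
    have nnn: "n \<le> 2 ^ S.dd" unfolding S.dd_def by (rule clog_le)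
    have nw: "n < 2 ^ S.ww"
    proof -
      have "(2::nat) ^ S.dd < 2 ^ S.ww" unfolding S.ww_def using dd1 by (intro power_strict_increasing) auto
      then show ?thesis using nnn by linarith
    qed
    show ?thesis
    proof (cases "S.ss * B < n")
      case False
      \<comment> \<open>The hashed sketch would be at least as large as n, so n rows are within the
        bound and the identity matrix may be used.\<close>
      then have "real n \<le> real C * (real k / \<epsilon>) * log 2 (real n)" using mB unfolding q_def by linarith
      then show ?thesis unfolding w using n nw dd1 assms \<epsilon>(1) C16(1)
        by (intro good_sketch_identity) (auto simp: S.ww_def)
    next
      case True
      have "1 * B \<le> S.ss * B" using dd1 unfolding S.ss_def by (intro mult_le_mono1) simp
      then have "(2::nat) ^ bexp < 2 ^ S.dd" using True nnn unfolding B_def by linarith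
      then have bd: "bexp < S.dd" by (simp add: power_less_imp_less_exp)
      \<comment> \<open>From B < 2^dd the exponent of B is below dd, and L was chosen so that this
        exponent is at least 2^(128 c); hence \<open>aa\<close> is at least c.\<close>
      then have "(2::nat) ^ (128 * c) < 2 ^ clog S.dd" using be clog_le[of S.dd] by linarith
      then have "128 * c < clog S.dd" by (simp add: power_less_imp_less_exp)
      then have ca: "c \<le> S.aa" unfolding S.aa_def by linarith
      have "c < 2 ^ (128 * c)" using less_exp[of "128 * c"] by linarith
      then have cd: "c \<le> S.dd" using be bd by linarith
      interpret P: sketch_par n B c
      proof unfold_locales
        show "even B" unfolding B2 by simp
        show "0 < B" unfolding B_def by simp
        show "0 < S.aa" using ca c2 by linarith
        show "0 < c" using c2 by linarith
      qed (use True cd in auto)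
      have cv: "c \<le> S.vv"
      proof -
        have "c \<le> 64 * S.aa" using ca by linarith
        also have "\<dots> < 2 ^ (64 * S.aa)" by (rule less_exp)
        finally show ?thesis unfolding S.vv_def by simp
      qed
      have bh: "(90 + 3 * real c) * 2 ^ 414 * (real c)\<^sup>2 * (real k / \<epsilon>) \<le> real S.bh"
      proof -
        define K where "K = (90 + 3 * real c) * 2 ^ 414 * (real c)\<^sup>2"
        have "2 * K \<le> real L" using L2 unfolding K_def by (simp only: mult.assoc)
        then have "2 * K * q \<le> real L * q" using q1 by (intro mult_right_mono) auto
        also have "\<dots> \<le> real B" using X(1) XB by linarith
        also have "real B = 2 * real S.bh" using P.bh_eq(1) by linarith
        finally have "2 * (K * q) \<le> 2 * real S.bh" by (simp only: mult.assoc)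
        then have "K * q \<le> real S.bh" by simp
        then show ?thesis unfolding q_def K_def .
      qed
      have nz: "real S.ss \<le> real C * log 2 (real n)"
      proof -
        have "100 * 1 \<le> 100 * c" using c2 by simp
        then have "46 \<le> real C" using C16(2) by linarith
        then have "46 * log 2 (real n) \<le> real C * log 2 (real n)" using log1 by (intro mult_right_mono) auto
        then show ?thesis using ssl by linarith
      qed
      show ?thesis unfolding w
        by (rule P.good_sketch_main[OF B_def be412 c2 cv \<epsilon> bh \<delta> _ nz C16(2)]) (use mB in \<open>simp add: q_def\<close>)
    qed
  qed
  show ?thesis
    by (rule exI[of _ "compile 0 (prog c)"], rule exI[of _ 8], rule exI[of _ C])
      (use main[unfolded good_sketch_def] in \<open>simp only: Let_def, blast\<close>)
qed

end
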